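(* Assume $n-d\ll d$ as $n\to\infty$. Then $$ F_{[-1,1]}=\binom nd\,\frac{2}{2^{n-d}}\;\exp\!\left(\frac{(n-d)^2}{\pi d}+O\!\left(\frac{(n-d)^3}{d^2}\right)+o(1)\right). $$
   Context: Asymptotic setting: $\mathbb{N}\ni n\to\infty$ and $d=d(n)\in\{2,\ldots,n-1\}$ is a function of $n$ which is either constant or tends to infinity. The notation $f\ll g$ means $f(n)/g(n)\to0$; $O(f(n))$ (resp. $o(f(n))$) stands for a sequence $g(n)$ with $g(n)/f(n)$ bounded (resp. tending to $0$). Let $X_1,\ldots,X_n$ be i.i.d. random vectors uniformly distributed on the unit sphere $\mathbb{S}^{d-1}\subset\mathbb{R}^d$, and let $P_{n,d}=[X_1,\ldots,X_n]$ be their convex hull. $F_{[-1,1]}$ denotes the expected number of facets ($(d-1)$-dimensional faces) of $P_{n,d}$. *)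

theory Defs
  imports "HOL-Probability.Probability" "HOL-Library.Function_Algebras"
    "HOL-Library.Landau_Symbols"
begin

text \<open>
  The dimension of the ambient space varies with n, so \<open>\<real>\<^sup>d\<close> is taken to be
  the set of all \<open>x :: nat \<Rightarrow> real\<close> with \<open>x i = 0\<close> for \<open>i \<ge> d\<close>, as in
  \<^const>\<open>Euclidean_space\<close> and \<^const>\<open>nsphere\<close>.  The pointwise vector space structure below
  makes the library notions of convex hull, affine hull and face available there.
\<close>

instantiation "fun" :: (type, real_vector) real_vector
begin

definition scaleR_fun :: "real \<Rightarrow> ('a \<Rightarrow> 'b) \<Rightarrow> 'a \<Rightarrow> 'b"
  where "scaleR_fun r f = (\<lambda>x. r *\<^sub>R f x)"

instance
  by standard (auto simp: scaleR_fun_def fun_eq_iff algebra_simps)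

end

definition lborel_space :: "nat \<Rightarrow> (nat \<Rightarrow> real) measure"
  where "lborel_space d =
    distr (\<Pi>\<^sub>M i\<in>{..<d}. lborel) borel (\<lambda>x i. if i < d then x i else 0)"

definition enorm :: "nat \<Rightarrow> (nat \<Rightarrow> real) \<Rightarrow> real"
  where "enorm d x = sqrt (\<Sum>i<d. (x i)\<^sup>2)"

definition unit_ball :: "nat \<Rightarrow> (nat \<Rightarrow> real) set"
  where "unit_ball d = {x \<in> topspace (Euclidean_space d). enorm d x \<le> 1}"

definition unit_sphere :: "nat \<Rightarrow> (nat \<Rightarrow> real) set"
  where "unit_sphere d = {x \<in> topspace (Euclidean_space d). enorm d x = 1}"

text \<open>
  The normalised surface measure of the unit sphere: the surface measure of a Borel set \<open>A\<close> of the
  sphere is \<open>d\<close> times the volume of the cone \<open>{r x | 0 < r \<le> 1, x \<in> A}\<close>, so after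
  normalisation it is the image of the uniform distribution on the unit ball under radial projection.
\<close>

definition uniform_sphere :: "nat \<Rightarrow> (nat \<Rightarrow> real) measure"
  where "uniform_sphere d =
    distr (uniform_measure (lborel_space d) (unit_ball d)) borel (\<lambda>x. x /\<^sub>R enorm d x)"

lemma unit_sphere_eq_nsphere: "unit_sphere (Suc k) = topspace (nsphere k)"
  by (auto simp: unit_sphere_def enorm_def nsphere topspace_Euclidean_space Suc_le_eq
      lessThan_Suc_atMost)

lemma enorm_measurable [measurable]: "enorm d \<in> borel_measurable borel"
proof -
  have [measurable]: "(\<lambda>x :: nat \<Rightarrow> real. x i) \<in> borel_measurable borel" for i
    by (intro borel_measurable_continuous_onI continuous_on_product_coordinates)
  show ?thesis
    unfolding enorm_def [abs_def] by measurable
qed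

lemma truncate_measurable [measurable]:
  fixes d :: nat
  shows "(\<lambda>x i. if i < d then x i else 0) \<in> (\<Pi>\<^sub>M i\<in>{..<d}. lborel :: real measure) \<rightarrow>\<^sub>M borel"
proof (rule measurable_coordinatewise_then_product)
  show "(\<lambda>x. if i < d then x i else 0)
      \<in> (\<Pi>\<^sub>M i\<in>{..<d}. lborel :: real measure) \<rightarrow>\<^sub>M borel" for i
    by (cases "i < d") auto
qed

lemma radial_measurable [measurable]: "(\<lambda>x. x /\<^sub>R enorm d x) \<in> borel \<rightarrow>\<^sub>M borel"
proof (rule measurable_coordinatewise_then_product)
  fix i
  have [measurable]: "(\<lambda>x :: nat \<Rightarrow> real. x i) \<in> borel_measurable borel"
    by (intro borel_measurable_continuous_onI continuous_on_product_coordinates)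
  show "(\<lambda>x. (x /\<^sub>R enorm d x) i) \<in> borel_measurable borel"
    unfolding scaleR_fun_def by measurable
qed

lemma Euclidean_space_borel [measurable]: "topspace (Euclidean_space d) \<in> sets borel"
  by (metis borel_closed closedin_Euclidean_imp_closed closedin_topspace)

lemma unit_ball_borel [measurable]: "unit_ball d \<in> sets borel"
proof -
  have "unit_ball d = topspace (Euclidean_space d) \<inter> {x \<in> space borel. enorm d x \<le> 1}"
    by (auto simp: unit_ball_def)
  also have "\<dots> \<in> sets borel" by measurable
  finally show ?thesis .
qed

lemma unit_sphere_borel [measurable]: "unit_sphere d \<in> sets borel"
proof -
  have "unit_sphere d = topspace (Euclidean_space d) \<inter> {x \<in> space borel. enorm d x = 1}"
    by (auto simp: unit_sphere_def)
  also have "\<dots> \<in> sets borel" by measurable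
  finally show ?thesis .
qed

lemma enorm_truncate [simp]: "enorm d (\<lambda>i. if i < d then x i else 0) = enorm d x"
  by (simp add: enorm_def)

lemma emeasure_lborel_space_unit_ball:
  shows emeasure_unit_ball_pos: "emeasure (lborel_space d) (unit_ball d) > 0"
    and emeasure_unit_ball_finite: "emeasure (lborel_space d) (unit_ball d) < \<infinity>"
proof -
  interpret product_sigma_finite "\<lambda>_::nat. lborel :: real measure" ..
  let ?P = "\<Pi>\<^sub>M i\<in>{..<d}. (lborel :: real measure)"
  let ?t = "\<lambda>x i. if i < d then x i else 0 :: real"
  let ?A = "?t -` unit_ball d \<inter> space ?P"
  have eq: "emeasure (lborel_space d) (unit_ball d) = emeasure ?P ?A"
    unfolding lborel_space_def by (rule emeasure_distr [OF truncate_measurable unit_ball_borel])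
  have Am [measurable]: "?A \<in> sets ?P"
    by (rule measurable_sets [OF truncate_measurable unit_ball_borel])
  have "(\<Pi>\<^sub>E i\<in>{..<d}. {0..1 / real d}) \<subseteq> ?A"
  proof
    fix x assume x: "x \<in> (\<Pi>\<^sub>E i\<in>{..<d}. {0..1 / real d})"
    have "(\<Sum>i<d. (x i)\<^sup>2) \<le> (\<Sum>i<d. 1 / real d)"
    proof (rule sum_mono)
      fix i assume i: "i \<in> {..<d}"
      then have xi: "0 \<le> x i" "x i \<le> 1 / real d" using x by (auto simp: PiE_iff)
      moreover have "1 / real d \<le> 1" using i by simp
      ultimately have "x i * x i \<le> 1 / real d * 1" by (intro mult_mono) auto
      then show "(x i)\<^sup>2 \<le> 1 / real d" by (simp add: power2_eq_square)
    qed
    also have "\<dots> \<le> 1" by simp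
    finally have "enorm d x \<le> 1" by (simp add: enorm_def)
    then show "x \<in> ?A"
      using x by (simp add: unit_ball_def topspace_Euclidean_space space_PiM PiE_iff)
  qed
  then have "emeasure ?P (\<Pi>\<^sub>E i\<in>{..<d}. {0..1 / real d}) \<le> emeasure ?P ?A"
    by (rule emeasure_mono [OF _ Am])
  moreover have "emeasure ?P (\<Pi>\<^sub>E i\<in>{..<d}. {0..1 / real d}) = (\<Prod>i<d. ennreal (1 / real d))"
    by (subst emeasure_PiM) auto
  moreover have "(\<Prod>i<d. ennreal (1 / real d)) > 0"
    by (subst prod_ennreal) (auto simp: ennreal_less_zero_iff simp del: prod_constant intro!: prod_pos)
  ultimately show "emeasure (lborel_space d) (unit_ball d) > 0"
    unfolding eq by (simp only:)
  have "?A \<subseteq> (\<Pi>\<^sub>E i\<in>{..<d}. {-1..1})"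
  proof
    fix x assume x: "x \<in> ?A"
    have "\<bar>x i\<bar> \<le> 1" if "i < d" for i
    proof -
      have "(x i)\<^sup>2 \<le> (\<Sum>i<d. (x i)\<^sup>2)"
        by (rule member_le_sum) (use that in auto)
      also have "\<dots> \<le> 1" using x by (auto simp: unit_ball_def enorm_def)
      finally show ?thesis by (simp add: abs_square_le_1)
    qed
    then show "x \<in> (\<Pi>\<^sub>E i\<in>{..<d}. {-1..1})"
      using x by (auto simp: space_PiM PiE_iff abs_le_iff)
  qed
  then have "emeasure ?P ?A \<le> emeasure ?P (\<Pi>\<^sub>E i\<in>{..<d}. {-1..1})"
    by (rule emeasure_mono) (auto intro!: sets_PiM_I_finite)
  also have "\<dots> = (\<Prod>i<d. ennreal 2)"
    by (subst emeasure_PiM) auto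
  also have "\<dots> < \<infinity>"
    by (simp add: power_less_top_ennreal)
  finally show "emeasure (lborel_space d) (unit_ball d) < \<infinity>"
    unfolding eq .
qed

lemma sets_lborel_space [simp, measurable_cong]: "sets (lborel_space d) = sets borel"
  by (simp add: lborel_space_def)

lemma prob_space_uniform_ball: "prob_space (uniform_measure (lborel_space d) (unit_ball d))"
  using emeasure_unit_ball_pos [of d] emeasure_unit_ball_finite [of d]
  by (intro prob_space_uniform_measure) auto

lemma prob_space_uniform_sphere: "prob_space (uniform_sphere d)"
  unfolding uniform_sphere_def
  by (rule prob_space.prob_space_distr [OF prob_space_uniform_ball]) measurable

lemma emeasure_uniform_sphere:
  assumes [measurable]: "A \<in> sets borel"
  shows "emeasure (uniform_sphere d) A =
    emeasure (lborel_space d) {x \<in> unit_ball d. x /\<^sub>R enorm d x \<in> A}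
      / emeasure (lborel_space d) (unit_ball d)"
proof -
  have sp: "space (lborel_space d) = UNIV"
    using sets_eq_imp_space_eq [OF sets_lborel_space] by simp
  have "(\<lambda>x. x /\<^sub>R enorm d x) -` A \<inter> space borel \<in> sets borel"
    by (rule measurable_sets [OF radial_measurable assms])
  then have "emeasure (uniform_sphere d) A =
      emeasure (lborel_space d) (unit_ball d \<inter> (\<lambda>x. x /\<^sub>R enorm d x) -` A)
        / emeasure (lborel_space d) (unit_ball d)"
    unfolding uniform_sphere_def by (subst emeasure_distr) (auto simp: sp)
  also have "unit_ball d \<inter> (\<lambda>x. x /\<^sub>R enorm d x) -` A =
      {x \<in> unit_ball d. x /\<^sub>R enorm d x \<in> A}"
    by auto
  finally show ?thesis .
qed

lemma AE_uniform_sphere: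
  assumes "d > 0"
  shows "AE x in uniform_sphere d. x \<in> unit_sphere d"
proof -
  interpret product_sigma_finite "\<lambda>_::nat. lborel :: real measure" ..
  let ?P = "\<Pi>\<^sub>M i\<in>{..<d}. (lborel :: real measure)"
  let ?t = "\<lambda>x i. if i < d then x i else 0 :: real"
  have scale: "x /\<^sub>R enorm d x \<in> unit_sphere d"
    if "x \<in> topspace (Euclidean_space d)" "enorm d x \<noteq> 0" for x
  proof -
    have nn: "enorm d x > 0"
      using that by (simp add: enorm_def sum_nonneg less_le)
    have "(\<Sum>i<d. (x i)\<^sup>2) = (enorm d x)\<^sup>2"
      by (simp add: enorm_def sum_nonneg)
    then have "(\<Sum>i<d. (x i / enorm d x)\<^sup>2) = 1"
      using nn by (simp add: power_divide flip: sum_divide_distrib)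
    then have "enorm d (x /\<^sub>R enorm d x) = 1"
      by (subst enorm_def) (simp add: scaleR_fun_def divide_inverse mult.commute)
    then show ?thesis
      using that by (simp add: unit_sphere_def topspace_Euclidean_space scaleR_fun_def)
  qed
  have ae: "AE x in lborel_space d. x \<in> topspace (Euclidean_space d) \<and> enorm d x \<noteq> 0"
  proof -
    have Z: "{x \<in> space ?P. enorm d x = 0} \<subseteq> (\<Pi>\<^sub>E i\<in>{..<d}. {0})"
      by (auto simp: enorm_def sum_nonneg_eq_0_iff space_PiM PiE_iff extensional_def fun_eq_iff)
    have "emeasure ?P (\<Pi>\<^sub>E i\<in>{..<d}. {0}) = 0"
      by (subst emeasure_PiM) (use assms in \<open>auto simp: prod_zero_iff\<close>)
    then have N: "AE x in ?P. x \<notin> (\<Pi>\<^sub>E i\<in>{..<d}. {0})"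
      by (intro AE_not_in null_setsI sets_PiM_I_finite) auto
    have "AE x in ?P. ?t x \<in> topspace (Euclidean_space d) \<and> enorm d (?t x) \<noteq> 0"
      using N AE_space
    proof eventually_elim
      case (elim x)
      then have "enorm d x \<noteq> 0" using Z by blast
      then show ?case by (simp add: topspace_Euclidean_space)
    qed
    moreover have "{x \<in> space borel. x \<in> topspace (Euclidean_space d) \<and> enorm d x \<noteq> 0} \<in> sets borel"
    proof -
      show ?thesis by measurable
    qed
    ultimately show ?thesis
      unfolding lborel_space_def by (subst AE_distr_iff) auto
  qed
  have "AE x in uniform_measure (lborel_space d) (unit_ball d). x /\<^sub>R enorm d x \<in> unit_sphere d"
    by (rule AE_uniform_measureI, simp, rule eventually_mono [OF ae]) (use scale in blast)
  then show ?thesis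
    unfolding uniform_sphere_def by (subst AE_distr_iff) auto
qed

text \<open>
  The library's \<^const>\<open>aff_dim\<close>, with the same defining term, is restricted to
  \<^class>\<open>euclidean_space\<close>.
\<close>

definition affdim :: "'a::real_vector set \<Rightarrow> int"
  where "affdim V =
    (SOME d. \<exists>B. affine hull B = affine hull V \<and> \<not> affine_dependent B \<and> of_nat (card B) = d + 1)"

lemma affdim_eq_aff_dim: "affdim (V :: 'a::euclidean_space set) = aff_dim V"
  by (simp add: affdim_def aff_dim_def)

definition facets :: "nat \<Rightarrow> (nat \<Rightarrow> real) set \<Rightarrow> (nat \<Rightarrow> real) set set"
  where "facets d P = {F. F face_of P \<and> affdim F = int d - 1}"

definition expected_facets ::
    "'a measure \<Rightarrow> nat \<Rightarrow> nat \<Rightarrow> (nat \<Rightarrow> 'a \<Rightarrow> nat \<Rightarrow> real) \<Rightarrow> real"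
  where "expected_facets M n d X =
    (\<integral>\<omega>. real (card (facets d (convex hull ((\<lambda>i. X i \<omega>) ` {..<n})))) \<partial>M)"

definition iid_uniform_sphere ::
    "'a measure \<Rightarrow> nat \<Rightarrow> nat \<Rightarrow> (nat \<Rightarrow> 'a \<Rightarrow> nat \<Rightarrow> real) \<Rightarrow> bool"
  where "iid_uniform_sphere M n d X \<longleftrightarrow>
    prob_space M \<and>
    prob_space.indep_vars M (\<lambda>_. borel) X {..<n} \<and>
    (\<forall>i<n. distr M borel (X i) = uniform_sphere d)"

end

theory Submission
  imports Defs "Jordan_Normal_Form.Determinant"
begin

text \<open>
  Almost surely the points are in general position, and then the facets correspond to the \<open>d\<close>-subsets whose
  spanning hyperplane \<open>{y. \<langle>v, y\<rangle> = 1}\<close> has all other points strictly on one side. So the expected number of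
  facets is \<open>n choose d\<close> times the probability that the first \<open>d\<close> points have this property.

  This probability is first computed for the beta density proportional to \<open>(1 - |x|\<^sup>2)\<^sup>\<beta>\<close>. By the affine
  Blaschke--Petkantschin formula the hyperplane through \<open>d\<close> such points has a distance \<open>h\<close> to the origin with
  density proportional to a power of \<open>1 - h\<^sup>2\<close>, and given \<open>h\<close> the other points fall on either side independently.
  The Jacobian is never evaluated: its shape follows from the uniqueness of translation invariant measures and
  from scaling. The uniform distribution on the sphere is the limit \<open>\<beta> \<rightarrow> -1\<close>.

  With \<open>k = d - 1\<close> and \<open>m = n - d\<close> the probability becomes \<open>2 / 2\<^sup>m\<close> times the mean of
  \<open>((1 + X)\<^sup>m + (1 - X)\<^sup>m) / 2\<close>, where \<open>X\<close> is approximately \<open>s |h|\<close> with \<open>s\<^sup>2\<close> between \<open>2 (k - 1) / \<pi>\<close> and \<open>2 k / \<pi>\<close>.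
  Comparing this mean with that of \<open>cosh (m s h)\<close>, from below by Jensen's inequality for the measure
  weighted by \<open>cosh (m s h)\<close>, gives \<open>m\<^sup>2 / (\<pi> d)\<close> with an error between \<open>- 11 m\<^sup>3 / k\<^sup>2 - 10 m / k\<close> and \<open>m / k\<close>.
\<close>

subsection \<open>Lebesgue measure on finitely supported functions\<close>

text \<open>Blaschke--Petkantschin needs densities, and the sphere has none in R^d. Beta laws serve
  as a detour because their direction is uniform for every \<beta>, while the radius tends to 1 as
  \<beta> tends to -1; configurations on the boundary of the facet event form a null set, so its
  probability passes to the limit.

  Hyperplanes are written as graphs z = a . y + b over the first k coordinates. For fixed slope a,
  the Jacobians depend on b only through scaling, which gives the shape of the density of h; what
  remains is one unknown constant, and the same formula applied to the function 1 fixes it.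

  At \<beta> = -1 the density of h is proportional to (1 - h^2)^((k^2 - 2) / 2), close to a Gaussian
  with variance 1 / k^2, and X is the fraction of the weight (1 - t^2)^(k / 2 - 1) between -|h| and
  |h|. Its slope at 0 is s = 1 / \<open>wallis_integral (k / 2 - 1)\<close>, so cosh (m s h) has
  mean about exp (m^2 s^2 / (2 k^2)), and s^2 of about 2 k / \<pi> yields m^2 / (\<pi> d).\<close>

definition trunc :: "'i set \<Rightarrow> ('i \<Rightarrow> real) \<Rightarrow> 'i \<Rightarrow> real"
  where "trunc I x = (\<lambda>i. if i \<in> I then x i else 0)"

definition supp_on :: "'i set \<Rightarrow> ('i \<Rightarrow> real) set"
  where "supp_on I = {x. \<forall>i. i \<notin> I \<longrightarrow> x i = 0}"

text \<open>Any countable index type is allowed because vectors use \<open>nat\<close> and tuples of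
  points use pairs. All these measures live on a full function space, so splitting coordinates
  becomes pointwise addition of vectors with disjoint supports, and a linear substitution is a map
  of the whole space.\<close>

definition LB :: "'i set \<Rightarrow> ('i::countable \<Rightarrow> real) measure"
  where "LB I = distr (\<Pi>\<^sub>M i\<in>I. lborel) borel (trunc I)"

lemma coord_measurable [measurable]: "(\<lambda>x :: 'i \<Rightarrow> real. x i) \<in> borel_measurable borel"
  by (intro borel_measurable_continuous_onI continuous_on_product_coordinates)

lemma fun_measurableI:
  "(\<And>i. (\<lambda>x. f x i) \<in> borel_measurable M) \<Longrightarrow> f \<in> M \<rightarrow>\<^sub>M (borel :: ('i::countable \<Rightarrow> real) measure)"
  by (rule measurable_coordinatewise_then_product)

lemma plus_fun_measurable [measurable (raw)]:
  fixes f g :: "'b \<Rightarrow> 'i::countable \<Rightarrow> real"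
  assumes [measurable]: "f \<in> M \<rightarrow>\<^sub>M borel" "g \<in> M \<rightarrow>\<^sub>M borel"
  shows "(\<lambda>x. f x + g x) \<in> M \<rightarrow>\<^sub>M borel"
  by (rule fun_measurableI) (simp add: plus_fun_def)

lemma scaleR_fun_measurable [measurable (raw)]:
  fixes f :: "'b \<Rightarrow> 'i::countable \<Rightarrow> real"
  assumes [measurable]: "f \<in> M \<rightarrow>\<^sub>M borel" "g \<in> M \<rightarrow>\<^sub>M borel"
  shows "(\<lambda>x. g x *\<^sub>R f x) \<in> M \<rightarrow>\<^sub>M borel"
  by (rule fun_measurableI) (simp add: scaleR_fun_def)

lemma minus_fun_measurable [measurable (raw)]:
  fixes f g :: "'b \<Rightarrow> 'i::countable \<Rightarrow> real"
  assumes [measurable]: "f \<in> M \<rightarrow>\<^sub>M borel" "g \<in> M \<rightarrow>\<^sub>M borel"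
  shows "(\<lambda>x. f x - g x) \<in> M \<rightarrow>\<^sub>M borel"
  by (rule fun_measurableI) simp

lemma uminus_fun_measurable [measurable (raw)]:
  fixes f :: "'b \<Rightarrow> 'i::countable \<Rightarrow> real"
  assumes [measurable]: "f \<in> M \<rightarrow>\<^sub>M borel"
  shows "(\<lambda>x. - f x) \<in> M \<rightarrow>\<^sub>M borel"
  by (rule fun_measurableI) simp

interpretation lborel_product: product_sigma_finite "\<lambda>_. lborel :: real measure" ..

lemma trunc_measurable [measurable]:
  "trunc I \<in> (\<Pi>\<^sub>M i\<in>I. lborel :: real measure) \<rightarrow>\<^sub>M (borel :: ('i::countable \<Rightarrow> real) measure)"
proof (rule fun_measurableI)
  show "(\<lambda>x. trunc I x i) \<in> borel_measurable (\<Pi>\<^sub>M i\<in>I. lborel)" for i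
    using measurable_component_singleton[of i I "\<lambda>_. lborel"]
    by (cases "i \<in> I") (simp_all add: trunc_def)
qed

lemma trunc_in_supp [simp]: "trunc I x \<in> supp_on I"
  by (auto simp: trunc_def supp_on_def)

lemma sets_LB [simp, measurable_cong]: "sets (LB I) = sets borel"
  by (simp add: LB_def)

lemma space_LB [simp]: "space (LB I) = UNIV"
  by (simp add: LB_def)

lemma lborel_space_eq_LB: "lborel_space d = LB {..<d}"
  by (simp add: lborel_space_def LB_def trunc_def [abs_def])

lemma supp_on_borel [measurable]: "supp_on I \<in> sets (borel :: ('i::countable \<Rightarrow> real) measure)"
proof -
  have "supp_on I = {x \<in> space borel. \<forall>i. i \<notin> I \<longrightarrow> x i = 0}"
    by (auto simp: supp_on_def)
  also have "\<dots> \<in> sets borel"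
    by measurable
  finally show ?thesis .
qed

lemma nn_integral_LB:
  assumes [measurable]: "g \<in> borel_measurable borel"
  shows "(\<integral>\<^sup>+x. g x \<partial>LB I) = (\<integral>\<^sup>+x. g (trunc I x) \<partial>(\<Pi>\<^sub>M i\<in>I. lborel))"
  unfolding LB_def by (rule nn_integral_distr) auto

lemma AE_LB_supp: "AE x in LB I. x \<in> supp_on I"
  unfolding LB_def by (subst AE_distr_iff) (auto simp: supp_on_borel)

lemma nn_integral_LB_cong:
  assumes "\<And>x. x \<in> supp_on I \<Longrightarrow> f x = g x"
  shows "(\<integral>\<^sup>+x. f x \<partial>LB I) = (\<integral>\<^sup>+x. g x \<partial>LB I)"
  by (rule nn_integral_cong_AE) (use AE_LB_supp[of I] assms in \<open>auto elim!: eventually_mono\<close>)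

lemma emeasure_LB_box:
  fixes I :: "'i::countable set"
  assumes "finite I" "\<And>i. i \<in> I \<Longrightarrow> A i \<in> sets borel"
  shows "emeasure (LB I) {x \<in> supp_on I. \<forall>i\<in>I. x i \<in> A i} = (\<Prod>i\<in>I. emeasure lborel (A i))"
proof -
  have [measurable]: "{x \<in> supp_on I. \<forall>i\<in>I. x i \<in> A i} \<in> sets borel"
  proof -
    have "Measurable.pred borel (\<lambda>x. x i \<in> A i)" if "i \<in> I" for i
      using assms(2)[OF that] by measurable
    then have "{x \<in> space borel. \<forall>i\<in>I. x i \<in> A i} \<in> sets borel"
      using assms(1) by (intro sets.sets_Collect_finite_All) (auto simp: pred_def)
    then have "supp_on I \<inter> {x \<in> space borel. \<forall>i\<in>I. x i \<in> A i} \<in> sets borel"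
      by measurable
    also have "supp_on I \<inter> {x \<in> space borel. \<forall>i\<in>I. x i \<in> A i} = {x \<in> supp_on I. \<forall>i\<in>I. x i \<in> A i}"
      by auto
    finally show ?thesis .
  qed
  have "emeasure (LB I) {x \<in> supp_on I. \<forall>i\<in>I. x i \<in> A i} =
      emeasure (\<Pi>\<^sub>M i\<in>I. lborel) (trunc I -` {x \<in> supp_on I. \<forall>i\<in>I. x i \<in> A i} \<inter> space (\<Pi>\<^sub>M i\<in>I. lborel))"
    unfolding LB_def by (rule emeasure_distr) auto
  also have "trunc I -` {x \<in> supp_on I. \<forall>i\<in>I. x i \<in> A i} \<inter> space (\<Pi>\<^sub>M i\<in>I. lborel :: real measure) = Pi\<^sub>E I A"
    by (auto simp: space_PiM PiE_iff trunc_def extensional_def supp_on_def)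
  finally show ?thesis
    using assms by (simp add: lborel_product.emeasure_PiM)
qed

lemma sigma_finite_LB:
  fixes I :: "'i::countable set"
  assumes "finite I"
  shows "sigma_finite_measure (LB I)"
proof
  \<comment> \<open>The boxes exhaust only \<open>supp_on I\<close>; adding its null complement to
    each of them makes the union the whole space at no cost in measure.\<close>
  let ?B = "\<lambda>k::nat. {x \<in> supp_on I. \<forall>i\<in>I. x i \<in> {-real k..real k}} \<union> - supp_on I"
  have 1: "{x \<in> supp_on I. \<forall>i\<in>I. x i \<in> {-real k..real k}} \<in> sets borel" for k
  proof -
    have "{x \<in> space borel. \<forall>i\<in>I. x i \<in> {-real k..real k}} \<in> sets borel"
      using assms by (intro sets.sets_Collect_finite_All) auto
    then have "supp_on I \<inter> {x \<in> space borel. \<forall>i\<in>I. x i \<in> {-real k..real k}} \<in> sets borel"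
      by measurable
    also have "supp_on I \<inter> {x \<in> space borel. \<forall>i\<in>I. x i \<in> {-real k..real k}} = {x \<in> supp_on I. \<forall>i\<in>I. x i \<in> {-real k..real k}}"
      by auto
    finally show ?thesis .
  qed
  have 2: "emeasure (LB I) (- supp_on I) = 0"
  proof -
    have "- supp_on I \<in> sets (LB I)" by measurable
    then have "- supp_on I \<in> null_sets (LB I)"
      using AE_LB_supp[of I] by (simp add: AE_iff_null_sets)
    then show ?thesis by (rule null_setsD1)
  qed
  show "\<exists>A. countable A \<and> A \<subseteq> sets (LB I) \<and> \<Union> A = space (LB I) \<and> (\<forall>a\<in>A. emeasure (LB I) a \<noteq> \<infinity>)"
  proof (intro exI[of _ "range ?B"] conjI ballI)
    show "countable (range ?B)" by simp
    show "range ?B \<subseteq> sets (LB I)" using 1 by auto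
    have "\<exists>k. x \<in> ?B k" for x
    proof -
      obtain k :: nat where k: "Max (insert 0 ((\<lambda>i. \<bar>x i\<bar>) ` I)) \<le> real k"
        using real_arch_simple by blast
      have "\<bar>x i\<bar> \<le> real k" if "i \<in> I" for i
        using assms that k by (intro order_trans[OF Max_ge k]) auto
      then have "\<forall>i\<in>I. x i \<in> {-real k..real k}" by (auto simp: abs_le_iff minus_le_iff)
      then show ?thesis by auto
    qed
    then show "\<Union> (range ?B) = space (LB I)" by auto
    fix a assume "a \<in> range ?B"
    then obtain k where a: "a = ?B k" by auto
    have "emeasure (LB I) a \<le> emeasure (LB I) {x \<in> supp_on I. \<forall>i\<in>I. x i \<in> {-real k..real k}} + emeasure (LB I) (- supp_on I)"
      unfolding a using 1 by (intro emeasure_subadditive) auto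
    also have "\<dots> = (\<Prod>i\<in>I. ennreal (2 * real k))"
      using 2 emeasure_LB_box[OF assms, of "\<lambda>_. {-real k..real k}"]
      by (simp del: prod_constant atLeastAtMost_iff)
    also have "\<dots> < \<infinity>"
      by (simp add: ennreal_prod_eq_top less_top[symmetric] del: prod_constant)
    finally show "emeasure (LB I) a \<noteq> \<infinity>" by simp
  qed
qed

text \<open>Preimages of boxes under coordinatewise maps are boxes, so invariance of
  \<open>lborel\<close> in each coordinate is enough. Translations and the reflection at the origin
  are the two cases needed.\<close>

lemma LB_componentwise:
  fixes I :: "'i::countable set"
  assumes "finite I" and \<phi>: "\<And>i. i \<in> I \<Longrightarrow> distr lborel lborel (\<phi> i) = lborel"
    and m [measurable]: "\<And>i. i \<in> I \<Longrightarrow> \<phi> i \<in> borel_measurable borel"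
    and g [measurable]: "g \<in> borel_measurable borel"
  shows "(\<integral>\<^sup>+x. g (trunc I (\<lambda>i. \<phi> i (x i))) \<partial>LB I) = (\<integral>\<^sup>+x. g x \<partial>LB I)"
proof -
  let ?P = "\<Pi>\<^sub>M i\<in>I. lborel :: real measure"
  let ?T = "\<lambda>x. \<lambda>i\<in>I. \<phi> i (x i)"
  have T [measurable]: "?T \<in> ?P \<rightarrow>\<^sub>M ?P"
    by (rule measurable_restrict) measurable
  have eq: "distr ?P ?P ?T = ?P"
  proof (rule lborel_product.PiM_eqI)
    fix A :: "'i \<Rightarrow> real set" assume A: "\<And>i. i \<in> I \<Longrightarrow> A i \<in> sets lborel"
    have "emeasure (distr ?P ?P ?T) (Pi\<^sub>E I A) = emeasure ?P (?T -` Pi\<^sub>E I A \<inter> space ?P)"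
      using A assms(1) by (intro emeasure_distr T sets_PiM_I_finite) auto
    also have "?T -` Pi\<^sub>E I A \<inter> space ?P = Pi\<^sub>E I (\<lambda>i. \<phi> i -` A i)"
      by (auto simp: space_PiM PiE_iff)
    also have "emeasure ?P \<dots> = (\<Prod>i\<in>I. emeasure lborel (\<phi> i -` A i))"
      using A m by (intro lborel_product.emeasure_PiM assms(1)) (metis measurable_sets[of _ borel borel] sets_lborel space_borel Int_UNIV_right)
    also have "\<dots> = (\<Prod>i\<in>I. emeasure (distr lborel lborel (\<phi> i)) (A i))"
      using A m by (intro prod.cong refl) (subst emeasure_distr; auto)
    finally show "emeasure (distr ?P ?P ?T) (Pi\<^sub>E I A) = (\<Prod>i\<in>I. emeasure lborel (A i))"
      by (simp only: \<phi> cong: prod.cong)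
  qed (use assms(1) in auto)
  have [measurable]: "(\<lambda>x. trunc I (\<lambda>i. \<phi> i (x i))) \<in> borel \<rightarrow>\<^sub>M borel"
  proof (rule fun_measurableI)
    show "(\<lambda>x. trunc I (\<lambda>i. \<phi> i (x i)) i) \<in> borel_measurable borel" for i
      by (cases "i \<in> I") (auto simp: trunc_def)
  qed
  have "(\<integral>\<^sup>+x. g (trunc I (\<lambda>i. \<phi> i (x i))) \<partial>LB I) = (\<integral>\<^sup>+x. g (trunc I (\<lambda>i. \<phi> i (trunc I x i))) \<partial>?P)"
    by (subst nn_integral_LB) auto
  also have "\<dots> = (\<integral>\<^sup>+x. g (trunc I (?T x)) \<partial>?P)"
    by (intro nn_integral_cong arg_cong[of _ _ g]) (auto simp: trunc_def)
  also have "\<dots> = (\<integral>\<^sup>+x. g (trunc I x) \<partial>distr ?P ?P ?T)"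
    by (subst nn_integral_distr) auto
  finally show ?thesis
    by (simp add: eq nn_integral_LB)
qed

lemma LB_translate:
  fixes I :: "'i::countable set"
  assumes "finite I" "w \<in> supp_on I" and g [measurable]: "g \<in> borel_measurable borel"
  shows "(\<integral>\<^sup>+x. g (x + w) \<partial>LB I) = (\<integral>\<^sup>+x. g x \<partial>LB I)"
proof -
  have "(\<integral>\<^sup>+x. g (x + w) \<partial>LB I) = (\<integral>\<^sup>+x. g (trunc I (\<lambda>i. w i + x i)) \<partial>LB I)"
    using assms(2) by (intro nn_integral_LB_cong arg_cong[of _ _ g])
      (auto simp: trunc_def supp_on_def fun_eq_iff)
  also have "\<dots> = (\<integral>\<^sup>+x. g x \<partial>LB I)"
    by (rule LB_componentwise) (use assms in \<open>auto simp: lborel_distr_plus cong: distr_cong\<close>)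
  finally show ?thesis .
qed

lemma LB_uminus:
  fixes I :: "'i::countable set"
  assumes "finite I" and g [measurable]: "g \<in> borel_measurable borel"
  shows "(\<integral>\<^sup>+x. g (- x) \<partial>LB I) = (\<integral>\<^sup>+x. g x \<partial>LB I)"
proof -
  have "(\<integral>\<^sup>+x. g (- x) \<partial>LB I) = (\<integral>\<^sup>+x. g (trunc I (\<lambda>i. - x i)) \<partial>LB I)"
    by (intro nn_integral_LB_cong arg_cong[of _ _ g])
      (auto simp: trunc_def supp_on_def fun_eq_iff)
  also have "\<dots> = (\<integral>\<^sup>+x. g x \<partial>LB I)"
    by (rule LB_componentwise) (use assms lborel_distr_uminus in \<open>auto cong: distr_cong\<close>)
  finally show ?thesis .
qed


lemma supp_on_uminus [simp]: "x \<in> supp_on I \<Longrightarrow> - x \<in> supp_on I"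
  by (auto simp: supp_on_def)

lemma supp_on_scaleR [simp]: "x \<in> supp_on I \<Longrightarrow> c *\<^sub>R x \<in> supp_on I"
  by (auto simp: supp_on_def scaleR_fun_def)

text \<open>Fubini in the form used for splitting off a coordinate or a row: \<open>merge\<close> of
  partial functions turns into a sum, as each truncated part is 0 where the other one lives.\<close>

lemma nn_integral_LB_Un:
  fixes I J :: "'i::countable set"
  assumes "I \<inter> J = {}" "finite I" "finite J" and g [measurable]: "g \<in> borel_measurable borel"
  shows "(\<integral>\<^sup>+x. g x \<partial>LB (I \<union> J)) = (\<integral>\<^sup>+x. \<integral>\<^sup>+y. g (x + y) \<partial>LB J \<partial>LB I)"
proof -
  interpret J: sigma_finite_measure "LB J"
    using assms by (rule_tac sigma_finite_LB)
  have "(\<integral>\<^sup>+x. g x \<partial>LB (I \<union> J)) = (\<integral>\<^sup>+x. g (trunc (I \<union> J) x) \<partial>(\<Pi>\<^sub>M i\<in>I\<union>J. lborel))"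
    by (simp add: nn_integral_LB)
  also have "\<dots> = (\<integral>\<^sup>+x. \<integral>\<^sup>+y. g (trunc (I \<union> J) (merge I J (x, y))) \<partial>(\<Pi>\<^sub>M i\<in>J. lborel) \<partial>(\<Pi>\<^sub>M i\<in>I. lborel))"
    using assms by (subst lborel_product.product_nn_integral_fold) auto
  also have "\<dots> = (\<integral>\<^sup>+x. \<integral>\<^sup>+y. g (trunc I x + trunc J y) \<partial>(\<Pi>\<^sub>M i\<in>J. lborel) \<partial>(\<Pi>\<^sub>M i\<in>I. lborel))"
    using assms(1) by (intro nn_integral_cong arg_cong[of _ _ g]) (auto simp: trunc_def merge_def fun_eq_iff)
  also have "\<dots> = (\<integral>\<^sup>+x. \<integral>\<^sup>+y. g (trunc I x + y) \<partial>LB J \<partial>(\<Pi>\<^sub>M i\<in>I. lborel))"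
    by (intro nn_integral_cong nn_integral_LB[symmetric]) measurable
  also have "\<dots> = (\<integral>\<^sup>+x. \<integral>\<^sup>+y. g (x + y) \<partial>LB J \<partial>LB I)"
    by (intro nn_integral_LB[symmetric]) measurable
  finally show ?thesis .
qed

lemma nn_integral_LB_singleton:
  fixes i :: "'i::countable"
  assumes [measurable]: "g \<in> borel_measurable borel"
  shows "(\<integral>\<^sup>+x. g x \<partial>LB {i}) = (\<integral>\<^sup>+t. g (\<lambda>j. if j = i then t else 0) \<partial>lborel)"
proof -
  have m [measurable]: "(\<lambda>t j. if j = i then t else 0) \<in> borel \<rightarrow>\<^sub>M (borel :: ('i \<Rightarrow> real) measure)"
    by (rule fun_measurableI) auto
  have "(\<integral>\<^sup>+x. g x \<partial>LB {i}) = (\<integral>\<^sup>+x. g (\<lambda>j. if j = i then x i else 0) \<partial>(\<Pi>\<^sub>M i\<in>{i}. lborel))"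
    by (subst nn_integral_LB) (auto simp: trunc_def intro!: nn_integral_cong arg_cong[of _ _ g])
  also have "\<dots> = (\<integral>\<^sup>+t. g (\<lambda>j. if j = i then t else 0) \<partial>lborel)"
    using measurable_compose[OF m assms]
    by (intro lborel_product.product_nn_integral_singleton[where f = "\<lambda>t. g (\<lambda>j. if j = i then t else 0)"]) simp
  finally show ?thesis .
qed

definition unit_cube :: "'i set \<Rightarrow> ('i \<Rightarrow> real) set"
  where "unit_cube I = {x \<in> supp_on I. \<forall>i\<in>I. x i \<in> {0..1}}"

lemma unit_cube_borel [measurable]:
  "finite I \<Longrightarrow> unit_cube I \<in> sets (borel :: ('i::countable \<Rightarrow> real) measure)"
proof -
  assume "finite I"
  then have "{x \<in> space borel. \<forall>i\<in>I. x i \<in> {0..1::real}} \<in> sets borel"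
    by (intro sets.sets_Collect_finite_All) auto
  then have "supp_on I \<inter> {x \<in> space borel. \<forall>i\<in>I. x i \<in> {0..1}} \<in> sets borel"
    by measurable
  also have "supp_on I \<inter> {x \<in> space borel. \<forall>i\<in>I. x i \<in> {0..1}} = unit_cube I"
    by (auto simp: unit_cube_def)
  finally show ?thesis .
qed

lemma emeasure_unit_cube:
  "finite I \<Longrightarrow> emeasure (LB I) (unit_cube I :: ('i::countable \<Rightarrow> real) set) = 1"
  unfolding unit_cube_def by (subst emeasure_LB_box) auto

text \<open>
  Uniqueness of translation invariant measures, in the form of the double integral of
  \<open>g (T x) * indicator (unit_cube J) (y + T x)\<close> evaluated in both orders.
\<close>

lemma LB_linear_factor:
  fixes I :: "'i::countable set" and J :: "'j::countable set"
  assumes fin: "finite I" "finite J"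
    and T [measurable]: "T \<in> borel \<rightarrow>\<^sub>M borel" and T' [measurable]: "T' \<in> borel \<rightarrow>\<^sub>M borel"
    and TI: "\<And>x. x \<in> supp_on I \<Longrightarrow> T x \<in> supp_on J" and T'J: "\<And>y. y \<in> supp_on J \<Longrightarrow> T' y \<in> supp_on I"
    and add: "\<And>x w. x \<in> supp_on I \<Longrightarrow> w \<in> supp_on I \<Longrightarrow> T (x + w) = T x + T w"
    and inv: "\<And>y. y \<in> supp_on J \<Longrightarrow> T (T' y) = y" "\<And>x. x \<in> supp_on I \<Longrightarrow> T' (T x) = x"
  defines "\<kappa> \<equiv> \<integral>\<^sup>+x. indicator (unit_cube J) (T x) \<partial>LB I"
  shows LB_linear_factor_pos: "0 < \<kappa>" and LB_linear_factor_finite: "\<kappa> < \<infinity>"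
    and nn_integral_LB_linear: "\<And>g. g \<in> borel_measurable borel \<Longrightarrow> (\<integral>\<^sup>+x. g (T x) \<partial>LB I) = \<kappa> * (\<integral>\<^sup>+y. g y \<partial>LB J)"
proof -
  interpret I: sigma_finite_measure "LB I" using fin by (rule_tac sigma_finite_LB)
  interpret J: sigma_finite_measure "LB J" using fin by (rule_tac sigma_finite_LB)
  interpret IJ: pair_sigma_finite "LB I" "LB J" ..
  have [measurable]: "unit_cube J \<in> sets (borel :: ('j \<Rightarrow> real) measure)" "unit_cube I \<in> sets (borel :: ('i \<Rightarrow> real) measure)"
    using fin by auto
  let ?k = "indicator (unit_cube J) :: _ \<Rightarrow> ennreal"
  show *: "(\<integral>\<^sup>+x. g (T x) \<partial>LB I) = \<kappa> * (\<integral>\<^sup>+y. g y \<partial>LB J)"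
    if g [measurable]: "g \<in> borel_measurable borel" for g
  proof -
    have "(\<integral>\<^sup>+x. g (T x) \<partial>LB I) = (\<integral>\<^sup>+x. \<integral>\<^sup>+y. g (T x) * ?k y \<partial>LB J \<partial>LB I)"
      by (simp add: nn_integral_cmult emeasure_unit_cube fin)
    also have "\<dots> = (\<integral>\<^sup>+x. \<integral>\<^sup>+y. g (T x) * ?k (y + T x) \<partial>LB J \<partial>LB I)"
      by (intro nn_integral_LB_cong LB_translate[symmetric, where g = "\<lambda>y. g (T _) * ?k y"] fin TI) measurable
    also have "\<dots> = (\<integral>\<^sup>+y. \<integral>\<^sup>+x. g (T x) * ?k (y + T x) \<partial>LB I \<partial>LB J)"
      by (rule IJ.Fubini'[symmetric]) measurable
    \<comment> \<open>Translating x by \<open>T' (- y)\<close> moves y out of the cube and into g;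
      after reflecting and translating y the two integrals decouple.\<close>
    also have "\<dots> = (\<integral>\<^sup>+y. \<integral>\<^sup>+x. g (T (x + T' (- y))) * ?k (y + T (x + T' (- y))) \<partial>LB I \<partial>LB J)"
      by (intro nn_integral_LB_cong LB_translate[symmetric, where g = "\<lambda>x. g (T x) * ?k (_ + T x)"] fin T'J) auto
    also have "\<dots> = (\<integral>\<^sup>+y. \<integral>\<^sup>+x. g (T x + (- y)) * ?k (T x) \<partial>LB I \<partial>LB J)"
      by (intro nn_integral_LB_cong) (simp add: add inv T'J)
    also have "\<dots> = (\<integral>\<^sup>+x. \<integral>\<^sup>+y. g (T x + (- y)) * ?k (T x) \<partial>LB J \<partial>LB I)"
      by (rule IJ.Fubini') measurable
    also have "\<dots> = (\<integral>\<^sup>+x. \<integral>\<^sup>+y. g (T x + y) * ?k (T x) \<partial>LB J \<partial>LB I)"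
      by (intro nn_integral_LB_cong LB_uminus[where g = "\<lambda>y. g (T _ + y) * ?k (T _)"] fin) measurable
    also have "\<dots> = (\<integral>\<^sup>+x. \<integral>\<^sup>+y. g (y + T x) * ?k (T x) \<partial>LB J \<partial>LB I)"
      by (simp add: add.commute)
    also have "\<dots> = (\<integral>\<^sup>+x. \<integral>\<^sup>+y. g y * ?k (T x) \<partial>LB J \<partial>LB I)"
      by (intro nn_integral_LB_cong LB_translate[where g = "\<lambda>y. g y * ?k (T _)"] fin TI) measurable
    also have "\<dots> = \<kappa> * (\<integral>\<^sup>+y. g y \<partial>LB J)"
      by (simp add: nn_integral_multc nn_integral_cmult \<kappa>_def mult.commute)
    finally show ?thesis .
  qed
  \<comment> \<open>A test function pulled back along the inverse map shows that \<kappa> times some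
    value is 1, which excludes both 0 and infinity.\<close>
  have "(\<integral>\<^sup>+x. indicator (unit_cube I) (T' (T x)) \<partial>LB I) = (\<integral>\<^sup>+x. indicator (unit_cube I) x \<partial>LB I)"
    by (intro nn_integral_LB_cong) (simp add: inv)
  then have eq: "\<kappa> * (\<integral>\<^sup>+y. indicator (unit_cube I) (T' y) \<partial>LB J) = 1"
    using *[of "\<lambda>y. indicator (unit_cube I) (T' y)"] by (simp add: emeasure_unit_cube fin)
  then show "0 < \<kappa>"
    by (metis mult_zero_left not_gr_zero zero_neq_one)
  show "\<kappa> < \<infinity>"
  proof (rule ccontr)
    assume "\<not> \<kappa> < \<infinity>"
    then have "\<kappa> = \<infinity>" using less_top[of \<kappa>] by auto
    with eq show False
      by (auto simp: ennreal_top_mult split: if_splits)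
  qed
qed

text \<open>Here the factor of \<open>LB_linear_factor\<close> can be read off, as the preimage of
  the unit cube under the dilation is the cube with side 1 / s.\<close>

lemma LB_scale:
  fixes I :: "'i::countable set"
  assumes fin: "finite I" and s: "s > 0" and g: "g \<in> borel_measurable borel"
  shows "(\<integral>\<^sup>+x. g (s *\<^sub>R x) \<partial>LB I) = ennreal ((1 / s) ^ card I) * (\<integral>\<^sup>+x. g x \<partial>LB I)"
proof -
  have "(\<integral>\<^sup>+x. indicator (unit_cube I) (s *\<^sub>R x) \<partial>LB I) =
      (\<integral>\<^sup>+x. indicator {x \<in> supp_on I. \<forall>i\<in>I. x i \<in> {0..1/s}} x \<partial>LB I)"
    using s by (intro nn_integral_LB_cong)
      (auto simp: indicator_def unit_cube_def scaleR_fun_def supp_on_def field_simps zero_le_mult_iff)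
  also have "\<dots> = ennreal ((1 / s) ^ card I)"
  proof -
    have "{x \<in> space borel. \<forall>i\<in>I. x i \<in> {0..1/s}} \<in> sets borel"
      using fin by (intro sets.sets_Collect_finite_All) auto
    then have "supp_on I \<inter> {x \<in> space borel. \<forall>i\<in>I. x i \<in> {0..1/s}} \<in> sets borel"
      by measurable
    also have "supp_on I \<inter> {x \<in> space borel. \<forall>i\<in>I. x i \<in> {0..1/s}} = {x \<in> supp_on I. \<forall>i\<in>I. x i \<in> {0..1/s}}"
      by auto
    finally show ?thesis
      using s emeasure_LB_box[OF fin, of "\<lambda>_. {0..1/s}"]
      by (subst nn_integral_indicator) (simp_all add: ennreal_power)
  qed
  finally have \<kappa>: "(\<integral>\<^sup>+x. indicator (unit_cube I) (s *\<^sub>R x) \<partial>LB I) = ennreal ((1 / s) ^ card I)" .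
  have m: "(\<lambda>x. r *\<^sub>R x) \<in> borel \<rightarrow>\<^sub>M (borel :: ('i \<Rightarrow> real) measure)" for r
    by measurable
  show ?thesis
    using nn_integral_LB_linear[of I I "\<lambda>x. s *\<^sub>R x" "\<lambda>x. (1 / s) *\<^sub>R x" g, OF fin fin m m] s g
    unfolding \<kappa> by (simp add: scaleR_add_right)
qed

text \<open>On each line through \<open>x0\<close> the polynomial is nonzero at t = 1 and has
  finitely many zeros, so almost no t leads into the zero set. For t up to 1/2, on the other hand,
  the homothety from x to (1 - t) x + t \<open>x0\<close> pulls the zero set back to a set of at
  least the same measure. Averaging over t with Fubini makes that measure 0.\<close>

lemma LB_zero_set_null:
  fixes I :: "'i::countable set" and P :: "('i \<Rightarrow> real) \<Rightarrow> real"
  assumes fin: "finite I" and P [measurable]: "P \<in> borel_measurable borel"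
    and x0: "x0 \<in> supp_on I" "P x0 \<noteq> 0"
    and poly: "\<And>x. x \<in> supp_on I \<Longrightarrow> \<exists>p. \<forall>t. P (x + t *\<^sub>R (x0 - x)) = poly p t"
  shows "AE x in LB I. P x \<noteq> 0"
proof -
  interpret I: sigma_finite_measure "LB I" using fin by (rule_tac sigma_finite_LB)
  interpret pair_sigma_finite "LB I" lborel ..
  let ?N = "\<lambda>x. indicator {x. P x = 0} x :: ennreal"
  have [measurable]: "?N \<in> borel_measurable borel"
  proof -
    have "{x \<in> space borel. P x = 0} \<in> sets borel" by measurable
    then show ?thesis by simp
  qed
  define G where "G = (\<integral>\<^sup>+x. ?N x \<partial>LB I)"
  have ge: "G \<le> (\<integral>\<^sup>+x. ?N (x + t *\<^sub>R (x0 - x)) \<partial>LB I)" if t: "t \<in> {0..1/2}" for t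
  proof -
    have "(\<integral>\<^sup>+x. ?N (x + t *\<^sub>R (x0 - x)) \<partial>LB I) = (\<integral>\<^sup>+x. ?N ((1 - t) *\<^sub>R x + t *\<^sub>R x0) \<partial>LB I)"
      by (simp add: algebra_simps)
    also have "\<dots> = ennreal ((1 / (1 - t)) ^ card I) * (\<integral>\<^sup>+x. ?N (x + t *\<^sub>R x0) \<partial>LB I)"
      using t by (intro LB_scale[where g = "\<lambda>x. ?N (x + t *\<^sub>R x0)"] fin) auto
    also have "(\<integral>\<^sup>+x. ?N (x + t *\<^sub>R x0) \<partial>LB I) = G"
      unfolding G_def by (intro LB_translate fin supp_on_scaleR x0) measurable
    finally have *: "(\<integral>\<^sup>+x. ?N (x + t *\<^sub>R (x0 - x)) \<partial>LB I) = ennreal ((1 / (1 - t)) ^ card I) * G" .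
    have "1 \<le> (1 / (1 - t)) ^ card I"
      using t by (intro one_le_power) auto
    then have "1 * G \<le> ennreal ((1 / (1 - t)) ^ card I) * G"
      by (intro mult_right_mono) auto
    then show ?thesis unfolding * by simp
  qed
  have "G * ennreal (1/2) = (\<integral>\<^sup>+t. G * indicator {0..1/2::real} t \<partial>lborel)"
    by (simp add: nn_integral_cmult)
  also have "\<dots> \<le> (\<integral>\<^sup>+t. (\<integral>\<^sup>+x. ?N (x + t *\<^sub>R (x0 - x)) * indicator {0..1/2::real} t \<partial>LB I) \<partial>lborel)"
    using ge by (intro nn_integral_mono) (auto simp: indicator_def)
  also have "\<dots> = (\<integral>\<^sup>+x. (\<integral>\<^sup>+t. ?N (x + t *\<^sub>R (x0 - x)) * indicator {0..1/2::real} t \<partial>lborel) \<partial>LB I)"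
    by (rule Fubini') measurable
  also have "\<dots> = (\<integral>\<^sup>+x. 0 \<partial>LB I)"
  proof (rule nn_integral_LB_cong)
    fix x assume "x \<in> supp_on I"
    then obtain p where p: "\<And>t. P (x + t *\<^sub>R (x0 - x)) = poly p t"
      using poly by blast
    from p[of 1] x0 have "p \<noteq> 0" by auto
    then have "finite {t. poly p t = 0}" by (rule poly_roots_finite)
    then have "{t. poly p t = 0} \<in> null_sets lborel"
      by (simp add: finite_imp_null_set_lborel)
    then have "AE t in lborel. t \<notin> {t. poly p t = 0}"
      by (rule AE_not_in)
    then have "AE t in lborel. ?N (x + t *\<^sub>R (x0 - x)) * indicator {0..1/2::real} t = 0"
      by (rule eventually_mono) (simp add: p)
    then have "(\<integral>\<^sup>+t. ?N (x + t *\<^sub>R (x0 - x)) * indicator {0..1/2::real} t \<partial>lborel) = (\<integral>\<^sup>+(t::real). 0 \<partial>lborel)"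
      by (rule nn_integral_cong_AE)
    then show "(\<integral>\<^sup>+t. ?N (x + t *\<^sub>R (x0 - x)) * indicator {0..1/2::real} t \<partial>lborel) = 0"
      by simp
  qed
  finally have "G * ennreal (1/2) = 0" by simp
  then have "G = 0" by (simp add: ennreal_eq_0_iff)
  then have "AE x in LB I. ?N x = 0"
    unfolding G_def by (subst (asm) nn_integral_0_iff_AE) simp_all
  then show ?thesis
    by (rule eventually_mono) (simp add: indicator_def split: if_splits)
qed

subsection \<open>Determinants and adjugates\<close>

text \<open>A matrix is a plain function of two indices, so that a configuration of points is its
  own matrix with the points as rows, and measurability and limits are treated entry by
  entry.\<close>

definition mdet :: "nat \<Rightarrow> (nat \<Rightarrow> nat \<Rightarrow> real) \<Rightarrow> real"
  where "mdet d A = det (mat d d (\<lambda>(i, j). A i j))"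

text \<open>The adjugate. It stands in for the inverse because its entries are polynomials in the
  matrix, hence measurable and continuous even where the determinant vanishes.\<close>

definition madj :: "nat \<Rightarrow> (nat \<Rightarrow> nat \<Rightarrow> real) \<Rightarrow> nat \<Rightarrow> nat \<Rightarrow> real"
  where "madj d A i j = (-1) ^ (i + j) * mdet (d - 1) (\<lambda>a b. A (insert_index j a) (insert_index i b))"

lemma mdet_sum:
  "mdet d A = (\<Sum>p | p permutes {0..<d}. signof p * (\<Prod>i = 0..<d. A i (p i)))"
proof -
  have "mdet d A = (\<Sum>p | p permutes {0..<d}. signof p * (\<Prod>i = 0..<d. mat d d (\<lambda>(i, j). A i j) $$ (i, p i)))"
    unfolding mdet_def by (rule det_def') simp
  also have "\<dots> = (\<Sum>p | p permutes {0..<d}. signof p * (\<Prod>i = 0..<d. A i (p i)))"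
  proof (intro sum.cong refl arg_cong2[of _ _ _ _ "(*)"] prod.cong)
    fix p i assume "p \<in> {p. p permutes {0..<d}}" "i \<in> {0..<d}"
    then have "p i < d" using permutes_in_image[of p "{0..<d}" i] by simp
    then show "mat d d (\<lambda>(i, j). A i j) $$ (i, p i) = A i (p i)"
      using \<open>i \<in> {0..<d}\<close> by simp
  qed
  finally show ?thesis .
qed

lemma adj_mat_eq_madj:
  assumes "i < d" "j < d"
  shows "adj_mat (mat d d (\<lambda>(i, j). A i j)) $$ (i, j) = madj d A i j"
proof -
  let ?A = "mat d d (\<lambda>(i, j). A i j)"
  have "mat_delete ?A j i = mat (d - 1) (d - 1) (\<lambda>(a, b). A (insert_index j a) (insert_index i b))"
    using assms by (intro eq_matI) (auto simp: mat_delete_def insert_index_def)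
  then show ?thesis
    using assms by (simp add: adj_mat_def cofactor_def madj_def mdet_def add.commute)
qed

lemma madj_mult_left:
  assumes "i < d" "j < d"
  shows "(\<Sum>k<d. madj d A i k * A k j) = (if i = j then mdet d A else 0)"
proof -
  let ?A = "mat d d (\<lambda>(i, j). A i j)"
  have car: "?A \<in> carrier_mat d d" by simp
  have "(adj_mat ?A * ?A) $$ (i, j) = (\<Sum>k<d. madj d A i k * A k j)"
    using assms adj_mat(1)[OF car]
    by (auto simp: scalar_prod_def atLeast0LessThan adj_mat_eq_madj intro!: sum.cong)
  moreover have "(adj_mat ?A * ?A) $$ (i, j) = (if i = j then mdet d A else 0)"
    using assms by (simp add: adj_mat(3)[OF car] mdet_def)
  ultimately show ?thesis by simp
qed

lemma madj_mult_right:
  assumes "i < d" "j < d"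
  shows "(\<Sum>k<d. A i k * madj d A k j) = (if i = j then mdet d A else 0)"
proof -
  let ?A = "mat d d (\<lambda>(i, j). A i j)"
  have car: "?A \<in> carrier_mat d d" by simp
  have "(?A * adj_mat ?A) $$ (i, j) = (\<Sum>k<d. A i k * madj d A k j)"
    using assms adj_mat(1)[OF car]
    by (auto simp: scalar_prod_def atLeast0LessThan adj_mat_eq_madj intro!: sum.cong)
  moreover have "(?A * adj_mat ?A) $$ (i, j) = (if i = j then mdet d A else 0)"
    using assms by (simp add: adj_mat(2)[OF car] mdet_def)
  ultimately show ?thesis by simp
qed

lemma mdet_nonzeroI:
  assumes "\<And>v j. (\<And>i. i < d \<Longrightarrow> (\<Sum>j<d. A i j * v j) = 0) \<Longrightarrow> j < d \<Longrightarrow> v j = 0"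
  shows "mdet d A \<noteq> 0"
proof
  let ?A = "mat d d (\<lambda>(i, j). A i j)"
  assume "mdet d A = 0"
  then obtain v where v: "v \<in> carrier_vec d" "v \<noteq> 0\<^sub>v d" "?A *\<^sub>v v = 0\<^sub>v d"
    unfolding mdet_def by (subst (asm) det_0_iff_vec_prod_zero[of _ d]) auto
  have "(\<Sum>j<d. A i j * vec_index v j) = 0" if "i < d" for i
  proof -
    have "vec_index (?A *\<^sub>v v) i = 0" using v(3) that by simp
    then show ?thesis
      using that v(1) by (simp add: scalar_prod_def atLeast0LessThan)
  qed
  then have "vec_index v j = 0" if "j < d" for j
    using assms[of "vec_index v"] that by blast
  then have "v = 0\<^sub>v d" using v(1) by (intro eq_vecI) auto
  with v(2) show False by simp
qed

text \<open>Multiplying the system by the adjugate leaves the determinant times v.\<close>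

lemma mdet_nonzeroD:
  assumes "mdet d A \<noteq> 0" "\<And>i. i < d \<Longrightarrow> (\<Sum>j<d. A i j * v j) = 0" "j < d"
  shows "v j = 0"
proof -
  have "mdet d A * v j = (\<Sum>l<d. (if j = l then mdet d A else 0) * v l)"
    using assms(3) by (simp add: if_distrib[of "\<lambda>x. x * _"] cong: if_cong)
  also have "\<dots> = (\<Sum>l<d. (\<Sum>k<d. madj d A j k * A k l) * v l)"
    using assms(3) by (intro sum.cong refl) (simp add: madj_mult_left)
  also have "\<dots> = (\<Sum>k<d. madj d A j k * (\<Sum>l<d. A k l * v l))"
    by (simp add: sum_distrib_left sum_distrib_right mult.assoc) (rule sum.swap)
  also have "\<dots> = 0"
    using assms(2) by simp
  finally show ?thesis using assms(1) by simp
qed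

lemma mdet_upper_unit:
  assumes "\<And>i. i < d \<Longrightarrow> A i i = 1" "\<And>i j. j < i \<Longrightarrow> i < d \<Longrightarrow> A i j = 0"
  shows "mdet d A = 1"
proof -
  have "mdet d A = prod_list (diag_mat (mat d d (\<lambda>(i, j). A i j)))"
    unfolding mdet_def
    by (rule det_upper_triangular[of _ d]) (use assms in \<open>auto simp: upper_triangular_def\<close>)
  also have "diag_mat (mat d d (\<lambda>(i, j). A i j)) = map (\<lambda>_. 1) [0..<d]"
    using assms by (auto simp: diag_mat_def)
  finally show ?thesis by (simp add: map_replicate_const)
qed

lemma mdet_measurable:
  assumes "\<And>i j. (\<lambda>x. A x i j) \<in> borel_measurable M"
  shows "(\<lambda>x. mdet d (A x)) \<in> borel_measurable M"
  unfolding mdet_sum using assms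
  by (intro borel_measurable_sum borel_measurable_times borel_measurable_const borel_measurable_prod) auto

lemma madj_measurable:
  assumes "\<And>i j. (\<lambda>x. A x i j) \<in> borel_measurable M"
  shows "(\<lambda>x. madj d (A x) i j) \<in> borel_measurable M"
  unfolding madj_def using assms
  by (intro borel_measurable_times borel_measurable_const mdet_measurable) auto

lemma tendsto_mdet:
  assumes "\<And>i j. ((\<lambda>x. A x i j) \<longlongrightarrow> B i j) F"
  shows "((\<lambda>x. mdet d (A x)) \<longlongrightarrow> mdet d B) F"
  unfolding mdet_sum using assms by (intro tendsto_intros) auto

lemma tendsto_madj:
  assumes "\<And>i j. ((\<lambda>x. A x i j) \<longlongrightarrow> B i j) F"
  shows "((\<lambda>x. madj d (A x) i j) \<longlongrightarrow> madj d B i j) F"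
  unfolding madj_def using assms by (intro tendsto_intros tendsto_mdet) auto

text \<open>Closure rules for this predicate supply the polynomials in one variable that
  \<open>LB_zero_set_null\<close> asks for.\<close>

definition is_poly :: "(real \<Rightarrow> real) \<Rightarrow> bool"
  where "is_poly f \<longleftrightarrow> (\<exists>p. \<forall>t. f t = poly p t)"

lemma is_poly_intros:
  "is_poly (\<lambda>t. c)" "is_poly (\<lambda>t. t)"
  "is_poly f \<Longrightarrow> is_poly g \<Longrightarrow> is_poly (\<lambda>t. f t + g t)"
  "is_poly f \<Longrightarrow> is_poly g \<Longrightarrow> is_poly (\<lambda>t. f t - g t)"
  "is_poly f \<Longrightarrow> is_poly g \<Longrightarrow> is_poly (\<lambda>t. f t * g t)"
proof -
  show "is_poly (\<lambda>t. c)" unfolding is_poly_def by (rule exI[of _ "[:c:]"]) simp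
  show "is_poly (\<lambda>t. t)" unfolding is_poly_def by (rule exI[of _ "[:0, 1:]"]) simp
  show "is_poly (\<lambda>t. f t + g t)" if "is_poly f" "is_poly g"
    using that unfolding is_poly_def by (metis poly_add)
  show "is_poly (\<lambda>t. f t - g t)" if "is_poly f" "is_poly g"
    using that unfolding is_poly_def by (metis poly_diff)
  show "is_poly (\<lambda>t. f t * g t)" if "is_poly f" "is_poly g"
    using that unfolding is_poly_def by (metis poly_mult)
qed

lemma is_poly_sum: "(\<And>i. i \<in> I \<Longrightarrow> is_poly (\<lambda>t. f t i)) \<Longrightarrow> is_poly (\<lambda>t. \<Sum>i\<in>I. f t i)"
  by (induction I rule: infinite_finite_induct) (auto intro: is_poly_intros)

lemma is_poly_prod: "(\<And>i. i \<in> I \<Longrightarrow> is_poly (\<lambda>t. f t i)) \<Longrightarrow> is_poly (\<lambda>t. \<Prod>i\<in>I. f t i)"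
  by (induction I rule: infinite_finite_induct) (auto intro: is_poly_intros)

lemma is_poly_mdet: "(\<And>i j. is_poly (\<lambda>t. A t i j)) \<Longrightarrow> is_poly (\<lambda>t. mdet d (A t))"
  unfolding mdet_sum by (intro is_poly_sum is_poly_intros is_poly_prod) auto

subsection \<open>The affine Blaschke--Petkantschin formula for beta densities\<close>

definition dotp :: "nat \<Rightarrow> (nat \<Rightarrow> real) \<Rightarrow> (nat \<Rightarrow> real) \<Rightarrow> real"
  where "dotp k a y = (\<Sum>j<k. a j * y j)"

lemma dotp_cong: "(\<And>j. j < k \<Longrightarrow> a j = a' j) \<Longrightarrow> (\<And>j. j < k \<Longrightarrow> y j = y' j) \<Longrightarrow> dotp k a y = dotp k a' y'"
  by (simp add: dotp_def)

lemma dotp_add_left: "dotp k (\<lambda>j. a j + b j) y = dotp k a y + dotp k b y"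
  by (simp add: dotp_def algebra_simps sum.distrib)

lemma dotp_add_right: "dotp k y (\<lambda>j. a j + b j) = dotp k y a + dotp k y b"
  by (simp add: dotp_def algebra_simps sum.distrib)

lemma dotp_diff_left: "dotp k (\<lambda>j. a j - b j) y = dotp k a y - dotp k b y"
  by (simp add: dotp_def algebra_simps sum_subtractf)

lemma dotp_diff_right: "dotp k y (\<lambda>j. a j - b j) = dotp k y a - dotp k y b"
  by (simp add: dotp_def algebra_simps sum_subtractf)

lemma dotp_mult_left: "dotp k (\<lambda>j. c * a j) y = c * dotp k a y"
  by (simp add: dotp_def sum_distrib_left mult.assoc)

lemma dotp_mult_right: "dotp k y (\<lambda>j. c * a j) = c * dotp k y a"
  by (simp add: dotp_def sum_distrib_left algebra_simps)

lemma dotp_commute: "dotp k a y = dotp k y a"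
  by (simp add: dotp_def mult.commute)

lemma dotp_nonneg [simp]: "0 \<le> dotp k a a"
  by (simp add: dotp_def sum_nonneg)

lemmas dotp_linear = dotp_add_left dotp_add_right dotp_diff_left dotp_diff_right dotp_mult_left dotp_mult_right

lemma dotp_measurable [measurable (raw)]:
  assumes "\<And>j. (\<lambda>x. f x j) \<in> borel_measurable M" "\<And>j. (\<lambda>x. g x j) \<in> borel_measurable M"
  shows "(\<lambda>x. dotp k (f x) (g x)) \<in> borel_measurable M"
  unfolding dotp_def using assms by measurable

section \<open>Hyperplanes as graphs over the first k coordinates\<close>

definition ymat :: "nat \<Rightarrow> (nat \<times> nat \<Rightarrow> real) \<Rightarrow> nat \<Rightarrow> nat \<Rightarrow> real"
  where "ymat k Y i j = (if j < k then Y (i, j) else 1)"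

text \<open>The k + 1 points of R^(k + 1) are split into base points Y, their first k coordinates,
  and heights, which form column k. \<open>\<alpha>\<close> encodes the graph of a . y + b, with the
  slope a in the entries below k and b = \<open>\<alpha> k\<close>. The heights are
  \<open>ymat\<close> applied to \<open>\<alpha>\<close>, so they determine the hyperplane when the
  base points are affinely independent.\<close>

definition zmap :: "nat \<Rightarrow> (nat \<times> nat \<Rightarrow> real) \<Rightarrow> (nat \<Rightarrow> real) \<Rightarrow> nat \<times> nat \<Rightarrow> real"
  where "zmap k Y \<alpha> = (\<lambda>(i, j). if i < Suc k \<and> j = k then dotp k \<alpha> (\<lambda>l. Y (i, l)) + \<alpha> k else 0)"

definition zinv :: "nat \<Rightarrow> (nat \<times> nat \<Rightarrow> real) \<Rightarrow> (nat \<times> nat \<Rightarrow> real) \<Rightarrow> nat \<Rightarrow> real"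
  where "zinv k Y Z = (\<lambda>j. if j < Suc k
    then (\<Sum>i<Suc k. madj (Suc k) (ymat k Y) j i * Z (i, k)) / mdet (Suc k) (ymat k Y) else 0)"

abbreviation Iy :: "nat \<Rightarrow> (nat \<times> nat) set" where "Iy k \<equiv> {..<Suc k} \<times> {..<k}"
abbreviation Iz :: "nat \<Rightarrow> (nat \<times> nat) set" where "Iz k \<equiv> {..<Suc k} \<times> {k}"

lemma zmap_supp [simp]: "zmap k Y \<alpha> \<in> supp_on (Iz k)"
  by (auto simp: zmap_def supp_on_def)

lemma zinv_supp [simp]: "zinv k Y Z \<in> supp_on {..<Suc k}"
  by (auto simp: zinv_def supp_on_def)

lemma zmap_eq_ymat: "zmap k Y \<alpha> (i, k) = (if i < Suc k then \<Sum>l<Suc k. ymat k Y i l * \<alpha> l else 0)"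
  by (simp add: zmap_def ymat_def dotp_def mult.commute)

lemma zmap_zinv:
  assumes "mdet (Suc k) (ymat k Y) \<noteq> 0" "Z \<in> supp_on (Iz k)"
  shows "zmap k Y (zinv k Y Z) = Z"
proof (rule ext)
  fix p :: "nat \<times> nat"
  obtain i j where p: "p = (i, j)" by (cases p)
  let ?D = "mdet (Suc k) (ymat k Y)" and ?B = "madj (Suc k) (ymat k Y)"
  show "zmap k Y (zinv k Y Z) p = Z p"
  proof (cases "i < Suc k \<and> j = k")
    case True
    have "zmap k Y (zinv k Y Z) (i, k) = (\<Sum>l<Suc k. ymat k Y i l * ((\<Sum>m<Suc k. ?B l m * Z (m, k)) / ?D))"
      using True by (subst zmap_eq_ymat) (auto simp: zinv_def intro!: sum.cong)
    also have "\<dots> = (\<Sum>l<Suc k. \<Sum>m<Suc k. ymat k Y i l * ?B l m * (Z (m, k) / ?D))"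
      by (simp only: sum_distrib_left sum_divide_distrib times_divide_eq_right mult.assoc)
    also have "\<dots> = (\<Sum>m<Suc k. (\<Sum>l<Suc k. ymat k Y i l * ?B l m) * (Z (m, k) / ?D))"
      unfolding sum_distrib_right by (rule sum.swap)
    also have "\<dots> = (\<Sum>m<Suc k. (if i = m then ?D else 0) * (Z (m, k) / ?D))"
      using True by (intro sum.cong refl arg_cong2[of _ _ _ _ "(*)"] madj_mult_right) auto
    also have "\<dots> = (\<Sum>m<Suc k. if i = m then Z (m, k) else 0)"
      using assms(1) by (intro sum.cong) auto
    also have "\<dots> = Z (i, k)"
      using True by (simp del: sum.lessThan_Suc)
    finally show ?thesis using True p by simp
  next
    case False
    then show ?thesis using assms(2) p by (auto simp: zmap_def supp_on_def)
  qed
qed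

lemma zinv_zmap:
  assumes "mdet (Suc k) (ymat k Y) \<noteq> 0" "\<alpha> \<in> supp_on {..<Suc k}"
  shows "zinv k Y (zmap k Y \<alpha>) = \<alpha>"
proof (rule ext)
  fix j
  let ?D = "mdet (Suc k) (ymat k Y)" and ?B = "madj (Suc k) (ymat k Y)"
  show "zinv k Y (zmap k Y \<alpha>) j = \<alpha> j"
  proof (cases "j < Suc k")
    case True
    have "zinv k Y (zmap k Y \<alpha>) j = (\<Sum>i<Suc k. ?B j i * (\<Sum>l<Suc k. ymat k Y i l * \<alpha> l)) / ?D"
      using True unfolding zinv_def by (auto simp: zmap_eq_ymat intro!: sum.cong)
    also have "(\<Sum>i<Suc k. ?B j i * (\<Sum>l<Suc k. ymat k Y i l * \<alpha> l)) =
        (\<Sum>i<Suc k. \<Sum>l<Suc k. ?B j i * ymat k Y i l * \<alpha> l)"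
      by (simp only: sum_distrib_left mult.assoc)
    also have "\<dots> = (\<Sum>l<Suc k. (\<Sum>i<Suc k. ?B j i * ymat k Y i l) * \<alpha> l)"
      unfolding sum_distrib_right by (rule sum.swap)
    also have "\<dots> = (\<Sum>l<Suc k. (if j = l then ?D else 0) * \<alpha> l)"
      using True by (intro sum.cong refl arg_cong2[of _ _ _ _ "(*)"] madj_mult_left) auto
    also have "\<dots> = ?D * \<alpha> j"
      using True by (simp add: if_distrib[of "\<lambda>x. x * _"] del: sum.lessThan_Suc cong: if_cong)
    finally show ?thesis using assms(1) by simp
  next
    case False
    then show ?thesis using assms(2) by (auto simp: zinv_def supp_on_def)
  qed
qed

lemma zmap_measurable [measurable (raw)]:
  assumes [measurable]: "f \<in> M \<rightarrow>\<^sub>M borel" "g \<in> M \<rightarrow>\<^sub>M borel"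
  shows "(\<lambda>x. zmap k (f x) (g x)) \<in> M \<rightarrow>\<^sub>M borel"
proof (rule fun_measurableI)
  fix p :: "nat \<times> nat"
  obtain i j where p: "p = (i, j)" by (cases p)
  show "(\<lambda>x. zmap k (f x) (g x) p) \<in> borel_measurable M"
    unfolding p zmap_def by (cases "i < Suc k \<and> j = k") (auto intro!: dotp_measurable borel_measurable_add)
qed

lemma zinv_measurable [measurable]: "zinv k Y \<in> borel \<rightarrow>\<^sub>M borel"
proof (rule fun_measurableI)
  show "(\<lambda>x. zinv k Y x j) \<in> borel_measurable borel" for j
    unfolding zinv_def by (cases "j < Suc k") (auto simp del: sum.lessThan_Suc)
qed

text \<open>The reciprocal Jacobian of the map sending a hyperplane \<open>z = a y + b\<close> to its heights over the points \<open>Y\<close>.\<close>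

definition kappa :: "nat \<Rightarrow> (nat \<times> nat \<Rightarrow> real) \<Rightarrow> ennreal"
  where "kappa k Y = (\<integral>\<^sup>+\<alpha>. indicator (unit_cube (Iz k)) (zmap k Y \<alpha>) \<partial>LB {..<Suc k})"

lemma zmap_additive: "zmap k Y (\<alpha> + \<alpha>') = zmap k Y \<alpha> + zmap k Y \<alpha>'"
  by (auto simp: zmap_def fun_eq_iff dotp_def algebra_simps sum.distrib)

lemma kappa_change:
  assumes "mdet (Suc k) (ymat k Y) \<noteq> 0"
  shows kappa_pos: "0 < kappa k Y" and kappa_finite: "kappa k Y < \<infinity>"
    and nn_integral_zmap: "g \<in> borel_measurable borel \<Longrightarrow>
      (\<integral>\<^sup>+\<alpha>. g (zmap k Y \<alpha>) \<partial>LB {..<Suc k}) = kappa k Y * (\<integral>\<^sup>+Z. g Z \<partial>LB (Iz k))"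
proof -
  have m: "zmap k Y \<in> borel \<rightarrow>\<^sub>M borel" by measurable
  have f: "finite {..<Suc k}" "finite (Iz k)" by auto
  note * = f m zinv_measurable[of k Y] zmap_supp zinv_supp zmap_additive zmap_zinv[OF assms] zinv_zmap[OF assms]
  show "0 < kappa k Y" unfolding kappa_def by (rule LB_linear_factor_pos[OF *])
  show "kappa k Y < \<infinity>" unfolding kappa_def by (rule LB_linear_factor_finite[OF *])
  show "(\<integral>\<^sup>+\<alpha>. g (zmap k Y \<alpha>) \<partial>LB {..<Suc k}) = kappa k Y * (\<integral>\<^sup>+Z. g Z \<partial>LB (Iz k))"
    if "g \<in> borel_measurable borel"
    unfolding kappa_def by (rule nn_integral_LB_linear[OF * that])
qed

lemma kappa_measurable [measurable]: "kappa k \<in> borel_measurable borel"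
proof -
  interpret sigma_finite_measure "LB {..<Suc k}" by (rule sigma_finite_LB) simp
  have [measurable]: "unit_cube (Iz k) \<in> sets borel" by (rule unit_cube_borel) simp
  show ?thesis unfolding kappa_def [abs_def] by measurable
qed

lemma AE_ymat_nondegenerate: "AE Y in LB (Iy k). mdet (Suc k) (ymat k Y) \<noteq> 0"
proof (rule LB_zero_set_null)
  \<comment> \<open>The unit vectors and the origin as base points: with the column of ones
    appended, this is upper triangular with unit diagonal.\<close>
  let ?x0 = "\<lambda>(i, j). if i = j \<and> i < k then 1 else 0 :: real"
  show "?x0 \<in> supp_on (Iy k)" by (auto simp: supp_on_def)
  have "mdet (Suc k) (ymat k ?x0) = 1"
    by (rule mdet_upper_unit) (auto simp: ymat_def)
  then show "mdet (Suc k) (ymat k ?x0) \<noteq> 0" by simp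
  show "(\<lambda>Y. mdet (Suc k) (ymat k Y)) \<in> borel_measurable borel"
  proof (rule mdet_measurable)
    show "(\<lambda>Y. ymat k Y i j) \<in> borel_measurable borel" for i j
      unfolding ymat_def by (cases "j < k") auto
  qed
  fix Y :: "nat \<times> nat \<Rightarrow> real"
  have "is_poly (\<lambda>t. mdet (Suc k) (ymat k (Y + t *\<^sub>R (?x0 - Y))))"
  proof (rule is_poly_mdet)
    show "is_poly (\<lambda>t. ymat k (Y + t *\<^sub>R (?x0 - Y)) i j)" for i j
      unfolding ymat_def by (cases "j < k") (auto simp: scaleR_fun_def intro!: is_poly_intros)
  qed
  then show "\<exists>p. \<forall>t. mdet (Suc k) (ymat k (Y + t *\<^sub>R (?x0 - Y))) = poly p t"
    by (simp add: is_poly_def)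
qed simp

text \<open>
  The substitution \<open>y = y' - (gam q * (a \<bullet> y') + b / (1 + q)) a\<close> with \<open>q = a \<bullet> a\<close> turns the restriction of the
  Euclidean norm to the hyperplane \<open>z = a \<bullet> y + b\<close> into a rotation invariant norm.
\<close>

definition gam :: "real \<Rightarrow> real"
  where "gam q = (1 / sqrt (1 + q))\<^sup>2 / (1 + 1 / sqrt (1 + q))"

text \<open>\<open>gam q\<close> is (1 - 1 / sqrt (1 + q)) / q in a form that needs no exception for
  q = 0. The first identity is the contraction factor of the substitution in direction a; both sides
  of the second equal the square of this factor, which is what cancels the (a . y)^2 terms in
  \<open>hyperplane_norm\<close>.\<close>

lemma gam_props:
  assumes "q \<ge> 0"
  shows "1 - gam q * q = 1 / sqrt (1 + q)" "gam q * (2 - gam q * q) = 1 / (1 + q)"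
proof -
  define s where "s = sqrt (1 + q)"
  have s: "s > 0" "s\<^sup>2 = 1 + q" using assms by (auto simp: s_def)
  then have q: "q = s\<^sup>2 - 1" by simp
  have g: "gam q = 1 / (s * (s + 1))"
  proof -
    have "1 + 1 / s = (s + 1) / s" using s by (simp add: field_simps)
    then show ?thesis
      unfolding gam_def s_def[symmetric] using s(1) by (simp add: power2_eq_square)
  qed
  have e: "gam q * q = (s - 1) / s"
  proof -
    have "gam q * q = ((s - 1) * (s + 1)) / (s * (s + 1))"
      unfolding g by (subst q) (simp add: power2_eq_square algebra_simps)
    then show ?thesis using s by simp
  qed
  show "1 - gam q * q = 1 / sqrt (1 + q)"
    unfolding e s_def[symmetric] using s by (simp add: field_simps)
  have "gam q * (2 - gam q * q) = 1 / (s * (s + 1)) * ((s + 1) / s)"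
    unfolding e using s g by (simp add: field_simps)
  also have "\<dots> = 1 / s\<^sup>2" using s by (simp add: power2_eq_square)
  finally show "gam q * (2 - gam q * q) = 1 / (1 + q)" using s by simp
qed

definition sqn :: "nat \<Rightarrow> (nat \<Rightarrow> real) \<Rightarrow> real"
  where "sqn k y = dotp k y y"

lemma sqn_nonneg [simp]: "0 \<le> sqn k y"
  by (simp add: sqn_def)

lemma sqn_measurable [measurable (raw)]:
  assumes "\<And>j. (\<lambda>x. f x j) \<in> borel_measurable M"
  shows "(\<lambda>x. sqn k (f x)) \<in> borel_measurable M"
  unfolding sqn_def using assms by measurable

text \<open>The point of the hyperplane closest to the origin lies over - b / (1 + q) times a, at
  squared distance b^2 / (1 + q); moving the base there removes the cross terms. The contraction
  along a compensates for the stretching by sqrt (1 + q) that lifting to the graph causes in that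
  direction.\<close>

lemma hyperplane_norm:
  fixes k :: nat and a y :: "nat \<Rightarrow> real" and b :: real
  defines "q \<equiv> dotp k a a"
  defines "y' \<equiv> \<lambda>j. y j - (gam q * dotp k a y + b / (1 + q)) * a j"
  shows "sqn k y' + (dotp k a y' + b)\<^sup>2 = sqn k y + b\<^sup>2 / (1 + q)"
proof -
  define p where "p = dotp k a y"
  define \<tau> where "\<tau> = b / (1 + q)"
  define g where "g = gam q"
  have q0: "q \<ge> 0" by (simp add: q_def)
  have b: "b = \<tau> * (1 + q)" using q0 by (simp add: \<tau>_def)
  have 1: "dotp k a y' = p - (g * p + \<tau>) * q"
    unfolding y'_def by (simp add: dotp_linear p_def \<tau>_def g_def q_def)
  have 2: "sqn k y' = sqn k y - 2 * (g * p + \<tau>) * p + (g * p + \<tau>)\<^sup>2 * q"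
    unfolding y'_def sqn_def
    by (simp only: dotp_linear dotp_commute[of k y a] p_def[symmetric] \<tau>_def[symmetric] g_def[symmetric] q_def[symmetric])
      (simp add: algebra_simps power2_eq_square)
  have \<kappa>: "(1 - g * q)\<^sup>2 = g * (2 - g * q)"
    unfolding g_def gam_props(2)[OF q0] gam_props(1)[OF q0] using q0 by (simp add: power_divide)
  have "sqn k y' + (dotp k a y' + b)\<^sup>2 = sqn k y + \<tau>\<^sup>2 * (1 + q) + p\<^sup>2 * ((1 - g * q)\<^sup>2 - g * (2 - g * q))"
    unfolding 1 2 b by (simp add: algebra_simps power2_eq_square)
  also have "\<tau>\<^sup>2 * (1 + q) = b\<^sup>2 / (1 + q)"
    using q0 by (simp add: \<tau>_def power_divide power2_eq_square)
  finally show ?thesis unfolding \<kappa> by simp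
qed


text \<open>The dual of the substitution: the heights of \<open>\<alpha>\<close> over substituted
  base points are the heights of \<open>sstar k a \<tau> \<alpha>\<close> over the original ones,
  see \<open>zmap_hyp_subst\<close>.\<close>

definition sstar :: "nat \<Rightarrow> (nat \<Rightarrow> real) \<Rightarrow> real \<Rightarrow> (nat \<Rightarrow> real) \<Rightarrow> nat \<Rightarrow> real"
  where "sstar k a \<tau> \<alpha> = (\<lambda>j. if j < k then \<alpha> j - gam (dotp k a a) * dotp k a \<alpha> * a j
    else if j = k then \<alpha> k - \<tau> * dotp k a \<alpha> else 0)"

definition rank1 :: "nat \<Rightarrow> (nat \<Rightarrow> real) \<Rightarrow> real \<Rightarrow> (nat \<Rightarrow> real) \<Rightarrow> nat \<Rightarrow> real"
  where "rank1 k a c y = (\<lambda>j. y j + c * dotp k a y * (if j < k then a j else 0))"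

lemma dotp_rank1: "dotp k a (rank1 k a c y) = (1 + c * dotp k a a) * dotp k a y"
proof -
  have "dotp k a (rank1 k a c y) = dotp k a (\<lambda>j. y j + c * dotp k a y * a j)"
    by (rule dotp_cong) (auto simp: rank1_def)
  also have "\<dots> = dotp k a y + c * dotp k a y * dotp k a a"
    by (simp only: dotp_linear)
  finally show ?thesis by (simp add: algebra_simps)
qed

lemma rank1_rank1:
  "rank1 k a c' (rank1 k a c y) = rank1 k a (c + c' * (1 + c * dotp k a a)) y"
proof (rule ext)
  fix j
  have "rank1 k a c' (rank1 k a c y) j =
      rank1 k a c y j + c' * ((1 + c * dotp k a a) * dotp k a y) * (if j < k then a j else 0)"
    by (subst rank1_def) (simp only: dotp_rank1)
  then show "rank1 k a c' (rank1 k a c y) j = rank1 k a (c + c' * (1 + c * dotp k a a)) y j"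
    by (simp add: rank1_def algebra_simps)
qed

lemma rank1_zero [simp]: "rank1 k a 0 y = y"
  by (simp add: rank1_def)

text \<open>The solution c of c (1 - \<open>gam q\<close> q) = \<open>gam q\<close>, for which
  \<open>rank1\<close> with coefficient c is inverse to the contraction.\<close>

definition gam_inv :: "real \<Rightarrow> real"
  where "gam_inv q = gam q * sqrt (1 + q)"

lemma rank1_inverse:
  "rank1 k a (gam_inv (dotp k a a)) (rank1 k a (- gam (dotp k a a)) y) = y"
  "rank1 k a (- gam (dotp k a a)) (rank1 k a (gam_inv (dotp k a a)) y) = y"
proof -
  define q where "q = dotp k a a"
  have q: "q \<ge> 0" by (simp add: q_def)
  then have s: "sqrt (1 + q) > 0" by simp
  have g: "1 - gam q * q = 1 / sqrt (1 + q)" by (rule gam_props[OF q])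
  have 1: "- gam q + gam_inv q * (1 + - gam q * q) = 0"
    using s g by (simp add: gam_inv_def)
  have "gam_inv q + - gam q * (1 + gam_inv q * q) = - gam q + gam_inv q * (1 + - gam q * q)"
    by (simp add: algebra_simps)
  with 1 have 2: "gam_inv q + - gam q * (1 + gam_inv q * q) = 0"
    by simp
  show "rank1 k a (gam_inv (dotp k a a)) (rank1 k a (- gam (dotp k a a)) y) = y"
    unfolding rank1_rank1 q_def[symmetric] 1 by simp
  show "rank1 k a (- gam (dotp k a a)) (rank1 k a (gam_inv (dotp k a a)) y) = y"
    unfolding rank1_rank1 q_def[symmetric] 2 by simp
qed

lemma rank1_additive: "rank1 k a c (x + y) = rank1 k a c x + rank1 k a c y"
  by (auto simp: rank1_def fun_eq_iff dotp_def algebra_simps sum.distrib)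

lemma rank1_measurable [measurable]: "rank1 k a c \<in> borel \<rightarrow>\<^sub>M borel"
  by (rule fun_measurableI) (auto simp: rank1_def)

lemma rank1_supp: "k \<le> n \<Longrightarrow> y \<in> supp_on {..<n} \<Longrightarrow> rank1 k a c y \<in> supp_on {..<n}"
  by (auto simp: rank1_def supp_on_def)

text \<open>C is a Jacobian that depends on a. Later it is only cancelled, for which positivity and
  finiteness are enough.\<close>

lemma nn_integral_rank1:
  assumes "k \<le> n"
  shows "\<exists>C. 0 < C \<and> C < \<infinity> \<and> (\<forall>g\<in>borel_measurable borel.
    (\<integral>\<^sup>+x. g (rank1 k a (- gam (dotp k a a)) x) \<partial>LB {..<n}) = C * (\<integral>\<^sup>+x. g x \<partial>LB {..<n}))"
proof -
  have f: "finite {..<n}" by simp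
  note * = f f rank1_measurable rank1_measurable rank1_supp[OF assms] rank1_supp[OF assms] rank1_additive rank1_inverse(2) rank1_inverse(1)
  show ?thesis
    using LB_linear_factor_pos[OF *] LB_linear_factor_finite[OF *] nn_integral_LB_linear[OF *] by blast
qed

definition rank1_rows :: "nat \<Rightarrow> (nat \<Rightarrow> real) \<Rightarrow> real \<Rightarrow> (nat \<times> nat \<Rightarrow> real) \<Rightarrow> nat \<times> nat \<Rightarrow> real"
  where "rank1_rows k a c Y = (\<lambda>(i, j). rank1 k a c (\<lambda>l. Y (i, l)) j)"

lemma rank1_rows_measurable [measurable]: "rank1_rows k a c \<in> borel \<rightarrow>\<^sub>M borel"
  by (rule fun_measurableI) (auto simp: rank1_rows_def rank1_def)

lemma nn_integral_rank1_rows: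
  "\<exists>C. 0 < C \<and> C < \<infinity> \<and> (\<forall>g\<in>borel_measurable borel.
    (\<integral>\<^sup>+x. g (rank1_rows k a (- gam (dotp k a a)) x) \<partial>LB (Iy k)) = C * (\<integral>\<^sup>+x. g x \<partial>LB (Iy k)))"
proof -
  have f: "finite (Iy k)" by simp
  have s: "rank1_rows k a c x \<in> supp_on (Iy k)" if "x \<in> supp_on (Iy k)" for c x
    using that by (auto simp: rank1_rows_def rank1_def supp_on_def dotp_def)
  have ad: "rank1_rows k a c (x + y) = rank1_rows k a c x + rank1_rows k a c y" for c x y
    by (auto simp: rank1_rows_def rank1_def fun_eq_iff dotp_def algebra_simps sum.distrib)
  have inv: "rank1_rows k a (gam_inv (dotp k a a)) (rank1_rows k a (- gam (dotp k a a)) y) = y"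
    "rank1_rows k a (- gam (dotp k a a)) (rank1_rows k a (gam_inv (dotp k a a)) y) = y" for y
    by (auto simp: rank1_rows_def rank1_inverse fun_eq_iff)
  note * = f f rank1_rows_measurable rank1_rows_measurable s s ad inv(2) inv(1)
  show ?thesis
    using LB_linear_factor_pos[OF *] LB_linear_factor_finite[OF *] nn_integral_LB_linear[OF *] by blast
qed

lemma lessThan_Suc_Un: "{..<Suc k} = {..<k} \<union> {k}"
  by auto

lemma nn_integral_LB_Suc:
  assumes "g \<in> borel_measurable borel"
  shows "(\<integral>\<^sup>+\<alpha>. g \<alpha> \<partial>LB {..<Suc k}) = (\<integral>\<^sup>+u. \<integral>\<^sup>+v. g (u + v) \<partial>LB {k} \<partial>LB {..<k})"
  unfolding lessThan_Suc_Un by (rule nn_integral_LB_Un) (use assms in auto)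

lemma sstar_measurable [measurable]: "sstar k a \<tau> \<in> borel \<rightarrow>\<^sub>M borel"
proof (rule fun_measurableI)
  show "(\<lambda>x. sstar k a \<tau> x j) \<in> borel_measurable borel" for j
    by (cases j k rule: linorder_cases) (auto simp: sstar_def)
qed

text \<open>\<open>sstar\<close> differs from the contraction by a shear in coordinate k, and for
  fixed first k coordinates this is a translation. Hence the right-hand side is free of
  \<open>\<tau>\<close>, and the Jacobian cannot depend on the intercept b.\<close>

lemma nn_integral_sstar:
  assumes g [measurable]: "g \<in> borel_measurable borel"
  shows "(\<integral>\<^sup>+\<alpha>. g (sstar k a \<tau> \<alpha>) \<partial>LB {..<Suc k}) =
    (\<integral>\<^sup>+\<alpha>. g (rank1 k a (- gam (dotp k a a)) \<alpha>) \<partial>LB {..<Suc k})"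
proof -
  let ?r = "rank1 k a (- gam (dotp k a a))"
  have "(\<integral>\<^sup>+\<alpha>. g (sstar k a \<tau> \<alpha>) \<partial>LB {..<Suc k}) =
      (\<integral>\<^sup>+u. \<integral>\<^sup>+v. g (sstar k a \<tau> (u + v)) \<partial>LB {k} \<partial>LB {..<k})"
    by (rule nn_integral_LB_Suc) measurable
  also have "\<dots> = (\<integral>\<^sup>+u. \<integral>\<^sup>+v. g (?r u + v) \<partial>LB {k} \<partial>LB {..<k})"
  proof (rule nn_integral_LB_cong)
    fix u :: "nat \<Rightarrow> real" assume u: "u \<in> supp_on {..<k}"
    let ?w = "\<lambda>j. if j = k then - \<tau> * dotp k a u else 0"
    have "(\<integral>\<^sup>+v. g (sstar k a \<tau> (u + v)) \<partial>LB {k}) = (\<integral>\<^sup>+v. g (?r u + (v + ?w)) \<partial>LB {k})"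
    proof (rule nn_integral_LB_cong)
      fix v :: "nat \<Rightarrow> real" assume v: "v \<in> supp_on {k}"
      have "dotp k a (u + v) = dotp k a u"
        using v by (intro dotp_cong) (auto simp: supp_on_def)
      then have "sstar k a \<tau> (u + v) = ?r u + (v + ?w)"
        using u v by (auto simp: sstar_def rank1_def supp_on_def fun_eq_iff)
      then show "g (sstar k a \<tau> (u + v)) = g (?r u + (v + ?w))" by simp
    qed
    also have "\<dots> = (\<integral>\<^sup>+v. g (?r u + v) \<partial>LB {k})"
      by (rule LB_translate[where g = "\<lambda>v. g (?r u + v)"]) (auto simp: supp_on_def)
    finally show "(\<integral>\<^sup>+v. g (sstar k a \<tau> (u + v)) \<partial>LB {k}) = (\<integral>\<^sup>+v. g (?r u + v) \<partial>LB {k})" .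
  qed
  also have "\<dots> = (\<integral>\<^sup>+u. \<integral>\<^sup>+v. g (?r (u + v)) \<partial>LB {k} \<partial>LB {..<k})"
  proof (intro nn_integral_LB_cong arg_cong[of _ _ g])
    fix u v :: "nat \<Rightarrow> real" assume v: "v \<in> supp_on {k}"
    have "dotp k a v = 0"
      using v by (simp add: dotp_def supp_on_def)
    then have "?r v = v" by (simp add: rank1_def)
    then show "?r u + v = ?r (u + v)" by (simp add: rank1_additive)
  qed
  also have "\<dots> = (\<integral>\<^sup>+\<alpha>. g (?r \<alpha>) \<partial>LB {..<Suc k})"
    by (rule nn_integral_LB_Suc[symmetric]) measurable
  finally show ?thesis .
qed

definition hyp_subst :: "nat \<Rightarrow> (nat \<Rightarrow> real) \<Rightarrow> real \<Rightarrow> (nat \<times> nat \<Rightarrow> real) \<Rightarrow> nat \<times> nat \<Rightarrow> real"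
  where "hyp_subst k a \<tau> Y =
    rank1_rows k a (- gam (dotp k a a)) Y + (\<lambda>(i, j). if (i, j) \<in> Iy k then - \<tau> * a j else 0)"

lemma hyp_subst_row:
  "i < Suc k \<Longrightarrow> j < k \<Longrightarrow>
    hyp_subst k a \<tau> Y (i, j) = Y (i, j) - (gam (dotp k a a) * dotp k a (\<lambda>l. Y (i, l)) + \<tau>) * a j"
  by (simp add: hyp_subst_def rank1_rows_def rank1_def algebra_simps)

lemma zmap_hyp_subst: "zmap k (hyp_subst k a \<tau> Y) \<alpha> = zmap k Y (sstar k a \<tau> \<alpha>)"
proof -
  have "dotp k \<alpha> (\<lambda>l. hyp_subst k a \<tau> Y (i, l)) + \<alpha> k = dotp k (sstar k a \<tau> \<alpha>) (\<lambda>l. Y (i, l)) + sstar k a \<tau> \<alpha> k"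
    if "i < Suc k" for i
  proof -
    let ?y = "\<lambda>l. Y (i, l)" and ?g = "gam (dotp k a a)"
    have "dotp k \<alpha> (\<lambda>l. hyp_subst k a \<tau> Y (i, l)) = dotp k \<alpha> (\<lambda>l. ?y l - (?g * dotp k a ?y + \<tau>) * a l)"
      using that by (intro dotp_cong) (auto simp: hyp_subst_row)
    moreover have "dotp k (sstar k a \<tau> \<alpha>) ?y = dotp k (\<lambda>j. \<alpha> j - ?g * dotp k a \<alpha> * a j) ?y"
      by (intro dotp_cong) (auto simp: sstar_def)
    moreover have "sstar k a \<tau> \<alpha> k = \<alpha> k - \<tau> * dotp k a \<alpha>"
      by (simp add: sstar_def)
    ultimately show ?thesis
      by (simp only: dotp_linear dotp_commute[of k \<alpha> a]) (simp add: algebra_simps)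
  qed
  then show ?thesis by (auto simp: zmap_def fun_eq_iff)
qed

text \<open>C comes before \<open>\<tau>\<close> and Y in the quantifiers; as \<open>\<tau>\<close>
  carries the intercept, the factor depends on the slope alone.\<close>

lemma kappa_hyp_subst:
  "\<exists>C. 0 < C \<and> C < \<infinity> \<and> (\<forall>\<tau> Y. kappa k (hyp_subst k a \<tau> Y) = C * kappa k Y)"
proof -
  obtain C where C: "0 < C" "C < \<infinity>" "\<And>g. g \<in> borel_measurable borel \<Longrightarrow>
      (\<integral>\<^sup>+x. g (rank1 k a (- gam (dotp k a a)) x) \<partial>LB {..<Suc k}) = C * (\<integral>\<^sup>+x. g x \<partial>LB {..<Suc k})"
    using nn_integral_rank1[of k "Suc k" a] by auto
  have [measurable]: "unit_cube (Iz k) \<in> sets borel" by (rule unit_cube_borel) simp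
  have "kappa k (hyp_subst k a \<tau> Y) = C * kappa k Y" for \<tau> Y
  proof -
    have "(\<integral>\<^sup>+\<alpha>. indicator (unit_cube (Iz k)) (zmap k Y (sstar k a \<tau> \<alpha>)) \<partial>LB {..<Suc k}) =
      (\<integral>\<^sup>+\<alpha>. indicator (unit_cube (Iz k)) (zmap k Y (rank1 k a (- gam (dotp k a a)) \<alpha>)) \<partial>LB {..<Suc k} :: ennreal)"
      by (rule nn_integral_sstar[where g = "\<lambda>\<alpha>. indicator (unit_cube (Iz k)) (zmap k Y \<alpha>)"]) measurable
    also have "\<dots> = C * kappa k Y"
      unfolding kappa_def by (rule C(3)[where g = "\<lambda>\<alpha>. indicator (unit_cube (Iz k)) (zmap k Y \<alpha>)"]) measurable
    finally show ?thesis unfolding kappa_def zmap_hyp_subst .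
  qed
  with C show ?thesis by blast
qed

text \<open>Dilating the base points by s has the same effect on the heights as multiplying the
  slope by s, while the intercept stays. Only k of the k + 1 parameters are rescaled, hence the
  exponent k.\<close>

lemma kappa_scale:
  assumes s: "s > 0"
  shows "kappa k (s *\<^sub>R Y) = ennreal ((1 / s) ^ k) * kappa k Y"
proof -
  have [measurable]: "unit_cube (Iz k) \<in> sets borel" by (rule unit_cube_borel) simp
  let ?g = "\<lambda>\<alpha>. indicator (unit_cube (Iz k)) (zmap k Y \<alpha>) :: ennreal"
  interpret K: sigma_finite_measure "LB {k}" by (rule sigma_finite_LB) simp
  have "kappa k (s *\<^sub>R Y) = (\<integral>\<^sup>+u. \<integral>\<^sup>+v. indicator (unit_cube (Iz k)) (zmap k (s *\<^sub>R Y) (u + v)) \<partial>LB {k} \<partial>LB {..<k})"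
    unfolding kappa_def by (rule nn_integral_LB_Suc) measurable
  also have "\<dots> = (\<integral>\<^sup>+u. \<integral>\<^sup>+v. ?g (s *\<^sub>R u + v) \<partial>LB {k} \<partial>LB {..<k})"
  proof (intro nn_integral_LB_cong)
    fix u v :: "nat \<Rightarrow> real" assume uv: "u \<in> supp_on {..<k}" "v \<in> supp_on {k}"
    have "dotp k (u + v) (\<lambda>l. (s *\<^sub>R Y) (i, l)) + (u + v) k = dotp k (s *\<^sub>R u + v) (\<lambda>l. Y (i, l)) + (s *\<^sub>R u + v) k" for i
      using uv by (simp add: dotp_def supp_on_def scaleR_fun_def algebra_simps)
    then have "zmap k (s *\<^sub>R Y) (u + v) = zmap k Y (s *\<^sub>R u + v)"
      unfolding zmap_def by (simp add: fun_eq_iff)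
    then show "indicator (unit_cube (Iz k)) (zmap k (s *\<^sub>R Y) (u + v)) = ?g (s *\<^sub>R u + v)" by simp
  qed
  also have "\<dots> = ennreal ((1 / s) ^ k) * (\<integral>\<^sup>+u. \<integral>\<^sup>+v. ?g (u + v) \<partial>LB {k} \<partial>LB {..<k})"
    using LB_scale[of "{..<k}" s "\<lambda>u. \<integral>\<^sup>+v. ?g (u + v) \<partial>LB {k}"] s by simp
  also have "(\<integral>\<^sup>+u. \<integral>\<^sup>+v. ?g (u + v) \<partial>LB {k} \<partial>LB {..<k}) = kappa k Y"
    unfolding kappa_def by (rule nn_integral_LB_Suc[symmetric]) measurable
  finally show ?thesis .
qed

section \<open>The density of the hyperplane through k + 1 points\<close>

definition phi :: "real \<Rightarrow> real \<Rightarrow> ennreal"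
  where "phi \<beta> s = (if s < 1 then ennreal ((1 - s) powr \<beta>) else 0)"

lemma phi_measurable [measurable]: "phi \<beta> \<in> borel_measurable borel"
  unfolding phi_def [abs_def] by measurable

text \<open>A section of the unit ball at distance h is a unit ball scaled by sqrt (1 - h^2): one
  minus the argument on the left factors as (1 - h^2) (1 - u).\<close>

lemma phi_scale:
  assumes "\<bar>h\<bar> < 1" "u \<ge> 0"
  shows "phi \<beta> ((1 - h\<^sup>2) * u + h\<^sup>2) = ennreal ((1 - h\<^sup>2) powr \<beta>) * phi \<beta> u"
proof -
  have h: "1 - h\<^sup>2 > 0" using assms(1) by (simp add: abs_square_less_1)
  have eq: "1 - ((1 - h\<^sup>2) * u + h\<^sup>2) = (1 - h\<^sup>2) * (1 - u)"
    by (simp add: algebra_simps)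
  have "(1 - h\<^sup>2) * u + h\<^sup>2 < 1 \<longleftrightarrow> (1 - h\<^sup>2) * (1 - u) > 0"
    using eq by linarith
  then have iff: "(1 - h\<^sup>2) * u + h\<^sup>2 < 1 \<longleftrightarrow> u < 1"
    using h by (simp add: zero_less_mult_iff)
  show ?thesis
    unfolding phi_def iff eq using h by (auto simp: powr_mult ennreal_mult)
qed

text \<open>The unnormalised density of the parameters \<open>\<alpha>\<close> when the k + 1 points
  have beta densities; \<open>inverse (kappa k Y)\<close> is the Jacobian of passing from heights to
  parameters.\<close>

definition hyp_dens :: "nat \<Rightarrow> real \<Rightarrow> (nat \<Rightarrow> real) \<Rightarrow> ennreal"
  where "hyp_dens k \<beta> \<alpha> = (\<integral>\<^sup>+Y. inverse (kappa k Y) *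
    (\<Prod>i<Suc k. phi \<beta> (sqn k (\<lambda>l. Y (i, l)) + (dotp k \<alpha> (\<lambda>l. Y (i, l)) + \<alpha> k)\<^sup>2)) \<partial>LB (Iy k))"

definition dist_dens :: "nat \<Rightarrow> real \<Rightarrow> real \<Rightarrow> ennreal"
  where "dist_dens k \<beta> h = (\<integral>\<^sup>+Y. inverse (kappa k Y) *
    (\<Prod>i<Suc k. phi \<beta> (sqn k (\<lambda>l. Y (i, l)) + h\<^sup>2)) \<partial>LB (Iy k))"

lemma inverse_measurable_ennreal [measurable (raw)]:
  "f \<in> borel_measurable M \<Longrightarrow> (\<lambda>x. inverse (f x) :: ennreal) \<in> borel_measurable M"
  by (rule measurable_compose[OF _ borel_measurable_continuous_onI[OF continuous_on_inverse_ennreal[OF continuous_on_id]]])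

lemma ennreal_inverse_mult_finite:
  assumes "0 < c" "c < (\<infinity>::ennreal)"
  shows "inverse (c * x) = inverse c * inverse x"
proof (cases "x = \<infinity>")
  case True
  then show ?thesis using assms by (simp add: ennreal_mult_top)
next
  case False
  then show ?thesis using assms by (intro ennreal_inverse_mult) (auto simp: less_top)
qed

text \<open>For a fixed slope one constant serves all b, so the dependence on b, the only thing that
  matters, can be read off from the horizontal hyperplanes z = h. The substitution of
  \<open>hyperplane_norm\<close> is applied to every row.\<close>

lemma hyp_dens_eq_dist_dens:
  "\<exists>C. 0 < C \<and> C < \<infinity> \<and> (\<forall>b. C * hyp_dens k \<beta> (\<lambda>j. if j = k then b else a j) =
    dist_dens k \<beta> (b / sqrt (1 + dotp k a a)))"
proof -
  define q where "q = dotp k a a"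
  have q: "q \<ge> 0" by (simp add: q_def)
  obtain C1 where C1: "0 < C1" "C1 < \<infinity>" "\<And>\<tau> Y. kappa k (hyp_subst k a \<tau> Y) = C1 * kappa k Y"
    using kappa_hyp_subst[of k a] by auto
  obtain C2 where C2: "0 < C2" "C2 < \<infinity>" "\<And>g. g \<in> borel_measurable borel \<Longrightarrow>
      (\<integral>\<^sup>+x. g (rank1_rows k a (- gam (dotp k a a)) x) \<partial>LB (Iy k)) = C2 * (\<integral>\<^sup>+x. g x \<partial>LB (Iy k))"
    using nn_integral_rank1_rows[of k a] by auto
  have "C1 * C2 * hyp_dens k \<beta> (\<lambda>j. if j = k then b else a j) = dist_dens k \<beta> (b / sqrt (1 + q))" for b
  proof -
    define \<alpha> where "\<alpha> = (\<lambda>j. if j = k then b else a j)"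
    define \<tau> where "\<tau> = b / (1 + q)"
    let ?G = "\<lambda>Y. inverse (kappa k Y) *
      (\<Prod>i<Suc k. phi \<beta> (sqn k (\<lambda>l. Y (i, l)) + (dotp k \<alpha> (\<lambda>l. Y (i, l)) + \<alpha> k)\<^sup>2))"
    let ?w = "\<lambda>(i, j). if (i, j) \<in> Iy k then - \<tau> * a j else 0"
    have [measurable]: "?G \<in> borel_measurable borel" by measurable
    have "C2 * hyp_dens k \<beta> \<alpha> = C2 * (\<integral>\<^sup>+Y. ?G (Y + ?w) \<partial>LB (Iy k))"
      unfolding hyp_dens_def by (subst LB_translate[where g = ?G]) (auto simp: supp_on_def)
    also have "\<dots> = (\<integral>\<^sup>+Y. ?G (hyp_subst k a \<tau> Y) \<partial>LB (Iy k))"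
      unfolding hyp_subst_def by (rule C2(3)[symmetric, where g = "\<lambda>Y. ?G (Y + ?w)"]) measurable
    also have "\<dots> = (\<integral>\<^sup>+Y. inverse C1 * (inverse (kappa k Y) *
        (\<Prod>i<Suc k. phi \<beta> (sqn k (\<lambda>l. Y (i, l)) + (b / sqrt (1 + q))\<^sup>2))) \<partial>LB (Iy k))"
    proof (rule nn_integral_cong)
      fix Y
      have "sqn k (\<lambda>l. hyp_subst k a \<tau> Y (i, l)) + (dotp k \<alpha> (\<lambda>l. hyp_subst k a \<tau> Y (i, l)) + \<alpha> k)\<^sup>2 =
          sqn k (\<lambda>l. Y (i, l)) + (b / sqrt (1 + q))\<^sup>2" if "i < Suc k" for i
      proof -
        let ?y = "\<lambda>l. Y (i, l)"
        let ?y' = "\<lambda>j. ?y j - (gam q * dotp k a ?y + b / (1 + q)) * a j"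
        have "sqn k (\<lambda>l. hyp_subst k a \<tau> Y (i, l)) = sqn k ?y'"
          unfolding sqn_def using that by (intro dotp_cong) (auto simp: hyp_subst_row \<tau>_def q_def)
        moreover have "dotp k \<alpha> (\<lambda>l. hyp_subst k a \<tau> Y (i, l)) = dotp k a ?y'"
          using that by (intro dotp_cong) (auto simp: hyp_subst_row \<tau>_def q_def \<alpha>_def)
        moreover have "sqn k ?y' + (dotp k a ?y' + b)\<^sup>2 = sqn k ?y + b\<^sup>2 / (1 + q)"
          unfolding q_def by (rule hyperplane_norm)
        ultimately show ?thesis
          using q by (simp add: \<alpha>_def power_divide)
      qed
      then have "(\<Prod>i<Suc k. phi \<beta> (sqn k (\<lambda>l. hyp_subst k a \<tau> Y (i, l)) + (dotp k \<alpha> (\<lambda>l. hyp_subst k a \<tau> Y (i, l)) + \<alpha> k)\<^sup>2)) =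
          (\<Prod>i<Suc k. phi \<beta> (sqn k (\<lambda>l. Y (i, l)) + (b / sqrt (1 + q))\<^sup>2))"
        by (intro prod.cong refl arg_cong[of _ _ "phi \<beta>"]) simp
      moreover have "inverse (kappa k (hyp_subst k a \<tau> Y)) = inverse C1 * inverse (kappa k Y)"
        unfolding C1(3) using C1(1,2) by (intro ennreal_inverse_mult_finite) auto
      ultimately show "?G (hyp_subst k a \<tau> Y) = inverse C1 * (inverse (kappa k Y) *
        (\<Prod>i<Suc k. phi \<beta> (sqn k (\<lambda>l. Y (i, l)) + (b / sqrt (1 + q))\<^sup>2)))"
        by (simp only: mult.assoc)
    qed
    also have "\<dots> = inverse C1 * dist_dens k \<beta> (b / sqrt (1 + q))"
      unfolding dist_dens_def by (rule nn_integral_cmult) measurable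
    finally have "C1 * (C2 * hyp_dens k \<beta> \<alpha>) = (C1 * inverse C1) * dist_dens k \<beta> (b / sqrt (1 + q))"
      by (simp add: mult.assoc)
    also have "C1 * inverse C1 = 1"
      using C1(1,2) by (simp add: ennreal_divide_times divide_ennreal_def[symmetric] ennreal_divide_self)
    finally show ?thesis by (simp add: \<alpha>_def mult.assoc)
  qed
  moreover have "0 < C1 * C2" "C1 * C2 < \<infinity>"
    using C1 C2 by (auto simp: ennreal_zero_less_mult_iff ennreal_mult_less_top)
  ultimately show ?thesis unfolding q_def by blast
qed

text \<open>The exponent of \<open>1 - h\<^sup>2\<close> in the density of the distance \<open>h\<close> of the hyperplane through \<open>k + 1\<close> points.\<close>

definition hexp :: "nat \<Rightarrow> real \<Rightarrow> real"
  where "hexp k \<beta> = real (k * (k + 2)) / 2 + \<beta> * real (k + 1)"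

text \<open>Substitute Y = s Y' with s^2 = 1 - h^2. The k (k + 1) coordinates contribute s^(k (k +
  1)), the inverse of \<open>kappa\<close> contributes s^k, and the k + 1 weights contribute s^(2
  \<beta> (k + 1)); together this is 1 - h^2 to the power \<open>hexp k \<beta>\<close>. For |h| at
  least 1 both sides vanish.\<close>

lemma dist_dens_eq: "dist_dens k \<beta> h = phi (hexp k \<beta>) (h\<^sup>2) * dist_dens k \<beta> 0"
proof (cases "\<bar>h\<bar> < 1")
  case False
  then have h: "h\<^sup>2 \<ge> 1" by (simp add: abs_square_less_1[symmetric])
  have "phi \<beta> (sqn k y + h\<^sup>2) = 0" for y
    using h sqn_nonneg[of k y] unfolding phi_def by (smt (verit))
  then have "dist_dens k \<beta> h = 0"
    unfolding dist_dens_def by (simp add: prod_zero_iff)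
  then show ?thesis using h by (simp add: phi_def)
next
  case True
  define r where "r = 1 - h\<^sup>2"
  define s where "s = sqrt r"
  have r: "r > 0" using True by (simp add: r_def abs_square_less_1)
  then have s: "s > 0" "s\<^sup>2 = r" by (auto simp: s_def)
  let ?G = "\<lambda>h Y. inverse (kappa k Y) * (\<Prod>i<Suc k. phi \<beta> (sqn k (\<lambda>l. Y (i, l)) + h\<^sup>2))"
  have [measurable]: "?G h \<in> borel_measurable borel" for h by measurable
  have eq: "?G h (s *\<^sub>R Y) = ennreal (s ^ k * (r powr \<beta>) ^ Suc k) * ?G 0 Y" for Y
  proof -
    have 1: "inverse (kappa k (s *\<^sub>R Y)) = ennreal (s ^ k) * inverse (kappa k Y)"
      unfolding kappa_scale[OF s(1)] using s(1)
      by (subst ennreal_inverse_mult_finite) (auto simp: inverse_ennreal power_one_over divide_inverse power_inverse)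
    have "sqn k (\<lambda>l. (s *\<^sub>R Y) (i, l)) = r * sqn k (\<lambda>l. Y (i, l))" for i
      unfolding sqn_def s(2)[symmetric] scaleR_fun_def by (simp add: dotp_linear power2_eq_square)
    then have "(\<Prod>i<Suc k. phi \<beta> (sqn k (\<lambda>l. (s *\<^sub>R Y) (i, l)) + h\<^sup>2)) =
        (\<Prod>i<Suc k. ennreal (r powr \<beta>) * phi \<beta> (sqn k (\<lambda>l. Y (i, l)) + 0\<^sup>2))"
      using True by (intro prod.cong refl) (simp add: r_def phi_scale)
    also have "\<dots> = ennreal ((r powr \<beta>) ^ Suc k) * (\<Prod>i<Suc k. phi \<beta> (sqn k (\<lambda>l. Y (i, l)) + 0\<^sup>2))"
      unfolding prod.distrib by (simp only: prod_constant card_lessThan ennreal_power powr_ge_zero)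
    finally show ?thesis
      unfolding 1 using s(1) by (simp only: ennreal_mult' zero_le_power less_imp_le) (simp only: ac_simps)
  qed
  let ?D = "card (Iy k)"
  have "ennreal ((1 / s) ^ ?D) * dist_dens k \<beta> h = (\<integral>\<^sup>+Y. ?G h (s *\<^sub>R Y) \<partial>LB (Iy k))"
    unfolding dist_dens_def by (rule LB_scale[symmetric, OF _ s(1)]) auto
  also have "\<dots> = ennreal (s ^ k * (r powr \<beta>) ^ Suc k) * dist_dens k \<beta> 0"
    unfolding eq dist_dens_def by (rule nn_integral_cmult) measurable
  finally have "ennreal (s ^ ?D) * (ennreal ((1 / s) ^ ?D) * dist_dens k \<beta> h) =
      ennreal (s ^ ?D) * (ennreal (s ^ k * (r powr \<beta>) ^ Suc k) * dist_dens k \<beta> 0)"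
    by simp
  moreover have "ennreal (s ^ ?D) * ennreal ((1 / s) ^ ?D) = 1"
    using s(1) by (simp add: ennreal_mult'[symmetric] power_one_over)
  moreover have "ennreal (s ^ ?D) * ennreal (s ^ k * (r powr \<beta>) ^ Suc k) = ennreal (r powr hexp k \<beta>)"
  proof -
    have 0: "s ^ ?D * (s ^ k * (r powr \<beta>) ^ Suc k) = s ^ (k * (k + 2)) * (r powr \<beta>) ^ Suc k"
      by (simp add: power_add[symmetric] algebra_simps card_cartesian_product)
    have 1: "s ^ (k * (k + 2)) = r powr (real (k * (k + 2)) / 2)"
      unfolding s_def using r by (simp add: powr_realpow[symmetric] powr_half_sqrt[symmetric] powr_powr)
    have 2: "(r powr \<beta>) ^ Suc k = r powr (\<beta> * real (k + 1))"
      using r by (simp add: powr_realpow[symmetric] powr_powr powr_add[symmetric] algebra_simps)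
    have e: "s ^ ?D * (s ^ k * (r powr \<beta>) ^ Suc k) = r powr hexp k \<beta>"
      unfolding 0 unfolding 1 2 hexp_def by (rule powr_add[symmetric])
    have "0 \<le> s ^ ?D" using s(1) by simp
    then show ?thesis unfolding e[symmetric] by (simp only: ennreal_mult')
  qed
  ultimately have "dist_dens k \<beta> h = ennreal (r powr hexp k \<beta>) * dist_dens k \<beta> 0"
    by (simp add: mult.assoc[symmetric])
  then show ?thesis
    using True by (simp add: phi_def r_def abs_square_less_1)
qed

lemma hyp_dens_eq:
  "hyp_dens k \<beta> (\<lambda>j. if j = k then b else a j) =
    phi (hexp k \<beta>) ((b / sqrt (1 + dotp k a a))\<^sup>2) * hyp_dens k \<beta> (\<lambda>j. if j = k then 0 else a j)"
proof -
  obtain C where C: "0 < C" "C < \<infinity>" "\<And>b. C * hyp_dens k \<beta> (\<lambda>j. if j = k then b else a j) =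
      dist_dens k \<beta> (b / sqrt (1 + dotp k a a))"
    using hyp_dens_eq_dist_dens[of k \<beta> a] by auto
  have "C * hyp_dens k \<beta> (\<lambda>j. if j = k then b else a j) = dist_dens k \<beta> (b / sqrt (1 + dotp k a a))"
    by (rule C(3))
  also have "\<dots> = phi (hexp k \<beta>) ((b / sqrt (1 + dotp k a a))\<^sup>2) * dist_dens k \<beta> 0"
    by (rule dist_dens_eq)
  also have "dist_dens k \<beta> 0 = C * hyp_dens k \<beta> (\<lambda>j. if j = k then 0 else a j)"
    using C(3)[of 0] by simp
  finally have "C * hyp_dens k \<beta> (\<lambda>j. if j = k then b else a j) =
      C * (phi (hexp k \<beta>) ((b / sqrt (1 + dotp k a a))\<^sup>2) * hyp_dens k \<beta> (\<lambda>j. if j = k then 0 else a j))"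
    by (simp only: mult.left_commute)
  then show ?thesis
    using C(1,2) by (auto simp: ennreal_mult_cancel_left)
qed

text \<open>The factor sqrt (1 + |u|^2) comes from substituting b = sqrt (1 + |u|^2) h. The value is
  never computed; the integrand 1 determines it.\<close>

definition bp_const :: "nat \<Rightarrow> real \<Rightarrow> ennreal"
  where "bp_const k \<beta> = (\<integral>\<^sup>+u. hyp_dens k \<beta> (\<lambda>j. if j = k then 0 else u j) * ennreal (sqrt (1 + dotp k u u)) \<partial>LB {..<k})"

lemma nn_integral_lborel_scale:
  fixes c :: real
  assumes "c > 0" "f \<in> borel_measurable borel"
  shows "(\<integral>\<^sup>+b. f (b / c) \<partial>lborel) = ennreal c * (\<integral>\<^sup>+h. f h \<partial>lborel)"
  using nn_integral_real_affine[of "\<lambda>b. f (b / c)" c 0] assms by simp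

text \<open>H is to depend on the configuration only through the signed distance b / sqrt (1 +
  |a|^2) of its hyperplane from the origin, and \<Psi> expresses this dependence. It is asked for
  only off the null sets where the base points are dependent or b = 0.\<close>

lemma blaschke_petkantschin:
  assumes H [measurable]: "H \<in> borel_measurable borel" and \<Psi> [measurable]: "\<Psi> \<in> borel_measurable borel"
    and hyp: "\<And>Y \<alpha>. Y \<in> supp_on (Iy k) \<Longrightarrow> \<alpha> \<in> supp_on {..<Suc k} \<Longrightarrow> mdet (Suc k) (ymat k Y) \<noteq> 0 \<Longrightarrow> \<alpha> k \<noteq> 0 \<Longrightarrow>
      H (Y + zmap k Y \<alpha>) = \<Psi> (\<alpha> k / sqrt (1 + dotp k \<alpha> \<alpha>))"
  shows "(\<integral>\<^sup>+X. H X * (\<Prod>i<Suc k. phi \<beta> (sqn (Suc k) (\<lambda>j. X (i, j)))) \<partial>LB ({..<Suc k} \<times> {..<Suc k})) =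
    bp_const k \<beta> * (\<integral>\<^sup>+h. \<Psi> h * phi (hexp k \<beta>) (h\<^sup>2) \<partial>lborel)"
proof -
  interpret Y: sigma_finite_measure "LB (Iy k)" by (rule sigma_finite_LB) simp
  interpret Z: sigma_finite_measure "LB (Iz k)" by (rule sigma_finite_LB) simp
  interpret A: sigma_finite_measure "LB {..<Suc k}" by (rule sigma_finite_LB) simp
  interpret YA: pair_sigma_finite "LB (Iy k)" "LB {..<Suc k}" ..
  let ?F = "\<lambda>X. H X * (\<Prod>i<Suc k. phi \<beta> (sqn (Suc k) (\<lambda>j. X (i, j))))"
  let ?P = "\<lambda>\<alpha> Y. \<Prod>i<Suc k. phi \<beta> (sqn k (\<lambda>l. Y (i, l)) + (dotp k \<alpha> (\<lambda>l. Y (i, l)) + \<alpha> k)\<^sup>2)"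
  let ?h = "\<lambda>\<alpha>. \<alpha> k / sqrt (1 + dotp k \<alpha> \<alpha>)"
  have [measurable]: "?F \<in> borel_measurable borel" by measurable
  have sets: "{..<Suc k} \<times> {..<Suc k} = Iy k \<union> Iz k" by auto
  have ae: "AE \<alpha> in LB {..<Suc k}. \<alpha> \<in> supp_on {..<Suc k} \<and> \<alpha> k \<noteq> 0"
  proof (rule AE_conjI[OF AE_LB_supp])
    show "AE \<alpha> in LB {..<Suc k}. \<alpha> k \<noteq> (0::real)"
    proof (rule LB_zero_set_null)
      show "(\<lambda>j. if j = k then 1 else 0) \<in> supp_on {..<Suc k}" by (auto simp: supp_on_def)
      fix x :: "nat \<Rightarrow> real"
      have "is_poly (\<lambda>t. (x + t *\<^sub>R ((\<lambda>j. if j = k then 1 else 0) - x)) k)"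
        by (simp add: scaleR_fun_def) (intro is_poly_intros)
      then show "\<exists>p. \<forall>t. (x + t *\<^sub>R ((\<lambda>j. if j = k then 1 else 0) - x)) k = poly p t"
        by (simp add: is_poly_def)
    qed auto
  qed
  have "(\<integral>\<^sup>+X. ?F X \<partial>LB ({..<Suc k} \<times> {..<Suc k})) = (\<integral>\<^sup>+Y. \<integral>\<^sup>+Z. ?F (Y + Z) \<partial>LB (Iz k) \<partial>LB (Iy k))"
    unfolding sets by (rule nn_integral_LB_Un) auto
  also have "\<dots> = (\<integral>\<^sup>+Y. \<integral>\<^sup>+\<alpha>. inverse (kappa k Y) * (\<Psi> (?h \<alpha>) * ?P \<alpha> Y) \<partial>LB {..<Suc k} \<partial>LB (Iy k))"
  proof (rule nn_integral_cong_AE)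
    show "AE Y in LB (Iy k). (\<integral>\<^sup>+Z. ?F (Y + Z) \<partial>LB (Iz k)) =
        (\<integral>\<^sup>+\<alpha>. inverse (kappa k Y) * (\<Psi> (?h \<alpha>) * ?P \<alpha> Y) \<partial>LB {..<Suc k})"
      using AE_ymat_nondegenerate[of k] AE_LB_supp[of "Iy k"]
    proof eventually_elim
      case (elim Y)
      note nd = elim(1) and Y = elim(2)
      have kk: "inverse (kappa k Y) * kappa k Y = 1"
        using kappa_pos[OF nd] kappa_finite[OF nd]
        by (subst mult.commute) (simp add: divide_ennreal_def[symmetric] ennreal_divide_self)
      \<comment> \<open>Inserting \<open>inverse (kappa k Y) * kappa k Y\<close>, which is 1, turns
        the integral over heights into one over hyperplanes.\<close>
      have "(\<integral>\<^sup>+Z. ?F (Y + Z) \<partial>LB (Iz k)) = inverse (kappa k Y) * (kappa k Y * (\<integral>\<^sup>+Z. ?F (Y + Z) \<partial>LB (Iz k)))"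
        by (simp add: mult.assoc[symmetric] kk)
      also have "kappa k Y * (\<integral>\<^sup>+Z. ?F (Y + Z) \<partial>LB (Iz k)) = (\<integral>\<^sup>+\<alpha>. ?F (Y + zmap k Y \<alpha>) \<partial>LB {..<Suc k})"
        by (rule nn_integral_zmap[OF nd, symmetric]) measurable
      also have "\<dots> = (\<integral>\<^sup>+\<alpha>. \<Psi> (?h \<alpha>) * ?P \<alpha> Y \<partial>LB {..<Suc k})"
      proof (rule nn_integral_cong_AE, use ae in eventually_elim)
        case (elim \<alpha>)
        have "sqn (Suc k) (\<lambda>j. (Y + zmap k Y \<alpha>) (i, j)) = sqn k (\<lambda>l. Y (i, l)) + (dotp k \<alpha> (\<lambda>l. Y (i, l)) + \<alpha> k)\<^sup>2"
          if "i < Suc k" for i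
          using that Y by (simp add: sqn_def dotp_def zmap_def supp_on_def power2_eq_square)
        then have "(\<Prod>i<Suc k. phi \<beta> (sqn (Suc k) (\<lambda>j. (Y + zmap k Y \<alpha>) (i, j)))) = ?P \<alpha> Y"
          by (intro prod.cong refl) simp
        then show ?case using hyp[OF Y _ nd] elim by simp
      qed
      also have "inverse (kappa k Y) * \<dots> = (\<integral>\<^sup>+\<alpha>. inverse (kappa k Y) * (\<Psi> (?h \<alpha>) * ?P \<alpha> Y) \<partial>LB {..<Suc k})"
        by (rule nn_integral_cmult[symmetric]) measurable
      finally show ?case .
    qed
  qed
  \<comment> \<open>After this exchange the inner integral over the base points is
    \<open>hyp_dens\<close>, whose dependence on b is known.\<close>
  also have "\<dots> = (\<integral>\<^sup>+\<alpha>. \<integral>\<^sup>+Y. inverse (kappa k Y) * (\<Psi> (?h \<alpha>) * ?P \<alpha> Y) \<partial>LB (Iy k) \<partial>LB {..<Suc k})"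
    by (rule YA.Fubini'[symmetric]) measurable
  also have "\<dots> = (\<integral>\<^sup>+\<alpha>. \<Psi> (?h \<alpha>) * hyp_dens k \<beta> \<alpha> \<partial>LB {..<Suc k})"
    unfolding hyp_dens_def by (intro nn_integral_cong, subst nn_integral_cmult[symmetric]) (auto simp: ac_simps)
  also have "\<dots> = (\<integral>\<^sup>+u. \<integral>\<^sup>+v. \<Psi> (?h (u + v)) * hyp_dens k \<beta> (u + v) \<partial>LB {k} \<partial>LB {..<k})"
    by (rule nn_integral_LB_Suc) (unfold hyp_dens_def, measurable)
  also have "\<dots> = (\<integral>\<^sup>+u. hyp_dens k \<beta> (\<lambda>j. if j = k then 0 else u j) * ennreal (sqrt (1 + dotp k u u)) *
      (\<integral>\<^sup>+h. \<Psi> h * phi (hexp k \<beta>) (h\<^sup>2) \<partial>lborel) \<partial>LB {..<k})"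
  proof (rule nn_integral_LB_cong)
    fix u :: "nat \<Rightarrow> real" assume u: "u \<in> supp_on {..<k}"
    define c where "c = sqrt (1 + dotp k u u)"
    have "1 + dotp k u u > 0" using dotp_nonneg[of k u] by linarith
    then have c: "c > 0" by (simp add: c_def)
    have "(\<integral>\<^sup>+v. \<Psi> (?h (u + v)) * hyp_dens k \<beta> (u + v) \<partial>LB {k}) =
      (\<integral>\<^sup>+b. \<Psi> (?h (u + (\<lambda>j. if j = k then b else 0))) * hyp_dens k \<beta> (u + (\<lambda>j. if j = k then b else 0)) \<partial>lborel)"
      by (rule nn_integral_LB_singleton) (unfold hyp_dens_def, measurable)
    also have "\<dots> = (\<integral>\<^sup>+b. hyp_dens k \<beta> (\<lambda>j. if j = k then 0 else u j) * (\<Psi> (b / c) * phi (hexp k \<beta>) ((b / c)\<^sup>2)) \<partial>lborel)"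
    proof (rule nn_integral_cong)
      fix b
      have 1: "u + (\<lambda>j. if j = k then b else 0) = (\<lambda>j. if j = k then b else u j)"
        using u by (auto simp: fun_eq_iff supp_on_def)
      have 2: "dotp k (\<lambda>j. if j = k then b else u j) (\<lambda>j. if j = k then b else u j) = dotp k u u"
        by (rule dotp_cong) auto
      show "\<Psi> (?h (u + (\<lambda>j. if j = k then b else 0))) * hyp_dens k \<beta> (u + (\<lambda>j. if j = k then b else 0)) =
        hyp_dens k \<beta> (\<lambda>j. if j = k then 0 else u j) * (\<Psi> (b / c) * phi (hexp k \<beta>) ((b / c)\<^sup>2))"
        unfolding 1 2 by (subst hyp_dens_eq) (simp add: c_def ac_simps)
    qed
    also have "\<dots> = hyp_dens k \<beta> (\<lambda>j. if j = k then 0 else u j) * (ennreal c * (\<integral>\<^sup>+h. \<Psi> h * phi (hexp k \<beta>) (h\<^sup>2) \<partial>lborel))"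
      using nn_integral_lborel_scale[OF c, of "\<lambda>h. \<Psi> h * phi (hexp k \<beta>) (h\<^sup>2)"]
      by (subst nn_integral_cmult) auto
    finally show "(\<integral>\<^sup>+v. \<Psi> (?h (u + v)) * hyp_dens k \<beta> (u + v) \<partial>LB {k}) =
      hyp_dens k \<beta> (\<lambda>j. if j = k then 0 else u j) * ennreal (sqrt (1 + dotp k u u)) *
      (\<integral>\<^sup>+h. \<Psi> h * phi (hexp k \<beta>) (h\<^sup>2) \<partial>lborel)"
      by (simp add: c_def ac_simps)
  qed
  also have "\<dots> = bp_const k \<beta> * (\<integral>\<^sup>+h. \<Psi> h * phi (hexp k \<beta>) (h\<^sup>2) \<partial>lborel)"
  proof -
    have m: "(\<lambda>u j. if j = k then 0 else u j) \<in> borel \<rightarrow>\<^sub>M (borel :: (nat \<Rightarrow> real) measure)"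
    proof (rule fun_measurableI)
      show "(\<lambda>u. if j = k then 0 else u j) \<in> borel_measurable borel" for j by (cases "j = k") auto
    qed
    have "hyp_dens k \<beta> \<in> borel_measurable borel" unfolding hyp_dens_def [abs_def] by measurable
    from measurable_compose[OF m this]
    have [measurable]: "(\<lambda>u. hyp_dens k \<beta> (\<lambda>j. if j = k then 0 else u j)) \<in> borel_measurable borel" .
    have [measurable]: "(\<lambda>u. dotp k u u) \<in> borel_measurable borel"
      by (rule dotp_measurable) auto
    show ?thesis
      unfolding bp_const_def by (intro nn_integral_multc) measurable
  qed
  finally show ?thesis .
qed


section \<open>The position of a single point relative to a hyperplane\<close>

definition slice :: "nat \<Rightarrow> real \<Rightarrow> real \<Rightarrow> ennreal"
  where "slice k \<beta> h = (\<integral>\<^sup>+y. phi \<beta> (sqn k y + h\<^sup>2) \<partial>LB {..<k})"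

lemma sqn_measurable' [measurable]: "sqn k \<in> borel_measurable borel"
  using sqn_measurable[of "\<lambda>x. x" borel k] by simp

lemma dotp_measurable' [measurable]: "dotp k a \<in> borel_measurable borel"
  using dotp_measurable[of "\<lambda>x. a" borel "\<lambda>x. x" k] by simp

text \<open>The argument of \<open>dist_dens_eq\<close> for one point: the dilation of the k
  coordinates contributes k / 2 to the exponent and the weight contributes \<beta>.\<close>

lemma slice_eq: "slice k \<beta> h = phi (\<beta> + real k / 2) (h\<^sup>2) * slice k \<beta> 0"
proof (cases "\<bar>h\<bar> < 1")
  case False
  then have h: "h\<^sup>2 \<ge> 1" by (simp add: abs_square_less_1[symmetric])
  have "phi \<beta> (sqn k y + h\<^sup>2) = 0" for y
    using h sqn_nonneg[of k y] unfolding phi_def by (smt (verit))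
  then have "slice k \<beta> h = 0"
    unfolding slice_def by simp
  then show ?thesis using h by (simp add: phi_def)
next
  case True
  define r where "r = 1 - h\<^sup>2"
  define s where "s = sqrt r"
  have r: "r > 0" using True by (simp add: r_def abs_square_less_1)
  then have s: "s > 0" "s\<^sup>2 = r" by (auto simp: s_def)
  have "phi \<beta> (sqn k (s *\<^sub>R y) + h\<^sup>2) = ennreal (r powr \<beta>) * phi \<beta> (sqn k y + 0\<^sup>2)" for y
  proof -
    have "sqn k (s *\<^sub>R y) = r * sqn k y"
      unfolding sqn_def s(2)[symmetric] scaleR_fun_def by (simp add: dotp_linear power2_eq_square)
    then show ?thesis using True by (simp add: r_def phi_scale)
  qed
  then have "(\<integral>\<^sup>+y. phi \<beta> (sqn k (s *\<^sub>R y) + h\<^sup>2) \<partial>LB {..<k}) = ennreal (r powr \<beta>) * slice k \<beta> 0"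
    unfolding slice_def by (simp add: nn_integral_cmult)
  moreover have "(\<integral>\<^sup>+y. phi \<beta> (sqn k (s *\<^sub>R y) + h\<^sup>2) \<partial>LB {..<k}) = ennreal ((1 / s) ^ k) * slice k \<beta> h"
    unfolding slice_def using LB_scale[of "{..<k}" s "\<lambda>y. phi \<beta> (sqn k y + h\<^sup>2)"] s(1) by simp
  ultimately have "ennreal (s ^ k) * (ennreal ((1 / s) ^ k) * slice k \<beta> h) = ennreal (s ^ k) * (ennreal (r powr \<beta>) * slice k \<beta> 0)"
    by simp
  moreover have "ennreal (s ^ k) * ennreal ((1 / s) ^ k) = 1"
    using s(1) by (simp add: ennreal_mult'[symmetric] power_one_over)
  moreover have "ennreal (s ^ k) * ennreal (r powr \<beta>) = ennreal (r powr (\<beta> + real k / 2))"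
  proof -
    have "s ^ k = r powr (real k / 2)"
      unfolding s_def using r by (simp add: powr_realpow[symmetric] powr_half_sqrt[symmetric] powr_powr)
    then show ?thesis
      using r by (simp add: ennreal_mult'[symmetric] powr_add mult.commute)
  qed
  ultimately have "slice k \<beta> h = ennreal (r powr (\<beta> + real k / 2)) * slice k \<beta> 0"
    by (simp add: mult.assoc[symmetric])
  then show ?thesis
    using True by (simp add: phi_def r_def abs_square_less_1)
qed

lemma nn_integral_hyperplane_slice:
  "\<exists>C. 0 < C \<and> C < \<infinity> \<and> (\<forall>b. C * (\<integral>\<^sup>+y. phi \<beta> (sqn k y + (dotp k a y + b)\<^sup>2) \<partial>LB {..<k}) =
    slice k \<beta> (b / sqrt (1 + dotp k a a)))"
proof -
  define q where "q = dotp k a a"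
  have q: "q \<ge> 0" by (simp add: q_def)
  obtain C where C: "0 < C" "C < \<infinity>" "\<And>g. g \<in> borel_measurable borel \<Longrightarrow>
      (\<integral>\<^sup>+x. g (rank1 k a (- gam (dotp k a a)) x) \<partial>LB {..<k}) = C * (\<integral>\<^sup>+x. g x \<partial>LB {..<k})"
    using nn_integral_rank1[of k k a] by auto
  have "C * (\<integral>\<^sup>+y. phi \<beta> (sqn k y + (dotp k a y + b)\<^sup>2) \<partial>LB {..<k}) = slice k \<beta> (b / sqrt (1 + q))" for b
  proof -
    define \<tau> where "\<tau> = b / (1 + q)"
    let ?G = "\<lambda>y. phi \<beta> (sqn k y + (dotp k a y + b)\<^sup>2)"
    let ?w = "\<lambda>j. if j < k then - \<tau> * a j else 0"
    have "(\<integral>\<^sup>+y. ?G y \<partial>LB {..<k}) = (\<integral>\<^sup>+y. ?G (y + ?w) \<partial>LB {..<k})"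
      by (subst LB_translate[where g = ?G]) (auto simp: supp_on_def)
    then have "C * (\<integral>\<^sup>+y. ?G y \<partial>LB {..<k}) = C * (\<integral>\<^sup>+y. ?G (y + ?w) \<partial>LB {..<k})"
      by simp
    also have "\<dots> = (\<integral>\<^sup>+y. ?G (rank1 k a (- gam (dotp k a a)) y + ?w) \<partial>LB {..<k})"
      by (rule C(3)[symmetric, where g = "\<lambda>y. ?G (y + ?w)"]) measurable
    also have "\<dots> = (\<integral>\<^sup>+y. phi \<beta> (sqn k y + (b / sqrt (1 + q))\<^sup>2) \<partial>LB {..<k})"
    proof (intro nn_integral_cong arg_cong[of _ _ "phi \<beta>"])
      fix y :: "nat \<Rightarrow> real"
      let ?x = "rank1 k a (- gam (dotp k a a)) y + ?w"
      let ?y' = "\<lambda>j. y j - (gam q * dotp k a y + b / (1 + q)) * a j"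
      have e: "?x j = ?y' j" if "j < k" for j
        using that by (simp add: rank1_def q_def[symmetric] \<tau>_def algebra_simps)
      have "sqn k ?x = sqn k ?y'"
        unfolding sqn_def using e by (intro dotp_cong) auto
      moreover have "dotp k a ?x = dotp k a ?y'"
        using e by (intro dotp_cong) auto
      moreover have "sqn k ?y' + (dotp k a ?y' + b)\<^sup>2 = sqn k y + b\<^sup>2 / (1 + q)"
        unfolding q_def by (rule hyperplane_norm)
      ultimately show "sqn k ?x + (dotp k a ?x + b)\<^sup>2 = sqn k y + (b / sqrt (1 + q))\<^sup>2"
        using q by (simp add: power_divide)
    qed
    finally show ?thesis by (simp add: slice_def)
  qed
  with C show ?thesis unfolding q_def by blast
qed

text \<open>(x k - a . x) / sqrt (1 + |a|^2) is the component of x along the unit normal of the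
  hyperplane, and sweeping space by parallel hyperplanes reveals its density. C depends on a but not
  on \<psi>, so the choice \<psi> = 1 normalises.\<close>

lemma point_law:
  "\<exists>C. \<forall>\<psi>\<in>borel_measurable borel.
    (\<integral>\<^sup>+x. \<psi> ((x k - dotp k a x) / sqrt (1 + dotp k a a)) * phi \<beta> (sqn (Suc k) x) \<partial>LB {..<Suc k}) =
    C * (\<integral>\<^sup>+h. \<psi> h * phi (\<beta> + real k / 2) (h\<^sup>2) \<partial>lborel)"
proof -
  define c where "c = sqrt (1 + dotp k a a)"
  have "1 + dotp k a a > 0" using dotp_nonneg[of k a] by linarith
  then have c: "c > 0" by (simp add: c_def)
  obtain D where D: "0 < D" "D < \<infinity>" "\<And>b. D * (\<integral>\<^sup>+y. phi \<beta> (sqn k y + (dotp k a y + b)\<^sup>2) \<partial>LB {..<k}) = slice k \<beta> (b / c)"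
    using nn_integral_hyperplane_slice[where k = k and \<beta> = \<beta> and a = a] by (auto simp: c_def)
  interpret K: sigma_finite_measure "LB {..<k}" by (rule sigma_finite_LB) simp
  interpret KL: pair_sigma_finite "LB {..<k}" "lborel :: real measure" ..
  have "(\<integral>\<^sup>+x. \<psi> ((x k - dotp k a x) / c) * phi \<beta> (sqn (Suc k) x) \<partial>LB {..<Suc k}) =
    inverse D * slice k \<beta> 0 * ennreal c * (\<integral>\<^sup>+h. \<psi> h * phi (\<beta> + real k / 2) (h\<^sup>2) \<partial>lborel)"
    if [measurable]: "\<psi> \<in> borel_measurable borel" for \<psi>
  proof -
    let ?e = "\<lambda>z j. if j = k then z else 0 :: real"
    have [measurable]: "?e \<in> borel \<rightarrow>\<^sub>M borel" by (rule fun_measurableI) auto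
    have "(\<integral>\<^sup>+x. \<psi> ((x k - dotp k a x) / c) * phi \<beta> (sqn (Suc k) x) \<partial>LB {..<Suc k}) =
      (\<integral>\<^sup>+y. \<integral>\<^sup>+v. \<psi> (((y + v) k - dotp k a (y + v)) / c) * phi \<beta> (sqn (Suc k) (y + v)) \<partial>LB {k} \<partial>LB {..<k})"
      by (rule nn_integral_LB_Suc) measurable
    also have "\<dots> = (\<integral>\<^sup>+y. \<integral>\<^sup>+t. \<psi> (t / c) * phi \<beta> (sqn k y + (dotp k a y + t)\<^sup>2) \<partial>lborel \<partial>LB {..<k})"
    proof (rule nn_integral_LB_cong)
      fix y :: "nat \<Rightarrow> real" assume y: "y \<in> supp_on {..<k}"
      have "(\<integral>\<^sup>+v. \<psi> (((y + v) k - dotp k a (y + v)) / c) * phi \<beta> (sqn (Suc k) (y + v)) \<partial>LB {k}) =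
        (\<integral>\<^sup>+z. \<psi> (((y + ?e z) k - dotp k a (y + ?e z)) / c) * phi \<beta> (sqn (Suc k) (y + ?e z)) \<partial>lborel)"
        by (rule nn_integral_LB_singleton) measurable
      also have "\<dots> = (\<integral>\<^sup>+z. \<psi> ((z - dotp k a y) / c) * phi \<beta> (sqn k y + z\<^sup>2) \<partial>lborel)"
      proof (rule nn_integral_cong)
        fix z
        have 1: "dotp k a (y + ?e z) = dotp k a y" by (rule dotp_cong) auto
        have 2: "sqn (Suc k) (y + ?e z) = sqn k y + z\<^sup>2"
          using y by (simp add: sqn_def dotp_def supp_on_def power2_eq_square)
        have 3: "(y + ?e z) k = z" using y by (simp add: supp_on_def)
        show "\<psi> (((y + ?e z) k - dotp k a (y + ?e z)) / c) * phi \<beta> (sqn (Suc k) (y + ?e z)) =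
          \<psi> ((z - dotp k a y) / c) * phi \<beta> (sqn k y + z\<^sup>2)"
          unfolding 1 2 3 ..
      qed
      also have "\<dots> = (\<integral>\<^sup>+t. \<psi> (t / c) * phi \<beta> (sqn k y + (dotp k a y + t)\<^sup>2) \<partial>lborel)"
        by (subst nn_integral_real_affine[where c = 1 and t = "dotp k a y"]) auto
      finally show "(\<integral>\<^sup>+v. \<psi> (((y + v) k - dotp k a (y + v)) / c) * phi \<beta> (sqn (Suc k) (y + v)) \<partial>LB {k}) =
        (\<integral>\<^sup>+t. \<psi> (t / c) * phi \<beta> (sqn k y + (dotp k a y + t)\<^sup>2) \<partial>lborel)" .
    qed
    also have "\<dots> = (\<integral>\<^sup>+t. \<integral>\<^sup>+y. \<psi> (t / c) * phi \<beta> (sqn k y + (dotp k a y + t)\<^sup>2) \<partial>LB {..<k} \<partial>lborel)"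
      by (rule KL.Fubini'[symmetric]) measurable
    also have "\<dots> = (\<integral>\<^sup>+t. inverse D * slice k \<beta> 0 * (\<psi> (t / c) * phi (\<beta> + real k / 2) ((t / c)\<^sup>2)) \<partial>lborel)"
    proof (rule nn_integral_cong)
      fix t :: real
      let ?S = "\<integral>\<^sup>+y. phi \<beta> (sqn k y + (dotp k a y + t)\<^sup>2) \<partial>LB {..<k}"
      have "inverse D * D = 1"
        using D(1,2) by (subst mult.commute) (simp add: divide_ennreal_def[symmetric] ennreal_divide_self)
      then have "?S = inverse D * (D * ?S)" by (simp add: mult.assoc[symmetric])
      also have "\<dots> = inverse D * (phi (\<beta> + real k / 2) ((t / c)\<^sup>2) * slice k \<beta> 0)"
        by (subst D(3), subst slice_eq) simp
      finally have S: "?S = inverse D * (phi (\<beta> + real k / 2) ((t / c)\<^sup>2) * slice k \<beta> 0)" .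
      have "(\<integral>\<^sup>+y. \<psi> (t / c) * phi \<beta> (sqn k y + (dotp k a y + t)\<^sup>2) \<partial>LB {..<k}) = \<psi> (t / c) * ?S"
        by (rule nn_integral_cmult) measurable
      then show "(\<integral>\<^sup>+y. \<psi> (t / c) * phi \<beta> (sqn k y + (dotp k a y + t)\<^sup>2) \<partial>LB {..<k}) =
        inverse D * slice k \<beta> 0 * (\<psi> (t / c) * phi (\<beta> + real k / 2) ((t / c)\<^sup>2))"
        unfolding S by (simp only: ac_simps)
    qed
    also have "\<dots> = inverse D * slice k \<beta> 0 * (ennreal c * (\<integral>\<^sup>+h. \<psi> h * phi (\<beta> + real k / 2) (h\<^sup>2) \<partial>lborel))"
      using nn_integral_lborel_scale[OF c, of "\<lambda>h. \<psi> h * phi (\<beta> + real k / 2) (h\<^sup>2)"]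
      by (subst nn_integral_cmult) auto
    finally show ?thesis by (simp only: mult.assoc)
  qed
  then show ?thesis unfolding c_def by blast
qed

subsection \<open>Random configurations\<close>

lemma nn_integral_LB_row:
  fixes n :: "'i::countable" and J :: "'j::countable set"
  assumes "finite J" and g: "g \<in> borel_measurable borel"
  shows "(\<integral>\<^sup>+X. g (\<lambda>j. X (n, j)) \<partial>LB ({n} \<times> J)) = (\<integral>\<^sup>+y. g y \<partial>LB J)"
proof -
  let ?T = "\<lambda>X (j :: 'j). X (n, j) :: real" and ?T' = "\<lambda>y (i, j). if i = n then y j else 0 :: real"
  have f: "finite ({n} \<times> J)" using assms by simp
  have mT: "?T \<in> borel \<rightarrow>\<^sub>M borel" by (rule fun_measurableI) auto
  have mT': "?T' \<in> borel \<rightarrow>\<^sub>M (borel :: ('i \<times> 'j \<Rightarrow> real) measure)"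
  proof (rule fun_measurableI)
    show "(\<lambda>x. ?T' x p) \<in> borel_measurable borel" for p :: "'i \<times> 'j"
      by (cases p) (auto split: if_splits)
  qed
  note [simp] = supp_on_def
  have "(\<integral>\<^sup>+X. g (?T X) \<partial>LB ({n} \<times> J)) = (\<integral>\<^sup>+X. indicator (unit_cube J) (?T X) \<partial>LB ({n} \<times> J)) * (\<integral>\<^sup>+y. g y \<partial>LB J)"
    by (rule nn_integral_LB_linear[OF f assms(1) mT mT' _ _ _ _ _ g]) (auto simp: fun_eq_iff)
  also have "(\<integral>\<^sup>+X. indicator (unit_cube J) (?T X) \<partial>LB ({n} \<times> J)) = (\<integral>\<^sup>+X. indicator (unit_cube ({n} \<times> J)) X \<partial>LB ({n} \<times> J) :: ennreal)"
    by (rule nn_integral_LB_cong) (auto simp: unit_cube_def indicator_def)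
  also have "\<dots> = 1"
    using f unit_cube_borel[OF f] emeasure_unit_cube[OF f] by simp
  finally show ?thesis by simp
qed

lemma row_measurable:
  fixes i :: "'i::countable"
  shows "(\<lambda>X (j :: 'j::countable). X (i, j) :: real) \<in> borel \<rightarrow>\<^sub>M borel"
  by (rule fun_measurableI) auto

lemma nn_integral_LB_rows_prod:
  fixes J :: "'j::countable set" and n :: nat
  assumes J: "finite J" and g [measurable]: "\<And>i. g i \<in> borel_measurable borel"
  shows "(\<integral>\<^sup>+X. (\<Prod>i<n. g i (\<lambda>j. X (i, j))) \<partial>LB ({..<n} \<times> J)) = (\<Prod>i<n. \<integral>\<^sup>+y. g i y \<partial>LB J)"
proof (induction n)
  have gr [measurable]: "(\<lambda>X. g i (\<lambda>j. X (i', j))) \<in> borel_measurable borel" for i and i' :: nat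
    using measurable_compose[OF row_measurable g] .
  {
  case 0
  have "(\<integral>\<^sup>+X. 1 \<partial>LB ({} :: (nat \<times> 'j) set)) = (\<integral>\<^sup>+X. 1 \<partial>(\<Pi>\<^sub>M i\<in>({} :: (nat \<times> 'j) set). (lborel :: real measure)))"
    by (rule nn_integral_LB) simp
  also have "\<dots> = 1"
    by (rule lborel_product.nn_integral_empty) simp
  finally show ?case
    by (simp only: lessThan_0 prod.empty Sigma_empty1)
  }
  case (Suc n)
  have s: "{..<Suc n} \<times> J = ({..<n} \<times> J) \<union> ({n} \<times> J)" by auto
  have "(\<integral>\<^sup>+X. (\<Prod>i<Suc n. g i (\<lambda>j. X (i, j))) \<partial>LB ({..<Suc n} \<times> J)) =
    (\<integral>\<^sup>+X. \<integral>\<^sup>+X'. (\<Prod>i<Suc n. g i (\<lambda>j. (X + X') (i, j))) \<partial>LB ({n} \<times> J) \<partial>LB ({..<n} \<times> J))"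
    unfolding s by (rule nn_integral_LB_Un) (use J in auto)
  also have "\<dots> = (\<integral>\<^sup>+X. \<integral>\<^sup>+X'. (\<Prod>i<n. g i (\<lambda>j. X (i, j))) * g n (\<lambda>j. X' (n, j)) \<partial>LB ({n} \<times> J) \<partial>LB ({..<n} \<times> J))"
  proof (intro nn_integral_LB_cong)
    fix X X' :: "nat \<times> 'j \<Rightarrow> real" assume X: "X \<in> supp_on ({..<n} \<times> J)" "X' \<in> supp_on ({n} \<times> J)"
    have "(\<lambda>j. (X + X') (i, j)) = (\<lambda>j. X (i, j))" if "i < n" for i
      using X that by (auto simp: supp_on_def)
    moreover have "(\<lambda>j. (X + X') (n, j)) = (\<lambda>j. X' (n, j))"
      using X by (auto simp: supp_on_def)
    ultimately show "(\<Prod>i<Suc n. g i (\<lambda>j. (X + X') (i, j))) = (\<Prod>i<n. g i (\<lambda>j. X (i, j))) * g n (\<lambda>j. X' (n, j))"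
      by simp
  qed
  also have "\<dots> = (\<integral>\<^sup>+X. (\<Prod>i<n. g i (\<lambda>j. X (i, j))) * (\<integral>\<^sup>+y. g n y \<partial>LB J) \<partial>LB ({..<n} \<times> J))"
    by (intro nn_integral_cong, subst nn_integral_cmult) (auto simp: nn_integral_LB_row J)
  also have "\<dots> = (\<Prod>i<Suc n. \<integral>\<^sup>+y. g i y \<partial>LB J)"
    by (subst nn_integral_multc) (auto simp: Suc)
  finally show ?case .
qed

text \<open>A configuration of \<open>n\<close> points is a function \<open>x :: nat \<Rightarrow> nat \<Rightarrow> real\<close> with point \<open>x i\<close> for \<open>i < n\<close> and \<open>x i = 0\<close> beyond.\<close>

definition law :: "nat \<Rightarrow> (nat \<Rightarrow> real) measure \<Rightarrow> (nat \<Rightarrow> nat \<Rightarrow> real) measure"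
  where "law n \<mu> = distr (\<Pi>\<^sub>M i\<in>{..<n}. \<mu>) borel (\<lambda>x i. if i < n then x i else 0)"

lemma truncate_rows_measurable:
  assumes "sets \<mu> = sets borel"
  shows "(\<lambda>x i. if i < n then x i else 0) \<in> (\<Pi>\<^sub>M i\<in>{..<n}. \<mu>) \<rightarrow>\<^sub>M (borel :: (nat \<Rightarrow> nat \<Rightarrow> real) measure)"
proof (rule measurable_coordinatewise_then_product)
  show "(\<lambda>x. if i < n then x i else 0) \<in> (\<Pi>\<^sub>M i\<in>{..<n}. \<mu>) \<rightarrow>\<^sub>M borel" for i
    using measurable_component_singleton[of i "{..<n}" "\<lambda>_. \<mu>"]
    by (cases "i < n") (simp_all add: measurable_cong_sets[OF refl assms])
qed

lemma sets_law [simp, measurable_cong]: "sets (law n \<mu>) = sets borel"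
  by (simp add: law_def)

lemma coord2_measurable [measurable]: "(\<lambda>x :: nat \<Rightarrow> nat \<Rightarrow> real. x i) \<in> borel \<rightarrow>\<^sub>M borel"
  by (intro borel_measurable_continuous_onI continuous_on_product_coordinates)

lemma entry_measurable [measurable]: "(\<lambda>x :: nat \<Rightarrow> nat \<Rightarrow> real. x i j) \<in> borel_measurable borel"
  using measurable_compose[OF coord2_measurable coord_measurable] .

lemma fun2_measurableI:
  "(\<And>i j. (\<lambda>x. f x i j) \<in> borel_measurable M) \<Longrightarrow> f \<in> M \<rightarrow>\<^sub>M (borel :: (nat \<Rightarrow> nat \<Rightarrow> real) measure)"
  by (intro measurable_coordinatewise_then_product) auto

lemma phi_sqn_measurable [measurable]: "(\<lambda>x. phi \<beta> (sqn d x)) \<in> borel_measurable borel"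
  using measurable_compose[OF sqn_measurable' phi_measurable] .

lemma weight_measurable: "(\<lambda>x. phi \<beta> (sqn d x) * c) \<in> borel_measurable borel"
  by (intro borel_measurable_times_ennreal phi_sqn_measurable borel_measurable_const)

lemma measurable_LB_I: "f \<in> borel \<rightarrow>\<^sub>M N \<Longrightarrow> f \<in> LB I \<rightarrow>\<^sub>M N"
  by (simp add: measurable_cong_sets[OF sets_LB refl])

definition beta_const :: "nat \<Rightarrow> real \<Rightarrow> ennreal"
  where "beta_const d \<beta> = (\<integral>\<^sup>+x. phi \<beta> (sqn d x) \<partial>LB {..<d})"

definition beta_law :: "nat \<Rightarrow> real \<Rightarrow> (nat \<Rightarrow> real) measure"
  where "beta_law d \<beta> = density (LB {..<d}) (\<lambda>x. phi \<beta> (sqn d x) / beta_const d \<beta>)"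

lemma sets_beta_law [simp, measurable_cong]: "sets (beta_law d \<beta>) = sets borel"
  by (simp add: beta_law_def)

lemma space_beta_law [simp]: "space (beta_law d \<beta>) = UNIV"
  by (simp add: beta_law_def)

lemma nn_integral_beta_law:
  "g \<in> borel_measurable borel \<Longrightarrow>
    (\<integral>\<^sup>+x. g x \<partial>beta_law d \<beta>) = (\<integral>\<^sup>+x. g x * phi \<beta> (sqn d x) \<partial>LB {..<d}) / beta_const d \<beta>"
proof -
  assume [measurable]: "g \<in> borel_measurable borel"
  have "(\<integral>\<^sup>+x. g x \<partial>beta_law d \<beta>) = (\<integral>\<^sup>+x. phi \<beta> (sqn d x) * inverse (beta_const d \<beta>) * g x \<partial>LB {..<d})"
    unfolding beta_law_def divide_ennreal_def
    by (intro nn_integral_density measurable_LB_I weight_measurable) fact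
  also have "\<dots> = (\<integral>\<^sup>+x. g x * phi \<beta> (sqn d x) * inverse (beta_const d \<beta>) \<partial>LB {..<d})"
    by (simp only: ac_simps)
  also have "\<dots> = (\<integral>\<^sup>+x. g x * phi \<beta> (sqn d x) \<partial>LB {..<d}) * inverse (beta_const d \<beta>)"
    by (intro nn_integral_multc measurable_LB_I borel_measurable_times_ennreal phi_sqn_measurable) fact
  finally show ?thesis by (simp add: divide_ennreal_def)
qed

lemma prob_space_beta_law:
  assumes "0 < beta_const d \<beta>" "beta_const d \<beta> < \<infinity>"
  shows "prob_space (beta_law d \<beta>)"
proof
  have "emeasure (beta_law d \<beta>) (space (beta_law d \<beta>)) = (\<integral>\<^sup>+x. 1 \<partial>beta_law d \<beta>)"
    by simp
  also have "\<dots> = beta_const d \<beta> / beta_const d \<beta>"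
    by (subst nn_integral_beta_law) (auto simp: beta_const_def)
  also have "\<dots> = 1"
    using assms by (simp add: ennreal_divide_self)
  finally show "emeasure (beta_law d \<beta>) (space (beta_law d \<beta>)) = 1" .
qed

text \<open>Connects the law of n independent points with Lebesgue measure on all their coordinates
  together, where Blaschke--Petkantschin is available.\<close>

lemma law_beta_law:
  fixes d n :: nat
  assumes c: "0 < beta_const d \<beta>" "beta_const d \<beta> < \<infinity>"
    and G [measurable]: "G \<in> borel_measurable borel"
  shows "(\<integral>\<^sup>+x. G x \<partial>law n (beta_law d \<beta>)) =
    (\<integral>\<^sup>+X. G (\<lambda>i j. X (i, j)) * (\<Prod>i<n. phi \<beta> (sqn d (\<lambda>j. X (i, j)))) \<partial>LB ({..<n} \<times> {..<d})) / beta_const d \<beta> ^ n"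
proof -
  interpret B: prob_space "beta_law d \<beta>" by (rule prob_space_beta_law[OF c])
  interpret P: product_prob_space "\<lambda>_::nat. beta_law d \<beta>" by (rule product_prob_spaceI) (rule B.prob_space_axioms)
  let ?f = "\<lambda>X. \<Prod>i<n. phi \<beta> (sqn d (\<lambda>j. X (i, j))) / beta_const d \<beta>"
  let ?r = "\<lambda>X. \<lambda>i\<in>{..<n}. \<lambda>j. X (i, j) :: real"
  let ?P = "\<Pi>\<^sub>M i\<in>{..<n}. beta_law d \<beta>"
  have r [measurable]: "?r \<in> borel \<rightarrow>\<^sub>M ?P"
    by (rule measurable_restrict) (simp add: measurable_cong_sets[OF refl sets_beta_law] row_measurable)
  have f [measurable]: "?f \<in> borel_measurable borel" unfolding divide_ennreal_def by measurable
  have eq: "distr (density (LB ({..<n} \<times> {..<d})) ?f) ?P ?r = ?P"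
  proof (rule P.PiM_eqI)
    fix A :: "nat \<Rightarrow> (nat \<Rightarrow> real) set" assume A': "\<And>i. i \<in> {..<n} \<Longrightarrow> A i \<in> sets (beta_law d \<beta>)"
    \<comment> \<open>The given sets are measurable only for i below n; the empty set elsewhere
      makes every \<open>A2 i\<close> measurable.\<close>
    define A2 where "A2 i = (if i < n then A i else {})" for i
    have A [measurable]: "A2 i \<in> sets borel" for i using A' by (auto simp: A2_def)
    have P: "Pi\<^sub>E {..<n} A \<in> sets ?P" using A' by (intro sets_PiM_I_finite) auto
    have P': "?r -` Pi\<^sub>E {..<n} A \<in> sets (LB ({..<n} \<times> {..<d}))"
      using measurable_sets[OF r P] by simp
    have "emeasure (distr (density (LB ({..<n} \<times> {..<d})) ?f) ?P ?r) (Pi\<^sub>E {..<n} A) =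
        emeasure (density (LB ({..<n} \<times> {..<d})) ?f) (?r -` Pi\<^sub>E {..<n} A \<inter> space (density (LB ({..<n} \<times> {..<d})) ?f))"
      by (rule emeasure_distr[OF _ P]) measurable
    also have "\<dots> = (\<integral>\<^sup>+X. ?f X * indicator (?r -` Pi\<^sub>E {..<n} A) X \<partial>LB ({..<n} \<times> {..<d}))"
      using P' f by (simp add: emeasure_density del: prod_dividef)
    also have "\<dots> = (\<integral>\<^sup>+X. (\<Prod>i<n. (\<lambda>i y. phi \<beta> (sqn d y) / beta_const d \<beta> * indicator (A2 i) y) i (\<lambda>j. X (i, j))) \<partial>LB ({..<n} \<times> {..<d}))"
    proof (rule nn_integral_cong)
      fix X :: "nat \<times> nat \<Rightarrow> real"
      have "(\<Prod>i<n. indicator (A2 i) (\<lambda>j. X (i, j))) = (indicator (?r -` Pi\<^sub>E {..<n} A) X :: ennreal)"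
        by (auto simp: indicator_def A2_def PiE_iff prod_zero_iff)
      then show "?f X * indicator (?r -` Pi\<^sub>E {..<n} A) X =
        (\<Prod>i<n. (\<lambda>i y. phi \<beta> (sqn d y) / beta_const d \<beta> * indicator (A2 i) y) i (\<lambda>j. X (i, j)))"
        by (simp add: prod.distrib)
    qed
    also have "\<dots> = (\<Prod>i<n. \<integral>\<^sup>+y. phi \<beta> (sqn d y) / beta_const d \<beta> * indicator (A2 i) y \<partial>LB {..<d})"
      by (rule nn_integral_LB_rows_prod) (auto simp: divide_ennreal_def)
    also have "\<dots> = (\<Prod>i<n. emeasure (beta_law d \<beta>) (A2 i))"
      unfolding beta_law_def by (intro prod.cong refl emeasure_density[symmetric])
        (auto simp: divide_ennreal_def intro: measurable_LB_I weight_measurable)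
    finally show "emeasure (distr (density (LB ({..<n} \<times> {..<d})) ?f) ?P ?r) (Pi\<^sub>E {..<n} A) = (\<Prod>i\<in>{..<n}. emeasure (beta_law d \<beta>) (A i))"
      by (simp add: A2_def)
  qed auto
  let ?t = "\<lambda>x i. if i < n then x i else 0 :: nat \<Rightarrow> real"
  have t [measurable]: "?t \<in> ?P \<rightarrow>\<^sub>M borel" by (rule truncate_rows_measurable) simp
  have [measurable]: "(\<lambda>X i j. X (i, j) :: real) \<in> borel \<rightarrow>\<^sub>M (borel :: (nat \<Rightarrow> nat \<Rightarrow> real) measure)"
    by (rule fun2_measurableI) auto
  have "(\<integral>\<^sup>+x. G x \<partial>law n (beta_law d \<beta>)) = (\<integral>\<^sup>+x. G (?t x) \<partial>?P)"
    unfolding law_def by (rule nn_integral_distr) auto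
  also have "\<dots> = (\<integral>\<^sup>+x. G (?t x) \<partial>distr (density (LB ({..<n} \<times> {..<d})) ?f) ?P ?r)"
    unfolding eq ..
  also have "\<dots> = (\<integral>\<^sup>+X. ?f X * G (?t (?r X)) \<partial>LB ({..<n} \<times> {..<d}))"
    by (subst nn_integral_distr, simp, measurable, subst nn_integral_density) auto
  also have "\<dots> = (\<integral>\<^sup>+X. inverse (beta_const d \<beta> ^ n) * (G (\<lambda>i j. X (i, j)) * (\<Prod>i<n. phi \<beta> (sqn d (\<lambda>j. X (i, j))))) \<partial>LB ({..<n} \<times> {..<d}))"
  proof (rule nn_integral_LB_cong)
    fix X :: "nat \<times> nat \<Rightarrow> real" assume X: "X \<in> supp_on ({..<n} \<times> {..<d})"
    have 1: "?t (?r X) = (\<lambda>i j. X (i, j))"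
      using X by (auto simp: fun_eq_iff supp_on_def)
    have "inverse (beta_const d \<beta>) ^ n = inverse (beta_const d \<beta> ^ n)"
      using c by (induction n) (auto simp: ennreal_inverse_mult_finite)
    then have 2: "?f X = inverse (beta_const d \<beta> ^ n) * (\<Prod>i<n. phi \<beta> (sqn d (\<lambda>j. X (i, j))))"
      by (simp add: divide_ennreal_def prod.distrib mult.commute)
    show "?f X * G (?t (?r X)) = inverse (beta_const d \<beta> ^ n) * (G (\<lambda>i j. X (i, j)) * (\<Prod>i<n. phi \<beta> (sqn d (\<lambda>j. X (i, j)))))"
      unfolding 1 2 by (simp only: ac_simps)
  qed
  also have "\<dots> = (\<integral>\<^sup>+X. G (\<lambda>i j. X (i, j)) * (\<Prod>i<n. phi \<beta> (sqn d (\<lambda>j. X (i, j)))) \<partial>LB ({..<n} \<times> {..<d})) / beta_const d \<beta> ^ n"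
    by (subst nn_integral_cmult) (auto simp: divide_ennreal_def mult.commute)
  finally show ?thesis .
qed

section \<open>The hyperplane through the first d points of a configuration\<close>

lemma mdet_cong:
  "(\<And>i j. i < d \<Longrightarrow> j < d \<Longrightarrow> A i j = B i j) \<Longrightarrow> mdet d A = mdet d B"
  unfolding mdet_def by (intro arg_cong[of _ _ det] eq_matI) auto

lemma madj_cong:
  assumes "\<And>i j. i < d \<Longrightarrow> j < d \<Longrightarrow> A i j = B i j"
  shows "madj d A i j = madj d B i j"
proof -
  have "insert_index i a < d" if "a < d - 1" for i a
    using that by (auto simp: insert_index_def)
  then show ?thesis
    unfolding madj_def using assms by (intro arg_cong2[of _ _ _ _ "(*)"] refl mdet_cong) auto
qed

text \<open>\<open>{y. dotp d (hvec d x) y = 1}\<close> is the hyperplane through the first \<open>d\<close> points, if \<open>mdet d x \<noteq> 0\<close>.\<close>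

definition hvec :: "nat \<Rightarrow> (nat \<Rightarrow> nat \<Rightarrow> real) \<Rightarrow> nat \<Rightarrow> real"
  where "hvec d x l = (\<Sum>i<d. madj d x l i) / mdet d x"

lemma hvec_cong:
  assumes "\<And>i j. i < d \<Longrightarrow> j < d \<Longrightarrow> x i j = y i j"
  shows "hvec d x = hvec d y"
proof (rule ext)
  show "hvec d x l = hvec d y l" for l
    unfolding hvec_def using mdet_cong[of d x y] madj_cong[of d x y] assms by simp
qed

lemma dotp_hvec:
  assumes "mdet d x \<noteq> 0" "i < d"
  shows "dotp d (hvec d x) (x i) = 1"
proof -
  have "dotp d (hvec d x) (x i) = (\<Sum>l<d. \<Sum>m<d. x i l * madj d x l m / mdet d x)"
    by (simp add: dotp_def hvec_def sum_distrib_left sum_distrib_right sum_divide_distrib mult.commute)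
  also have "\<dots> = (\<Sum>m<d. \<Sum>l<d. x i l * madj d x l m / mdet d x)"
    by (rule sum.swap)
  also have "\<dots> = (\<Sum>m<d. (if i = m then mdet d x else 0) / mdet d x)"
    using assms(2) by (intro sum.cong refl) (simp add: madj_mult_right[symmetric] sum_divide_distrib)
  also have "\<dots> = (\<Sum>m<d. if i = m then 1 else 0)"
    using assms(1) by (intro sum.cong) auto
  finally show ?thesis using assms(2) by simp
qed

lemma hvec_unique:
  assumes "mdet d x \<noteq> 0" "\<And>i. i < d \<Longrightarrow> dotp d v (x i) = 1" "l < d"
  shows "hvec d x l = v l"
proof -
  have "hvec d x l - v l = 0"
  proof (rule mdet_nonzeroD[OF assms(1) _ assms(3), of "\<lambda>l. hvec d x l - v l"])
    fix i assume i: "i < d"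
    have "(\<Sum>j<d. x i j * (hvec d x j - v j)) = dotp d (hvec d x) (x i) - dotp d v (x i)"
      by (simp add: dotp_def algebra_simps sum_subtractf)
    then show "(\<Sum>j<d. x i j * (hvec d x j - v j)) = 0"
      using i assms dotp_hvec by simp
  qed
  then show ?thesis by simp
qed

lemma mdet_config_measurable [measurable]: "mdet d \<in> borel_measurable borel"
  using mdet_measurable[of "\<lambda>x. x" borel d] by simp

lemma hvec_measurable [measurable]: "(\<lambda>x. hvec d x l) \<in> borel_measurable borel"
  unfolding hvec_def
  by (intro borel_measurable_divide borel_measurable_sum madj_measurable mdet_config_measurable entry_measurable)

text \<open>Zero on the hyperplane and negative on the side of the origin, where the value is -1 at
  the origin itself.\<close>

definition above :: "nat \<Rightarrow> (nat \<Rightarrow> nat \<Rightarrow> real) \<Rightarrow> (nat \<Rightarrow> real) \<Rightarrow> real"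
  where "above d x y = dotp d (hvec d x) y - 1"

lemma above_measurable: "(\<lambda>(x, y). above d x y) \<in> borel_measurable (borel \<Otimes>\<^sub>M borel)"
proof -
  have 1: "(\<lambda>z :: (nat \<Rightarrow> nat \<Rightarrow> real) \<times> (nat \<Rightarrow> real). snd z j) \<in> borel_measurable (borel \<Otimes>\<^sub>M borel)" for j :: nat
    using measurable_compose[OF measurable_snd coord_measurable] .
  have 2: "(\<lambda>z :: (nat \<Rightarrow> nat \<Rightarrow> real) \<times> (nat \<Rightarrow> real). hvec d (fst z) j) \<in> borel_measurable (borel \<Otimes>\<^sub>M borel)" for j :: nat
    using measurable_compose[OF measurable_fst hvec_measurable] .
  show ?thesis
    unfolding above_def dotp_def case_prod_beta
    by (intro borel_measurable_diff borel_measurable_const borel_measurable_sum borel_measurable_times 1 2)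
qed

lemma above_measurable_left [measurable]: "(\<lambda>y. above d x y) \<in> borel_measurable borel"
  using measurable_compose[OF measurable_Pair1'[of x borel borel] above_measurable] by simp

lemma above_row_measurable [measurable]: "(\<lambda>x. above d x (x j)) \<in> borel_measurable borel"
proof -
  have "(\<lambda>x :: nat \<Rightarrow> nat \<Rightarrow> real. (x, x j)) \<in> borel \<rightarrow>\<^sub>M borel \<Otimes>\<^sub>M borel"
    by (intro measurable_Pair measurable_ident_sets coord2_measurable refl)
  from measurable_compose[OF this above_measurable] show ?thesis by simp
qed

definition facet_set :: "nat \<Rightarrow> nat \<Rightarrow> (nat \<Rightarrow> nat \<Rightarrow> real) set"
  where "facet_set d n = {x. mdet d x \<noteq> 0 \<and>
    ((\<forall>j\<in>{d..<n}. above d x (x j) < 0) \<or> (\<forall>j\<in>{d..<n}. above d x (x j) > 0))}"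

lemma facet_set_borel [measurable]: "facet_set d n \<in> sets borel"
proof -
  have "{x \<in> space borel. mdet d x \<noteq> 0 \<and>
    ((\<forall>j\<in>{d..<n}. above d x (x j) < 0) \<or> (\<forall>j\<in>{d..<n}. above d x (x j) > 0))} \<in> sets borel"
    by measurable
  then show ?thesis by (simp add: facet_set_def)
qed

lemma of_bool_conj_if: "P = (Q \<and> R) \<Longrightarrow> of_bool P = (if Q then of_bool R else 0)"
  by simp

lemma law_facet_set_measurable:
  assumes \<mu>: "prob_space \<mu>" and sets: "sets \<mu> = sets borel"
  shows "(\<lambda>x. if mdet d x \<noteq> 0 then emeasure \<mu> {y. above d x y < 0} ^ m + emeasure \<mu> {y. above d x y > 0} ^ m else 0)
      \<in> borel_measurable borel"
proof -
  interpret \<mu>: prob_space \<mu> by fact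
  have sp: "space \<mu> = UNIV" using sets_eq_imp_space_eq[OF sets] by simp
    have q: "(\<lambda>x. emeasure \<mu> {y. P (above d x y)}) \<in> borel_measurable borel"
      if [measurable]: "Measurable.pred borel P" for P
    proof -
      have "{z \<in> space (borel \<Otimes>\<^sub>M \<mu>). P (above d (fst z) (snd z))} \<in> sets (borel \<Otimes>\<^sub>M \<mu>)"
      proof -
        have "(\<lambda>z. above d (fst z) (snd z)) \<in> borel_measurable (borel \<Otimes>\<^sub>M \<mu>)"
          using above_measurable[of d]
          by (simp add: case_prod_beta' measurable_cong_sets[OF sets_pair_measure_cong[OF refl sets] refl])
        then show ?thesis using that by measurable
      qed
      from \<mu>.measurable_emeasure_Pair[OF this] show ?thesis
        by (simp add: space_pair_measure sp vimage_def)
    qed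
    show "(\<lambda>x. if mdet d x \<noteq> 0 then emeasure \<mu> {y. above d x y < 0} ^ m + emeasure \<mu> {y. above d x y > 0} ^ m else 0)
      \<in> borel_measurable borel"
      using q[of "\<lambda>r. r < 0"] q[of "\<lambda>r. r > 0"] by measurable
qed

text \<open>\<open>mdet\<close> and \<open>hvec\<close> involve only the first d points. Given
  these, the other m points are still independent with law \<open>\<mu>\<close>, so each side of the
  hyperplane contributes an m-th power.\<close>

lemma law_facet_set:
  assumes \<mu>: "prob_space \<mu>" and sets: "sets \<mu> = sets borel" and m: "m > 0"
  shows "emeasure (law (d + m) \<mu>) (facet_set d (d + m)) =
    (\<integral>\<^sup>+x. (if mdet d x \<noteq> 0
      then emeasure \<mu> {y. above d x y < 0} ^ m + emeasure \<mu> {y. above d x y > 0} ^ m else 0) \<partial>law d \<mu>)"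
proof -
  interpret \<mu>: prob_space \<mu> by fact
  interpret P: product_prob_space "\<lambda>_::nat. \<mu>" by (rule product_prob_spaceI) fact
  have sp: "space \<mu> = UNIV" using sets_eq_imp_space_eq[OF sets] by simp
  let ?n = "d + m"
  have un: "{..<?n} = {..<d} \<union> {d..<?n}" by auto
  let ?t = "\<lambda>n x i. if i < n then x i else 0 :: nat \<Rightarrow> real"
  let ?g = "\<lambda>x. indicator (facet_set d ?n) (?t ?n x) :: ennreal"
  note t = truncate_rows_measurable[OF sets]
  have g: "?g \<in> borel_measurable (\<Pi>\<^sub>M i\<in>{..<?n}. \<mu>)"
    by (rule measurable_compose[OF t borel_measurable_indicator[OF facet_set_borel]])
  have "emeasure (law ?n \<mu>) (facet_set d ?n) = (\<integral>\<^sup>+x. indicator (facet_set d ?n) x \<partial>law ?n \<mu>)"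
    by simp
  also have "\<dots> = (\<integral>\<^sup>+x. ?g x \<partial>(\<Pi>\<^sub>M i\<in>{..<?n}. \<mu>))"
    unfolding law_def by (rule nn_integral_distr[OF t]) simp
  also have "\<dots> = (\<integral>\<^sup>+x. (\<integral>\<^sup>+y. ?g (merge {..<d} {d..<?n} (x, y)) \<partial>(\<Pi>\<^sub>M i\<in>{d..<?n}. \<mu>)) \<partial>(\<Pi>\<^sub>M i\<in>{..<d}. \<mu>))"
    using g unfolding un by (intro P.product_nn_integral_fold) auto
  also have "\<dots> = (\<integral>\<^sup>+x. (if mdet d (?t d x) \<noteq> 0
      then emeasure \<mu> {y. above d (?t d x) y < 0} ^ m + emeasure \<mu> {y. above d (?t d x) y > 0} ^ m else 0) \<partial>(\<Pi>\<^sub>M i\<in>{..<d}. \<mu>))"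
  proof (rule nn_integral_cong)
    fix x :: "nat \<Rightarrow> nat \<Rightarrow> real"
    let ?A = "\<lambda>i::nat. {y. above d (?t d x) y < 0}" and ?B = "\<lambda>i::nat. {y. above d (?t d x) y > 0}"
    have "{y \<in> space borel. above d (?t d x) y < 0} \<in> sets borel" "{y \<in> space borel. above d (?t d x) y > 0} \<in> sets borel"
      by measurable
    then have AB: "?A i \<in> sets \<mu>" "?B i \<in> sets \<mu>" for i
      using sets by auto
    have e: "emeasure (\<Pi>\<^sub>M i\<in>{d..<?n}. \<mu>) (Pi\<^sub>E {d..<?n} ?A) = emeasure \<mu> (?A 0) ^ m"
      "emeasure (\<Pi>\<^sub>M i\<in>{d..<?n}. \<mu>) (Pi\<^sub>E {d..<?n} ?B) = emeasure \<mu> (?B 0) ^ m"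
      using AB by (subst P.emeasure_PiM; simp)+
    have S: "Pi\<^sub>E {d..<?n} ?A \<in> sets (\<Pi>\<^sub>M i\<in>{d..<?n}. \<mu>)" "Pi\<^sub>E {d..<?n} ?B \<in> sets (\<Pi>\<^sub>M i\<in>{d..<?n}. \<mu>)"
      using AB by (intro sets_PiM_I_finite; simp)+
    \<comment> \<open>Point d exists because m is positive; with no further points the two
      alternatives would coincide.\<close>
    have disj: "Pi\<^sub>E {d..<?n} ?A \<inter> Pi\<^sub>E {d..<?n} ?B = {}"
    proof -
      have "d \<in> {d..<?n}" using m by simp
      then have "y d \<in> ?A d \<and> y d \<in> ?B d" if "y \<in> Pi\<^sub>E {d..<?n} ?A \<inter> Pi\<^sub>E {d..<?n} ?B" for y
        using that by (blast dest: PiE_mem)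
      then show ?thesis by fastforce
    qed
    have md: "mdet d (?t ?n (merge {..<d} {d..<?n} (x, y))) = mdet d (?t d x)" for y
      by (rule mdet_cong) (auto simp: merge_def)
    have hv: "hvec d (?t ?n (merge {..<d} {d..<?n} (x, y))) = hvec d (?t d x)" for y
      by (rule hvec_cong) (auto simp: merge_def)
    have "?g (merge {..<d} {d..<?n} (x, y)) =
      (if mdet d (?t d x) \<noteq> 0 then indicator (Pi\<^sub>E {d..<?n} ?A \<union> Pi\<^sub>E {d..<?n} ?B) y else 0)"
      if "y \<in> space (\<Pi>\<^sub>M i\<in>{d..<?n}. \<mu>)" for y
    proof -
      let ?z = "?t ?n (merge {..<d} {d..<?n} (x, y))"
      have zj: "?z j = y j" if "j \<in> {d..<?n}" for j
        using that by (simp add: merge_def)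
      have z: "above d ?z (?z j) = above d (?t d x) (y j)" if "j \<in> {d..<?n}" for j
        unfolding above_def hv zj[OF that] ..
      have ext: "y \<in> extensional {d..<?n}"
        using that by (simp add: space_PiM PiE_def)
      have mem: "?z \<in> facet_set d ?n \<longleftrightarrow> mdet d (?t d x) \<noteq> 0 \<and>
        ((\<forall>j\<in>{d..<?n}. above d (?t d x) (y j) < 0) \<or> (\<forall>j\<in>{d..<?n}. above d (?t d x) (y j) > 0))"
        unfolding facet_set_def mem_Collect_eq md by (simp only: z cong: ball_cong)
      have "(?z \<in> facet_set d ?n) = (mdet d (?t d x) \<noteq> 0 \<and> y \<in> Pi\<^sub>E {d..<?n} ?A \<union> Pi\<^sub>E {d..<?n} ?B)"
        unfolding mem Un_iff PiE_iff mem_Collect_eq using ext by blast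
      then show ?thesis
        unfolding indicator_def by (rule of_bool_conj_if)
    qed
    then have "(\<integral>\<^sup>+y. ?g (merge {..<d} {d..<?n} (x, y)) \<partial>(\<Pi>\<^sub>M i\<in>{d..<?n}. \<mu>)) =
      (\<integral>\<^sup>+y. (if mdet d (?t d x) \<noteq> 0 then indicator (Pi\<^sub>E {d..<?n} ?A \<union> Pi\<^sub>E {d..<?n} ?B) y else 0) \<partial>(\<Pi>\<^sub>M i\<in>{d..<?n}. \<mu>))"
      by (rule nn_integral_cong)
    also have "\<dots> = (if mdet d (?t d x) \<noteq> 0
      then emeasure (\<Pi>\<^sub>M i\<in>{d..<?n}. \<mu>) (Pi\<^sub>E {d..<?n} ?A \<union> Pi\<^sub>E {d..<?n} ?B) else 0)"
      using S by (auto simp: sets.Un)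
    also have "emeasure (\<Pi>\<^sub>M i\<in>{d..<?n}. \<mu>) (Pi\<^sub>E {d..<?n} ?A \<union> Pi\<^sub>E {d..<?n} ?B) =
      emeasure \<mu> (?A 0) ^ m + emeasure \<mu> (?B 0) ^ m"
      using plus_emeasure[OF S disj] e by simp
    finally show "(\<integral>\<^sup>+y. ?g (merge {..<d} {d..<?n} (x, y)) \<partial>(\<Pi>\<^sub>M i\<in>{d..<?n}. \<mu>)) = (if mdet d (?t d x) \<noteq> 0
      then emeasure \<mu> (?A 0) ^ m + emeasure \<mu> (?B 0) ^ m else 0)" .
  qed
  also have "\<dots> = (\<integral>\<^sup>+x. (if mdet d x \<noteq> 0
      then emeasure \<mu> {y. above d x y < 0} ^ m + emeasure \<mu> {y. above d x y > 0} ^ m else 0) \<partial>law d \<mu>)"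
    unfolding law_def
    by (subst nn_integral_distr[OF t]) (use law_facet_set_measurable[OF assms(1,2)] in simp_all)
  finally show ?thesis .
qed


section \<open>The facet probability for beta densities\<close>

definition cap :: "real \<Rightarrow> real \<Rightarrow> ennreal"
  where "cap \<beta> h = (\<integral>\<^sup>+t. indicator {..<h} t * phi \<beta> (t\<^sup>2) \<partial>lborel) / (\<integral>\<^sup>+t. phi \<beta> (t\<^sup>2) \<partial>lborel)"

definition cocap :: "real \<Rightarrow> real \<Rightarrow> ennreal"
  where "cocap \<beta> h = (\<integral>\<^sup>+t. indicator {h<..} t * phi \<beta> (t\<^sup>2) \<partial>lborel) / (\<integral>\<^sup>+t. phi \<beta> (t\<^sup>2) \<partial>lborel)"

text \<open>The constants from \<open>point_law\<close> and \<open>beta_const\<close> need not be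
  known: A = \<open>UNIV\<close> has probability 1, which makes their quotient the inverse of the
  integral in the denominator.\<close>

lemma beta_law_halfspace:
  fixes k :: nat
  assumes c: "0 < beta_const (Suc k) \<beta>" "beta_const (Suc k) \<beta> < \<infinity>"
    and A [measurable]: "A \<in> sets borel"
  shows "emeasure (beta_law (Suc k) \<beta>) {x. (x k - dotp k a x) / sqrt (1 + dotp k a a) \<in> A} =
    (\<integral>\<^sup>+t. indicator A t * phi (\<beta> + real k / 2) (t\<^sup>2) \<partial>lborel) / (\<integral>\<^sup>+t. phi (\<beta> + real k / 2) (t\<^sup>2) \<partial>lborel)"
proof -
  let ?f = "\<lambda>x. (x k - dotp k a x) / sqrt (1 + dotp k a a)"
  let ?V = "\<lambda>A. \<integral>\<^sup>+t. indicator A t * phi (\<beta> + real k / 2) (t\<^sup>2) \<partial>lborel"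
  obtain C where C: "\<And>\<psi>. \<psi> \<in> borel_measurable borel \<Longrightarrow>
    (\<integral>\<^sup>+x. \<psi> (?f x) * phi \<beta> (sqn (Suc k) x) \<partial>LB {..<Suc k}) =
    C * (\<integral>\<^sup>+h. \<psi> h * phi (\<beta> + real k / 2) (h\<^sup>2) \<partial>lborel)"
    using point_law[where k = k and a = a and \<beta> = \<beta>] by auto
  have f [measurable]: "?f \<in> borel_measurable borel"
    by (intro borel_measurable_divide borel_measurable_diff coord_measurable dotp_measurable' borel_measurable_const)
  have S: "{x. ?f x \<in> A} \<in> sets borel"
    using measurable_sets[OF f A] by (simp add: vimage_def)
  have eq: "emeasure (beta_law (Suc k) \<beta>) {x. ?f x \<in> A} = C * ?V A / beta_const (Suc k) \<beta>"
    if A [measurable]: "A \<in> sets borel" for A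
  proof -
    have S: "{x. ?f x \<in> A} \<in> sets borel"
      using measurable_sets[OF f A] by (simp add: vimage_def)
    have "emeasure (beta_law (Suc k) \<beta>) {x. ?f x \<in> A} = (\<integral>\<^sup>+x. indicator {x. ?f x \<in> A} x \<partial>beta_law (Suc k) \<beta>)"
      using S by simp
    also have "\<dots> = (\<integral>\<^sup>+x. indicator {x. ?f x \<in> A} x * phi \<beta> (sqn (Suc k) x) \<partial>LB {..<Suc k}) / beta_const (Suc k) \<beta>"
      using S by (intro nn_integral_beta_law) simp
    also have "(\<integral>\<^sup>+x. indicator {x. ?f x \<in> A} x * phi \<beta> (sqn (Suc k) x) \<partial>LB {..<Suc k}) =
        (\<integral>\<^sup>+x. indicator A (?f x) * phi \<beta> (sqn (Suc k) x) \<partial>LB {..<Suc k})"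
      by (intro nn_integral_cong) (simp add: indicator_def)
    also have "\<dots> = C * ?V A"
      by (rule C) measurable
    finally show ?thesis .
  qed
  interpret prob_space "beta_law (Suc k) \<beta>" by (rule prob_space_beta_law[OF c])
  have one: "C * ?V UNIV / beta_const (Suc k) \<beta> = 1"
    using eq[of UNIV] emeasure_space_1 by simp
  define r where "r = C / beta_const (Suc k) \<beta>"
  have one': "r * ?V UNIV = 1"
    using one by (simp only: r_def divide_ennreal_def ac_simps indicator_UNIV mult_1_left)
  have V: "?V UNIV \<noteq> 0" using one' by auto
  have r0: "r \<noteq> 0" using one' by auto
  have V2: "?V UNIV \<noteq> \<infinity>"
  proof
    assume "?V UNIV = \<infinity>"
    then show False using one' r0 by (simp add: ennreal_mult_top)
  qed
  have "r = inverse (?V UNIV)"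
  proof -
    have "r = r * (?V UNIV * inverse (?V UNIV))"
      using V V2 by (simp add: divide_ennreal_def[symmetric] ennreal_divide_self less_top)
    then show ?thesis by (simp only: mult.assoc[symmetric] one' mult_1_left)
  qed
  have "C * ?V A / beta_const (Suc k) \<beta> = r * ?V A"
    by (simp only: r_def divide_ennreal_def ac_simps)
  also have "\<dots> = ?V A / ?V UNIV"
    by (simp only: \<open>r = inverse (?V UNIV)\<close> divide_ennreal_def mult.commute)
  finally show ?thesis using eq[OF A] by (simp only: indicator_UNIV mult_1_left)
qed

text \<open>Affinely independent base points, lifted to a graph that misses the origin, become
  linearly independent.\<close>

lemma mdet_graph:
  assumes nd: "mdet (Suc k) (ymat k Y) \<noteq> 0" and b: "\<alpha> k \<noteq> 0"
    and Y: "Y \<in> supp_on (Iy k)"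
  shows "mdet (Suc k) (\<lambda>i j. (Y + zmap k Y \<alpha>) (i, j)) \<noteq> 0"
proof (rule mdet_nonzeroI)
  fix v :: "nat \<Rightarrow> real" and j
  assume v: "\<And>i. i < Suc k \<Longrightarrow> (\<Sum>j<Suc k. (Y + zmap k Y \<alpha>) (i, j) * v j) = 0" and j: "j < Suc k"
  \<comment> \<open>A relation v among the columns of the configuration becomes, on collecting the
    coefficients of the base coordinates and of the constant 1, a relation \<open>?u\<close> among
    the columns of \<open>ymat\<close>. Its last entry is v k times b, so v k vanishes with
    it.\<close>
  let ?u = "\<lambda>l. if l < k then v l + v k * \<alpha> l else v k * \<alpha> k"
  have u: "?u l = 0" if "l < Suc k" for l
  proof (rule mdet_nonzeroD[OF nd _ that, of ?u])
    fix i assume i: "i < Suc k"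
    have 1: "(Y + zmap k Y \<alpha>) (i, j) = (if j < k then Y (i, j) else dotp k \<alpha> (\<lambda>l. Y (i, l)) + \<alpha> k)" if "j < Suc k" for j
      using that i Y by (auto simp: zmap_def supp_on_def)
    have "(\<Sum>l<Suc k. ymat k Y i l * ?u l) = (\<Sum>l<k. Y (i, l) * v l) + (dotp k \<alpha> (\<lambda>l. Y (i, l)) + \<alpha> k) * v k"
      by (simp add: ymat_def dotp_def algebra_simps sum.distrib sum_distrib_left sum_distrib_right)
    also have "\<dots> = (\<Sum>j<Suc k. (Y + zmap k Y \<alpha>) (i, j) * v j)"
      by (simp add: 1 del: plus_fun_apply)
    finally show "(\<Sum>l<Suc k. ymat k Y i l * ?u l) = 0" using v[OF i] by simp
  qed
  have vk: "v k = 0" using u[of k] b by simp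
  show "v j = 0"
  proof (cases "j = k")
    case False
    then have "j < k" using j by simp
    then show ?thesis using u[of j] vk by simp
  qed (simp add: vk)
qed

lemma above_graph:
  assumes nd: "mdet (Suc k) (ymat k Y) \<noteq> 0" and b: "\<alpha> k \<noteq> 0"
    and Y: "Y \<in> supp_on (Iy k)"
  shows "above (Suc k) (\<lambda>i j. (Y + zmap k Y \<alpha>) (i, j)) y = (y k - dotp k \<alpha> y) / \<alpha> k - 1"
proof -
  let ?x = "\<lambda>i j. (Y + zmap k Y \<alpha>) (i, j)"
  \<comment> \<open>The equation z - a . y = b of the hyperplane divided by b, which brings its
    right-hand side to 1 as \<open>hvec\<close> requires.\<close>
  let ?v = "\<lambda>l. if l < k then - \<alpha> l / \<alpha> k else 1 / \<alpha> k"
  have v: "dotp (Suc k) ?v z = (z k - dotp k \<alpha> z) / \<alpha> k" for z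
    by (simp add: dotp_def diff_divide_distrib sum_divide_distrib sum_negf)
  have h: "hvec (Suc k) ?x l = ?v l" if "l < Suc k" for l
  proof (rule hvec_unique[OF mdet_graph[where \<alpha> = \<alpha>, OF assms] _ that])
    fix i assume i: "i < Suc k"
    have 1: "?x i j = (if j < k then Y (i, j) else dotp k \<alpha> (\<lambda>l. Y (i, l)) + \<alpha> k)" if "j < Suc k" for j
      using that i Y by (auto simp: zmap_def supp_on_def)
    have "dotp k \<alpha> (?x i) = dotp k \<alpha> (\<lambda>l. Y (i, l))"
      by (rule dotp_cong) (auto simp: 1 simp del: plus_fun_apply)
    moreover have "?x i k = dotp k \<alpha> (\<lambda>l. Y (i, l)) + \<alpha> k"
      by (simp add: 1 del: plus_fun_apply)
    ultimately show "dotp (Suc k) ?v (?x i) = 1"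
      unfolding v using b by simp
  qed
  have "dotp (Suc k) (hvec (Suc k) ?x) y = dotp (Suc k) ?v y"
    using h by (intro dotp_cong) auto
  then show ?thesis unfolding above_def v by simp
qed

text \<open>Given the hyperplane, the conditional probability is a function of its signed distance h
  alone, as \<open>blaschke_petkantschin\<close> requires; the same formula for the function 1
  supplies the denominator.\<close>

lemma beta_law_facet_set:
  fixes k m :: nat and \<beta> :: real
  assumes c: "0 < beta_const (Suc k) \<beta>" "beta_const (Suc k) \<beta> < \<infinity>" and m: "m > 0"
  shows "emeasure (law (Suc k + m) (beta_law (Suc k) \<beta>)) (facet_set (Suc k) (Suc k + m)) =
    (\<integral>\<^sup>+h. (cap (\<beta> + real k / 2) h ^ m + cocap (\<beta> + real k / 2) h ^ m) * phi (hexp k \<beta>) (h\<^sup>2) \<partial>lborel) /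
    (\<integral>\<^sup>+h. phi (hexp k \<beta>) (h\<^sup>2) \<partial>lborel)"
proof -
  let ?\<mu> = "beta_law (Suc k) \<beta>" and ?d = "Suc k"
  let ?b = "\<beta> + real k / 2"
  let ?q = "\<lambda>x. if mdet ?d x \<noteq> 0 then emeasure ?\<mu> {y. above ?d x y < 0} ^ m + emeasure ?\<mu> {y. above ?d x y > 0} ^ m else 0"
  let ?\<Psi> = "\<lambda>h. cap ?b h ^ m + cocap ?b h ^ m"
  let ?W = "\<integral>\<^sup>+h. phi (hexp k \<beta>) (h\<^sup>2) \<partial>lborel"
  have S [measurable]: "{z \<in> space (borel \<Otimes>\<^sub>M lborel). snd z < fst z} \<in> sets (borel \<Otimes>\<^sub>M (lborel :: real measure))"
    "{z \<in> space (borel \<Otimes>\<^sub>M lborel). snd z > fst z} \<in> sets (borel \<Otimes>\<^sub>M (lborel :: real measure))"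
    by measurable
  have [measurable]: "cap ?b \<in> borel_measurable borel"
  proof -
    have "(\<lambda>h. \<integral>\<^sup>+t. indicator {..<h} t * phi ?b (t\<^sup>2) \<partial>lborel) \<in> borel_measurable borel"
      unfolding indicator_def lessThan_iff by measurable
    then show ?thesis unfolding cap_def [abs_def] divide_ennreal_def by measurable
  qed
  have [measurable]: "cocap ?b \<in> borel_measurable borel"
  proof -
    have "(\<lambda>h. \<integral>\<^sup>+t. indicator {h<..} t * phi ?b (t\<^sup>2) \<partial>lborel) \<in> borel_measurable borel"
      unfolding indicator_def greaterThan_iff by measurable
    then show ?thesis unfolding cocap_def [abs_def] divide_ennreal_def by measurable
  qed
  have BP: "(\<integral>\<^sup>+x. G x \<partial>law ?d ?\<mu>) = bp_const k \<beta> * (\<integral>\<^sup>+h. \<Psi> h * phi (hexp k \<beta>) (h\<^sup>2) \<partial>lborel) / beta_const ?d \<beta> ^ ?d"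
    if [measurable]: "G \<in> borel_measurable borel" "\<Psi> \<in> borel_measurable borel"
      and hyp: "\<And>Y \<alpha>. Y \<in> supp_on (Iy k) \<Longrightarrow> mdet ?d (ymat k Y) \<noteq> 0 \<Longrightarrow> \<alpha> k \<noteq> 0 \<Longrightarrow>
        G (\<lambda>i j. (Y + zmap k Y \<alpha>) (i, j)) = \<Psi> (\<alpha> k / sqrt (1 + dotp k \<alpha> \<alpha>))" for G \<Psi>
  proof -
    have "(\<lambda>X i j. X (i, j) :: real) \<in> borel \<rightarrow>\<^sub>M (borel :: (nat \<Rightarrow> nat \<Rightarrow> real) measure)"
      by (rule fun2_measurableI) auto
    then have m: "(\<lambda>X. G (\<lambda>i j. X (i, j))) \<in> borel_measurable borel"
      by (rule measurable_compose) fact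
    show ?thesis
      unfolding law_beta_law[OF c that(1)]
      by (subst blaschke_petkantschin[OF m that(2)]) (rule hyp, assumption+, rule refl)
  qed
  have one: "bp_const k \<beta> * ?W / beta_const ?d \<beta> ^ ?d = 1"
  proof -
    interpret prob_space ?\<mu> by (rule prob_space_beta_law[OF c])
    interpret P: prob_space "law ?d ?\<mu>"
      unfolding law_def
      by (intro prob_space.prob_space_distr prob_space_PiM prob_space_axioms truncate_rows_measurable) simp
    have "(\<integral>\<^sup>+x. 1 \<partial>law ?d ?\<mu>) = 1"
      using P.emeasure_space_1 by simp
    then show ?thesis using BP[of "\<lambda>_. 1" "\<lambda>_. 1"] by simp
  qed
  define r where "r = bp_const k \<beta> / beta_const ?d \<beta> ^ ?d"
  have one': "r * ?W = 1"
    using one by (simp only: r_def divide_ennreal_def ac_simps indicator_UNIV mult_1_left)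
  have W: "?W \<noteq> 0" using one' by auto
  have r0: "r \<noteq> 0" using one' by auto
  have W2: "?W \<noteq> \<infinity>"
  proof
    assume "?W = \<infinity>"
    then show False using one' r0 by (simp add: ennreal_mult_top)
  qed
  have rW: "r = inverse ?W"
  proof -
    have "r = r * (?W * inverse ?W)"
      using W W2 by (simp add: divide_ennreal_def[symmetric] ennreal_divide_self less_top)
    then show ?thesis by (simp only: mult.assoc[symmetric] one' mult_1_left)
  qed
  have "emeasure (law (?d + m) ?\<mu>) (facet_set ?d (?d + m)) = (\<integral>\<^sup>+x. ?q x \<partial>law ?d ?\<mu>)"
    by (rule law_facet_set[OF prob_space_beta_law[OF c] sets_beta_law m])
  also have "\<dots> = bp_const k \<beta> * (\<integral>\<^sup>+h. ?\<Psi> h * phi (hexp k \<beta>) (h\<^sup>2) \<partial>lborel) / beta_const ?d \<beta> ^ ?d"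
  proof (rule BP)
    show "?\<Psi> \<in> borel_measurable borel" by measurable
    show "?q \<in> borel_measurable borel"
      by (rule law_facet_set_measurable[OF prob_space_beta_law[OF c] sets_beta_law])
    fix Y \<alpha> assume Y: "Y \<in> supp_on (Iy k)" and nd: "mdet ?d (ymat k Y) \<noteq> 0" and b: "\<alpha> k \<noteq> (0::real)"
    let ?x = "\<lambda>i j. (Y + zmap k Y \<alpha>) (i, j)"
    define c' where "c' = sqrt (1 + dotp k \<alpha> \<alpha>)"
    define h where "h = \<alpha> k / c'"
    have "1 + dotp k \<alpha> \<alpha> > 0" using dotp_nonneg[of k \<alpha>] by linarith
    then have c': "c' > 0" by (simp add: c'_def)
    have ab: "above ?d ?x y = ((y k - dotp k \<alpha> y) / c' - h) / h" for y
      unfolding above_graph[where \<alpha> = \<alpha>, OF nd b Y] h_def using c' b by (simp add: field_simps)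
    note H = beta_law_halfspace[OF c, where a = \<alpha>, folded c'_def]
    have L: "emeasure ?\<mu> {y. (y k - dotp k \<alpha> y) / c' < h} = cap ?b h"
      using H[of "{..<h}"] by (simp add: cap_def)
    have U: "emeasure ?\<mu> {y. h < (y k - dotp k \<alpha> y) / c'} = cocap ?b h"
      using H[of "{h<..}"] by (simp add: cocap_def)
    have "emeasure ?\<mu> {y. above ?d ?x y < 0} ^ m + emeasure ?\<mu> {y. above ?d ?x y > 0} ^ m = ?\<Psi> h"
    \<comment> \<open>\<open>above\<close> is oriented away from the origin, so for negative h the
      two sides trade places; the sum is symmetric in them.\<close>
    proof (cases "h > 0")
      case True
      then have "{y. above ?d ?x y < 0} = {y. (y k - dotp k \<alpha> y) / c' < h}"
        "{y. above ?d ?x y > 0} = {y. h < (y k - dotp k \<alpha> y) / c'}"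
        unfolding ab by (auto simp: divide_less_0_iff zero_less_divide_iff)
      then show ?thesis by (simp only: L U)
    next
      case False
      then have "\<alpha> k < 0" using b c' by (auto simp: h_def zero_less_divide_iff)
      then have "h < 0" using c' by (simp add: h_def divide_neg_pos)
      then have "{y. above ?d ?x y < 0} = {y. h < (y k - dotp k \<alpha> y) / c'}"
        "{y. above ?d ?x y > 0} = {y. (y k - dotp k \<alpha> y) / c' < h}"
        unfolding ab by (auto simp: divide_less_0_iff zero_less_divide_iff)
      then show ?thesis by (simp only: L U add.commute)
    qed
    then show "?q ?x = ?\<Psi> (\<alpha> k / sqrt (1 + dotp k \<alpha> \<alpha>))"
      using mdet_graph[where \<alpha> = \<alpha>, OF nd b Y] by (simp only: h_def c'_def if_True simp_thms not_False_eq_True)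
  qed
  also have "\<dots> = r * (\<integral>\<^sup>+h. ?\<Psi> h * phi (hexp k \<beta>) (h\<^sup>2) \<partial>lborel)"
    by (simp only: r_def divide_ennreal_def ac_simps)
  also have "\<dots> = (\<integral>\<^sup>+h. ?\<Psi> h * phi (hexp k \<beta>) (h\<^sup>2) \<partial>lborel) / ?W"
    by (simp only: rW divide_ennreal_def mult.commute)
  finally show ?thesis .
qed

subsection \<open>Normalising constants of beta densities\<close>

definition weight_integral :: "real \<Rightarrow> ennreal"
  where "weight_integral \<beta> = (\<integral>\<^sup>+h. phi \<beta> (h\<^sup>2) \<partial>lborel)"

lemma nn_integral_one_minus_powr:
  assumes "\<beta> > -1"
  shows "(\<integral>\<^sup>+h. indicator {0..1} h * ennreal ((1 - h) powr \<beta>) \<partial>lborel) = ennreal (1 / (\<beta> + 1))"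
proof -
  have "((\<lambda>h. (1 - h) powr \<beta>) has_integral (- ((1 - 1) powr (\<beta> + 1) / (\<beta> + 1)) - (- ((1 - 0) powr (\<beta> + 1) / (\<beta> + 1))))) {0..1}"
  proof (rule fundamental_theorem_of_calculus_interior)
    show "continuous_on {0..1} (\<lambda>h. - ((1 - h) powr (\<beta> + 1) / (\<beta> + 1)))"
      using assms by (intro continuous_intros continuous_on_powr') auto
    fix x :: real assume "x \<in> {0<..<1}"
    then show "((\<lambda>h. - ((1 - h) powr (\<beta> + 1) / (\<beta> + 1))) has_vector_derivative (1 - x) powr \<beta>) (at x)"
    proof -
      assume x: "x \<in> {0<..<1}"
      have "((\<lambda>h. (1 - h) powr (\<beta> + 1)) has_real_derivative (\<beta> + 1) * (1 - x) powr (\<beta> + 1 - 1) * (- 1)) (at x)"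
        by (rule DERIV_chain2[OF has_real_derivative_powr]) (use x in \<open>auto intro!: derivative_eq_intros\<close>)
      then have "((\<lambda>h. - ((1 - h) powr (\<beta> + 1) / (\<beta> + 1))) has_real_derivative (1 - x) powr \<beta>) (at x)"
        using assms DERIV_minus[OF DERIV_cdivide, of "\<lambda>h. (1 - h) powr (\<beta> + 1)" _ x UNIV "\<beta> + 1"] by fastforce
      then show ?thesis
        unfolding has_real_derivative_iff_has_vector_derivative .
    qed
  qed auto
  then have "((\<lambda>h. (1 - h) powr \<beta>) has_integral 1 / (\<beta> + 1)) {0..1}"
    using assms by simp
  then have "((\<lambda>h. if h \<in> {0..1} then (1 - h) powr \<beta> else 0) has_integral 1 / (\<beta> + 1)) UNIV"
    by (simp only: has_integral_restrict_UNIV)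
  then have "(\<integral>\<^sup>+h. ennreal (if h \<in> {0..1} then (1 - h) powr \<beta> else 0) \<partial>lborel) = ennreal (1 / (\<beta> + 1))"
    by (intro nn_integral_has_integral_lborel) auto
  moreover have "ennreal (if h \<in> {0..1} then (1 - h) powr \<beta> else 0) = indicator {0..1} h * ennreal ((1 - h) powr \<beta>)" for h
    by (simp add: indicator_def)
  ultimately show ?thesis by simp
qed

lemma weight_integral_antimono:
  assumes "\<beta> \<le> \<beta>'"
  shows "weight_integral \<beta>' \<le> weight_integral \<beta>"
  unfolding weight_integral_def
proof (rule nn_integral_mono)
  fix h :: real
  have "0 \<le> h\<^sup>2" by simp
  then show "phi \<beta>' (h\<^sup>2) \<le> phi \<beta> (h\<^sup>2)"
    using assms by (auto simp: phi_def intro!: powr_mono')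
qed

text \<open>For negative \<beta> the factor (1 + |h|)^\<beta> is at most 1, which leaves the
  elementary integral of (1 - |h|)^\<beta> on both halves. Nonnegative exponents give smaller
  weights than -1/2 does.\<close>

lemma weight_integral_finite:
  assumes "\<beta> > -1"
  shows "weight_integral \<beta> < \<infinity>"
proof -
  have neg: "weight_integral \<beta> < \<infinity>" if "\<beta> > -1" "\<beta> < 0" for \<beta>
  proof -
    let ?f = "\<lambda>h. indicator {0..1} h * ennreal ((1 - h) powr \<beta>)"
    have "weight_integral \<beta> \<le> (\<integral>\<^sup>+h. ?f h + ?f (- h) \<partial>lborel)"
      unfolding weight_integral_def
    proof (rule nn_integral_mono)
      fix h :: real
      show "phi \<beta> (h\<^sup>2) \<le> ?f h + ?f (- h)"
      proof (cases "h\<^sup>2 < 1")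
        case True
        then have h: "\<bar>h\<bar> < 1" by (simp add: abs_square_less_1)
        have "1 - h\<^sup>2 = (1 - \<bar>h\<bar>) * (1 + \<bar>h\<bar>)"
          by (simp add: algebra_simps power2_eq_square)
        also have "\<dots> \<ge> (1 - \<bar>h\<bar>) * 1"
          using h by (intro mult_left_mono) auto
        finally have "(1 - h\<^sup>2) powr \<beta> \<le> (1 - \<bar>h\<bar>) powr \<beta>"
          using h that by (intro powr_mono2') auto
        then have "phi \<beta> (h\<^sup>2) \<le> ennreal ((1 - \<bar>h\<bar>) powr \<beta>)"
          using True by (simp add: phi_def ennreal_leI)
        also have "\<dots> \<le> ?f h + ?f (- h)"
          using h by (cases "h \<ge> 0") (auto simp: indicator_def)
        finally show ?thesis .
      qed (simp add: phi_def)
    qed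
    also have "\<dots> = (\<integral>\<^sup>+h. ?f h \<partial>lborel) + (\<integral>\<^sup>+h. ?f (- h) \<partial>lborel)"
    proof -
      have f: "?f \<in> borel_measurable borel" by measurable
      from measurable_compose[OF borel_measurable_uminus[OF measurable_ident_sets[OF refl]] f] f
      show ?thesis by (intro nn_integral_add) simp_all
    qed
    also have "(\<integral>\<^sup>+h. ?f (- h) \<partial>lborel) = (\<integral>\<^sup>+h. ?f h \<partial>lborel)"
      using nn_integral_real_affine[of ?f "-1" 0] by simp
    also have "(\<integral>\<^sup>+h. ?f h \<partial>lborel) = ennreal (1 / (\<beta> + 1))"
      by (rule nn_integral_one_minus_powr[OF that(1)])
    also have "ennreal (1 / (\<beta> + 1)) + ennreal (1 / (\<beta> + 1)) < \<infinity>"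
      by simp
    finally show ?thesis .
  qed
  show ?thesis
  proof (cases "\<beta> < 0")
    case True
    then show ?thesis using neg assms by blast
  next
    case False
    then have "weight_integral \<beta> \<le> weight_integral (-1/2)" by (intro weight_integral_antimono) simp
    also have "\<dots> < \<infinity>" by (rule neg) auto
    finally show ?thesis .
  qed
qed

lemma weight_integral_pos: "weight_integral \<beta> > 0"
proof -
  have "0 < ennreal (min 1 ((3/4) powr \<beta>)) * ennreal (1/2)"
    by (auto simp: ennreal_zero_less_mult_iff simp del: ennreal_half)
  also have "\<dots> = (\<integral>\<^sup>+h. ennreal (min 1 ((3/4) powr \<beta>)) * indicator {0..1/2::real} h \<partial>lborel)"
    by (subst nn_integral_cmult) auto
  also have "\<dots> \<le> weight_integral \<beta>"
    unfolding weight_integral_def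
  proof (rule nn_integral_mono)
    fix h :: real
    show "ennreal (min 1 ((3/4) powr \<beta>)) * indicator {0..1/2::real} h \<le> phi \<beta> (h\<^sup>2)"
    proof (cases "h \<in> {0..1/2}")
      case True
      then have "h\<^sup>2 \<le> (1/2)\<^sup>2" by (intro power_mono) auto
      then have h: "h\<^sup>2 \<le> 1/4" by (simp add: power2_eq_square)
      have "min 1 ((3/4) powr \<beta>) \<le> (1 - h\<^sup>2) powr \<beta>"
      proof (cases "\<beta> \<ge> 0")
        case True
        then have "(3/4) powr \<beta> \<le> (1 - h\<^sup>2) powr \<beta>" using h by (intro powr_mono2) auto
        then show ?thesis by simp
      next
        case False
        then have "1 powr \<beta> \<le> (1 - h\<^sup>2) powr \<beta>" using h by (intro powr_mono2') auto
        then show ?thesis by simp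
      qed
      then show ?thesis using h True by (simp add: phi_def ennreal_leI)
    qed simp
  qed
  finally show ?thesis .
qed

text \<open>1 - h^2 is at most 2 (1 - h), as the difference is (1 - h)^2, and 2^\<beta> is at least
  1/2. This blow-up at \<beta> = -1 is what drives the mass of the beta law to the sphere.\<close>

lemma weight_integral_lower:
  assumes "\<beta> > -1" "\<beta> < 0"
  shows "ennreal (1 / (2 * (\<beta> + 1))) \<le> weight_integral \<beta>"
proof -
  have "ennreal (1 / (2 * (\<beta> + 1))) = ennreal (1/2) * (\<integral>\<^sup>+h. indicator {0..1} h * ennreal ((1 - h) powr \<beta>) \<partial>lborel)"
  proof -
    have "1 / (2 * (\<beta> + 1)) = 1 / 2 * (1 / (\<beta> + 1))" by simp
    then show ?thesis
      unfolding nn_integral_one_minus_powr[OF assms(1)] by (simp only: ennreal_mult'[of "1/2"])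
  qed
  also have "\<dots> = (\<integral>\<^sup>+h. ennreal (1/2) * (indicator {0..1} h * ennreal ((1 - h) powr \<beta>)) \<partial>lborel)"
    by (simp add: nn_integral_cmult)
  also have "\<dots> \<le> weight_integral \<beta>"
    unfolding weight_integral_def
  proof (rule nn_integral_mono)
    fix h :: real
    show "ennreal (1/2) * (indicator {0..1} h * ennreal ((1 - h) powr \<beta>)) \<le> phi \<beta> (h\<^sup>2)"
    proof (cases "0 \<le> h \<and> h < 1")
      case True
      then have h: "h\<^sup>2 < 1" by (simp add: abs_square_less_1)
      have "1/2 * (1 - h) powr \<beta> \<le> 2 powr \<beta> * (1 - h) powr \<beta>"
        using assms powr_mono[of "-1" \<beta> 2] by (intro mult_right_mono) (auto simp: powr_minus)
      also have "\<dots> = (2 * (1 - h)) powr \<beta>"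
        using True powr_mult[of 2 "1 - h" \<beta>] by simp
      also have "\<dots> \<le> (1 - h\<^sup>2) powr \<beta>"
      proof (rule powr_mono2')
        show "1 - h\<^sup>2 \<le> 2 * (1 - h)"
          using zero_le_power2[of "1 - h"] by (simp add: power2_eq_square algebra_simps)
      qed (use assms h in auto)
      finally have "ennreal (1/2 * (1 - h) powr \<beta>) \<le> phi \<beta> (h\<^sup>2)"
        using h unfolding phi_def by (simp only: if_True ennreal_leI)
      moreover have "ennreal (1/2) * (indicator {0..1} h * ennreal ((1 - h) powr \<beta>)) = ennreal (1/2 * (1 - h) powr \<beta>)"
        using True by (subst ennreal_mult') simp_all
      ultimately show ?thesis by (simp only:)
    next
      case False
      then show ?thesis by (cases "h = 1") (auto simp: indicator_def)
    qed
  qed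
  finally show ?thesis .
qed

text \<open>Slice the ball orthogonally to the last coordinate: by \<open>slice_eq\<close> each
  slice is a multiple of the constant in dimension k.\<close>

lemma beta_const_Suc: "beta_const (Suc k) \<beta> = beta_const k \<beta> * weight_integral (\<beta> + real k / 2)"
proof -
  interpret K: sigma_finite_measure "LB {..<k}" by (rule sigma_finite_LB) simp
  interpret KL: pair_sigma_finite "LB {..<k}" "lborel :: real measure" ..
  let ?e = "\<lambda>z j. if j = k then z else 0 :: real"
  have "beta_const (Suc k) \<beta> = (\<integral>\<^sup>+y. \<integral>\<^sup>+v. phi \<beta> (sqn (Suc k) (y + v)) \<partial>LB {k} \<partial>LB {..<k})"
    unfolding beta_const_def by (rule nn_integral_LB_Suc) (rule phi_sqn_measurable)
  also have "\<dots> = (\<integral>\<^sup>+y. \<integral>\<^sup>+z. phi \<beta> (sqn k y + z\<^sup>2) \<partial>lborel \<partial>LB {..<k})"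
  proof (rule nn_integral_LB_cong)
    fix y :: "nat \<Rightarrow> real" assume y: "y \<in> supp_on {..<k}"
    have "(\<lambda>v. y + v) \<in> borel \<rightarrow>\<^sub>M borel" by measurable
    then have "(\<integral>\<^sup>+v. phi \<beta> (sqn (Suc k) (y + v)) \<partial>LB {k}) = (\<integral>\<^sup>+z. phi \<beta> (sqn (Suc k) (y + ?e z)) \<partial>lborel)"
      by (intro nn_integral_LB_singleton) (rule measurable_compose[OF _ phi_sqn_measurable])
    also have "\<dots> = (\<integral>\<^sup>+z. phi \<beta> (sqn k y + z\<^sup>2) \<partial>lborel)"
    proof (rule nn_integral_cong)
      fix z
      have "sqn (Suc k) (y + ?e z) = sqn k y + z\<^sup>2"
        using y by (simp add: sqn_def dotp_def supp_on_def power2_eq_square)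
      then show "phi \<beta> (sqn (Suc k) (y + ?e z)) = phi \<beta> (sqn k y + z\<^sup>2)" by simp
    qed
    finally show "(\<integral>\<^sup>+v. phi \<beta> (sqn (Suc k) (y + v)) \<partial>LB {k}) = (\<integral>\<^sup>+z. phi \<beta> (sqn k y + z\<^sup>2) \<partial>lborel)" .
  qed
  also have "\<dots> = (\<integral>\<^sup>+z. slice k \<beta> z \<partial>lborel)"
    unfolding slice_def by (rule KL.Fubini'[symmetric]) measurable
  also have "\<dots> = (\<integral>\<^sup>+z. beta_const k \<beta> * phi (\<beta> + real k / 2) (z\<^sup>2) \<partial>lborel)"
  proof (rule nn_integral_cong)
    fix z
    have "slice k \<beta> 0 = beta_const k \<beta>" by (simp add: slice_def beta_const_def)
    then show "slice k \<beta> z = beta_const k \<beta> * phi (\<beta> + real k / 2) (z\<^sup>2)"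
      by (subst slice_eq) (simp add: mult.commute)
  qed
  finally show ?thesis
    unfolding weight_integral_def by (simp add: nn_integral_cmult)
qed

lemma beta_const_0: "beta_const 0 \<beta> = 1"
proof -
  have "beta_const 0 \<beta> = (\<integral>\<^sup>+x. 1 \<partial>LB ({} :: nat set))"
    by (simp add: beta_const_def sqn_def dotp_def phi_def)
  also have "\<dots> = (\<integral>\<^sup>+X. 1 \<partial>(\<Pi>\<^sub>M i\<in>({} :: nat set). (lborel :: real measure)))"
    by (rule nn_integral_LB) simp
  also have "\<dots> = 1"
    by (rule lborel_product.nn_integral_empty) simp
  finally show ?thesis .
qed

lemma beta_const_prod: "beta_const d \<beta> = (\<Prod>j<d. weight_integral (\<beta> + real j / 2))"
  by (induction d) (auto simp: beta_const_0 beta_const_Suc)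

lemma beta_const_pos: "beta_const d \<beta> > 0"
proof (induction d)
  case (Suc d)
  then show ?case using weight_integral_pos by (simp add: beta_const_Suc ennreal_zero_less_mult_iff)
qed (simp add: beta_const_0)

lemma beta_const_finite:
  assumes "\<beta> > -1"
  shows "beta_const d \<beta> < \<infinity>"
proof (induction d)
  case (Suc d)
  have "weight_integral (\<beta> + real d / 2) < \<infinity>" using assms by (intro weight_integral_finite) (simp add: field_simps)
  then show ?case using Suc by (simp add: beta_const_Suc ennreal_mult_less_top)
qed (simp add: beta_const_0)

text \<open>Only the factor j = 0 of the product blows up as \<beta> tends to -1. The others are
  bounded below by their values at \<beta> = 0, since smaller exponents give larger weights.\<close>

lemma beta_const_lower:
  assumes "\<beta> > -1" "\<beta> < 0"
  shows "ennreal (1 / (2 * (\<beta> + 1))) * (\<Prod>j<k. weight_integral (real (Suc j) / 2)) \<le> beta_const (Suc k) \<beta>"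
proof -
  have "(\<Prod>j<k. weight_integral (real (Suc j) / 2)) \<le> (\<Prod>j<k. weight_integral (\<beta> + real (Suc j) / 2))"
    using assms by (intro prod_mono_ennreal weight_integral_antimono) linarith
  then show ?thesis
    unfolding beta_const_prod prod.lessThan_Suc_shift
    using weight_integral_lower[OF assms] by (intro mult_mono) auto
qed

section \<open>Polar decomposition of the beta laws\<close>

lemma enorm_eq_sqn: "enorm d x = sqrt (sqn d x)"
  by (simp add: enorm_def sqn_def dotp_def power2_eq_square)

lemma enorm_sq: "(enorm d x)\<^sup>2 = sqn d x"
  by (simp add: enorm_eq_sqn)

lemma enorm_nonneg [simp]: "0 \<le> enorm d x"
  by (simp add: enorm_eq_sqn)

lemma enorm_scaleR: "enorm d (t *\<^sub>R x) = \<bar>t\<bar> * enorm d x"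
proof -
  have "sqn d (t *\<^sub>R x) = t\<^sup>2 * sqn d x"
    unfolding sqn_def scaleR_fun_def by (simp add: dotp_linear power2_eq_square)
  then show ?thesis by (simp add: enorm_eq_sqn real_sqrt_mult)
qed

lemma unit_ball_eq: "unit_ball d = {x \<in> supp_on {..<d}. enorm d x \<le> 1}"
  by (auto simp: unit_ball_def topspace_Euclidean_space supp_on_def)

lemma enorm_eq_0: "x \<in> supp_on {..<d} \<Longrightarrow> enorm d x = 0 \<Longrightarrow> x = 0"
  by (auto simp: enorm_def sum_nonneg_eq_0_iff supp_on_def fun_eq_iff)

text \<open>The value at the origin is 0, because the inverse of 0 is 0, so \<open>enorm_dir\<close>
  holds there too.\<close>

definition dir :: "nat \<Rightarrow> (nat \<Rightarrow> real) \<Rightarrow> nat \<Rightarrow> real"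
  where "dir d x = x /\<^sub>R enorm d x"

lemma dir_measurable [measurable]: "dir d \<in> borel \<rightarrow>\<^sub>M borel"
  using radial_measurable[of d] by (simp add: dir_def [abs_def])

lemma enorm_dir: "x \<in> supp_on {..<d} \<Longrightarrow> enorm d x *\<^sub>R dir d x = x"
  using enorm_eq_0[of x d] by (cases "enorm d x = 0") (auto simp: dir_def)

lemma dir_scaleR: "t > 0 \<Longrightarrow> dir d (t *\<^sub>R x) = dir d x"
  by (simp add: dir_def enorm_scaleR)

lemma ball_sector_borel [measurable]:
  assumes [measurable]: "B \<in> sets borel"
  shows "{x \<in> unit_ball d. enorm d x \<le> t \<and> dir d x \<in> B} \<in> sets borel"
    "{x \<in> unit_ball d. dir d x \<in> B} \<in> sets borel"
proof -
  have "unit_ball d \<inter> {x \<in> space borel. enorm d x \<le> t \<and> dir d x \<in> B} \<in> sets borel"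
    "unit_ball d \<inter> {x \<in> space borel. dir d x \<in> B} \<in> sets borel"
    by measurable
  moreover have "unit_ball d \<inter> {x \<in> space borel. enorm d x \<le> t \<and> dir d x \<in> B} = {x \<in> unit_ball d. enorm d x \<le> t \<and> dir d x \<in> B}"
    "unit_ball d \<inter> {x \<in> space borel. dir d x \<in> B} = {x \<in> unit_ball d. dir d x \<in> B}"
    by auto
  ultimately show "{x \<in> unit_ball d. enorm d x \<le> t \<and> dir d x \<in> B} \<in> sets borel"
    "{x \<in> unit_ball d. dir d x \<in> B} \<in> sets borel"
    by simp_all
qed

text \<open>Dilation by t maps the sector over B onto its part of radius at most t, since directions
  are unaffected.\<close>

lemma polar_scaling:
  assumes t: "0 < t" "t \<le> 1" and B [measurable]: "B \<in> sets borel"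
  shows "emeasure (LB {..<d}) {x \<in> unit_ball d. enorm d x \<le> t \<and> dir d x \<in> B} =
    ennreal (t ^ d) * emeasure (LB {..<d}) {x \<in> unit_ball d. dir d x \<in> B}"
proof -
  let ?S = "{x \<in> unit_ball d. enorm d x \<le> t \<and> dir d x \<in> B}"
  have S: "?S \<in> sets borel" by (rule ball_sector_borel[OF B])
  have "(\<integral>\<^sup>+x. indicator ?S (t *\<^sub>R x) \<partial>LB {..<d}) = ennreal ((1 / t) ^ card {..<d}) * (\<integral>\<^sup>+x. indicator ?S x \<partial>LB {..<d})"
    by (rule LB_scale) (use t S in auto)
  also have "(\<integral>\<^sup>+x. indicator ?S (t *\<^sub>R x) \<partial>LB {..<d}) = (\<integral>\<^sup>+x. indicator {x \<in> unit_ball d. dir d x \<in> B} x \<partial>LB {..<d})"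
  proof (rule nn_integral_LB_cong)
    fix x :: "nat \<Rightarrow> real" assume x: "x \<in> supp_on {..<d}"
    have "t *\<^sub>R x \<in> ?S \<longleftrightarrow> x \<in> {x \<in> unit_ball d. dir d x \<in> B}"
      using t x mult_left_le[of "enorm d x" t] mult_le_one[of t "enorm d x"] by (auto simp: unit_ball_eq enorm_scaleR dir_scaleR)
    then show "indicator ?S (t *\<^sub>R x) = (indicator {x \<in> unit_ball d. dir d x \<in> B} x :: ennreal)"
      by (simp add: indicator_def)
  qed
  also have "\<dots> = emeasure (LB {..<d}) {x \<in> unit_ball d. dir d x \<in> B}"
    using ball_sector_borel(2)[OF B] by simp
  finally have "ennreal (t ^ d) * emeasure (LB {..<d}) {x \<in> unit_ball d. dir d x \<in> B} =
      (ennreal (t ^ d) * ennreal ((1 / t) ^ d)) * emeasure (LB {..<d}) ?S"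
    using S by (simp add: mult.assoc)
  also have "ennreal (t ^ d) * ennreal ((1 / t) ^ d) = 1"
    using t by (simp add: ennreal_mult'[symmetric] power_one_over)
  finally show ?thesis by simp
qed

abbreviation uball :: "nat \<Rightarrow> (nat \<Rightarrow> real) measure"
  where "uball d \<equiv> uniform_measure (LB {..<d}) (unit_ball d)"

lemma prob_space_uball: "prob_space (uball d)"
  using prob_space_uniform_ball by (simp add: lborel_space_eq_LB)

lemma uniform_sphere_eq: "uniform_sphere d = distr (uball d) borel (dir d)"
  by (simp add: uniform_sphere_def lborel_space_eq_LB dir_def [abs_def])

text \<open>For fixed B, the radius restricted to the sector over B and the radius weighted by the
  probability of B define two finite measures on the line; by \<open>polar_scaling\<close> their
  distribution functions agree.\<close>

lemma polar_independent:
  assumes d: "d > 0"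
  shows "distr (uball d) (borel \<Otimes>\<^sub>M borel) (\<lambda>x. (enorm d x, dir d x)) =
    distr (uball d) borel (enorm d) \<Otimes>\<^sub>M uniform_sphere d"
proof -
  interpret U: prob_space "uball d" by (rule prob_space_uball)
  interpret S: prob_space "uniform_sphere d" by (rule prob_space_uniform_sphere)
  have m1 [measurable]: "enorm d \<in> uball d \<rightarrow>\<^sub>M borel" and m2 [measurable]: "dir d \<in> uball d \<rightarrow>\<^sub>M borel"
    by (simp_all add: measurable_cong_sets[OF sets_uniform_measure refl] measurable_LB_I)
  interpret R: prob_space "distr (uball d) borel (enorm d)" by (rule U.prob_space_distr) fact
  have m3 [measurable]: "(\<lambda>x. (enorm d x, dir d x)) \<in> uball d \<rightarrow>\<^sub>M borel \<Otimes>\<^sub>M borel" by measurable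
  let ?V = "emeasure (LB {..<d}) (unit_ball d)"
  have V: "?V \<noteq> 0" "?V \<noteq> \<infinity>"
    using emeasure_unit_ball_pos[of d] emeasure_unit_ball_finite[of d] by (auto simp: lborel_space_eq_LB)
  have sphere: "emeasure (uniform_sphere d) B = emeasure (LB {..<d}) {x \<in> unit_ball d. dir d x \<in> B} / ?V"
    if "B \<in> sets borel" for B
    using emeasure_uniform_sphere[OF that, of d] by (simp add: lborel_space_eq_LB dir_def)
  \<comment> \<open>Covers t = 0, where the sector shrinks to the origin, a null set in positive
    dimension.\<close>
  have null: "emeasure (LB {..<d}) {x \<in> unit_ball d. enorm d x \<le> t \<and> dir d x \<in> B} = 0" if "t \<le> 0" for t B
  proof -
    have "{x \<in> supp_on {..<d}. \<forall>i\<in>{..<d}. x i \<in> {0}} = {\<lambda>_. 0}"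
      by (auto simp: supp_on_def fun_eq_iff)
    then have z: "emeasure (LB {..<d}) {\<lambda>_. 0} = 0"
      using emeasure_LB_box[of "{..<d}" "\<lambda>_. {0}"] d by simp
    have sub: "{x \<in> unit_ball d. enorm d x \<le> t \<and> dir d x \<in> B} \<subseteq> {\<lambda>_. 0}"
    proof
      fix x assume "x \<in> {x \<in> unit_ball d. enorm d x \<le> t \<and> dir d x \<in> B}"
      then have "x \<in> supp_on {..<d}" "enorm d x \<le> 0"
        using that unfolding unit_ball_eq by auto
      then have "x \<in> supp_on {..<d}" "enorm d x = 0"
        using enorm_nonneg[of d x] by simp_all
      then have "x = 0" by (rule enorm_eq_0)
      then show "x \<in> {\<lambda>_. 0}" by (simp add: fun_eq_iff)
    qed
    show ?thesis
      using emeasure_mono[OF sub, of "LB {..<d}"] z by simp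
  qed
  have key: "emeasure (uball d) {x. enorm d x \<in> A \<and> dir d x \<in> B} =
      emeasure (distr (uball d) borel (enorm d)) A * emeasure (uniform_sphere d) B"
    if A: "A \<in> sets borel" and B [measurable]: "B \<in> sets borel" for A B
  proof -
    let ?N1 = "distr (density (uball d) (indicator {x. dir d x \<in> B})) borel (enorm d)"
    let ?N2 = "scale_measure (emeasure (uniform_sphere d) B) (distr (uball d) borel (enorm d))"
    have D [measurable]: "{x. dir d x \<in> B} \<in> sets borel"
      using measurable_sets[OF dir_measurable B, of d] by (simp add: vimage_def)
    have E: "{x. enorm d x \<in> C} \<in> sets borel" if "C \<in> sets borel" for C
      using measurable_sets[OF enorm_measurable that, of d] by (simp add: vimage_def)
    have N1: "emeasure ?N1 C = emeasure (uball d) {x. enorm d x \<in> C \<and> dir d x \<in> B}" if C: "C \<in> sets borel" for C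
    proof -
      have "emeasure ?N1 C = emeasure (density (uball d) (indicator {x. dir d x \<in> B})) {x. enorm d x \<in> C}"
        using C by (subst emeasure_distr) (auto simp: vimage_def)
      also have "\<dots> = emeasure (uball d) ({x. dir d x \<in> B} \<inter> {x. enorm d x \<in> C})"
        using E[OF C] D by (subst emeasure_density) (auto simp: indicator_inter_arith[symmetric] nn_integral_indicator)
      finally show ?thesis by (simp add: Collect_conj_eq Int_commute)
    qed
    have N2: "emeasure ?N2 C = emeasure (uniform_sphere d) B * emeasure (uball d) {x. enorm d x \<in> C}" if "C \<in> sets borel" for C
      using that by (simp add: emeasure_distr vimage_def)
    have le: "emeasure (uball d) {x. enorm d x \<le> t \<and> dir d x \<in> B'} =
        emeasure (LB {..<d}) {x \<in> unit_ball d. enorm d x \<le> t \<and> dir d x \<in> B'} / ?V" if "B' \<in> sets borel" for t B'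
    proof -
      have "{x \<in> space borel. enorm d x \<le> t \<and> dir d x \<in> B'} \<in> sets borel"
        using that by measurable
      then show ?thesis by (simp add: Int_def)
    qed
    have "?N1 = ?N2"
    proof (rule cdf_unique')
      have u: "UNIV \<in> sets (borel :: real measure)" and uB: "UNIV \<in> sets (borel :: (nat \<Rightarrow> real) measure)"
        by simp_all
      have sp: "space ?N1 = UNIV" "space ?N2 = UNIV" by (simp_all add: space_scale_measure)
      have f1: "emeasure ?N1 (space ?N1) \<noteq> \<infinity>"
        unfolding sp N1[OF u] infinity_ennreal_def by (rule U.emeasure_finite)
      have "emeasure (uniform_sphere d) B < \<infinity>" "emeasure (uball d) {x. enorm d x \<in> UNIV} < \<infinity>"
        unfolding infinity_ennreal_def less_top[symmetric] by (rule S.emeasure_finite, rule U.emeasure_finite)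
      then have f2: "emeasure ?N2 (space ?N2) \<noteq> \<infinity>"
        unfolding sp N2[OF u] infinity_ennreal_def less_top by (simp only: ennreal_mult_less_top simp_thms)
      show "finite_borel_measure ?N1"
        using finite_measureI[OF f1] by (simp add: finite_borel_measure_def finite_borel_measure_axioms_def)
      show "finite_borel_measure ?N2"
        using finite_measureI[OF f2] by (simp add: finite_borel_measure_def finite_borel_measure_axioms_def)
      have "emeasure ?N1 {..t} = emeasure ?N2 {..t}" for t
      proof -
        have N2': "emeasure ?N2 {..t} = emeasure (uniform_sphere d) B *
            (emeasure (LB {..<d}) {x \<in> unit_ball d. enorm d x \<le> t \<and> dir d x \<in> UNIV} / ?V)"
          using N2[OF atMost_borel[of t]] le[OF uB, of t] by (simp only: atMost_iff UNIV_I simp_thms)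
        have N1': "emeasure ?N1 {..t} = emeasure (LB {..<d}) {x \<in> unit_ball d. enorm d x \<le> t \<and> dir d x \<in> B} / ?V"
          using N1[OF atMost_borel[of t]] le[OF B, of t] by (simp only: atMost_iff)
        consider "t \<le> 0" | "0 < t" "t \<le> 1" | "t > 1" by linarith
        then show ?thesis
        proof cases
          case 1
          show ?thesis unfolding N1' N2' null[OF 1] by simp
        next
          case 2
          have "emeasure (LB {..<d}) {x \<in> unit_ball d. dir d x \<in> UNIV} = ?V" by simp
          moreover have "?V * inverse ?V = 1"
            using V by (simp add: divide_ennreal_def[symmetric] ennreal_divide_self less_top)
          moreover have "emeasure (uniform_sphere d) B * (ennreal (t ^ d) * ?V / ?V) =
              (?V * inverse ?V) * (ennreal (t ^ d) * emeasure (uniform_sphere d) B)"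
            unfolding divide_ennreal_def by (simp only: ac_simps)
          ultimately have "emeasure (uniform_sphere d) B * (ennreal (t ^ d) * emeasure (LB {..<d}) {x \<in> unit_ball d. dir d x \<in> UNIV} / ?V) =
              ennreal (t ^ d) * emeasure (uniform_sphere d) B"
            by (simp only: mult_1_left)
          then show ?thesis
            unfolding N1' N2' unfolding polar_scaling[OF 2 B] polar_scaling[OF 2 uB]
            by (simp only: sphere[OF B] divide_ennreal_def mult.assoc)
        next
          case 3
          then have "{x \<in> unit_ball d. enorm d x \<le> t \<and> dir d x \<in> B'} = {x \<in> unit_ball d. dir d x \<in> B'}" for B'
            by (auto simp: unit_ball_eq)
          moreover have "emeasure (LB {..<d}) {x \<in> unit_ball d. dir d x \<in> UNIV} / ?V = 1"
            using V by (simp add: ennreal_divide_self less_top)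
          ultimately show ?thesis
            unfolding N1' N2' by (simp only: sphere[OF B] mult_1_right)
        qed
      qed
      then show "cdf ?N1 = cdf ?N2"
        unfolding cdf_def measure_def by (intro ext arg_cong[of _ _ enn2real])
    qed
    then have "emeasure ?N1 A = emeasure ?N2 A" by simp
    then show ?thesis
      unfolding N1[OF A] N2[OF A] using A E[OF A] by (simp add: emeasure_distr vimage_def mult.commute)
  qed
  show ?thesis
  proof (rule pair_measure_eqI[symmetric])
    show "sigma_finite_measure (distr (uball d) borel (enorm d))" by (rule R.sigma_finite_measure_axioms)
    show "sigma_finite_measure (uniform_sphere d)" by (rule S.sigma_finite_measure_axioms)
    have ss: "sets (uniform_sphere d) = sets borel" by (simp add: uniform_sphere_eq)
    show "sets (distr (uball d) borel (enorm d) \<Otimes>\<^sub>M uniform_sphere d) = sets (distr (uball d) (borel \<Otimes>\<^sub>M borel) (\<lambda>x. (enorm d x, dir d x)))"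
      by (simp add: sets_pair_measure_cong[OF refl ss] cong: sets_pair_measure_cong)
    fix A B assume "A \<in> sets (distr (uball d) borel (enorm d))" "B \<in> sets (uniform_sphere d)"
    then have A: "A \<in> sets borel" and B: "B \<in> sets borel" by (simp_all add: ss)
    have "emeasure (distr (uball d) (borel \<Otimes>\<^sub>M borel) (\<lambda>x. (enorm d x, dir d x))) (A \<times> B) =
        emeasure (uball d) {x. enorm d x \<in> A \<and> dir d x \<in> B}"
      using A B by (subst emeasure_distr) (auto simp: vimage_def)
    then show "emeasure (distr (uball d) borel (enorm d)) A * emeasure (uniform_sphere d) B =
        emeasure (distr (uball d) (borel \<Otimes>\<^sub>M borel) (\<lambda>x. (enorm d x, dir d x))) (A \<times> B)"
      using key[OF A B] by simp
  qed
qed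


lemma sets_uniform_sphere [simp, measurable_cong]: "sets (uniform_sphere d) = sets borel"
  by (simp add: uniform_sphere_eq)

lemma ennreal_solve_mult:
  assumes "u = s * i" "v * i = (1 :: ennreal)"
  shows "s = v * u"
proof -
  have "v * u = (v * i) * s" unfolding assms(1) by (simp only: ac_simps)
  then show ?thesis using assms(2) by simp
qed

text \<open>Relative to the uniform law on the ball, the beta law has a density that depends on the
  radius only. Reweighting by such a density leaves the direction uniform and independent of the
  radius.\<close>

lemma beta_law_polar:
  assumes d: "d > 0" and c: "0 < beta_const d \<beta>" "beta_const d \<beta> < \<infinity>"
  shows "beta_law d \<beta> = distr (distr (beta_law d \<beta>) borel (enorm d) \<Otimes>\<^sub>M uniform_sphere d) borel (\<lambda>(r, \<theta>). r *\<^sub>R \<theta>)"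
proof -
  interpret U: prob_space "uball d" by (rule prob_space_uball)
  interpret S: prob_space "uniform_sphere d" by (rule prob_space_uniform_sphere)
  interpret B: prob_space "beta_law d \<beta>" by (rule prob_space_beta_law[OF c])
  let ?V = "emeasure (LB {..<d}) (unit_ball d)"
  have V: "?V \<noteq> 0" "?V \<noteq> \<infinity>"
    using emeasure_unit_ball_pos[of d] emeasure_unit_ball_finite[of d] by (auto simp: lborel_space_eq_LB)
  let ?pair = "\<lambda>x. (enorm d x, dir d x)"
  define \<rho>0 where "\<rho>0 = distr (uball d) borel (enorm d)"
  define \<rho> where "\<rho> = density \<rho>0 (\<lambda>r. (?V / beta_const d \<beta>) * phi \<beta> (r\<^sup>2))"
  have m: "enorm d \<in> uball d \<rightarrow>\<^sub>M borel" "dir d \<in> uball d \<rightarrow>\<^sub>M borel"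
    by (simp_all add: measurable_cong_sets[OF sets_uniform_measure refl] measurable_LB_I)
  have moment4_bound [measurable]: "enorm d \<in> beta_law d \<beta> \<rightarrow>\<^sub>M borel" "dir d \<in> beta_law d \<beta> \<rightarrow>\<^sub>M borel"
    by (simp_all add: measurable_cong_sets[OF sets_beta_law refl])
  have mp: "?pair \<in> uball d \<rightarrow>\<^sub>M borel \<Otimes>\<^sub>M borel" using m by measurable
  have mpb [measurable]: "?pair \<in> borel \<rightarrow>\<^sub>M borel \<Otimes>\<^sub>M borel" by measurable
  have mpB: "?pair \<in> beta_law d \<beta> \<rightarrow>\<^sub>M borel \<Otimes>\<^sub>M borel" by measurable
  interpret R0: prob_space \<rho>0 unfolding \<rho>0_def by (rule U.prob_space_distr[OF m(1)])
  have sets: "sets \<rho>0 = sets borel" "sets \<rho> = sets borel" by (simp_all add: \<rho>0_def \<rho>_def)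
  have ball: "unit_ball d \<in> sets (LB {..<d})" by measurable
  have int: "(\<integral>\<^sup>+x. g (?pair x) \<partial>beta_law d \<beta>) = (\<integral>\<^sup>+r. \<integral>\<^sup>+\<theta>. g (r, \<theta>) \<partial>uniform_sphere d \<partial>\<rho>)"
    if g [measurable]: "g \<in> borel_measurable (borel \<Otimes>\<^sub>M borel)" for g :: "real \<times> (nat \<Rightarrow> real) \<Rightarrow> ennreal"
  proof -
    have gp [measurable]: "(\<lambda>x. g (?pair x)) \<in> borel_measurable borel"
      by (rule measurable_compose[OF mpb g])
    have G: "(\<lambda>x. g (?pair x) * phi \<beta> (sqn d x)) \<in> borel_measurable borel"
      by (intro borel_measurable_times_ennreal gp phi_sqn_measurable)
    have g': "g \<in> borel_measurable (\<rho>0 \<Otimes>\<^sub>M uniform_sphere d)"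
      using g by (simp add: measurable_cong_sets[OF sets_pair_measure_cong[OF sets(1) sets_uniform_sphere] refl])
    have gi: "(\<lambda>r. \<integral>\<^sup>+\<theta>. g (r, \<theta>) \<partial>uniform_sphere d) \<in> borel_measurable \<rho>0"
      using S.borel_measurable_nn_integral_fst[OF g'] .
    have ph: "(\<lambda>r. phi \<beta> (r\<^sup>2)) \<in> borel_measurable \<rho>0"
      by (simp add: measurable_cong_sets[OF sets(1) refl])
    have "(\<integral>\<^sup>+x. g (?pair x) \<partial>beta_law d \<beta>) = (\<integral>\<^sup>+x. g (?pair x) * phi \<beta> (sqn d x) \<partial>LB {..<d}) / beta_const d \<beta>"
      by (rule nn_integral_beta_law[OF gp])
    also have "(\<integral>\<^sup>+x. g (?pair x) * phi \<beta> (sqn d x) \<partial>LB {..<d}) =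
        (\<integral>\<^sup>+x. g (?pair x) * phi \<beta> (sqn d x) * indicator (unit_ball d) x \<partial>LB {..<d})"
    proof (rule nn_integral_LB_cong)
      fix x :: "nat \<Rightarrow> real" assume x: "x \<in> supp_on {..<d}"
      have "phi \<beta> (sqn d x) = 0" if "x \<notin> unit_ball d"
        using that x by (auto simp: phi_def unit_ball_eq enorm_eq_sqn)
      then show "g (?pair x) * phi \<beta> (sqn d x) = g (?pair x) * phi \<beta> (sqn d x) * indicator (unit_ball d) x"
        by (simp add: indicator_def)
    qed
    also have "\<dots> = ?V * (\<integral>\<^sup>+x. g (?pair x) * phi \<beta> (sqn d x) \<partial>uball d)"
    proof -
      have "(\<integral>\<^sup>+x. g (?pair x) * phi \<beta> (sqn d x) \<partial>uball d) =
        (\<integral>\<^sup>+x. g (?pair x) * phi \<beta> (sqn d x) * indicator (unit_ball d) x \<partial>LB {..<d}) / ?V"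
        by (rule nn_integral_uniform_measure[OF measurable_LB_I[OF G] ball])
      moreover have "?V * inverse ?V = 1"
        using V by (simp add: divide_ennreal_def[symmetric] ennreal_divide_self less_top)
      ultimately show ?thesis
        unfolding divide_ennreal_def by (rule ennreal_solve_mult)
    qed
    also have "(\<integral>\<^sup>+x. g (?pair x) * phi \<beta> (sqn d x) \<partial>uball d) =
        (\<integral>\<^sup>+z. g z * phi \<beta> ((fst z)\<^sup>2) \<partial>distr (uball d) (borel \<Otimes>\<^sub>M borel) ?pair)"
      by (subst nn_integral_distr[OF mp]) (auto simp: enorm_sq)
    also have "\<dots> = (\<integral>\<^sup>+z. g z * phi \<beta> ((fst z)\<^sup>2) \<partial>(\<rho>0 \<Otimes>\<^sub>M uniform_sphere d))"
      unfolding polar_independent[OF d] \<rho>0_def ..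
    also have "\<dots> = (\<integral>\<^sup>+r. \<integral>\<^sup>+\<theta>. g (r, \<theta>) * phi \<beta> (r\<^sup>2) \<partial>uniform_sphere d \<partial>\<rho>0)"
    proof -
      have "(\<lambda>z. g z * phi \<beta> ((fst z)\<^sup>2)) \<in> borel_measurable (\<rho>0 \<Otimes>\<^sub>M uniform_sphere d)"
        using g' measurable_compose[OF measurable_fst ph] by (intro borel_measurable_times_ennreal)
      from S.nn_integral_fst[OF this] show ?thesis by simp
    qed
    also have "\<dots> = (\<integral>\<^sup>+r. phi \<beta> (r\<^sup>2) * (\<integral>\<^sup>+\<theta>. g (r, \<theta>) \<partial>uniform_sphere d) \<partial>\<rho>0)"
    proof (rule nn_integral_cong)
      fix r
      have "(\<lambda>\<theta>. g (r, \<theta>)) \<in> borel_measurable (uniform_sphere d)"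
        using measurable_compose[OF measurable_Pair1'[of r borel borel] g] by (simp add: measurable_cong_sets[OF sets_uniform_sphere refl])
      then show "(\<integral>\<^sup>+\<theta>. g (r, \<theta>) * phi \<beta> (r\<^sup>2) \<partial>uniform_sphere d) = phi \<beta> (r\<^sup>2) * (\<integral>\<^sup>+\<theta>. g (r, \<theta>) \<partial>uniform_sphere d)"
        by (subst nn_integral_multc) (auto simp: mult.commute)
    qed
    finally have "(\<integral>\<^sup>+x. g (?pair x) \<partial>beta_law d \<beta>) =
        ?V / beta_const d \<beta> * (\<integral>\<^sup>+r. phi \<beta> (r\<^sup>2) * (\<integral>\<^sup>+\<theta>. g (r, \<theta>) \<partial>uniform_sphere d) \<partial>\<rho>0)"
      by (simp only: divide_ennreal_def ac_simps)
    also have "\<dots> = (\<integral>\<^sup>+r. ?V / beta_const d \<beta> * phi \<beta> (r\<^sup>2) * (\<integral>\<^sup>+\<theta>. g (r, \<theta>) \<partial>uniform_sphere d) \<partial>\<rho>0)"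
      using gi ph by (subst nn_integral_cmult[symmetric]) (auto simp: mult.assoc)
    also have "\<dots> = (\<integral>\<^sup>+r. \<integral>\<^sup>+\<theta>. g (r, \<theta>) \<partial>uniform_sphere d \<partial>\<rho>)"
      unfolding \<rho>_def using gi ph by (subst nn_integral_density) auto
    finally show ?thesis .
  qed
  have \<rho>: "\<rho> = distr (beta_law d \<beta>) borel (enorm d)"
  proof (rule measure_eqI)
    fix A assume "A \<in> sets \<rho>"
    then have A [measurable]: "A \<in> sets borel" by (simp add: sets)
    have "emeasure \<rho> A = (\<integral>\<^sup>+r. \<integral>\<^sup>+\<theta>. indicator A (fst (r, \<theta>)) \<partial>uniform_sphere d \<partial>\<rho>)"
      using A sets S.emeasure_space_1 by simp
    also have "\<dots> = (\<integral>\<^sup>+x. indicator A (fst (?pair x)) \<partial>beta_law d \<beta>)"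
      by (rule int[symmetric, where g = "\<lambda>z. indicator A (fst z)"]) measurable
    also have "\<dots> = (\<integral>\<^sup>+x. indicator A x \<partial>distr (beta_law d \<beta>) borel (enorm d))"
      by (subst nn_integral_distr) auto
    also have "\<dots> = emeasure (distr (beta_law d \<beta>) borel (enorm d)) A"
      by simp
    finally show "emeasure \<rho> A = emeasure (distr (beta_law d \<beta>) borel (enorm d)) A" .
  qed (simp add: sets)
  have pm: "(\<lambda>(r, \<theta>). r *\<^sub>R \<theta>) \<in> (borel :: real measure) \<Otimes>\<^sub>M borel \<rightarrow>\<^sub>M (borel :: (nat \<Rightarrow> real) measure)"
    by measurable
  have pm': "(\<lambda>(r, \<theta>). r *\<^sub>R \<theta>) \<in> \<rho> \<Otimes>\<^sub>M uniform_sphere d \<rightarrow>\<^sub>M borel"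
    using pm by (simp add: measurable_cong_sets[OF sets_pair_measure_cong[OF sets(2) sets_uniform_sphere] refl])
  show ?thesis
    unfolding \<rho>[symmetric]
  proof (rule measure_eqI)
    fix A assume "A \<in> sets (beta_law d \<beta>)"
    then have A [measurable]: "A \<in> sets borel" by simp
    let ?g = "\<lambda>z. indicator A ((\<lambda>(r, \<theta>). r *\<^sub>R \<theta>) z) :: ennreal"
    have gm: "?g \<in> borel_measurable (borel \<Otimes>\<^sub>M borel)"
      by (rule measurable_compose[OF pm borel_measurable_indicator[OF A]])
    have gm': "?g \<in> borel_measurable (\<rho> \<Otimes>\<^sub>M uniform_sphere d)"
      by (rule measurable_compose[OF pm' borel_measurable_indicator[OF A]])
    have ae: "AE x in beta_law d \<beta>. x \<in> supp_on {..<d}"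
      unfolding beta_law_def divide_ennreal_def
      by (subst AE_density) (use AE_LB_supp[of "{..<d}"] in \<open>auto intro: measurable_LB_I weight_measurable\<close>)
    have "emeasure (beta_law d \<beta>) A = (\<integral>\<^sup>+x. indicator A x \<partial>beta_law d \<beta>)"
      by simp
    also have "\<dots> = (\<integral>\<^sup>+x. ?g (?pair x) \<partial>beta_law d \<beta>)"
      by (rule nn_integral_cong_AE, rule eventually_mono[OF ae]) (simp add: enorm_dir)
    also have "\<dots> = (\<integral>\<^sup>+r. \<integral>\<^sup>+\<theta>. ?g (r, \<theta>) \<partial>uniform_sphere d \<partial>\<rho>)"
      by (rule int[OF gm])
    also have "\<dots> = (\<integral>\<^sup>+z. ?g z \<partial>(\<rho> \<Otimes>\<^sub>M uniform_sphere d))"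
      using S.nn_integral_fst[OF gm'] by simp
    also have "\<dots> = (\<integral>\<^sup>+x. indicator A x \<partial>distr (\<rho> \<Otimes>\<^sub>M uniform_sphere d) borel (\<lambda>(r, \<theta>). r *\<^sub>R \<theta>))"
      by (rule nn_integral_distr[OF pm', symmetric]) simp
    also have "\<dots> = emeasure (distr (\<rho> \<Otimes>\<^sub>M uniform_sphere d) borel (\<lambda>(r, \<theta>). r *\<^sub>R \<theta>)) A"
      by simp
    finally show "emeasure (beta_law d \<beta>) A = emeasure (distr (\<rho> \<Otimes>\<^sub>M uniform_sphere d) borel (\<lambda>(r, \<theta>). r *\<^sub>R \<theta>)) A" .
  qed simp
qed

lemma ennreal_inverse_antimono: "a \<le> b \<Longrightarrow> inverse b \<le> inverse (a :: ennreal)"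
proof (cases "a = 0 \<or> b = \<infinity>")
  case False
  assume ab: "a \<le> b"
  obtain r s where rs: "a = ennreal r" "b = ennreal s" "0 \<le> r" "0 \<le> s"
    using False ab by (cases a; cases b) (auto simp: top_unique)
  then have "0 < r" "r \<le> s" using False ab by (auto simp: less_le)
  then show ?thesis
    unfolding rs by (simp add: inverse_ennreal ennreal_leI le_imp_inverse_le)
qed auto

text \<open>On the ball of radius x the unnormalised density is at most 1 / (1 - x^2), uniformly in
  \<beta>, while the normalising constant is at least a fixed multiple of 1 / (\<beta> + 1). So the
  inner mass is of order \<beta> + 1.\<close>

lemma beta_law_radius_tail:
  assumes d: "d > 0" and \<beta>: "-1 < \<beta>" "\<beta> < 0" and x: "x < 1"
  shows "emeasure (beta_law d \<beta>) {y. enorm d y \<le> x} \<le>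
    ennreal (2 * (\<beta> + 1)) * (inverse (\<Prod>j<d - 1. weight_integral (real (Suc j) / 2)) * (emeasure (LB {..<d}) (unit_ball d) * ennreal (1 / (1 - x\<^sup>2))))"
proof -
  let ?V = "emeasure (LB {..<d}) (unit_ball d)"
  let ?P = "\<Prod>j<d - 1. weight_integral (real (Suc j) / 2)"
  show ?thesis
  proof (cases "x < 0")
    case True
    have "{y. enorm d y \<le> x} = {}"
      using True enorm_nonneg[of d] by (auto simp: not_le intro: less_le_trans)
    then show ?thesis by simp
  next
    case False
    have x2: "x\<^sup>2 < 1" using x False by (simp add: abs_square_less_1)
    have B: "unit_ball d \<in> sets borel" by measurable
    have S: "{y. enorm d y \<le> x} \<in> sets borel"
      using measurable_sets[OF enorm_measurable, of "{..x}" d] by (simp add: vimage_def)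
    have "emeasure (beta_law d \<beta>) {y. enorm d y \<le> x} = (\<integral>\<^sup>+y. indicator {y. enorm d y \<le> x} y \<partial>beta_law d \<beta>)"
      using S by simp
    also have "\<dots> = (\<integral>\<^sup>+y. indicator {y. enorm d y \<le> x} y * phi \<beta> (sqn d y) \<partial>LB {..<d}) / beta_const d \<beta>"
      using S by (intro nn_integral_beta_law) simp
    also have "\<dots> \<le> (?V * ennreal (1 / (1 - x\<^sup>2))) / (ennreal (1 / (2 * (\<beta> + 1))) * ?P)"
      unfolding divide_ennreal_def
    proof (rule mult_mono)
      have "(\<integral>\<^sup>+y. indicator {y. enorm d y \<le> x} y * phi \<beta> (sqn d y) \<partial>LB {..<d}) \<le>
          (\<integral>\<^sup>+y. indicator (unit_ball d) y * ennreal (1 / (1 - x\<^sup>2)) \<partial>LB {..<d})"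
      proof (rule nn_integral_mono_AE, rule eventually_mono[OF AE_LB_supp])
        fix y :: "nat \<Rightarrow> real" assume y: "y \<in> supp_on {..<d}"
        show "indicator {y. enorm d y \<le> x} y * phi \<beta> (sqn d y) \<le> indicator (unit_ball d) y * ennreal (1 / (1 - x\<^sup>2))"
        proof (cases "enorm d y \<le> x")
          case True
          have "sqn d y \<le> x\<^sup>2" unfolding enorm_sq[symmetric] using True by (intro power_mono) auto
          then have q: "1 - x\<^sup>2 \<le> 1 - sqn d y" by simp
          then have "(1 - sqn d y) powr \<beta> \<le> (1 - x\<^sup>2) powr \<beta>"
            using x2 \<beta> by (intro powr_mono2') auto
          also have "\<dots> \<le> (1 - x\<^sup>2) powr (-1)"
            using x2 \<beta> by (intro powr_mono') auto
          also have "\<dots> = 1 / (1 - x\<^sup>2)"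
            using x2 by (simp add: powr_minus divide_inverse)
          finally have "phi \<beta> (sqn d y) \<le> ennreal (1 / (1 - x\<^sup>2))"
            by (simp add: phi_def ennreal_leI)
          moreover have "y \<in> unit_ball d" using True x y by (simp add: unit_ball_eq)
          ultimately show ?thesis using True by simp
        qed simp
      qed
      also have "\<dots> = ?V * ennreal (1 / (1 - x\<^sup>2))"
        using B by (subst nn_integral_multc) (auto intro: measurable_LB_I)
      finally show "(\<integral>\<^sup>+y. indicator {y. enorm d y \<le> x} y * phi \<beta> (sqn d y) \<partial>LB {..<d}) \<le> ?V * ennreal (1 / (1 - x\<^sup>2))" .
      show "inverse (beta_const d \<beta>) \<le> inverse (ennreal (1 / (2 * (\<beta> + 1))) * ?P)"
        using beta_const_lower[OF \<beta>, of "d - 1"] d by (intro ennreal_inverse_antimono) simp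
    qed simp_all
    also have "\<dots> = ennreal (2 * (\<beta> + 1)) * (inverse ?P * (?V * ennreal (1 / (1 - x\<^sup>2))))"
    proof -
      have "inverse (ennreal (1 / (2 * (\<beta> + 1))) * ?P) = inverse (ennreal (1 / (2 * (\<beta> + 1)))) * inverse ?P"
        using \<beta> by (intro ennreal_inverse_mult_finite) auto
      also have "inverse (ennreal (1 / (2 * (\<beta> + 1)))) = ennreal (2 * (\<beta> + 1))"
        using \<beta> by (subst inverse_ennreal) auto
      finally show ?thesis by (simp only: divide_ennreal_def ac_simps)
    qed
    finally show ?thesis .
  qed
qed

subsection \<open>The uniform distribution on the sphere as a limit of beta distributions\<close>

text \<open>The cone over this section of the sphere lies in the zero set of the quadratic
  polynomial (v . x)^2 - |x|^2, which does not vanish identically in dimension at least 2.\<close>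

lemma sphere_hyperplane_null:
  assumes d: "d \<ge> 2"
  shows "emeasure (uniform_sphere d) {y. dotp d v y = 1} = 0"
proof -
  let ?P = "\<lambda>x. (dotp d v x)\<^sup>2 - sqn d x"
  have P: "?P \<in> borel_measurable borel"
    by (intro borel_measurable_diff borel_measurable_power dotp_measurable' sqn_measurable')
  obtain x0 where x0: "x0 \<in> supp_on {..<d}" "?P x0 \<noteq> 0"
  proof (cases "v 0 = 0 \<and> v 1 = 0")
    case True
    let ?x = "\<lambda>j::nat. if j = 0 then 1 else 0 :: real"
    have "dotp d v ?x = 0" "sqn d ?x = 1"
      using True d by (simp_all add: dotp_def sqn_def if_distrib[of "\<lambda>x. _ * x"] cong: if_cong)
    then show ?thesis using d by (intro that[of ?x]) (auto simp: supp_on_def)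
  next
    case False
    \<comment> \<open>A vector orthogonal to v in the plane of the first two coordinates.\<close>
    let ?x = "\<lambda>j::nat. if j = 0 then - v 1 else if j = 1 then v 0 else 0 :: real"
    have s: "(\<Sum>j<d. f j) = f 0 + f 1 + (\<Sum>j\<in>{2..<d}. f j)" for f :: "nat \<Rightarrow> real"
    proof -
      have "{..<d} = insert 0 (insert 1 {2..<d})" using d by auto
      then show ?thesis by simp
    qed
    have "dotp d v ?x = 0" "sqn d ?x = (v 0)\<^sup>2 + (v 1)\<^sup>2"
      by (simp_all add: dotp_def sqn_def s power2_eq_square)
    moreover have "(v 0)\<^sup>2 + (v 1)\<^sup>2 > 0" using False by (simp add: sum_power2_gt_zero_iff)
    ultimately have "?P ?x < 0" by (simp only:) simp
    then show ?thesis using d by (intro that[of ?x]) (auto simp: supp_on_def)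
  qed
  have poly: "\<exists>p. \<forall>t. ?P (x + t *\<^sub>R (x0 - x)) = poly p t" for x
  proof -
    have "is_poly (\<lambda>t. (dotp d v (x + t *\<^sub>R (x0 - x)))\<^sup>2 - sqn d (x + t *\<^sub>R (x0 - x)))"
      unfolding dotp_def sqn_def power2_eq_square
      by (intro is_poly_intros is_poly_sum; simp add: scaleR_fun_def; intro is_poly_intros)
    then show ?thesis by (simp add: is_poly_def)
  qed
  have ae: "AE x in LB {..<d}. ?P x \<noteq> 0"
    by (rule LB_zero_set_null[OF _ P x0 poly]) simp
  have A: "{y. dotp d v y = 1} \<in> sets borel"
    using measurable_sets[OF dotp_measurable', of "{1}" d v] by (simp add: vimage_def)
  have S: "{x \<in> unit_ball d. dir d x \<in> {y. dotp d v y = 1}} \<in> sets borel"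
    by (rule ball_sector_borel[OF A])
  have "AE x in LB {..<d}. x \<notin> {x \<in> unit_ball d. dir d x \<in> {y. dotp d v y = 1}}"
    using ae
  proof eventually_elim
    case (elim x)
    have "(dotp d v x)\<^sup>2 = sqn d x" if "dotp d v (dir d x) = 1"
    proof -
      have "dotp d v (dir d x) = dotp d v x / enorm d x"
        unfolding dir_def scaleR_fun_def real_scaleR_def by (simp only: dotp_mult_right) (simp add: divide_inverse)
      with that have "dotp d v x = enorm d x"
        by (cases "enorm d x = 0") (auto simp: field_simps)
      then show ?thesis by (simp add: enorm_sq)
    qed
    then show ?case using elim by auto
  qed
  then have "emeasure (LB {..<d}) {x \<in> unit_ball d. dir d x \<in> {y. dotp d v y = 1}} = 0"
    using S by (subst (asm) AE_iff_measurable[OF _ refl]) auto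
  then show ?thesis
    using emeasure_uniform_sphere[OF A, of d] by (simp add: lborel_space_eq_LB dir_def)
qed

lemma AE_law_beta_mdet:
  assumes c: "0 < beta_const d \<beta>" "beta_const d \<beta> < \<infinity>" and n: "d \<le> n"
  shows "AE x in law n (beta_law d \<beta>). mdet d x \<noteq> 0"
proof -
  have Z: "{x. mdet d x = 0} \<in> sets borel"
    using measurable_sets[OF mdet_config_measurable, of "{0}" d] by (simp add: vimage_def)
  have ae: "AE X in LB ({..<n} \<times> {..<d}). mdet d (\<lambda>i j. X (i, j)) \<noteq> 0"
  proof (rule LB_zero_set_null)
    let ?x0 = "\<lambda>(i, j). if i = j \<and> i < d then 1 else 0 :: real"
    show "?x0 \<in> supp_on ({..<n} \<times> {..<d})" using n by (auto simp: supp_on_def)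
    have "mdet d (\<lambda>i j. ?x0 (i, j)) = 1"
      by (rule mdet_upper_unit) auto
    then show "mdet d (\<lambda>i j. ?x0 (i, j)) \<noteq> 0" by simp
    show "(\<lambda>X. mdet d (\<lambda>i j. X (i, j))) \<in> borel_measurable borel"
      by (rule mdet_measurable) (rule coord_measurable)
    fix X :: "nat \<times> nat \<Rightarrow> real"
    have "is_poly (\<lambda>t. mdet d (\<lambda>i j. (X + t *\<^sub>R (?x0 - X)) (i, j)))"
    proof (rule is_poly_mdet)
      show "is_poly (\<lambda>t. (X + t *\<^sub>R (?x0 - X)) (i, j))" for i j
        by (auto simp: scaleR_fun_def intro!: is_poly_intros)
    qed
    then show "\<exists>p. \<forall>t. mdet d (\<lambda>i j. (X + t *\<^sub>R (?x0 - X)) (i, j)) = poly p t"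
      by (simp add: is_poly_def)
  qed simp
  have "emeasure (law n (beta_law d \<beta>)) {x. mdet d x = 0} = (\<integral>\<^sup>+x. indicator {x. mdet d x = 0} x \<partial>law n (beta_law d \<beta>))"
    using Z by simp
  also have "\<dots> = (\<integral>\<^sup>+X. indicator {x. mdet d x = 0} (\<lambda>i j. X (i, j)) * (\<Prod>i<n. phi \<beta> (sqn d (\<lambda>j. X (i, j)))) \<partial>LB ({..<n} \<times> {..<d})) / beta_const d \<beta> ^ n"
    by (rule law_beta_law[OF c]) (use Z in simp)
  also have "(\<integral>\<^sup>+X. indicator {x. mdet d x = 0} (\<lambda>i j. X (i, j)) * (\<Prod>i<n. phi \<beta> (sqn d (\<lambda>j. X (i, j)))) \<partial>LB ({..<n} \<times> {..<d})) =
      (\<integral>\<^sup>+X. 0 \<partial>LB ({..<n} \<times> {..<d}))"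
    by (rule nn_integral_cong_AE, rule eventually_mono[OF ae]) simp
  finally have "{x. mdet d x = 0} \<in> null_sets (law n (beta_law d \<beta>))"
    using Z by (auto simp: null_sets_def)
  then have "AE x in law n (beta_law d \<beta>). x \<notin> {x. mdet d x = 0}"
    by (rule AE_not_in)
  then show ?thesis by simp
qed

lemma law_distr:
  assumes N: "prob_space N" and f: "f \<in> N \<rightarrow>\<^sub>M (borel :: (nat \<Rightarrow> real) measure)"
  shows "law n (distr N borel f) = distr (\<Pi>\<^sub>M i\<in>{..<n}. N) borel (\<lambda>q i. if i < n then f (q i) else 0)"
proof -
  let ?D = "distr N borel f"
  have D: "prob_space ?D" by (rule prob_space.prob_space_distr[OF N f])
  have fD: "f \<in> N \<rightarrow>\<^sub>M ?D" using f by simp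
  have "distr (\<Pi>\<^sub>M i\<in>{..<n}. N) (\<Pi>\<^sub>M i\<in>{..<n}. ?D) (compose {..<n} f) = (\<Pi>\<^sub>M i\<in>{..<n}. distr N ?D f)"
    by (rule distr_PiM_finite_prob_space') (use N D fD in auto)
  also have "distr N ?D f = ?D" by (rule distr_cong) auto
  finally have eq: "(\<Pi>\<^sub>M i\<in>{..<n}. ?D) = distr (\<Pi>\<^sub>M i\<in>{..<n}. N) (\<Pi>\<^sub>M i\<in>{..<n}. ?D) (compose {..<n} f)" ..
  have c: "compose {..<n} f \<in> (\<Pi>\<^sub>M i\<in>{..<n}. N) \<rightarrow>\<^sub>M (\<Pi>\<^sub>M i\<in>{..<n}. ?D)"
    unfolding compose_def using fD by measurable
  have t: "(\<lambda>x i. if i < n then x i else 0) \<in> (\<Pi>\<^sub>M i\<in>{..<n}. ?D) \<rightarrow>\<^sub>M (borel :: (nat \<Rightarrow> nat \<Rightarrow> real) measure)"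
    by (rule truncate_rows_measurable) simp
  have "law n ?D = distr (distr (\<Pi>\<^sub>M i\<in>{..<n}. N) (\<Pi>\<^sub>M i\<in>{..<n}. ?D) (compose {..<n} f)) borel (\<lambda>x i. if i < n then x i else 0)"
    unfolding law_def using eq by simp
  also have "\<dots> = distr (\<Pi>\<^sub>M i\<in>{..<n}. N) borel ((\<lambda>x i. if i < n then x i else 0) \<circ> compose {..<n} f)"
    by (rule distr_distr[OF t c])
  also have "(\<lambda>x i. if i < n then x i else 0) \<circ> compose {..<n} f = (\<lambda>q i. if i < n then f (q i) else 0)"
    by (auto simp: fun_eq_iff compose_def)
  finally show ?thesis .
qed

lemma prob_space_law:
  assumes "prob_space \<mu>" "sets \<mu> = sets borel"
  shows "prob_space (law n \<mu>)"
  unfolding law_def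
  by (rule prob_space.prob_space_distr[OF prob_space_PiM truncate_rows_measurable]) (use assms in auto)

text \<open>The hyperplane depends only on points with index below d, so point j can be integrated
  out first with the hyperplane fixed.\<close>

lemma AE_law_above:
  assumes \<mu>: "prob_space \<mu>" "sets \<mu> = sets borel"
    and null: "\<And>v. emeasure \<mu> {y. dotp d v y = 1} = 0" and j: "d \<le> j" "j < n"
  shows "AE x in law n \<mu>. above d x (x j) \<noteq> 0"
proof -
  interpret P: product_prob_space "\<lambda>_::nat. \<mu>" by (rule product_prob_spaceI) (rule \<mu>)
  let ?t = "\<lambda>x i. if i < n then x i else 0 :: nat \<Rightarrow> real"
  have t: "?t \<in> (\<Pi>\<^sub>M i\<in>{..<n}. \<mu>) \<rightarrow>\<^sub>M borel" by (rule truncate_rows_measurable[OF \<mu>(2)])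
  let ?Z = "{x. above d x (x j) = 0}"
  have Z: "?Z \<in> sets borel"
    using measurable_sets[OF above_row_measurable, of "{0}" d j] by (simp add: vimage_def)
  let ?I = "{..<n} - {j}"
  have ins: "insert j ?I = {..<n}" using j by auto
  let ?g = "\<lambda>x. indicator ?Z (?t x) :: ennreal"
  have g: "?g \<in> borel_measurable (\<Pi>\<^sub>M i\<in>insert j ?I. \<mu>)"
    unfolding ins by (rule measurable_compose[OF t borel_measurable_indicator[OF Z]])
  have "emeasure (law n \<mu>) ?Z = (\<integral>\<^sup>+x. indicator ?Z x \<partial>law n \<mu>)"
    using Z by simp
  also have "\<dots> = (\<integral>\<^sup>+x. ?g x \<partial>(\<Pi>\<^sub>M i\<in>insert j ?I. \<mu>))"
    unfolding law_def ins by (rule nn_integral_distr[OF t]) (use Z in simp)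
  also have "\<dots> = (\<integral>\<^sup>+x. \<integral>\<^sup>+y. ?g (x(j := y)) \<partial>\<mu> \<partial>(\<Pi>\<^sub>M i\<in>?I. \<mu>))"
    by (rule P.product_nn_integral_insert[OF _ _ g]) auto
  also have "\<dots> = (\<integral>\<^sup>+x. 0 \<partial>(\<Pi>\<^sub>M i\<in>?I. \<mu>))"
  proof (rule nn_integral_cong)
    fix x :: "nat \<Rightarrow> nat \<Rightarrow> real"
    have "above d (?t (x(j := y))) (?t (x(j := y)) j) = dotp d (hvec d (?t x)) y - 1" for y
    proof -
      have "hvec d (?t (x(j := y))) = hvec d (?t x)"
        using j by (intro hvec_cong) auto
      then show ?thesis using j by (simp add: above_def)
    qed
    then have "(\<integral>\<^sup>+y. ?g (x(j := y)) \<partial>\<mu>) = (\<integral>\<^sup>+y. indicator {y. dotp d (hvec d (?t x)) y = 1} y \<partial>\<mu>)"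
      by (intro nn_integral_cong) (simp add: indicator_def)
    also have "\<dots> = 0"
    proof -
      have "{y. dotp d (hvec d (?t x)) y = 1} \<in> sets \<mu>"
        using measurable_sets[OF dotp_measurable', of "{1}" d "hvec d (?t x)"] \<mu>(2) by (simp add: vimage_def)
      then show ?thesis using null by simp
    qed
    finally show "(\<integral>\<^sup>+y. ?g (x(j := y)) \<partial>\<mu>) = 0" .
  qed
  finally have "?Z \<in> null_sets (law n \<mu>)"
    using Z by (auto simp: null_sets_def)
  then have "AE x in law n \<mu>. x \<notin> ?Z" by (rule AE_not_in)
  then show ?thesis by simp
qed

lemma tendsto_above:
  assumes "\<And>i l. (\<lambda>k. X k i l) \<longlonglongrightarrow> x i l" "mdet d x \<noteq> 0"
  shows "(\<lambda>k. above d (X k) (X k j)) \<longlonglongrightarrow> above d x (x j)"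
  unfolding above_def dotp_def hvec_def
  using assms by (intro tendsto_intros tendsto_mdet tendsto_madj) auto

text \<open>The determinant and the values of \<open>above\<close> converge to limits that are all
  nonzero, so eventually their signs are those of the limits and the indicator is constant.\<close>

lemma facet_set_indicator_tendsto:
  assumes lim: "\<And>i l. (\<lambda>k. X k i l) \<longlonglongrightarrow> x i l" and D: "mdet d x \<noteq> 0"
    and ab: "\<And>j. j \<in> {d..<n} \<Longrightarrow> above d x (x j) \<noteq> 0"
  shows "(\<lambda>k. indicator (facet_set d n) (X k) :: real) \<longlonglongrightarrow> indicator (facet_set d n) x"
proof -
  have "(\<lambda>k. mdet d (X k)) \<longlonglongrightarrow> mdet d x"
    by (rule tendsto_mdet) (rule lim)
  then have e1: "eventually (\<lambda>k. mdet d (X k) \<noteq> 0) sequentially"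
    using D by (rule tendsto_imp_eventually_ne)
  have e2: "eventually (\<lambda>k. (above d (X k) (X k j) < 0 \<longleftrightarrow> above d x (x j) < 0) \<and> (above d (X k) (X k j) > 0 \<longleftrightarrow> above d x (x j) > 0)) sequentially"
    if j: "j \<in> {d..<n}" for j
  proof -
    have t: "(\<lambda>k. above d (X k) (X k j)) \<longlonglongrightarrow> above d x (x j)"
      by (rule tendsto_above[OF lim D])
    show ?thesis
    proof (cases "above d x (x j) > 0")
      case True
      then have "eventually (\<lambda>k. above d (X k) (X k j) > 0) sequentially"
        using order_tendstoD(1)[OF t] by blast
      then show ?thesis by (rule eventually_mono) (use True in auto)
    next
      case False
      then have n: "above d x (x j) < 0" using ab[OF j] by simp
      then have "eventually (\<lambda>k. above d (X k) (X k j) < 0) sequentially"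
        using order_tendstoD(2)[OF t] by blast
      then show ?thesis by (rule eventually_mono) (use n in auto)
    qed
  qed
  have "eventually (\<lambda>k. \<forall>j\<in>{d..<n}. (above d (X k) (X k j) < 0 \<longleftrightarrow> above d x (x j) < 0) \<and> (above d (X k) (X k j) > 0 \<longleftrightarrow> above d x (x j) > 0)) sequentially"
    using e2 by (intro eventually_ball_finite) auto
  with e1 have "eventually (\<lambda>k. X k \<in> facet_set d n \<longleftrightarrow> x \<in> facet_set d n) sequentially"
  proof eventually_elim
    case (elim k)
    then show ?case unfolding facet_set_def using D by auto
  qed
  then have "eventually (\<lambda>k. (indicator (facet_set d n) (X k) :: real) = indicator (facet_set d n) x) sequentially"
    by (rule eventually_mono) (simp add: indicator_def)
  then show ?thesis by (rule tendsto_eventually)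
qed

text \<open>Any sequence in (-1, 0) that tends to -1 serves; the shift by 2 keeps the value at j = 0
  below 0.\<close>

definition beta_exponent :: "nat \<Rightarrow> real"
  where "beta_exponent j = -1 + 1 / real (j + 2)"

lemma beta_exponent: "-1 < beta_exponent j" "beta_exponent j < 0"
  by (auto simp: beta_exponent_def field_simps)

text \<open>The radii tend to 1 in distribution. Skorohod's theorem realises them on one probability
  space with pointwise convergence, which makes it possible to couple the beta laws with the
  sphere.\<close>

lemma radius_converges:
  assumes d: "d \<ge> 2"
  shows "\<exists>(\<Omega> :: real measure) Yseq Y. prob_space \<Omega> \<and>
    (\<forall>j. Yseq j \<in> borel_measurable \<Omega>) \<and>
    (\<forall>j. distr \<Omega> borel (Yseq j) = distr (beta_law d (beta_exponent j)) borel (enorm d)) \<and>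
    (AE w in \<Omega>. Y w = 1) \<and> (\<forall>w\<in>space \<Omega>. (\<lambda>j. Yseq j w) \<longlonglongrightarrow> Y w)"
proof -
  let ?\<mu> = "\<lambda>j. distr (beta_law d (beta_exponent j)) borel (enorm d)" and ?M = "return borel (1::real)"
  have c: "0 < beta_const d (beta_exponent j)" "beta_const d (beta_exponent j) < \<infinity>" for j
    using beta_const_pos beta_const_finite beta_exponent by auto
  have m: "enorm d \<in> beta_law d (beta_exponent j) \<rightarrow>\<^sub>M borel" for j
    by (simp add: measurable_cong_sets[OF sets_beta_law refl])
  interpret B: prob_space "beta_law d (beta_exponent j)" for j by (rule prob_space_beta_law[OF c])
  have \<mu>: "real_distribution (?\<mu> j)" for j
    unfolding real_distribution_def real_distribution_axioms_def
    using B.prob_space_distr[OF m] by simp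
  have M: "real_distribution ?M"
    unfolding real_distribution_def real_distribution_axioms_def by (simp add: prob_space_return)
  have S: "{y. enorm d y \<le> x} \<in> sets borel" for x
    using measurable_sets[OF enorm_measurable, of "{..x}" d] by (simp add: vimage_def)
  have cdf: "cdf (?\<mu> j) x = measure (beta_law d (beta_exponent j)) {y. enorm d y \<le> x}" for j x
    unfolding cdf_def by (subst measure_distr[OF m]) (auto simp: vimage_def)
  have "(\<lambda>j. cdf (?\<mu> j) x) \<longlonglongrightarrow> cdf ?M x" for x
  proof (cases "x < 1")
    case True
    let ?K = "inverse (\<Prod>j<d - 1. weight_integral (real (Suc j) / 2)) * (emeasure (LB {..<d}) (unit_ball d) * ennreal (1 / (1 - x\<^sup>2)))"
    have K: "?K < \<infinity>"
    proof -
      have "(\<Prod>j<k. weight_integral (real (Suc j) / 2)) \<noteq> 0" for k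
        using weight_integral_pos by (simp add: prod_zero_iff) (metis less_irrefl)
      then have "inverse (\<Prod>j<d - 1. weight_integral (real (Suc j) / 2)) < \<infinity>"
        by (simp add: less_top[symmetric] ennreal_inverse_eq_top_iff)
      then show ?thesis
        using emeasure_unit_ball_finite[of d] by (simp add: lborel_space_eq_LB ennreal_mult_less_top)
    qed
    define K where "K = enn2real ?K"
    have K': "?K = ennreal K" using K by (simp add: K_def)
    have K0: "K \<ge> 0" by (simp add: K_def)
    have le: "cdf (?\<mu> j) x \<le> 2 * (beta_exponent j + 1) * K" for j
    proof -
      have "emeasure (beta_law d (beta_exponent j)) {y. enorm d y \<le> x} \<le> ennreal (2 * (beta_exponent j + 1)) * ?K"
        by (rule beta_law_radius_tail) (use d beta_exponent True in auto)
      also have "\<dots> = ennreal (2 * (beta_exponent j + 1) * K)"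
        unfolding K' using beta_exponent[of j] by (simp add: ennreal_mult'[symmetric])
      finally show ?thesis
        unfolding cdf B.emeasure_eq_measure using beta_exponent[of j] K0 by (subst (asm) ennreal_le_iff) auto
    qed
    have "(\<lambda>j. 2 * (beta_exponent j + 1) * K) \<longlonglongrightarrow> 2 * 0 * K"
    proof (intro tendsto_intros)
      have "(\<lambda>j. inverse (real (j + 2))) \<longlonglongrightarrow> 0"
        by (rule LIMSEQ_ignore_initial_segment[OF lim_inverse_n])
      then show "(\<lambda>j. beta_exponent j + 1) \<longlonglongrightarrow> 0" by (simp add: beta_exponent_def inverse_eq_divide)
    qed
    then have up: "(\<lambda>j. 2 * (beta_exponent j + 1) * K) \<longlonglongrightarrow> 0" by simp
    have lo: "0 \<le> cdf (?\<mu> j) x" for j unfolding cdf by (rule measure_nonneg)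
    have "(\<lambda>j. cdf (?\<mu> j) x) \<longlonglongrightarrow> 0"
      by (rule tendsto_sandwich[OF always_eventually[OF allI[OF lo]] always_eventually[OF allI[OF le]] tendsto_const up])
    moreover have "cdf ?M x = 0" using True by (simp add: cdf_def measure_return)
    ultimately show ?thesis by simp
  next
    case False
    have "cdf (?\<mu> j) x = 1" for j
    proof -
      have ae: "AE y in beta_law d (beta_exponent j). enorm d y \<le> x"
        unfolding beta_law_def divide_ennreal_def
      proof (subst AE_density)
        show "(\<lambda>x. phi (beta_exponent j) (sqn d x) * inverse (beta_const d (beta_exponent j))) \<in> borel_measurable (LB {..<d})"
          by (intro measurable_LB_I weight_measurable)
        have "enorm d y \<le> x" if "0 < phi (beta_exponent j) (sqn d y) * inverse (beta_const d (beta_exponent j))" for y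
        proof -
          have "sqn d y < 1" using that by (auto simp: phi_def split: if_splits)
          then have "enorm d y < 1" by (simp add: enorm_eq_sqn)
          then show ?thesis using False by simp
        qed
        then show "AE y in LB {..<d}. 0 < phi (beta_exponent j) (sqn d y) * inverse (beta_const d (beta_exponent j)) \<longrightarrow> enorm d y \<le> x"
          by (intro AE_I2) blast
      qed
      then show ?thesis unfolding cdf using S by (subst B.prob_eq_1) auto
    qed
    moreover have "cdf ?M x = 1" using False by (simp add: cdf_def measure_return)
    ultimately show ?thesis by simp
  qed
  then have "weak_conv_m ?\<mu> ?M" by (simp add: weak_conv_m_def weak_conv_def)
  from Skorohod[OF \<mu> M this] obtain \<Omega> :: "real measure" and Yseq Y where
    Y: "prob_space \<Omega> \<and> (\<forall>j. Yseq j \<in> borel_measurable \<Omega>) \<and> (\<forall>j. distr \<Omega> borel (Yseq j) = ?\<mu> j) \<and>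
      Y \<in> measurable \<Omega> lborel \<and> distr \<Omega> borel Y = ?M \<and> (\<forall>w\<in>space \<Omega>. (\<lambda>j. Yseq j w) \<longlonglongrightarrow> Y w)"
    by (elim exE) (erule that)
  then have Yb: "Y \<in> borel_measurable \<Omega>" and Yd: "distr \<Omega> borel Y = ?M" by simp_all
  have "AE y in ?M. y = 1" by (subst AE_return) auto
  then have "AE y in distr \<Omega> borel Y. y = 1" unfolding Yd .
  then have "AE w in \<Omega>. Y w = 1" by (rule AE_distrD[OF Yb])
  then show ?thesis using Y by blast
qed


text \<open>All beta laws are coupled with the spherical law by keeping the independent directions
  and varying only the radii, which converge to 1. The facet indicators then converge almost surely,
  and dominated convergence applies.\<close>

lemma
  assumes d: "d \<ge> 2" and n: "d \<le> n"
  shows sphere_facet_limit: "(\<lambda>j. measure (law n (beta_law d (beta_exponent j))) (facet_set d n)) \<longlonglongrightarrow> measure (law n (uniform_sphere d)) (facet_set d n)"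
    and AE_law_sphere_mdet: "AE x in law n (uniform_sphere d). mdet d x \<noteq> 0"
proof -
  let ?\<sigma> = "uniform_sphere d"
  interpret S: prob_space ?\<sigma> by (rule prob_space_uniform_sphere)
  obtain \<Omega> :: "real measure" and Yseq Y where \<Omega>: "prob_space \<Omega>" and Ym: "\<And>j. Yseq j \<in> borel_measurable \<Omega>"
    and Yd: "\<And>j. distr \<Omega> borel (Yseq j) = distr (beta_law d (beta_exponent j)) borel (enorm d)"
    and Y1: "AE w in \<Omega>. Y w = 1" and Yl: "\<And>w. w \<in> space \<Omega> \<Longrightarrow> (\<lambda>j. Yseq j w) \<longlonglongrightarrow> Y w"
    using radius_converges[OF d] by blast
  interpret O: prob_space \<Omega> by fact
  interpret OS: pair_prob_space \<Omega> ?\<sigma> ..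
  let ?N = "\<Omega> \<Otimes>\<^sub>M ?\<sigma>"
  let ?Q = "\<Pi>\<^sub>M i\<in>{..<n}. ?N"
  have N: "prob_space ?N" by unfold_locales
  interpret Q: prob_space ?Q by (rule prob_space_PiM) (rule N)
  have c: "0 < beta_const d (beta_exponent j)" "beta_const d (beta_exponent j) < \<infinity>" for j
    using beta_const_pos beta_const_finite beta_exponent by auto
  have snd_m: "snd \<in> ?N \<rightarrow>\<^sub>M borel"
    using measurable_snd[of \<Omega> ?\<sigma>] by (simp add: measurable_cong_sets[OF refl sets_uniform_sphere])
  have f_m: "(\<lambda>z. Yseq j (fst z) *\<^sub>R snd z) \<in> ?N \<rightarrow>\<^sub>M borel" for j
    by (intro scaleR_fun_measurable snd_m measurable_compose[OF measurable_fst Ym])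
  have beta: "beta_law d (beta_exponent j) = distr ?N borel (\<lambda>z. Yseq j (fst z) *\<^sub>R snd z)" for j
  proof -
    have s: "(\<lambda>(r, \<theta>). r *\<^sub>R \<theta>) \<in> (borel :: real measure) \<Otimes>\<^sub>M ?\<sigma> \<rightarrow>\<^sub>M borel"
    proof -
      have "(\<lambda>(r, \<theta>). r *\<^sub>R \<theta>) \<in> (borel :: real measure) \<Otimes>\<^sub>M borel \<rightarrow>\<^sub>M (borel :: (nat \<Rightarrow> real) measure)"
        by measurable
      then show ?thesis
        by (simp add: measurable_cong_sets[OF sets_pair_measure_cong[OF refl sets_uniform_sphere] refl])
    qed
    have p: "(\<lambda>(w, \<theta>). (Yseq j w, \<theta>)) \<in> ?N \<rightarrow>\<^sub>M borel \<Otimes>\<^sub>M ?\<sigma>"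
      unfolding case_prod_beta
      by (intro measurable_Pair measurable_compose[OF measurable_fst Ym] measurable_snd)
    have "distr \<Omega> borel (Yseq j) \<Otimes>\<^sub>M distr ?\<sigma> ?\<sigma> (\<lambda>x. x) = distr ?N (borel \<Otimes>\<^sub>M ?\<sigma>) (\<lambda>(w, \<theta>). (Yseq j w, \<theta>))"
    proof (rule pair_measure_distr)
      show "sigma_finite_measure (distr ?\<sigma> ?\<sigma> (\<lambda>x. x))"
        by (simp add: distr_id S.sigma_finite_measure_axioms)
    qed (use Ym in auto)
    then have "distr (beta_law d (beta_exponent j)) borel (enorm d) \<Otimes>\<^sub>M ?\<sigma> = distr ?N (borel \<Otimes>\<^sub>M ?\<sigma>) (\<lambda>(w, \<theta>). (Yseq j w, \<theta>))"
      by (simp add: Yd distr_id)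
    then have "beta_law d (beta_exponent j) = distr (distr ?N (borel \<Otimes>\<^sub>M ?\<sigma>) (\<lambda>(w, \<theta>). (Yseq j w, \<theta>))) borel (\<lambda>(r, \<theta>). r *\<^sub>R \<theta>)"
      using beta_law_polar[OF _ c, of j] d by simp
    also have "\<dots> = distr ?N borel ((\<lambda>(r, \<theta>). r *\<^sub>R \<theta>) \<circ> (\<lambda>(w, \<theta>). (Yseq j w, \<theta>)))"
      by (rule distr_distr[OF s p])
    finally show ?thesis by (simp add: comp_def case_prod_beta)
  qed
  have sphere: "?\<sigma> = distr ?N borel snd"
  proof (rule measure_eqI)
    fix A assume "A \<in> sets ?\<sigma>"
    then have A: "A \<in> sets ?\<sigma>" "A \<in> sets borel" by simp_all
    have "snd -` A \<inter> space ?N = space \<Omega> \<times> A"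
      using sets.sets_into_space[OF A(1)] by (auto simp: space_pair_measure)
    then show "emeasure ?\<sigma> A = emeasure (distr ?N borel snd) A"
      using A O.emeasure_space_1 by (simp add: emeasure_distr[OF snd_m] S.emeasure_pair_measure_Times)
  qed simp
  let ?T = "\<lambda>j q i. if i < n then Yseq j (fst (q i)) *\<^sub>R snd (q i) else (0 :: nat \<Rightarrow> real)"
  let ?S = "\<lambda>q i. if i < n then snd (q i) else (0 :: nat \<Rightarrow> real)"
  have lawj: "law n (beta_law d (beta_exponent j)) = distr ?Q borel (?T j)" for j
    unfolding beta by (rule law_distr[OF N f_m])
  have law0: "law n ?\<sigma> = distr ?Q borel ?S"
    by (subst sphere) (rule law_distr[OF N snd_m])
  have tm: "(\<lambda>q i. if i < n then f (q i) else 0) \<in> ?Q \<rightarrow>\<^sub>M (borel :: (nat \<Rightarrow> nat \<Rightarrow> real) measure)"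
    if "f \<in> ?N \<rightarrow>\<^sub>M borel" for f
  proof (rule measurable_coordinatewise_then_product)
    show "(\<lambda>q. if i < n then f (q i) else 0) \<in> ?Q \<rightarrow>\<^sub>M borel" for i
      using measurable_compose[OF measurable_component_singleton[of i "{..<n}" "\<lambda>_. ?N"] that]
      by (cases "i < n") simp_all
  qed
  have Tm: "?T j \<in> ?Q \<rightarrow>\<^sub>M borel" for j by (rule tm[OF f_m])
  have T0m: "?S \<in> ?Q \<rightarrow>\<^sub>M borel" by (rule tm[OF snd_m])
  have aeY: "AE q in ?Q. \<forall>i\<in>{..<n}. (\<lambda>j. Yseq j (fst (q i))) \<longlonglongrightarrow> 1"
  proof (rule eventually_ball_finite, simp, rule ballI)
    fix i assume i: "i \<in> {..<n}"
    have "AE w in \<Omega>. (\<lambda>j. Yseq j w) \<longlonglongrightarrow> 1"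
      using Y1 AE_space by eventually_elim (use Yl in force)
    then have "AE w in distr ?N \<Omega> fst. (\<lambda>j. Yseq j w) \<longlonglongrightarrow> 1"
      unfolding S.distr_pair_fst .
    then have "AE z in ?N. (\<lambda>j. Yseq j (fst z)) \<longlonglongrightarrow> 1"
      by (rule AE_distrD[OF measurable_fst])
    then show "AE q in ?Q. (\<lambda>j. Yseq j (fst (q i))) \<longlonglongrightarrow> 1"
      by (rule AE_PiM_component[OF N i])
  qed
  \<comment> \<open>Rows of a beta configuration are multiples of the directions. A nontrivial
    relation among the columns of the direction matrix would hold for the beta configuration as
    well, where it is almost surely excluded.\<close>
  have aeD: "AE q in ?Q. mdet d (?S q) \<noteq> 0"
  proof -
    have "AE q in ?Q. mdet d (?T 0 q) \<noteq> 0"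
      using AE_law_beta_mdet[OF c n, of 0] unfolding lawj by (rule AE_distrD[OF Tm])
    then show ?thesis
    proof eventually_elim
      case (elim q)
      show ?case
      proof (rule mdet_nonzeroI)
        fix v :: "nat \<Rightarrow> real" and l assume v: "\<And>i. i < d \<Longrightarrow> (\<Sum>j<d. ?S q i j * v j) = 0" and l: "l < d"
        show "v l = 0"
        proof (rule mdet_nonzeroD[OF elim _ l])
          fix i assume i: "i < d"
          have "(\<Sum>j<d. ?T 0 q i j * v j) = Yseq 0 (fst (q i)) * (\<Sum>j<d. ?S q i j * v j)"
            using i n by (simp add: scaleR_fun_def sum_distrib_left mult.assoc)
          then show "(\<Sum>j<d. ?T 0 q i j * v j) = 0" using v[OF i] by simp
        qed
      qed
    qed
  qed
  have aeA: "AE q in ?Q. \<forall>j\<in>{d..<n}. above d (?S q) (?S q j) \<noteq> 0"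
  proof (rule eventually_ball_finite, simp, rule ballI)
    fix j assume j: "j \<in> {d..<n}"
    have "AE x in law n ?\<sigma>. above d x (x j) \<noteq> 0"
      by (rule AE_law_above[OF prob_space_uniform_sphere sets_uniform_sphere sphere_hyperplane_null[OF d]]) (use j in auto)
    then show "AE q in ?Q. above d (?S q) (?S q j) \<noteq> 0"
      unfolding law0 by (rule AE_distrD[OF T0m])
  qed
  let ?E = "facet_set d n"
  have mj: "measure (law n (beta_law d (beta_exponent j))) ?E = (\<integral>q. indicator ?E (?T j q) \<partial>?Q)" for j
    unfolding lawj using integral_distr[OF Tm, of "indicator ?E :: _ \<Rightarrow> real"] by simp
  have m0: "measure (law n ?\<sigma>) ?E = (\<integral>q. indicator ?E (?S q) \<partial>?Q)"
    unfolding law0 using integral_distr[OF T0m, of "indicator ?E :: _ \<Rightarrow> real"] by simp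
  have "{x \<in> space borel. mdet d x \<noteq> 0} \<in> sets borel"
    by measurable
  then show "AE x in law n ?\<sigma>. mdet d x \<noteq> 0"
    unfolding law0 using aeD by (subst AE_distr_iff[OF T0m]) simp_all
  show "(\<lambda>j. measure (law n (beta_law d (beta_exponent j))) (facet_set d n)) \<longlonglongrightarrow> measure (law n ?\<sigma>) (facet_set d n)"
    unfolding mj m0
  proof (rule integral_dominated_convergence[where w = "\<lambda>_. 1"])
    show "(\<lambda>q. indicator ?E (?S q) :: real) \<in> borel_measurable ?Q"
      by (rule measurable_compose[OF T0m]) simp
    show "(\<lambda>q. indicator ?E (?T j q) :: real) \<in> borel_measurable ?Q" for j
      by (rule measurable_compose[OF Tm]) simp
    show "AE q in ?Q. norm (indicator ?E (?T j q) :: real) \<le> 1" for j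
      by (simp add: indicator_def)
    show "AE q in ?Q. (\<lambda>j. indicator ?E (?T j q) :: real) \<longlonglongrightarrow> indicator ?E (?S q)"
      using aeY aeD aeA
    proof eventually_elim
      case (elim q)
      show ?case
      proof (rule facet_set_indicator_tendsto[OF _ elim(2)])
        fix i l
        show "(\<lambda>j. ?T j q i l) \<longlonglongrightarrow> ?S q i l"
        proof (cases "i < n")
          case True
          then have "(\<lambda>j. Yseq j (fst (q i)) * snd (q i) l) \<longlonglongrightarrow> 1 * snd (q i) l"
            using elim(1) by (intro tendsto_mult tendsto_const) auto
          then show ?thesis using True by (simp add: scaleR_fun_def)
        qed simp
      qed (use elim(3) in auto)
    qed
  qed simp
qed

section \<open>The facet probability on the sphere as a quotient of real integrals\<close>

definition rphi :: "real \<Rightarrow> real \<Rightarrow> real"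
  where "rphi e h = (if h\<^sup>2 < 1 then (1 - h\<^sup>2) powr e else 0)"

lemma rphi_nonneg [simp]: "0 \<le> rphi e h"
  by (simp add: rphi_def)

lemma phi_eq_rphi: "phi e (h\<^sup>2) = ennreal (rphi e h)"
  by (simp add: phi_def rphi_def)

lemma rphi_minus [simp]: "rphi e (- h) = rphi e h"
  by (simp add: rphi_def)

lemma rphi_measurable [measurable]: "rphi e \<in> borel_measurable borel"
  unfolding rphi_def [abs_def] by measurable

lemma integrable_rphi:
  assumes "e > -1"
  shows "integrable lborel (rphi e)"
proof (rule integrableI_nonneg)
  show "(\<integral>\<^sup>+h. ennreal (rphi e h) \<partial>lborel) < \<infinity>"
    using weight_integral_finite[OF assms] by (simp add: weight_integral_def phi_eq_rphi)
qed auto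

lemma integrable_rphi_bounded:
  assumes e: "e > -1" and f: "f \<in> borel_measurable borel" and le: "\<And>h. \<bar>f h\<bar> \<le> C"
  shows "integrable lborel (\<lambda>h. f h * rphi e h)"
proof (rule Bochner_Integration.integrable_bound)
  show "integrable lborel (\<lambda>h. C * rphi e h)"
    using integrable_rphi[OF e] by simp
  show "(\<lambda>h. f h * rphi e h) \<in> borel_measurable lborel" using f by simp
  have "norm (f h * rphi e h) \<le> norm (C * rphi e h)" for h
  proof -
    have "C \<ge> 0" using le[of 0] by linarith
    then show ?thesis using le[of h] by (simp add: abs_mult mult_right_mono)
  qed
  then show "AE h in lborel. norm (f h * rphi e h) \<le> norm (C * rphi e h)" by simp
qed

lemma integrable_rphi_indicator:
  assumes "e > -1" and "S \<in> sets borel"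
  shows "integrable lborel (\<lambda>h. indicator S h * rphi e h)"
  by (rule integrable_rphi_bounded[where C = 1]) (use assms in \<open>auto simp: indicator_def\<close>)

definition arc_int :: "real \<Rightarrow> real \<Rightarrow> real"
  where "arc_int e h = (\<integral>t. indicator {0..<h} t * rphi e t \<partial>lborel)"

lemma nn_integral_rphi_indicator:
  assumes "e > -1" "S \<in> sets borel"
  shows "(\<integral>\<^sup>+t. indicator S t * phi e (t\<^sup>2) \<partial>lborel) = ennreal (\<integral>t. indicator S t * rphi e t \<partial>lborel)"
proof -
  have "(\<integral>\<^sup>+t. indicator S t * phi e (t\<^sup>2) \<partial>lborel) = (\<integral>\<^sup>+t. ennreal (indicator S t * rphi e t) \<partial>lborel)"
    by (intro nn_integral_cong) (simp add: phi_eq_rphi indicator_def)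
  also have "\<dots> = ennreal (\<integral>t. indicator S t * rphi e t \<partial>lborel)"
    using integrable_rphi_indicator[OF assms] by (intro nn_integral_eq_integral) auto
  finally show ?thesis .
qed

lemma integral_reflect_rphi:
  "(\<integral>t. f (- t) * rphi e t \<partial>lborel) = (\<integral>t. f t * rphi e t \<partial>lborel)"
  using lborel_integral_real_affine[of "-1" "\<lambda>t. f t * rphi e t" 0] by simp

lemma AE_lborel_neq: "AE t in lborel. t \<noteq> (c::real)"
  using AE_lborel_singleton[of c] by simp

lemma halfline_integrals:
  assumes e: "e > -1" and h: "h \<ge> 0"
  shows "(\<integral>t. indicator {..<h} t * rphi e t \<partial>lborel) = arc_int e 1 + arc_int e h"
    "(\<integral>t. indicator {h<..} t * rphi e t \<partial>lborel) = arc_int e 1 - arc_int e h"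
proof -
  note int = integrable_rphi_indicator[OF e]
  have right: "(\<integral>t. indicator {0..} t * rphi e t \<partial>lborel) = arc_int e 1"
    unfolding arc_int_def
    by (intro Bochner_Integration.integral_cong refl) (auto simp: indicator_def rphi_def abs_square_less_1)
  have "(\<integral>t. indicator {..<0} t * rphi e t \<partial>lborel) = (\<integral>t. indicator {..<0} (- t) * rphi e t \<partial>lborel)"
    by (rule integral_reflect_rphi[symmetric])
  also have "\<dots> = (\<integral>t. indicator {0..} t * rphi e t \<partial>lborel)"
    by (intro integral_cong_AE) (use AE_lborel_neq[of 0] in \<open>auto simp: indicator_def elim!: eventually_mono\<close>)
  finally have left: "(\<integral>t. indicator {..<0} t * rphi e t \<partial>lborel) = arc_int e 1" using right by simp
  have "(\<integral>t. indicator {..<h} t * rphi e t \<partial>lborel) = (\<integral>t. indicator {..<0} t * rphi e t + indicator {0..<h} t * rphi e t \<partial>lborel)"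
    using h by (intro Bochner_Integration.integral_cong refl) (auto simp: indicator_def)
  also have "\<dots> = arc_int e 1 + arc_int e h"
    unfolding left[symmetric] unfolding arc_int_def by (rule Bochner_Integration.integral_add) (auto intro: int)
  finally show "(\<integral>t. indicator {..<h} t * rphi e t \<partial>lborel) = arc_int e 1 + arc_int e h" .
  have "(\<integral>t. indicator {h<..} t * rphi e t \<partial>lborel) = (\<integral>t. indicator {0..} t * rphi e t - indicator {0..<h} t * rphi e t \<partial>lborel)"
    using h by (intro integral_cong_AE) (use AE_lborel_neq[of h] in \<open>auto simp: indicator_def elim!: eventually_mono\<close>)
  also have "\<dots> = arc_int e 1 - arc_int e h"
    unfolding right[symmetric] unfolding arc_int_def by (rule Bochner_Integration.integral_diff) (auto intro: int)
  finally show "(\<integral>t. indicator {h<..} t * rphi e t \<partial>lborel) = arc_int e 1 - arc_int e h" .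
qed

lemma halfline_reflect:
  "(\<integral>t. indicator {..<- h} t * rphi e t \<partial>lborel) = (\<integral>t. indicator {h<..} t * rphi e t \<partial>lborel)"
  "(\<integral>t. indicator {- h<..} t * rphi e t \<partial>lborel) = (\<integral>t. indicator {..<h} t * rphi e t \<partial>lborel)"
proof -
  have "(\<integral>t. indicator {..<- h} t * rphi e t \<partial>lborel) = (\<integral>t. indicator {..<- h} (- t) * rphi e t \<partial>lborel)"
    "(\<integral>t. indicator {- h<..} t * rphi e t \<partial>lborel) = (\<integral>t. indicator {- h<..} (- t) * rphi e t \<partial>lborel)"
    by (rule integral_reflect_rphi[symmetric])+
  then show "(\<integral>t. indicator {..<- h} t * rphi e t \<partial>lborel) = (\<integral>t. indicator {h<..} t * rphi e t \<partial>lborel)"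
    "(\<integral>t. indicator {- h<..} t * rphi e t \<partial>lborel) = (\<integral>t. indicator {..<h} t * rphi e t \<partial>lborel)"
    by (simp_all add: indicator_def)
qed

lemma integral_rphi_pos:
  assumes "e > -1"
  shows "(\<integral>t. rphi e t \<partial>lborel) > 0"
proof -
  have "weight_integral e = ennreal (\<integral>t. rphi e t \<partial>lborel)"
    unfolding weight_integral_def phi_eq_rphi using integrable_rphi[OF assms] by (intro nn_integral_eq_integral) auto
  then show ?thesis using weight_integral_pos[of e] by (simp add: ennreal_less_zero_iff)
qed

lemma integral_rphi_eq_arc:
  assumes "e > -1"
  shows "(\<integral>t. rphi e t \<partial>lborel) = 2 * arc_int e 1"
proof -
  have "(\<integral>t. rphi e t \<partial>lborel) = (\<integral>t. indicator {..<0} t * rphi e t + indicator {0<..} t * rphi e t \<partial>lborel)"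
    by (intro integral_cong_AE) (use AE_lborel_neq[of 0] in \<open>auto simp: indicator_def elim!: eventually_mono\<close>)
  also have "\<dots> = (\<integral>t. indicator {..<0} t * rphi e t \<partial>lborel) + (\<integral>t. indicator {0<..} t * rphi e t \<partial>lborel)"
    by (rule Bochner_Integration.integral_add) (auto intro: integrable_rphi_indicator[OF assms])
  also have "\<dots> = 2 * arc_int e 1"
    using halfline_integrals[OF assms, of 0] by (simp add: arc_int_def)
  finally show ?thesis .
qed

lemma arc_one_pos: "e > -1 \<Longrightarrow> arc_int e 1 > 0"
  using integral_rphi_pos integral_rphi_eq_arc by force

lemma arc_nonneg: "0 \<le> arc_int e h"
  unfolding arc_int_def by (intro Bochner_Integration.integral_nonneg) auto

lemma arc_le:
  assumes "e > -1" "h \<ge> 0"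
  shows "arc_int e h \<le> arc_int e 1"
proof -
  have "0 \<le> (\<integral>t. indicator {h<..} t * rphi e t \<partial>lborel)"
    by (intro Bochner_Integration.integral_nonneg) auto
  then show ?thesis using halfline_integrals(2)[OF assms] by simp
qed

text \<open>The X of the overview: the fraction of the weight with exponent e that lies between -|h|
  and |h|. The sides of a hyperplane at distance |h| then have probabilities (1 + X) / 2 and (1 - X)
  / 2.\<close>

definition xfrac :: "real \<Rightarrow> real \<Rightarrow> real"
  where "xfrac e h = arc_int e \<bar>h\<bar> / arc_int e 1"

lemma xfrac_bounds: "e > -1 \<Longrightarrow> 0 \<le> xfrac e h" "e > -1 \<Longrightarrow> xfrac e h \<le> 1"
  using arc_nonneg[of e "\<bar>h\<bar>"] arc_le[of e "\<bar>h\<bar>"] arc_one_pos[of e] by (auto simp: xfrac_def)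

lemma cap_power_sum:
  assumes e: "e > -1"
  shows "cap e h ^ m + cocap e h ^ m = ennreal (((1 + xfrac e h) / 2) ^ m + ((1 - xfrac e h) / 2) ^ m)"
proof -
  have B: "(\<integral>\<^sup>+t. phi e (t\<^sup>2) \<partial>lborel) = ennreal (2 * arc_int e 1)"
    unfolding integral_rphi_eq_arc[OF e, symmetric] phi_eq_rphi
    using integrable_rphi[OF e] by (intro nn_integral_eq_integral) auto
  have p: "arc_int e 1 > 0" by (rule arc_one_pos[OF e])
  have cap: "cap e h = ennreal ((\<integral>t. indicator {..<h} t * rphi e t \<partial>lborel) / (2 * arc_int e 1))" for h
    unfolding cap_def B using p by (subst nn_integral_rphi_indicator[OF e]) (auto simp: divide_ennreal)
  have cocap: "cocap e h = ennreal ((\<integral>t. indicator {h<..} t * rphi e t \<partial>lborel) / (2 * arc_int e 1))" for h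
    unfolding cocap_def B using p by (subst nn_integral_rphi_indicator[OF e]) (auto simp: divide_ennreal)
  have P: "cap e h = ennreal ((1 + xfrac e h) / 2)" "cocap e h = ennreal ((1 - xfrac e h) / 2)" if "h \<ge> 0" for h
    unfolding cap cocap halfline_integrals[OF e that] xfrac_def using p that
    by (simp_all add: field_simps)
  have M: "cap e h = cocap e (- h)" "cocap e h = cap e (- h)" for h
    unfolding cap cocap using halfline_reflect[of "- h" e] by simp_all
  have "cap e h ^ m + cocap e h ^ m = ennreal ((1 + xfrac e h) / 2) ^ m + ennreal ((1 - xfrac e h) / 2) ^ m"
  proof (cases "h \<ge> 0")
    case True
    then show ?thesis by (simp only: P)
  next
    case False
    then have "- h \<ge> 0" by simp
    note P[OF this]
    moreover have "xfrac e (- h) = xfrac e h" by (simp add: xfrac_def)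
    ultimately show ?thesis unfolding M[of h] by (simp only: add.commute)
  qed
  then show ?thesis
    using xfrac_bounds[OF e, of h] by (simp add: ennreal_power ennreal_plus[symmetric] del: ennreal_plus)
qed

lemma rphi_tendsto:
  assumes "e \<longlonglongrightarrow> e0"
  shows "(\<lambda>j. rphi (e j) h) \<longlonglongrightarrow> rphi e0 h"
proof (cases "h\<^sup>2 < 1")
  case True
  then have "(\<lambda>j. (1 - h\<^sup>2) powr e j) \<longlonglongrightarrow> (1 - h\<^sup>2) powr e0"
    using assms by (intro tendsto_powr tendsto_const) auto
  then show ?thesis using True by (simp add: rphi_def)
qed (simp add: rphi_def)

lemma rphi_antimono: "e \<le> e' \<Longrightarrow> rphi e' h \<le> rphi e h"
  by (auto simp: rphi_def intro!: powr_mono')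

text \<open>The limit exponent is the smallest one, so its weight dominates all the others.\<close>

lemma arc_tendsto:
  assumes e: "e \<longlonglongrightarrow> e0" "\<And>j. e0 \<le> e j" "e0 > -1"
  shows "(\<lambda>j. arc_int (e j) h) \<longlonglongrightarrow> arc_int e0 h"
  unfolding arc_int_def
proof (rule integral_dominated_convergence[where w = "rphi e0"])
  show "integrable lborel (rphi e0)" by (rule integrable_rphi[OF e(3)])
  show "AE t in lborel. (\<lambda>j. indicator {0..<h} t * rphi (e j) t) \<longlonglongrightarrow> indicator {0..<h} t * rphi e0 t"
    by (intro AE_I2 tendsto_mult tendsto_const rphi_tendsto e)
  show "AE t in lborel. norm (indicator {0..<h} t * rphi (e j) t) \<le> rphi e0 t" for j
    using rphi_antimono[OF e(2)] by (intro AE_I2) (auto simp: indicator_def)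
qed auto

lemma arc_measurable [measurable]: "arc_int e \<in> borel_measurable borel"
proof -
  have "(\<lambda>h. \<integral>t. (if 0 \<le> t \<and> t < h then rphi e t else 0) \<partial>lborel) \<in> borel_measurable borel"
    by measurable
  also have "(\<lambda>h. \<integral>t. (if 0 \<le> t \<and> t < h then rphi e t else 0) \<partial>lborel) = arc_int e"
    unfolding arc_int_def by (auto simp: fun_eq_iff indicator_def intro!: Bochner_Integration.integral_cong)
  finally show ?thesis .
qed

lemma xfrac_measurable [measurable]: "xfrac e \<in> borel_measurable borel"
  unfolding xfrac_def [abs_def] by measurable

definition facet_integrand :: "real \<Rightarrow> nat \<Rightarrow> real \<Rightarrow> real"
  where "facet_integrand e m h = ((1 + xfrac e h) / 2) ^ m + ((1 - xfrac e h) / 2) ^ m"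

lemma facet_integrand_measurable [measurable]: "facet_integrand e m \<in> borel_measurable borel"
  unfolding facet_integrand_def [abs_def] by measurable

lemma facet_integrand_bounds:
  assumes "e > -1"
  shows "0 \<le> facet_integrand e m h" "facet_integrand e m h \<le> 2"
proof -
  have "0 \<le> (1 + xfrac e h) / 2" "(1 + xfrac e h) / 2 \<le> 1" "0 \<le> (1 - xfrac e h) / 2" "(1 - xfrac e h) / 2 \<le> 1"
    using xfrac_bounds[OF assms, of h] by auto
  then have "0 \<le> ((1 + xfrac e h) / 2) ^ m" "((1 + xfrac e h) / 2) ^ m \<le> 1"
    "0 \<le> ((1 - xfrac e h) / 2) ^ m" "((1 - xfrac e h) / 2) ^ m \<le> 1"
    by (auto intro: power_le_one)
  then show "0 \<le> facet_integrand e m h" "facet_integrand e m h \<le> 2"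
    by (simp_all add: facet_integrand_def)
qed

lemma beta_law_facet_measure:
  assumes \<beta>: "\<beta> > -1" and m: "m > 0" and a: "\<beta> + real k / 2 > -1" and e: "hexp k \<beta> > -1"
  shows "measure (law (Suc k + m) (beta_law (Suc k) \<beta>)) (facet_set (Suc k) (Suc k + m)) =
    (\<integral>h. facet_integrand (\<beta> + real k / 2) m h * rphi (hexp k \<beta>) h \<partial>lborel) / (\<integral>h. rphi (hexp k \<beta>) h \<partial>lborel)"
proof -
  let ?a = "\<beta> + real k / 2" and ?e = "hexp k \<beta>"
  have int: "integrable lborel (\<lambda>h. facet_integrand ?a m h * rphi ?e h)"
    by (rule integrable_rphi_bounded[OF e facet_integrand_measurable, where C = 2]) (use facet_integrand_bounds[OF a] in auto)
  have "(\<integral>\<^sup>+h. (cap ?a h ^ m + cocap ?a h ^ m) * phi ?e (h\<^sup>2) \<partial>lborel) = (\<integral>\<^sup>+h. ennreal (facet_integrand ?a m h * rphi ?e h) \<partial>lborel)"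
    using facet_integrand_bounds[OF a]
    by (intro nn_integral_cong) (simp add: cap_power_sum[OF a] phi_eq_rphi facet_integrand_def[symmetric] ennreal_mult)
  also have "\<dots> = ennreal (\<integral>h. facet_integrand ?a m h * rphi ?e h \<partial>lborel)"
    using int facet_integrand_bounds[OF a] by (intro nn_integral_eq_integral) auto
  finally have 1: "(\<integral>\<^sup>+h. (cap ?a h ^ m + cocap ?a h ^ m) * phi ?e (h\<^sup>2) \<partial>lborel) = ennreal (\<integral>h. facet_integrand ?a m h * rphi ?e h \<partial>lborel)" .
  have 2: "(\<integral>\<^sup>+h. phi ?e (h\<^sup>2) \<partial>lborel) = ennreal (\<integral>h. rphi ?e h \<partial>lborel)"
    unfolding phi_eq_rphi using integrable_rphi[OF e] by (intro nn_integral_eq_integral) auto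
  have "0 \<le> (\<integral>h. facet_integrand ?a m h * rphi ?e h \<partial>lborel)"
    using facet_integrand_bounds[OF a] by (intro Bochner_Integration.integral_nonneg) auto
  then show ?thesis
    unfolding measure_def
    by (subst beta_law_facet_set[OF beta_const_pos beta_const_finite[OF \<beta>] m])
      (use integral_rphi_pos[OF e] in \<open>simp add: 1 2 divide_ennreal\<close>)
qed

text \<open>At \<beta> = -1 the exponents \<beta> + k / 2 and \<open>hexp k \<beta>\<close> become k
  / 2 - 1 and (k^2 - 2) / 2. For k at least 1 both exceed -1, so these integrals converge although
  the beta density itself is no longer integrable.\<close>

lemma sphere_facet_measure:
  assumes k: "k \<ge> 1" and m: "m > 0"
  shows "measure (law (Suc k + m) (uniform_sphere (Suc k))) (facet_set (Suc k) (Suc k + m)) =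
    (\<integral>h. facet_integrand (real k / 2 - 1) m h * rphi ((real k ^ 2 - 2) / 2) h \<partial>lborel) /
    (\<integral>h. rphi ((real k ^ 2 - 2) / 2) h \<partial>lborel)"
proof -
  let ?a = "\<lambda>j. beta_exponent j + real k / 2" and ?e = "\<lambda>j. hexp k (beta_exponent j)"
  let ?al = "real k / 2 - 1" and ?el = "(real k ^ 2 - 2) / 2"
  have bl: "beta_exponent \<longlonglongrightarrow> -1"
  proof -
    have "(\<lambda>j. inverse (real (j + 2))) \<longlonglongrightarrow> 0"
      by (rule LIMSEQ_ignore_initial_segment[OF lim_inverse_n])
    then have "(\<lambda>j. -1 + inverse (real (j + 2))) \<longlonglongrightarrow> -1 + 0"
      by (intro tendsto_add tendsto_const)
    then show ?thesis by (simp add: beta_exponent_def[abs_def] inverse_eq_divide)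
  qed
  have a: "?a \<longlonglongrightarrow> ?al"
    using tendsto_add[OF bl tendsto_const, of "real k / 2"] by simp
  have e0: "?el = hexp k (-1)"
    by (simp add: hexp_def algebra_simps power2_eq_square) (simp add: field_simps)
  have e: "?e \<longlonglongrightarrow> ?el"
    unfolding e0 unfolding hexp_def by (intro tendsto_intros bl)
  have a_ge: "?al \<le> ?a j" for j using beta_exponent(1)[of j] by simp
  have e_ge: "?el \<le> ?e j" for j
    unfolding e0 hexp_def using beta_exponent(1)[of j] by (intro add_mono mult_right_mono) auto
  have a_gt: "?al > -1" using k by simp
  have e_gt: "?el > -1"
  proof -
    have "(1::real) ^ 2 \<le> real k ^ 2" using k by (intro power_mono) auto
    then show ?thesis using k by simp
  qed
  have x: "(\<lambda>j. facet_integrand (?a j) m h) \<longlonglongrightarrow> facet_integrand ?al m h" for h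
    unfolding facet_integrand_def xfrac_def
    using arc_one_pos[OF a_gt] by (intro tendsto_intros arc_tendsto[OF a a_ge a_gt]) auto
  have lim1: "(\<lambda>j. \<integral>h. facet_integrand (?a j) m h * rphi (?e j) h \<partial>lborel) \<longlonglongrightarrow> (\<integral>h. facet_integrand ?al m h * rphi ?el h \<partial>lborel)"
  proof (rule integral_dominated_convergence[where w = "\<lambda>h. 2 * rphi ?el h"])
    show "integrable lborel (\<lambda>h. 2 * rphi ?el h)" using integrable_rphi[OF e_gt] by simp
    show "AE h in lborel. (\<lambda>j. facet_integrand (?a j) m h * rphi (?e j) h) \<longlonglongrightarrow> facet_integrand ?al m h * rphi ?el h"
      by (intro AE_I2 tendsto_mult x rphi_tendsto e)
    show "AE h in lborel. norm (facet_integrand (?a j) m h * rphi (?e j) h) \<le> 2 * rphi ?el h" for j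
    proof (intro AE_I2)
      fix h
      have "?a j > -1" using a_gt a_ge[of j] by linarith
      from facet_integrand_bounds[OF this, of m h] show "norm (facet_integrand (?a j) m h * rphi (?e j) h) \<le> 2 * rphi ?el h"
        using rphi_antimono[OF e_ge, of j h] by (simp add: abs_mult mult_mono)
    qed
  qed auto
  have lim2: "(\<lambda>j. \<integral>h. rphi (?e j) h \<partial>lborel) \<longlonglongrightarrow> (\<integral>h. rphi ?el h \<partial>lborel)"
  proof (rule integral_dominated_convergence[where w = "rphi ?el"])
    show "integrable lborel (rphi ?el)" by (rule integrable_rphi[OF e_gt])
    show "AE h in lborel. (\<lambda>j. rphi (?e j) h) \<longlonglongrightarrow> rphi ?el h"
      by (intro AE_I2 rphi_tendsto e)
    show "AE h in lborel. norm (rphi (?e j) h) \<le> rphi ?el h" for j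
      using rphi_antimono[OF e_ge] by (intro AE_I2) auto
  qed auto
  have "measure (law (Suc k + m) (beta_law (Suc k) (beta_exponent j))) (facet_set (Suc k) (Suc k + m)) =
    (\<integral>h. facet_integrand (?a j) m h * rphi (?e j) h \<partial>lborel) / (\<integral>h. rphi (?e j) h \<partial>lborel)" for j
    by (rule beta_law_facet_measure[OF beta_exponent(1) m]) (use a_gt a_ge[of j] e_gt e_ge[of j] in linarith)+
  moreover have "(\<lambda>j. (\<integral>h. facet_integrand (?a j) m h * rphi (?e j) h \<partial>lborel) / (\<integral>h. rphi (?e j) h \<partial>lborel)) \<longlonglongrightarrow>
    (\<integral>h. facet_integrand ?al m h * rphi ?el h \<partial>lborel) / (\<integral>h. rphi ?el h \<partial>lborel)"
    using integral_rphi_pos[OF e_gt] by (intro tendsto_divide lim1 lim2) auto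
  moreover have "(\<lambda>j. measure (law (Suc k + m) (beta_law (Suc k) (beta_exponent j))) (facet_set (Suc k) (Suc k + m))) \<longlonglongrightarrow>
    measure (law (Suc k + m) (uniform_sphere (Suc k))) (facet_set (Suc k) (Suc k + m))"
    by (rule sphere_facet_limit) (use k in auto)
  ultimately show ?thesis
    using LIMSEQ_unique by (metis (no_types, lifting) ext)
qed

text \<open>Agrees with \<open>rphi\<close> on the open interval but is not cut off outside. For
  positive e it is continuous on [-1, 1], which suits the gauge integral and the fundamental theorem
  of calculus.\<close>

definition wt :: "real \<Rightarrow> real \<Rightarrow> real"
  where "wt e h = (1 - h\<^sup>2) powr e"

lemma one_minus_sq_nonneg: "h \<in> {-1..1} \<Longrightarrow> 0 \<le> 1 - (h::real)\<^sup>2"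
  by (simp add: abs_square_le_1 abs_le_iff)

lemma one_minus_sq_pos: "h \<in> {-1<..<1} \<Longrightarrow> 0 < 1 - (h::real)\<^sup>2"
  by (simp add: abs_square_less_1 abs_less_iff)

lemma wt_continuous: "e > 0 \<Longrightarrow> continuous_on {-1..1} (wt e)"
  unfolding wt_def using one_minus_sq_nonneg by (intro continuous_intros continuous_on_powr') auto

lemma wt_nonneg [simp]: "0 \<le> wt e h"
  by (simp add: wt_def)

lemma wt_Suc: "h \<in> {-1..1} \<Longrightarrow> e > 0 \<Longrightarrow> wt (e + 1) h = (1 - h\<^sup>2) * wt e h"
proof -
  assume h: "h \<in> {-1..1}" and e: "e > 0"
  show ?thesis
  proof (cases "1 - h\<^sup>2 = 0")
    case False
    then have "1 - h\<^sup>2 > 0" using one_minus_sq_nonneg[OF h] by linarith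
    then show ?thesis by (simp add: wt_def powr_add)
  qed (simp add: wt_def)
qed

lemma DERIV_wt:
  assumes "h \<in> {-1<..<1}"
  shows "(wt (e + 1) has_real_derivative - (2 * (e + 1) * h * wt e h)) (at h)"
proof -
  have "((\<lambda>h. (1 - h\<^sup>2) powr (e + 1)) has_real_derivative (e + 1) * (1 - h\<^sup>2) powr (e + 1 - 1) * (- (2 * h))) (at h)"
    by (rule DERIV_chain2[OF has_real_derivative_powr]) (use one_minus_sq_pos[OF assms] in \<open>auto intro!: derivative_eq_intros\<close>)
  then show ?thesis by (simp add: wt_def[abs_def] algebra_simps)
qed

subsection \<open>Wallis integrals\<close>

definition wallis_integral :: "real \<Rightarrow> real"
  where "wallis_integral e = integral {0..1} (wt e)"

text \<open>Integrate the derivative of t (1 - t^2)^(e + 1), rewriting t^2 as 1 - (1 - t^2).\<close>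

lemma wallis_integral_recurrence:
  assumes e: "e \<ge> 0"
  shows "wt e integrable_on {0..1}" "(2 * e + 3) * wallis_integral (e + 1) = (2 * e + 2) * wallis_integral e"
proof -
  have c1: "wt (e + 1) integrable_on {0..1}"
    using e by (intro integrable_continuous_real continuous_on_subset[OF wt_continuous]) auto
  show c0: "wt e integrable_on {0..1}"
  \<comment> \<open>For e = 0 continuity fails at t = 1, because \<open>0 powr 0\<close> is 0;
    elsewhere the integrand is 1.\<close>
  proof (cases "e = 0")
    case True
    show ?thesis
    proof (rule integrable_spike[of "\<lambda>_. 1 :: real" _ "{1}"])
      show "wt e x = 1" if "x \<in> {0..1} - {1}" for x
        using that True one_minus_sq_pos[of x] by (simp add: wt_def)
    qed auto
  next
    case False
    then show ?thesis
      using e by (intro integrable_continuous_real continuous_on_subset[OF wt_continuous]) auto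
  qed
  have "((\<lambda>t. (2 * e + 3) * wt (e + 1) t - (2 * e + 2) * wt e t) has_integral 1 * wt (e + 1) 1 - 0 * wt (e + 1) 0) {0..1}"
  proof (rule fundamental_theorem_of_calculus_interior)
    show "continuous_on {0..1} (\<lambda>t. t * wt (e + 1) t)"
      using e by (intro continuous_intros continuous_on_subset[OF wt_continuous]) auto
    fix x :: real assume x: "x \<in> {0<..<1}"
    then have x': "x \<in> {-1<..<1}" by auto
    have "((\<lambda>t. t * wt (e + 1) t) has_real_derivative 1 * wt (e + 1) x + x * (- (2 * (e + 1) * x * wt e x))) (at x)"
      by (rule DERIV_mult'[OF DERIV_ident DERIV_wt[OF x'], THEN DERIV_cong]) simp
    moreover have w: "wt (e + 1) x = (1 - x\<^sup>2) * wt e x"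
      using one_minus_sq_pos[OF x'] by (simp add: wt_def powr_add)
    have "1 * wt (e + 1) x + x * (- (2 * (e + 1) * x * wt e x)) = (2 * e + 3) * wt (e + 1) x - (2 * e + 2) * wt e x"
      unfolding w by (simp add: algebra_simps power2_eq_square)
    ultimately show "((\<lambda>t. t * wt (e + 1) t) has_vector_derivative (2 * e + 3) * wt (e + 1) x - (2 * e + 2) * wt e x) (at x)"
      by (simp only: has_real_derivative_iff_has_vector_derivative)
  qed simp
  then have i1: "((\<lambda>t. (2 * e + 3) * wt (e + 1) t - (2 * e + 2) * wt e t) has_integral 0) {0..1}"
    by (simp add: wt_def)
  have i2: "((\<lambda>t. (2 * e + 3) * wt (e + 1) t - (2 * e + 2) * wt e t) has_integral (2 * e + 3) * wallis_integral (e + 1) - (2 * e + 2) * wallis_integral e) {0..1}"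
    unfolding wallis_integral_def using c0 c1 by (intro has_integral_diff has_integral_mult_right integrable_integral)
  show "(2 * e + 3) * wallis_integral (e + 1) = (2 * e + 2) * wallis_integral e"
    using has_integral_unique[OF i2 i1] by simp
qed

lemma bint_0: "wallis_integral 0 = 1"
proof -
  have "integral {0..1} (wt 0) = integral {0..1} (\<lambda>_::real. 1::real)"
  proof (rule integral_spike[of "{1}"])
    show "1 = wt 0 x" if "x \<in> {0..1} - {1}" for x
      using that one_minus_sq_pos[of x] by (simp add: wt_def)
  qed simp
  then show ?thesis by (simp add: wallis_integral_def)
qed

lemma wallis_integral_half: "wallis_integral (1/2) = pi / 4"
proof -
  have "(wt (1/2) has_integral (1 * sqrt (1 - 1\<^sup>2) + arcsin 1) / 2 - (0 * sqrt (1 - 0\<^sup>2) + arcsin 0) / 2) {0..1}"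
  proof (rule fundamental_theorem_of_calculus_interior)
    show "continuous_on {0..1} (\<lambda>t. (t * sqrt (1 - t\<^sup>2) + arcsin t) / 2)"
      by (intro continuous_intros continuous_on_arcsin) auto
    fix x :: real assume x: "x \<in> {0<..<1}"
    then have p: "0 < 1 - x\<^sup>2" using one_minus_sq_pos[of x] by auto
    define r where "r = sqrt (1 - x\<^sup>2)"
    have r: "r > 0" "r\<^sup>2 = 1 - x\<^sup>2" using p by (auto simp: r_def)
    have "((\<lambda>t. (t * sqrt (1 - t\<^sup>2) + arcsin t) / 2) has_real_derivative
        ((1 * sqrt (1 - x\<^sup>2) + (inverse (sqrt (1 - x\<^sup>2)) / 2 * (- (2 * x))) * x) + inverse (sqrt (1 - x\<^sup>2))) / 2) (at x)"
    proof -
      have "((\<lambda>t. 1 - t\<^sup>2) has_real_derivative - (2 * x)) (at x)"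
        by (auto intro!: derivative_eq_intros)
      from DERIV_chain2[OF DERIV_real_sqrt[OF p] this]
      have 1: "((\<lambda>t. sqrt (1 - t\<^sup>2)) has_real_derivative inverse (sqrt (1 - x\<^sup>2)) / 2 * (- (2 * x))) (at x)" .
      have 2: "(arcsin has_real_derivative inverse (sqrt (1 - x\<^sup>2))) (at x)"
        using x by (intro DERIV_arcsin) auto
      show ?thesis
        by (rule DERIV_cdivide[OF DERIV_add[OF DERIV_mult[OF DERIV_ident 1] 2]])
    qed
    also have "((1 * sqrt (1 - x\<^sup>2) + (inverse (sqrt (1 - x\<^sup>2)) / 2 * (- (2 * x))) * x) + inverse (sqrt (1 - x\<^sup>2))) / 2 = r"
      unfolding r_def[symmetric] using r by (simp add: field_simps power2_eq_square)
    also have "r = wt (1/2) x" using p by (simp add: r_def wt_def powr_half_sqrt)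
    finally show "((\<lambda>t. (t * sqrt (1 - t\<^sup>2) + arcsin t) / 2) has_vector_derivative wt (1/2) x) (at x)"
      by (simp only: has_real_derivative_iff_has_vector_derivative)
  qed simp
  then have "wallis_integral (1/2) = (1 * sqrt (1 - 1\<^sup>2) + arcsin 1) / 2 - (0 * sqrt (1 - 0\<^sup>2) + arcsin 0) / 2"
    unfolding wallis_integral_def by (rule integral_unique)
  then show ?thesis by simp
qed

text \<open>By the recurrence this product of two neighbours does not change when n grows by 1, so
  it is known exactly although its factors are not evaluated.\<close>

lemma wallis_integral_product: "wallis_integral (real n / 2) * wallis_integral (real n / 2 + 1/2) * (real n / 2 + 1) = pi / 4"
proof (induction n)
  case 0
  then show ?case by (simp add: bint_0 wallis_integral_half[simplified])
next
  case (Suc n)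
  let ?e = "real n / 2"
  have r: "(2 * ?e + 3) * wallis_integral (?e + 1) = (2 * ?e + 2) * wallis_integral ?e"
    by (rule wallis_integral_recurrence) simp
  have E: "real (Suc n) / 2 = ?e + 1/2" "?e + 1/2 + 1/2 = ?e + 1" "?e + 1/2 + 1 = ?e + 3/2"
    by (simp_all add: add_divide_distrib)
  have "wallis_integral (real (Suc n) / 2) * wallis_integral (real (Suc n) / 2 + 1/2) * (real (Suc n) / 2 + 1) =
      wallis_integral (?e + 1/2) * wallis_integral (?e + 1) * (?e + 3/2)"
    by (simp only: E)
  also have "\<dots> = wallis_integral (?e + 1/2) * ((2 * ?e + 3) * wallis_integral (?e + 1)) / 2"
    by (simp add: algebra_simps)
  also have "\<dots> = wallis_integral ?e * wallis_integral (?e + 1/2) * (?e + 1)"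
    unfolding r by (simp add: algebra_simps)
  finally show ?case using Suc by simp
qed

lemma wallis_integral_antimono:
  assumes "0 \<le> e" "e \<le> e'"
  shows "wallis_integral e' \<le> wallis_integral e"
  unfolding wallis_integral_def
proof (rule integral_le)
  show "wt e' t \<le> wt e t" if "t \<in> {0..1}" for t
    using that assms one_minus_sq_nonneg[of t] by (cases "t = 1") (auto simp: wt_def intro!: powr_mono')
qed (use wallis_integral_recurrence(1) assms in auto)

lemma wallis_integral_pos: "wallis_integral (real n / 2) > 0"
proof -
  have "wallis_integral (real n / 2) \<ge> 0"
    unfolding wallis_integral_def by (rule integral_nonneg) (use wallis_integral_recurrence(1) in auto)
  moreover have "wallis_integral (real n / 2) \<noteq> 0"
    using wallis_integral_product[of n] by auto
  ultimately show ?thesis by linarith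
qed

text \<open>The integrals decrease in the exponent, so the square lies between the products with the
  upper and with the lower neighbour, both known exactly. The lower neighbour has exponent (k - 3) /
  2, hence k at least 3.\<close>

lemma wallis_integral_sq_bounds:
  assumes k: "k \<ge> 3"
  shows "pi / (2 * real k) \<le> (wallis_integral (real k / 2 - 1))\<^sup>2" "(wallis_integral (real k / 2 - 1))\<^sup>2 \<le> pi / (2 * (real k - 1))"
proof -
  define n where "n = k - 3"
  have k': "real k = real n + 3" using k by (simp add: n_def)
  let ?b = "wallis_integral (real k / 2 - 1)"
  have e: "real k / 2 - 1 = real (n + 1) / 2" by (simp add: k' field_simps)
  have b: "?b > 0" unfolding e by (rule wallis_integral_pos)
  have "wallis_integral (real (n + 1) / 2 + 1/2) \<le> ?b" unfolding e by (rule wallis_integral_antimono) auto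
  then have "?b * wallis_integral (real (n + 1) / 2 + 1/2) \<le> ?b\<^sup>2"
    using b by (simp add: power2_eq_square)
  moreover have "?b * wallis_integral (real (n + 1) / 2 + 1/2) = pi / (2 * real k)"
  proof -
    have "?b * wallis_integral (real (n + 1) / 2 + 1/2) * (real k / 2) = pi / 4"
      using wallis_integral_product[of "n + 1"] unfolding e by (simp add: k' algebra_simps add_divide_distrib)
    then show ?thesis using k by (simp add: field_simps)
  qed
  ultimately show "pi / (2 * real k) \<le> ?b\<^sup>2" by simp
  have h: "real n / 2 + 1/2 = real (n + 1) / 2" by simp
  have "?b \<le> wallis_integral (real n / 2)" unfolding e by (rule wallis_integral_antimono) auto
  then have "?b\<^sup>2 \<le> wallis_integral (real n / 2) * ?b"
    using b by (simp add: power2_eq_square)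
  moreover have "wallis_integral (real n / 2) * ?b = pi / (2 * (real k - 1))"
  proof -
    have "wallis_integral (real n / 2) * ?b * ((real k - 1) / 2) = pi / 4"
      using wallis_integral_product[of n] unfolding e h by (simp add: k' algebra_simps add_divide_distrib)
    then show ?thesis using k by (simp add: field_simps)
  qed
  ultimately show "?b\<^sup>2 \<le> pi / (2 * (real k - 1))" by simp
qed

subsection \<open>Exponential moments\<close>

definition wint :: "real \<Rightarrow> (real \<Rightarrow> real) \<Rightarrow> real"
  where "wint e f = integral {-1..1} (\<lambda>h. f h * wt e h)"

context
  fixes e :: real
  assumes e: "e > 0"
begin

lemma wint_integrable: "continuous_on {-1..1} f \<Longrightarrow> (\<lambda>h. f h * wt e h) integrable_on {-1..1}"
  using e by (intro integrable_continuous_real continuous_on_mult wt_continuous)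

lemma wint_add: "continuous_on {-1..1} f \<Longrightarrow> continuous_on {-1..1} g \<Longrightarrow> wint e (\<lambda>h. f h + g h) = wint e f + wint e g"
  unfolding wint_def using wint_integrable by (simp add: distrib_right integral_add)

lemma wint_diff: "continuous_on {-1..1} f \<Longrightarrow> continuous_on {-1..1} g \<Longrightarrow> wint e (\<lambda>h. f h - g h) = wint e f - wint e g"
  unfolding wint_def using wint_integrable by (simp add: left_diff_distrib integral_diff)

lemma wint_cmult: "wint e (\<lambda>h. c * f h) = c * wint e f"
  unfolding wint_def by (simp add: mult.assoc)

lemma wint_mono:
  assumes "continuous_on {-1..1} f" "continuous_on {-1..1} g" "\<And>h. h \<in> {-1..1} \<Longrightarrow> f h \<le> g h"
  shows "wint e f \<le> wint e g"
  unfolding wint_def by (rule integral_le) (use assms wint_integrable in \<open>auto intro!: mult_right_mono\<close>)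

lemma wint_nonneg: "continuous_on {-1..1} f \<Longrightarrow> (\<And>h. h \<in> {-1..1} \<Longrightarrow> 0 \<le> f h) \<Longrightarrow> 0 \<le> wint e f"
  unfolding wint_def by (rule integral_nonneg) (use wint_integrable in auto)

text \<open>Boundary terms vanish because \<open>wt (e + 1)\<close> is 0 at both ends. Up to the
  factor 1 - h^2 this is Stein's identity for a Gaussian with variance 1 / (2 e + 2), which is 1 /
  k^2 for the exponent e = (k^2 - 2) / 2.\<close>

lemma wint_by_parts:
  assumes u: "\<And>h. (u has_real_derivative u' h) (at h)" and u': "continuous_on {-1..1} u'"
  shows "wint e (\<lambda>h. (1 - h\<^sup>2) * u' h) = (2 * e + 2) * wint e (\<lambda>h. u h * h)"
proof -
  have uc: "continuous_on {-1..1} u"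
    using u by (auto intro!: continuous_at_imp_continuous_on DERIV_isCont)
  have "((\<lambda>h. (1 - h\<^sup>2) * u' h * wt e h - (2 * e + 2) * (u h * h * wt e h)) has_integral u 1 * wt (e + 1) 1 - u (-1) * wt (e + 1) (-1)) {-1..1}"
  proof (rule fundamental_theorem_of_calculus_interior)
    show "continuous_on {-1..1} (\<lambda>h. u h * wt (e + 1) h)"
      using e by (intro continuous_on_mult uc wt_continuous) auto
    fix x :: real assume x: "x \<in> {-1<..<1}"
    have "((\<lambda>h. u h * wt (e + 1) h) has_real_derivative u' x * wt (e + 1) x + u x * - (2 * (e + 1) * x * wt e x)) (at x)"
      by (rule DERIV_mult'[OF u DERIV_wt[OF x], THEN DERIV_cong]) simp
    moreover have "u' x * wt (e + 1) x + u x * - (2 * (e + 1) * x * wt e x) = (1 - x\<^sup>2) * u' x * wt e x - (2 * e + 2) * (u x * x * wt e x)"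
    proof -
      have w: "wt (e + 1) x = (1 - x\<^sup>2) * wt e x" using x e by (intro wt_Suc) auto
      show ?thesis unfolding w by (simp add: algebra_simps)
    qed
    ultimately show "((\<lambda>h. u h * wt (e + 1) h) has_vector_derivative (1 - x\<^sup>2) * u' x * wt e x - (2 * e + 2) * (u x * x * wt e x)) (at x)"
      by (simp only: has_real_derivative_iff_has_vector_derivative)
  qed simp
  then have i1: "((\<lambda>h. (1 - h\<^sup>2) * u' h * wt e h - (2 * e + 2) * (u h * h * wt e h)) has_integral 0) {-1..1}"
    using e by (simp add: wt_def)
  have i2: "((\<lambda>h. (1 - h\<^sup>2) * u' h * wt e h - (2 * e + 2) * (u h * h * wt e h)) has_integral
      wint e (\<lambda>h. (1 - h\<^sup>2) * u' h) - (2 * e + 2) * wint e (\<lambda>h. u h * h)) {-1..1}"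
    unfolding wint_def
    by (intro has_integral_diff has_integral_mult_right integrable_integral wint_integrable continuous_intros uc u')
  show ?thesis using has_integral_unique[OF i2 i1] by simp
qed

lemma wint_by_parts_le:
  assumes u: "\<And>h. (u has_real_derivative u' h) (at h)" and u': "continuous_on {-1..1} u'"
    and pos: "\<And>h. h \<in> {-1..1} \<Longrightarrow> 0 \<le> u' h"
  shows "(2 * e + 2) * wint e (\<lambda>h. u h * h) \<le> wint e u'"
  unfolding wint_by_parts[OF u u', symmetric]
proof (rule wint_mono)
  show "(1 - h\<^sup>2) * u' h \<le> u' h" if "h \<in> {-1..1}" for h
    using pos[OF that] by (simp add: mult_left_le_one_le algebra_simps)
qed (intro continuous_intros u')+

end

lemma DERIV_sinh_mult: "((\<lambda>h. sinh (l * h)) has_real_derivative l * cosh (l * h)) (at (h::real))"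
  by (auto intro!: derivative_eq_intros)

lemma DERIV_cosh_mult: "((\<lambda>h. cosh (l * h)) has_real_derivative l * sinh (l * h)) (at (h::real))"
  by (auto intro!: derivative_eq_intros)

lemma mult_sinh_nonneg: "0 \<le> (l::real) \<Longrightarrow> 0 \<le> h * sinh (l * h)"
  by (cases "h \<ge> 0") (auto simp: zero_le_mult_iff mult_nonneg_nonpos)

text \<open>A moment generating function without normalisation, the total mass being
  \<open>mgf e 0\<close>; \<open>cosh\<close> replaces the exponential since the weight is
  even.\<close>

definition mgf :: "real \<Rightarrow> real \<Rightarrow> real"
  where "mgf e l = wint e (\<lambda>h. cosh (l * h))"

lemma cont_cosh: "continuous_on S (\<lambda>h::real. cosh (l * h))"
  by (intro continuous_on_cosh continuous_intros)

lemma cont_sinh: "continuous_on S (\<lambda>h::real. sinh (l * h))"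
  by (intro continuous_on_sinh continuous_intros)

lemma DERIV_mgf:
  assumes e: "e > 0"
  shows "(mgf e has_real_derivative wint e (\<lambda>h. h * sinh (l * h))) (at l)"
proof -
  have "((\<lambda>l. integral (cbox (-1) 1) (\<lambda>h. cosh (l * h) * wt e h)) has_field_derivative
      integral (cbox (-1) 1) (\<lambda>h. h * sinh (l * h) * wt e h)) (at l within UNIV)"
  proof (rule leibniz_rule_field_derivative)
    fix x t :: real
    show "((\<lambda>x. cosh (x * t) * wt e t) has_field_derivative t * sinh (x * t) * wt e t) (at x within UNIV)"
      by (auto intro!: derivative_eq_intros)
  next
    show "(\<lambda>h. cosh (x * h) * wt e h) integrable_on cbox (-1) 1" for x
      using wint_integrable[OF e cont_cosh] by simp
    have w: "continuous_on (UNIV \<times> {-1..1}) (\<lambda>p :: real \<times> real. wt e (snd p))"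
      by (rule continuous_on_compose2[OF wt_continuous[OF e]]) (auto intro!: continuous_intros)
    show "continuous_on (UNIV \<times> cbox (-1) 1) (\<lambda>(x, t). t * sinh (x * t) * wt e t)"
      unfolding case_prod_beta box_real by (intro continuous_intros continuous_on_sinh w)
  qed auto
  then show ?thesis by (simp add: mgf_def[abs_def] wint_def)
qed

context
  fixes e l :: real
  assumes e: "e > 0" and l: "l \<ge> 0"
begin

text \<open>Partial integration with u = sinh (l h). The integral on the left is the derivative of
  \<open>mgf e\<close>, so this is a differential inequality; the exact form keeps the second
  moment, which the lower bound needs.\<close>

lemma moment_sinh: "(2 * e + 2) * wint e (\<lambda>h. h * sinh (l * h)) \<le> l * mgf e l"
  and moment_sinh_eq: "(2 * e + 2) * wint e (\<lambda>h. h * sinh (l * h)) = l * (mgf e l - wint e (\<lambda>h. h\<^sup>2 * cosh (l * h)))"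
proof -
  have "wint e (\<lambda>h. (1 - h\<^sup>2) * (l * cosh (l * h))) = (2 * e + 2) * wint e (\<lambda>h. sinh (l * h) * h)"
    by (rule wint_by_parts[OF e DERIV_sinh_mult]) (intro continuous_intros cont_cosh)
  also have "(\<lambda>h. (1 - h\<^sup>2) * (l * cosh (l * h))) = (\<lambda>h. l * (cosh (l * h) - h\<^sup>2 * cosh (l * h)))"
    by (simp add: fun_eq_iff algebra_simps)
  also have "wint e \<dots> = l * (mgf e l - wint e (\<lambda>h. h\<^sup>2 * cosh (l * h)))"
    unfolding mgf_def by (simp add: wint_cmult[OF e] wint_diff[OF e] cont_cosh continuous_intros)
  finally show eq: "(2 * e + 2) * wint e (\<lambda>h. h * sinh (l * h)) = l * (mgf e l - wint e (\<lambda>h. h\<^sup>2 * cosh (l * h)))"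
    by (simp add: mult.commute)
  have "0 \<le> wint e (\<lambda>h. h\<^sup>2 * cosh (l * h))"
    by (rule wint_nonneg[OF e]) (auto intro!: continuous_intros cont_cosh)
  then show "(2 * e + 2) * wint e (\<lambda>h. h * sinh (l * h)) \<le> l * mgf e l"
    unfolding eq using l by (intro mult_left_mono) auto
qed

text \<open>Partial integration with u = h cosh (l h), and below with h^2 sinh (l h) and h^3 cosh (l
  h), bounds each weighted moment by lower ones. The recursion ends in \<open>moment2_bound\<close>
  and \<open>moment4_bound\<close>.\<close>

lemma moment_2: "(2 * e + 2) * wint e (\<lambda>h. h\<^sup>2 * cosh (l * h)) \<le> mgf e l + l * wint e (\<lambda>h. h * sinh (l * h))"
proof -
  have "(2 * e + 2) * wint e (\<lambda>h. h * cosh (l * h) * h) \<le> wint e (\<lambda>h. cosh (l * h) + l * (h * sinh (l * h)))"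
  proof (rule wint_by_parts_le[OF e])
    show "((\<lambda>h. h * cosh (l * h)) has_real_derivative cosh (l * h) + l * (h * sinh (l * h))) (at h)" for h
      by (rule DERIV_mult[OF DERIV_ident DERIV_cosh_mult, THEN DERIV_cong]) simp
    show "continuous_on {-1..1} (\<lambda>h. cosh (l * h) + l * (h * sinh (l * h)))"
      by (intro continuous_intros cont_cosh cont_sinh)
    show "0 \<le> cosh (l * h) + l * (h * sinh (l * h))" for h
      using mult_nonneg_nonneg[OF l mult_sinh_nonneg[OF l, of h]] cosh_real_pos[of "l * h"] by linarith
  qed
  also have "\<dots> = mgf e l + l * wint e (\<lambda>h. h * sinh (l * h))"
    unfolding mgf_def by (subst wint_add[OF e]) (auto simp: wint_cmult[OF e] intro!: continuous_intros cont_cosh cont_sinh)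
  finally show ?thesis by (simp add: power2_eq_square mult_ac)
qed

lemma moment_sinh_3: "(2 * e + 2) * wint e (\<lambda>h. h ^ 3 * sinh (l * h)) \<le>
    2 * wint e (\<lambda>h. h * sinh (l * h)) + l * wint e (\<lambda>h. h\<^sup>2 * cosh (l * h))"
proof -
  have "(2 * e + 2) * wint e (\<lambda>h. h\<^sup>2 * sinh (l * h) * h) \<le> wint e (\<lambda>h. 2 * (h * sinh (l * h)) + l * (h\<^sup>2 * cosh (l * h)))"
  proof (rule wint_by_parts_le[OF e])
    show "((\<lambda>h. h\<^sup>2 * sinh (l * h)) has_real_derivative 2 * (h * sinh (l * h)) + l * (h\<^sup>2 * cosh (l * h))) (at h)" for h
      by (rule DERIV_mult[OF DERIV_power[OF DERIV_ident] DERIV_sinh_mult, THEN DERIV_cong]) simp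
    show "continuous_on {-1..1} (\<lambda>h. 2 * (h * sinh (l * h)) + l * (h\<^sup>2 * cosh (l * h)))"
      by (intro continuous_intros cont_cosh cont_sinh)
    show "0 \<le> 2 * (h * sinh (l * h)) + l * (h\<^sup>2 * cosh (l * h))" for h
      using mult_nonneg_nonneg[OF l, of "h\<^sup>2 * cosh (l * h)"] mult_sinh_nonneg[OF l, of h] by simp
  qed
  also have "\<dots> = 2 * wint e (\<lambda>h. h * sinh (l * h)) + l * wint e (\<lambda>h. h\<^sup>2 * cosh (l * h))"
    by (subst wint_add[OF e]) (auto simp: wint_cmult[OF e] intro!: continuous_intros cont_cosh cont_sinh)
  finally show ?thesis by (simp add: power2_eq_square power3_eq_cube mult_ac)
qed

lemma moment_4: "(2 * e + 2) * wint e (\<lambda>h. h ^ 4 * cosh (l * h)) \<le>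
    3 * wint e (\<lambda>h. h\<^sup>2 * cosh (l * h)) + l * wint e (\<lambda>h. h ^ 3 * sinh (l * h))"
proof -
  have s: "0 \<le> h ^ 3 * sinh (l * h)" for h
  proof -
    have "0 \<le> h\<^sup>2 * (h * sinh (l * h))"
      by (rule mult_nonneg_nonneg[OF zero_le_power2 mult_sinh_nonneg[OF l]])
    then show ?thesis by (simp add: power2_eq_square power3_eq_cube mult_ac)
  qed
  have "(2 * e + 2) * wint e (\<lambda>h. h ^ 3 * cosh (l * h) * h) \<le> wint e (\<lambda>h. 3 * (h\<^sup>2 * cosh (l * h)) + l * (h ^ 3 * sinh (l * h)))"
  proof (rule wint_by_parts_le[OF e])
    show "((\<lambda>h. h ^ 3 * cosh (l * h)) has_real_derivative 3 * (h\<^sup>2 * cosh (l * h)) + l * (h ^ 3 * sinh (l * h))) (at h)" for h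
      by (rule DERIV_mult[OF DERIV_power[OF DERIV_ident] DERIV_cosh_mult, THEN DERIV_cong]) simp
    show "continuous_on {-1..1} (\<lambda>h. 3 * (h\<^sup>2 * cosh (l * h)) + l * (h ^ 3 * sinh (l * h)))"
      by (intro continuous_intros cont_cosh cont_sinh)
    show "0 \<le> 3 * (h\<^sup>2 * cosh (l * h)) + l * (h ^ 3 * sinh (l * h))" for h
      using mult_nonneg_nonneg[OF l s[of h]] by simp
  qed
  also have "\<dots> = 3 * wint e (\<lambda>h. h\<^sup>2 * cosh (l * h)) + l * wint e (\<lambda>h. h ^ 3 * sinh (l * h))"
    by (subst wint_add[OF e]) (auto simp: wint_cmult[OF e] intro!: continuous_intros cont_cosh cont_sinh)
  finally show ?thesis by (simp add: eval_nat_numeral mult_ac)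
qed

text \<open>The second moment of a Gaussian with mean l / c and variance 1 / c, where c = 2 e +
  2.\<close>

definition moment2_bound :: real where "moment2_bound = 1 / (2 * e + 2) + l\<^sup>2 / (2 * e + 2)\<^sup>2"

text \<open>Expands to 3 / c^2 + 6 l^2 / c^3 + l^4 / c^4 with c = 2 e + 2, the fourth moment of the
  same Gaussian; the unexpanded form is what the recursion produces.\<close>

definition moment4_bound :: real where "moment4_bound = 3 * moment2_bound / (2 * e + 2) + 2 * l\<^sup>2 / (2 * e + 2) ^ 3 + l\<^sup>2 * moment2_bound / (2 * e + 2)\<^sup>2"

lemma moment_bounds:
  "wint e (\<lambda>h. h\<^sup>2 * cosh (l * h)) \<le> moment2_bound * mgf e l"
  "wint e (\<lambda>h. h ^ 4 * cosh (l * h)) \<le> moment4_bound * mgf e l"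
proof -
  define c where "c = 2 * e + 2"
  have c: "c > 0" using e by (simp add: c_def)
  define C A1 A2 B1 B3 where "C = mgf e l" and "A1 = wint e (\<lambda>h. h\<^sup>2 * cosh (l * h))" and "A2 = wint e (\<lambda>h. h ^ 4 * cosh (l * h))"
    and "B1 = wint e (\<lambda>h. h * sinh (l * h))" and "B3 = wint e (\<lambda>h. h ^ 3 * sinh (l * h))"
  have 1: "c * B1 \<le> l * C" and 2: "c * A1 \<le> C + l * B1" and 3: "c * B3 \<le> 2 * B1 + l * A1" and 4: "c * A2 \<le> 3 * A1 + l * B3"
    using moment_sinh moment_2 moment_sinh_3 moment_4
    unfolding c_def C_def A1_def A2_def B1_def B3_def by simp_all
  have B1: "B1 \<le> l * C / c" using 1 c by (simp add: field_simps)
  have "A1 \<le> (C + l * B1) / c" using 2 c by (simp add: field_simps)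
  also have "\<dots> \<le> (C + l * (l * C / c)) / c"
    using c l B1 by (intro divide_right_mono add_left_mono mult_left_mono) auto
  also have "\<dots> = moment2_bound * C" using c unfolding moment2_bound_def c_def[symmetric] by (simp add: field_simps power2_eq_square)
  finally have A1: "A1 \<le> moment2_bound * C" .
  have "B3 \<le> (2 * B1 + l * A1) / c" using 3 c by (simp add: field_simps)
  also have "\<dots> \<le> (2 * (l * C / c) + l * (moment2_bound * C)) / c"
    using c l B1 A1 by (intro divide_right_mono add_mono mult_left_mono) auto
  finally have B3: "B3 \<le> (2 * (l * C / c) + l * (moment2_bound * C)) / c" .
  have "A2 \<le> (3 * A1 + l * B3) / c" using 4 c by (simp add: field_simps)
  also have "\<dots> \<le> (3 * (moment2_bound * C) + l * ((2 * (l * C / c) + l * (moment2_bound * C)) / c)) / c"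
    using c l A1 B3 by (intro divide_right_mono add_mono mult_left_mono) auto
  also have "\<dots> = moment4_bound * C"
    using c unfolding moment4_bound_def c_def[symmetric] by (simp add: field_simps power2_eq_square power3_eq_cube)
  finally have A2: "A2 \<le> moment4_bound * C" .
  show "wint e (\<lambda>h. h\<^sup>2 * cosh (l * h)) \<le> moment2_bound * mgf e l" "wint e (\<lambda>h. h ^ 4 * cosh (l * h)) \<le> moment4_bound * mgf e l"
    using A1 A2 by (simp_all add: A1_def A2_def C_def)
qed

end

lemma mgf_0_pos:
  assumes e: "e > 0"
  shows "mgf e 0 > 0"
proof -
  have "0 < integral {-1..1} (wt e)"
  proof -
    have "integral {-1..1} (wt e) \<noteq> 0"
    proof
      assume "integral {-1..1} (wt e) = 0"
      moreover have "continuous_on {-1..1} (wt e)" by (rule wt_continuous[OF e])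
      ultimately have "wt e 0 = 0"
        using integral_eq_0_iff[of "-1" 1 "wt e"] by auto
      then show False by (simp add: wt_def)
    qed
    moreover have "integral {-1..1} (wt e) \<ge> 0"
      using wt_continuous[OF e] by (intro integral_nonneg integrable_continuous_real) auto
    ultimately show ?thesis by linarith
  qed
  then show ?thesis by (simp add: mgf_def wint_def)
qed

text \<open>By \<open>moment_sinh\<close> the quotient of \<open>mgf e\<close> and exp (x^2 / (2
  c)), with c = 2 e + 2, is nonincreasing.\<close>

lemma mgf_upper:
  assumes e: "e > 0" and l: "l \<ge> 0"
  shows "mgf e l \<le> mgf e 0 * exp (l\<^sup>2 / (2 * (2 * e + 2)))"
proof -
  define c where "c = 2 * e + 2"
  have c: "c > 0" using e by (simp add: c_def)
  let ?g = "\<lambda>x. mgf e x * exp (- (x\<^sup>2 / (2 * c)))"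
  have "?g l \<le> ?g 0"
  proof (rule DERIV_nonpos_imp_nonincreasing[OF l])
    fix x assume x: "0 \<le> x" "x \<le> l"
    let ?B = "wint e (\<lambda>h. h * sinh (x * h))"
    have "((\<lambda>x. exp (- (x\<^sup>2 / (2 * c)))) has_real_derivative exp (- (x\<^sup>2 / (2 * c))) * (- (x / c))) (at x)"
      using c by (auto intro!: derivative_eq_intros)
    from DERIV_mult[OF DERIV_mgf[OF e] this]
    have "(?g has_real_derivative (?B - x / c * mgf e x) * exp (- (x\<^sup>2 / (2 * c)))) (at x)"
      by (rule DERIV_cong) (simp add: algebra_simps)
    moreover have "?B \<le> x / c * mgf e x"
      using moment_sinh[OF e x(1)] c unfolding c_def[symmetric] by (simp add: field_simps)
    then have "(?B - x / c * mgf e x) * exp (- (x\<^sup>2 / (2 * c))) \<le> 0"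
      by (intro mult_nonpos_nonneg) auto
    ultimately show "\<exists>y. (?g has_real_derivative y) (at x) \<and> y \<le> 0" by blast
  qed
  then have "mgf e l * exp (- (l\<^sup>2 / (2 * c))) * exp (l\<^sup>2 / (2 * c)) \<le> mgf e 0 * exp (l\<^sup>2 / (2 * c))"
    by (intro mult_right_mono) auto
  then show ?thesis unfolding c_def[symmetric] by (simp add: mult.assoc exp_add[symmetric])
qed

text \<open>With c = 2 e + 2 and the bound for the second moment, the logarithmic derivative of
  \<open>mgf e\<close> at x is at least (x / c) (1 - 1 / c - x^2 / c^2); the exponent is the
  integral of this from 0 to l.\<close>

lemma mgf_lower:
  assumes e: "e > 0" and l: "l \<ge> 0"
  shows "mgf e 0 * exp (l\<^sup>2 / (2 * (2 * e + 2)) - l\<^sup>2 / (2 * (2 * e + 2)\<^sup>2) - l ^ 4 / (4 * (2 * e + 2) ^ 3)) \<le> mgf e l"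
proof -
  define c where "c = 2 * e + 2"
  have c: "c > 0" using e by (simp add: c_def)
  define q where "q x = x\<^sup>2 / (2 * c) - x\<^sup>2 / (2 * c\<^sup>2) - x ^ 4 / (4 * c ^ 3)" for x :: real
  let ?g = "\<lambda>x. mgf e x * exp (- q x)"
  have "?g 0 \<le> ?g l"
  proof (rule DERIV_nonneg_imp_nondecreasing[OF l])
    fix x assume x: "0 \<le> x" "x \<le> l"
    let ?B = "wint e (\<lambda>h. h * sinh (x * h))"
    let ?q' = "x / c * (1 - (1 / c + x\<^sup>2 / c\<^sup>2))"
    have "(q has_real_derivative ?q') (at x)"
      unfolding q_def using c by (auto intro!: derivative_eq_intros simp: field_simps power2_eq_square eval_nat_numeral)
    then have "((\<lambda>x. exp (- q x)) has_real_derivative exp (- q x) * (- ?q')) (at x)"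
      by (auto intro!: derivative_eq_intros)
    from DERIV_mult[OF DERIV_mgf[OF e] this]
    have "(?g has_real_derivative (?B - ?q' * mgf e x) * exp (- q x)) (at x)"
      by (rule DERIV_cong) (simp add: algebra_simps)
    moreover have "?q' * mgf e x \<le> ?B"
    proof -
      have "c * ?B = x * (mgf e x - wint e (\<lambda>h. h\<^sup>2 * cosh (x * h)))"
        using moment_sinh_eq[OF e x(1)] by (simp add: c_def)
      also have "\<dots> \<ge> x * (mgf e x - (1 / c + x\<^sup>2 / c\<^sup>2) * mgf e x)"
        using moment_bounds(1)[OF e x(1)] x unfolding moment2_bound_def[OF e x(1)] c_def[symmetric]
        by (intro mult_left_mono diff_left_mono) auto
      finally have "x * (mgf e x - (1 / c + x\<^sup>2 / c\<^sup>2) * mgf e x) / c \<le> ?B"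
        using c by (simp add: field_simps)
      moreover have "x * (M - A * M) / c = x / c * (1 - A) * M" for A M
        by (simp add: algebra_simps diff_divide_distrib)
      ultimately show ?thesis by (simp only:)
    qed
    then have "0 \<le> (?B - ?q' * mgf e x) * exp (- q x)" by simp
    ultimately show "\<exists>y. (?g has_real_derivative y) (at x) \<and> 0 \<le> y" by blast
  qed
  then have "mgf e 0 * exp (q l) \<le> mgf e l * exp (- q l) * exp (q l)"
    by (intro mult_right_mono) (auto simp: q_def)
  also have "\<dots> = mgf e l" by (simp add: mult.assoc exp_add[symmetric])
  finally show ?thesis unfolding q_def c_def .
qed

text \<open>Let D = p h^2 + r h^4 and let a be the upper bound for its mean under the weight cosh (l
  h). The tangent inequality exp (- D) >= exp (- a) (1 + a - D) integrates to the claim.\<close>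

lemma jensen_lower:
  assumes e: "e > 0" and l: "l \<ge> 0" and p: "p \<ge> 0" and r: "r \<ge> 0"
  shows "mgf e l * exp (- (p * moment2_bound e l + r * moment4_bound e l)) \<le> wint e (\<lambda>h. cosh (l * h) * exp (- (p * h\<^sup>2 + r * h ^ 4)))"
proof -
  define a where "a = p * moment2_bound e l + r * moment4_bound e l"
  have "exp (- a) * mgf e l \<le> exp (- a) * ((1 + a) * mgf e l - (p * wint e (\<lambda>h. h\<^sup>2 * cosh (l * h)) + r * wint e (\<lambda>h. h ^ 4 * cosh (l * h))))"
  proof (rule mult_left_mono)
    have "p * wint e (\<lambda>h. h\<^sup>2 * cosh (l * h)) + r * wint e (\<lambda>h. h ^ 4 * cosh (l * h)) \<le> p * (moment2_bound e l * mgf e l) + r * (moment4_bound e l * mgf e l)"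
      using moment_bounds[OF e l] p r by (intro add_mono mult_left_mono) auto
    also have "\<dots> = a * mgf e l" by (simp add: a_def algebra_simps)
    finally show "mgf e l \<le> (1 + a) * mgf e l - (p * wint e (\<lambda>h. h\<^sup>2 * cosh (l * h)) + r * wint e (\<lambda>h. h ^ 4 * cosh (l * h)))"
      by (simp add: algebra_simps)
  qed simp
  also have "\<dots> = wint e (\<lambda>h. exp (- a) * ((1 + a) * cosh (l * h) - (p * (h\<^sup>2 * cosh (l * h)) + r * (h ^ 4 * cosh (l * h)))))"
    unfolding mgf_def
    by (simp add: wint_cmult[OF e] wint_diff[OF e] wint_add[OF e] cont_cosh continuous_intros)
  also have "\<dots> \<le> wint e (\<lambda>h. cosh (l * h) * exp (- (p * h\<^sup>2 + r * h ^ 4)))"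
  proof (rule wint_mono[OF e])
    fix h :: real
    let ?D = "p * h\<^sup>2 + r * h ^ 4"
    have "exp (- a) * (1 + (a - ?D)) \<le> exp (- a) * exp (a - ?D)"
      by (intro mult_left_mono exp_ge_add_one_self) auto
    also have "\<dots> = exp (- ?D)" by (simp add: exp_add[symmetric])
    finally have "cosh (l * h) * (exp (- a) * (1 + (a - ?D))) \<le> cosh (l * h) * exp (- ?D)"
      by (intro mult_left_mono) auto
    then show "exp (- a) * ((1 + a) * cosh (l * h) - (p * (h\<^sup>2 * cosh (l * h)) + r * (h ^ 4 * cosh (l * h)))) \<le> cosh (l * h) * exp (- ?D)"
      by (simp add: algebra_simps)
  qed (intro continuous_intros cont_cosh)+
  finally show ?thesis by (simp add: a_def mult.commute)
qed

subsection \<open>Elementary inequalities\<close>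

lemma power_sum_le_cosh:
  assumes "0 \<le> x" "x \<le> (1::real)"
  shows "((1 + x) ^ m + (1 - x) ^ m) / 2 \<le> cosh (real m * x)"
proof -
  have "(1 + x) ^ m \<le> exp x ^ m" using assms by (intro power_mono exp_ge_add_one_self) auto
  moreover have "(1 - x) ^ m \<le> exp (- x) ^ m"
    using assms exp_ge_add_one_self[of "- x"] by (intro power_mono) auto
  ultimately show ?thesis
    by (simp add: cosh_def exp_of_nat_mult[symmetric] mult.commute[of x])
qed

text \<open>Up to x = 1/2 logarithmic bounds are available for both 1 + x and 1 - x. Beyond that 1 -
  x may vanish and its power is dropped: the bound for (1 + x)^m has 2 m x^2 to spare in the
  exponent, and exp (2 m x^2) absorbs the factor 1 + exp (- 2 m x).\<close>

lemma power_sum_ge_cosh: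
  assumes x: "0 \<le> x" "x \<le> (1::real)" and m: "m \<ge> 1"
  shows "cosh (real m * x) * exp (- (3 * real m * x\<^sup>2)) \<le> ((1 + x) ^ m + (1 - x) ^ m) / 2"
proof -
  let ?m = "real m"
  have p: "exp (?m * (x - x\<^sup>2)) \<le> (1 + x) ^ m"
  proof -
    have "exp (x - x\<^sup>2) \<le> 1 + x"
      using ln_one_plus_pos_lower_bound[OF x] x by (simp add: ln_ge_iff)
    then have "exp (x - x\<^sup>2) ^ m \<le> (1 + x) ^ m" by (intro power_mono) auto
    then show ?thesis by (simp add: exp_of_nat_mult[symmetric])
  qed
  show ?thesis
  proof (cases "x \<le> 1/2")
    case True
    have q: "exp (?m * (- x - 2 * x\<^sup>2)) \<le> (1 - x) ^ m"
    proof -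
      have "exp (- x - 2 * x\<^sup>2) \<le> 1 - x"
        using ln_one_minus_pos_lower_bound[OF x(1) True] True by (simp add: ln_ge_iff)
      then have "exp (- x - 2 * x\<^sup>2) ^ m \<le> (1 - x) ^ m" by (intro power_mono) auto
      then show ?thesis by (simp add: exp_of_nat_mult[symmetric])
    qed
    have q1: "exp (- (?m * x) - 3 * ?m * x\<^sup>2) \<le> exp (?m * (- x - 2 * x\<^sup>2))"
      by (simp add: algebra_simps)
    have q2: "exp (?m * x - 3 * ?m * x\<^sup>2) \<le> exp (?m * (x - x\<^sup>2))"
      by (simp add: algebra_simps)
    have "(exp (?m * x - 3 * ?m * x\<^sup>2) + exp (- (?m * x) - 3 * ?m * x\<^sup>2)) / 2 \<le> ((1 + x) ^ m + (1 - x) ^ m) / 2"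
      by (intro divide_right_mono add_mono order_trans[OF q2 p] order_trans[OF q1 q]) simp
    then show ?thesis by (simp add: cosh_def exp_diff exp_minus field_simps)
  next
    case False
    have mx: "?m * x \<ge> 1/2"
    proof -
      have "1 * (1/2) \<le> ?m * x" using False m by (intro mult_mono) auto
      then show ?thesis by simp
    qed
    have "1 + exp (- (2 * (?m * x))) \<le> 1 + 1/2"
    proof -
      have "exp (- (2 * (?m * x))) \<le> exp (-1)" using mx by simp
      also have "\<dots> \<le> 1/2" using exp_ge_add_one_self[of 1] by (simp add: exp_minus field_simps)
      finally show ?thesis by simp
    qed
    also have "\<dots> \<le> 1 + 2 * ?m * x\<^sup>2"
    proof -
      have "1/2 * (1/2) \<le> (?m * x) * x" using mx False by (intro mult_mono) auto
      then show ?thesis by (simp add: power2_eq_square algebra_simps)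
    qed
    also have "\<dots> \<le> exp (2 * ?m * x\<^sup>2)" by (rule exp_ge_add_one_self)
    finally have "exp (?m * x - 3 * ?m * x\<^sup>2) * (1 + exp (- (2 * (?m * x)))) \<le> exp (?m * x - 3 * ?m * x\<^sup>2) * exp (2 * ?m * x\<^sup>2)"
      by (intro mult_left_mono) auto
    also have "\<dots> = exp (?m * (x - x\<^sup>2))" by (simp add: exp_add[symmetric] algebra_simps)
    finally have "exp (?m * x - 3 * ?m * x\<^sup>2) * (1 + exp (- (2 * (?m * x)))) \<le> (1 + x) ^ m + (1 - x) ^ m"
      using p x by (smt (verit) zero_le_power)
    moreover have "exp (?m * x - 3 * ?m * x\<^sup>2) * (1 + exp (- (2 * (?m * x)))) = 2 * (cosh (?m * x) * exp (- (3 * ?m * x\<^sup>2)))"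
    proof -
      have "exp (?m * x - 3 * ?m * x\<^sup>2) * exp (- (2 * (?m * x))) = exp (- (?m * x)) * exp (- (3 * ?m * x\<^sup>2))"
        by (simp add: exp_add[symmetric])
      moreover have "exp (?m * x - 3 * ?m * x\<^sup>2) = exp (?m * x) * exp (- (3 * ?m * x\<^sup>2))"
        by (simp add: exp_add[symmetric])
      ultimately show ?thesis by (simp add: cosh_def algebra_simps)
    qed
    ultimately show ?thesis by simp
  qed
qed

text \<open>The logarithm of cosh has derivative tanh, which is at most 1, so lowering the argument
  by b - a lowers it by at most b - a.\<close>

lemma cosh_shift_le:
  assumes "a \<le> b"
  shows "cosh b * exp (- (b - a)) \<le> cosh (a::real)"
proof -
  have "exp b * exp (- (b - a)) = exp a" "exp (- b) * exp (- (b - a)) = exp (a - 2 * b)"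
    by (simp_all add: exp_add[symmetric])
  moreover have "exp (a - 2 * b) \<le> exp (- a)" using assms by simp
  ultimately show ?thesis by (simp add: cosh_def algebra_simps)
qed

subsection \<open>Asymptotics of the facet probability\<close>

lemma bernoulli_powr:
  assumes a: "a \<ge> 1" and u: "0 \<le> u" "u < (1::real)"
  shows "1 - a * u \<le> (1 - u) powr a"
proof -
  let ?f = "\<lambda>u. (1 - u) powr a + a * u"
  have "?f 0 \<le> ?f u"
  proof (rule DERIV_nonneg_imp_nondecreasing[OF u(1)])
    fix x assume x: "0 \<le> x" "x \<le> u"
    have "((\<lambda>u. (1 - u) powr a) has_real_derivative a * (1 - x) powr (a - 1) * (- 1)) (at x)"
      by (rule DERIV_chain2[OF has_real_derivative_powr]) (use x u in \<open>auto intro!: derivative_eq_intros\<close>)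
    from DERIV_add[OF this DERIV_cmult[OF DERIV_ident, of a]]
    have "(?f has_real_derivative a * (1 - x) powr (a - 1) * (- 1) + a * 1) (at x)" .
    moreover have "(1 - x) powr (a - 1) \<le> 1" using x u a by (intro powr_le1) auto
    then have "0 \<le> a * (1 - (1 - x) powr (a - 1))" using a by (intro mult_nonneg_nonneg) auto
    then have "0 \<le> a * (1 - x) powr (a - 1) * (- 1) + a * 1" by (simp add: algebra_simps)
    ultimately show "\<exists>y. (?f has_real_derivative y) (at x) \<and> 0 \<le> y" by blast
  qed
  then show ?thesis by simp
qed

lemma rphi_eq_wt: "\<bar>h\<bar> < 1 \<Longrightarrow> rphi e h = wt e h"
  by (simp add: rphi_def wt_def abs_square_less_1)

lemma wt_measurable: "wt e \<in> borel_measurable borel"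
  unfolding wt_def [abs_def] by measurable

lemma arc_eq_integral:
  assumes e: "e > 0" and h: "0 \<le> h" "h \<le> 1"
  shows "arc_int e h = integral {0..h} (wt e)"
proof -
  define g where "g t = indicator {0..h} t * wt e t" for t :: real
  define f where "f t = indicator {0..<h} t * rphi e t" for t :: real
  have gm: "g \<in> borel_measurable lborel" and fm: "f \<in> borel_measurable lborel"
    unfolding g_def[abs_def] f_def[abs_def]
    by (auto intro!: borel_measurable_times borel_measurable_indicator wt_measurable)
  have "f t = g t" if "t \<noteq> h" for t
    using that h by (auto simp: indicator_def rphi_eq_wt f_def g_def)
  then have ae: "AE t in lborel. f t = g t"
    using AE_lborel_singleton[of h] by (auto elim: eventually_mono)
  have "arc_int e h = integral\<^sup>L lborel f" unfolding arc_int_def f_def ..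
  also have "\<dots> = integral\<^sup>L lborel g" by (rule integral_cong_AE[OF fm gm ae])
  also have "\<dots> = integral {0..h} (wt e)"
  proof -
    have c: "continuous_on {0..h} (wt e)"
      by (rule continuous_on_subset[OF wt_continuous[OF e]]) (use h in auto)
    show ?thesis
      using set_borel_integral_eq_integral(2)[OF borel_integrable_atLeastAtMost'[OF c]]
      unfolding set_lebesgue_integral_def g_def by simp
  qed
  finally show ?thesis .
qed

text \<open>Integrals of Bernoulli's lower bound 1 - a t^2 and of the upper bound 1 for the
  weight.\<close>

lemma arc_bounds:
  assumes a: "a \<ge> 1" and h: "0 \<le> h" "h \<le> 1"
  shows "h - a * h ^ 3 / 3 \<le> arc_int a h" "arc_int a h \<le> h"
proof -
  have a0: "a > 0" using a by simp
  have int: "wt a integrable_on {0..h}"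
    by (rule integrable_continuous_real[OF continuous_on_subset[OF wt_continuous[OF a0]]]) (use h in auto)
  have "((\<lambda>t. 1 - a * t\<^sup>2) has_integral (h - a * h ^ 3 / 3) - (0 - a * 0 ^ 3 / 3)) {0..h}"
    by (rule fundamental_theorem_of_calculus[OF h(1)])
      (auto intro!: derivative_eq_intros simp: has_real_derivative_iff_has_vector_derivative[symmetric] power2_eq_square)
  then have lo: "((\<lambda>t. 1 - a * t\<^sup>2) has_integral (h - a * h ^ 3 / 3)) {0..h}" by simp
  have "h - a * h ^ 3 / 3 \<le> integral {0..h} (wt a)"
  proof (rule has_integral_le[OF lo integrable_integral[OF int]])
    fix t assume t: "t \<in> {0..h}"
    show "1 - a * t\<^sup>2 \<le> wt a t"
    proof (cases "t = 1")
      case True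
      then show ?thesis using a by (simp add: wt_def)
    next
      case False
      then have "t\<^sup>2 < 1" using t h by (simp add: abs_square_less_1)
      then show ?thesis unfolding wt_def using a by (intro bernoulli_powr) auto
    qed
  qed
  then show "h - a * h ^ 3 / 3 \<le> arc_int a h" using arc_eq_integral[OF a0 h] by simp
  have "integral {0..h} (wt a) \<le> integral {0..h} (\<lambda>_. 1)"
  proof (rule integral_le[OF int])
    show "wt a t \<le> 1" if "t \<in> {0..h}" for t
      unfolding wt_def using that h a one_minus_sq_nonneg[of t] by (intro powr_le1) auto
  qed auto
  then show "arc_int a h \<le> h" using arc_eq_integral[OF a0 h] h by simp
qed

lemma integral_rphi_eq_wint:
  assumes e: "e > 0" and f: "continuous_on {-1..1} f"
  shows "(\<integral>h. f h * rphi e h \<partial>lborel) = wint e f" "integrable lborel (\<lambda>h. f h * rphi e h)"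
proof -
  have eq: "f h * rphi e h = indicator {-1..1} h *\<^sub>R (f h * wt e h)" for h
    using e by (cases "\<bar>h\<bar> < 1")
      (auto simp: rphi_eq_wt indicator_def abs_less_iff rphi_def wt_def abs_square_less_1 power2_eq_1_iff)
  have c: "continuous_on {-1..1} (\<lambda>h. f h * wt e h)"
    by (intro continuous_intros f wt_continuous[OF e])
  note S = borel_integrable_atLeastAtMost'[OF c]
  show "(\<integral>h. f h * rphi e h \<partial>lborel) = wint e f"
    using set_borel_integral_eq_integral(2)[OF S] unfolding eq wint_def set_lebesgue_integral_def .
  show "integrable lborel (\<lambda>h. f h * rphi e h)"
    using S unfolding eq set_integrable_def .
qed

text \<open>The facet probability divided by 2 / 2^m, the value it would have if every hyperplane
  passed through the origin. Its logarithm is the exponent in the theorem.\<close>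

definition facet_ratio :: "nat \<Rightarrow> nat \<Rightarrow> real"
  where "facet_ratio k m = 2 ^ m / 2 * ((\<integral>h. facet_integrand (real k / 2 - 1) m h * rphi ((real k ^ 2 - 2) / 2) h \<partial>lborel) /
    (\<integral>h. rphi ((real k ^ 2 - 2) / 2) h \<partial>lborel))"

lemma facet_integrand_eq: "2 ^ m / 2 * facet_integrand a m h = ((1 + xfrac a h) ^ m + (1 - xfrac a h) ^ m) / 2"
  by (simp add: facet_integrand_def power_divide flip: add_divide_distrib)

text \<open>X lies between s (|h| - a |h|^3 / 3) and s |h|. The upper bound then follows from the
  monotonicity of cosh; the lower one pays for the cubic deficit and, with 3 m X^2, for replacing
  the powers by cosh.\<close>

lemma xfrac_cosh_bounds:
  assumes k: "k \<ge> 4" and m: "m \<ge> 1" and h: "\<bar>h\<bar> \<le> 1"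
  defines "a \<equiv> real k / 2 - 1" and "s \<equiv> 1 / wallis_integral (real k / 2 - 1)"
  shows "((1 + xfrac a h) ^ m + (1 - xfrac a h) ^ m) / 2 \<le> cosh (real m * s * h)"
    "cosh (real m * s * h) * exp (- (4 * real m * s\<^sup>2 * h\<^sup>2 + real m * (real k)\<^sup>2 * h ^ 4)) \<le>
      ((1 + xfrac a h) ^ m + (1 - xfrac a h) ^ m) / 2"
proof -
  have a: "a \<ge> 1" using k by (simp add: a_def)
  have am: "a > -1" using a by simp
  define x y where "x = xfrac a h" and "y = \<bar>h\<bar>"
  have y: "0 \<le> y" "y \<le> 1" using h by (auto simp: y_def)
  have x01: "0 \<le> x" "x \<le> 1" using xfrac_bounds[OF am] by (auto simp: x_def)
  have b: "arc_int a 1 = wallis_integral a" using a by (simp add: arc_eq_integral wallis_integral_def)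
  have s: "s > 0" unfolding s_def a_def[symmetric] b[symmetric] using arc_one_pos[OF am] by simp
  have x: "x = s * arc_int a y" unfolding x_def xfrac_def y_def s_def a_def[symmetric] b by simp
  have xu: "x \<le> s * y" unfolding x using arc_bounds(2)[OF a y] s by (intro mult_left_mono) auto
  have xl: "s * (y - a * y ^ 3 / 3) \<le> x" unfolding x using arc_bounds(1)[OF a y] s by (intro mult_left_mono) auto
  have M: "real m > 0" using m by simp
  have ch: "cosh (real m * s * h) = cosh (real m * (s * y))"
    by (cases "h \<ge> 0") (simp_all add: y_def mult.assoc)
  have mx: "real m * x \<le> real m * (s * y)" using xu M by (intro mult_left_mono) auto
  have "((1 + x) ^ m + (1 - x) ^ m) / 2 \<le> cosh (real m * x)"
    by (rule power_sum_le_cosh[OF x01])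
  also have "\<dots> \<le> cosh (real m * (s * y))"
    using mx x01 M by (subst cosh_real_nonneg_le_iff) auto
  finally show "((1 + xfrac a h) ^ m + (1 - xfrac a h) ^ m) / 2 \<le> cosh (real m * s * h)"
    unfolding ch x_def .
  have d1: "real m * (s * y) - real m * x \<le> real m * (s * y * (real k * y\<^sup>2)) / 6"
  proof -
    have "real m * (s * y) - real m * x \<le> real m * (s * y) - real m * (s * (y - a * y ^ 3 / 3))"
      using xl M by (intro diff_left_mono mult_left_mono) auto
    also have "\<dots> = real m * (s * y * (a * y\<^sup>2)) / 3"
      by (simp add: algebra_simps power2_eq_square power3_eq_cube)
    also have "\<dots> \<le> real m * (s * y * (real k / 2 * y\<^sup>2)) / 3"
      using M s y by (intro divide_right_mono mult_left_mono mult_right_mono) (auto simp: a_def)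
    finally show ?thesis by simp
  qed
  \<comment> \<open>Trades the odd power y^3 for y^2 and y^4, whose weighted moments are
    bounded.\<close>
  have am_gm: "s * y * (real k * y\<^sup>2) \<le> (s\<^sup>2 * y\<^sup>2 + (real k)\<^sup>2 * y ^ 4) / 2"
  proof -
    have "0 \<le> (s * y - real k * y\<^sup>2)\<^sup>2" by simp
    also have "\<dots> = s\<^sup>2 * y\<^sup>2 + (real k)\<^sup>2 * y ^ 4 - 2 * (s * y * (real k * y\<^sup>2))"
      by (simp add: power2_eq_square eval_nat_numeral algebra_simps)
    finally show ?thesis by simp
  qed
  have x2: "x\<^sup>2 \<le> s\<^sup>2 * y\<^sup>2"
    using power_mono[OF xu x01(1), of 2] by (simp add: power_mult_distrib)
  \<comment> \<open>The cubic deficit contributes 1/12 of each of the two terms, and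
    \<open>x2\<close> turns 3 m x^2 into 3 m s^2 y^2; the coefficients 4 and 1 are generous.\<close>
  have tot: "real m * (s * y) - real m * x + 3 * real m * x\<^sup>2 \<le> 4 * real m * s\<^sup>2 * h\<^sup>2 + real m * (real k)\<^sup>2 * h ^ 4"
  proof -
    have hy: "h\<^sup>2 = y\<^sup>2" "h ^ 4 = y ^ 4" by (simp_all add: y_def)
    have p1: "real m * (s * y * (real k * y\<^sup>2)) \<le> real m * ((s\<^sup>2 * y\<^sup>2 + (real k)\<^sup>2 * y ^ 4) / 2)"
      using am_gm M by (intro mult_left_mono) auto
    have p2: "real m * x\<^sup>2 \<le> real m * (s\<^sup>2 * y\<^sup>2)" using x2 M by (intro mult_left_mono) auto
    have n1: "0 \<le> real m * (s\<^sup>2 * y\<^sup>2)" "0 \<le> real m * ((real k)\<^sup>2 * y ^ 4)" by auto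
    have e1: "real m * ((s\<^sup>2 * y\<^sup>2 + (real k)\<^sup>2 * y ^ 4) / 2) = real m * (s\<^sup>2 * y\<^sup>2) / 2 + real m * ((real k)\<^sup>2 * y ^ 4) / 2"
      by (simp add: algebra_simps add_divide_distrib)
    have e2: "4 * real m * s\<^sup>2 * h\<^sup>2 + real m * (real k)\<^sup>2 * h ^ 4 = 4 * (real m * (s\<^sup>2 * y\<^sup>2)) + real m * ((real k)\<^sup>2 * y ^ 4)"
      unfolding hy by simp
    have e3: "3 * real m * x\<^sup>2 = 3 * (real m * x\<^sup>2)" by simp
    show ?thesis unfolding e2 e3 using d1 p1 p2 n1 unfolding e1 by linarith
  qed
  have "cosh (real m * s * h) * exp (- (4 * real m * s\<^sup>2 * h\<^sup>2 + real m * (real k)\<^sup>2 * h ^ 4)) \<le>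
      cosh (real m * (s * y)) * exp (- (real m * (s * y) - real m * x + 3 * real m * x\<^sup>2))"
    unfolding ch using tot by (intro mult_left_mono) auto
  also have "\<dots> = cosh (real m * (s * y)) * exp (- (real m * (s * y) - real m * x)) * exp (- (3 * real m * x\<^sup>2))"
    by (simp add: mult.assoc exp_add[symmetric])
  also have "\<dots> \<le> cosh (real m * x) * exp (- (3 * real m * x\<^sup>2))"
    by (intro mult_right_mono cosh_shift_le mx) auto
  also have "\<dots> \<le> ((1 + x) ^ m + (1 - x) ^ m) / 2"
    by (rule power_sum_ge_cosh[OF x01 m])
  finally show "cosh (real m * s * h) * exp (- (4 * real m * s\<^sup>2 * h\<^sup>2 + real m * (real k)\<^sup>2 * h ^ 4)) \<le>
      ((1 + xfrac a h) ^ m + (1 - xfrac a h) ^ m) / 2"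
    unfolding x_def .
qed

text \<open>Integrates \<open>xfrac_cosh_bounds\<close> against the density of h: p and r are the
  coefficients of h^2 and h^4 there, and l is m s.\<close>

lemma facet_ratio_mgf_bounds:
  fixes k m :: nat
  assumes k: "k \<ge> 4" and m: "m \<ge> 1"
  defines "e \<equiv> (real k ^ 2 - 2) / 2" and "l \<equiv> real m / wallis_integral (real k / 2 - 1)"
  defines "p \<equiv> 4 * real m * (1 / wallis_integral (real k / 2 - 1))\<^sup>2" and "r \<equiv> real m * (real k)\<^sup>2"
  shows "facet_ratio k m \<le> mgf e l / mgf e 0" "mgf e l * exp (- (p * moment2_bound e l + r * moment4_bound e l)) / mgf e 0 \<le> facet_ratio k m"
proof -
  have k2: "(real k)\<^sup>2 \<ge> 16" using k power_mono[of 4 "real k" 2] by simp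
  have e: "e > 0" using k2 by (simp add: e_def)
  let ?a = "real k / 2 - 1" and ?s = "1 / wallis_integral (real k / 2 - 1)"
  have a: "?a > -1" using k by simp
  have b: "wallis_integral ?a > 0"
    using arc_one_pos[OF a] k by (simp add: arc_eq_integral wallis_integral_def)
  let ?g = "\<lambda>h. ((1 + xfrac ?a h) ^ m + (1 - xfrac ?a h) ^ m) / 2"
  have den: "(\<integral>h. rphi e h \<partial>lborel) = mgf e 0"
    using integral_rphi_eq_wint(1)[OF e continuous_on_const, of 1] by (simp add: mgf_def)
  have gi: "integrable lborel (\<lambda>h. ?g h * rphi e h)"
    unfolding facet_integrand_eq[symmetric]
    by (rule integrable_rphi_bounded[where C = "2 ^ m"])
      (use e facet_integrand_bounds[OF a] in \<open>auto simp: abs_mult\<close>)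
  have num: "facet_ratio k m = (\<integral>h. ?g h * rphi e h \<partial>lborel) / mgf e 0"
    unfolding facet_ratio_def e_def[symmetric] den facet_integrand_eq[symmetric] by (simp add: mult.assoc)
  have pos: "mgf e 0 > 0" by (rule mgf_0_pos[OF e])
  have l: "l = real m * ?s" by (simp add: l_def)
  have "(\<integral>h. ?g h * rphi e h \<partial>lborel) \<le> (\<integral>h. cosh (l * h) * rphi e h \<partial>lborel)"
  proof (rule integral_mono[OF gi integral_rphi_eq_wint(2)[OF e cont_cosh]])
    fix h
    show "?g h * rphi e h \<le> cosh (l * h) * rphi e h"
    proof (cases "\<bar>h\<bar> \<le> 1")
      case True
      then show ?thesis unfolding l by (intro mult_right_mono xfrac_cosh_bounds(1)[OF k m]) auto
    next
      case False
      then have "rphi e h = 0" by (simp add: rphi_def abs_square_less_1)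
      then show ?thesis by simp
    qed
  qed
  also have "\<dots> = mgf e l" unfolding mgf_def by (rule integral_rphi_eq_wint(1)[OF e cont_cosh])
  finally show "facet_ratio k m \<le> mgf e l / mgf e 0"
    unfolding num using pos by (intro divide_right_mono) auto
  have cont: "continuous_on {-1..1} (\<lambda>h. cosh (l * h) * exp (- (p * h\<^sup>2 + r * h ^ 4)))"
    by (intro continuous_intros cont_cosh)
  have "mgf e l * exp (- (p * moment2_bound e l + r * moment4_bound e l)) \<le> wint e (\<lambda>h. cosh (l * h) * exp (- (p * h\<^sup>2 + r * h ^ 4)))"
    by (rule jensen_lower[OF e]) (use b in \<open>auto simp: l_def p_def r_def\<close>)
  also have "\<dots> = (\<integral>h. cosh (l * h) * exp (- (p * h\<^sup>2 + r * h ^ 4)) * rphi e h \<partial>lborel)"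
    by (rule integral_rphi_eq_wint(1)[OF e cont, symmetric])
  also have "\<dots> \<le> (\<integral>h. ?g h * rphi e h \<partial>lborel)"
  proof (rule integral_mono[OF integral_rphi_eq_wint(2)[OF e cont] gi])
    fix h
    show "cosh (l * h) * exp (- (p * h\<^sup>2 + r * h ^ 4)) * rphi e h \<le> ?g h * rphi e h"
    proof (cases "\<bar>h\<bar> \<le> 1")
      case True
      then show ?thesis unfolding l p_def r_def by (intro mult_right_mono xfrac_cosh_bounds(2)[OF k m]) auto
    next
      case False
      then have "rphi e h = 0" by (simp add: rphi_def abs_square_less_1)
      then show ?thesis by simp
    qed
  qed
  finally show "mgf e l * exp (- (p * moment2_bound e l + r * moment4_bound e l)) / mgf e 0 \<le> facet_ratio k m"
    unfolding num using pos by (intro divide_right_mono) auto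
qed

text \<open>The first of the two powers is at least (1/2)^m. Positivity allows an exponential form
  of the probability even where the asymptotic bounds do not apply.\<close>

lemma facet_ratio_pos:
  assumes k: "k \<ge> 1"
  shows "facet_ratio k m > 0"
proof -
  let ?a = "real k / 2 - 1" and ?e = "(real k ^ 2 - 2) / 2"
  have a: "?a > -1" using k by simp
  have e: "?e > -1"
  proof -
    have "(1::real) ^ 2 \<le> real k ^ 2" using k by (intro power_mono) auto
    then show ?thesis using k by simp
  qed
  have "(1 / 2) ^ m * rphi ?e h \<le> facet_integrand ?a m h * rphi ?e h" for h
  proof (rule mult_right_mono)
    have "(1 / 2) ^ m \<le> ((1 + xfrac ?a h) / 2) ^ m"
      using xfrac_bounds[OF a, of h] by (intro power_mono) auto
    moreover have "0 \<le> ((1 - xfrac ?a h) / 2) ^ m"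
      using xfrac_bounds[OF a, of h] by (intro zero_le_power) auto
    ultimately show "(1 / 2) ^ m \<le> facet_integrand ?a m h" by (simp add: facet_integrand_def)
  qed simp
  then have "(\<integral>h. (1 / 2) ^ m * rphi ?e h \<partial>lborel) \<le> (\<integral>h. facet_integrand ?a m h * rphi ?e h \<partial>lborel)"
    using integrable_rphi[OF e]
    by (intro integral_mono integrable_rphi_bounded[OF e facet_integrand_measurable, where C = 2])
      (use facet_integrand_bounds[OF a] in auto)
  moreover have "0 < (\<integral>h. (1 / 2) ^ m * rphi ?e h \<partial>lborel)"
    using integral_rphi_pos[OF e] by simp
  ultimately have "0 < (\<integral>h. facet_integrand ?a m h * rphi ?e h \<partial>lborel)" by (rule less_le_trans[rotated])
  then show ?thesis
    unfolding facet_ratio_def using integral_rphi_pos[OF e] by (intro mult_pos_pos divide_pos_pos) auto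
qed

text \<open>K, M, S, A and B stand for k, m, s^2, \<open>moment2_bound\<close> and
  \<open>moment4_bound\<close>, with 2 e + 2 = K^2 and l^2 = M^2 S. All errors are reduced to u = M
  / K and w = M^3 / K^2, using v = M^2 S / K^3 <= u^2 and 1 / K <= 1.\<close>

lemma numeric_bounds:
  fixes K M S A B :: real
  assumes K: "K \<ge> 4" and M: "1 \<le> M" "M \<le> K" and S: "2 * (K - 1) / pi \<le> S" "S \<le> 2 * K / pi"
  defines "A \<equiv> 1 / K\<^sup>2 + M\<^sup>2 * S / K ^ 4"
  defines "B \<equiv> 3 * A / K\<^sup>2 + 2 * (M\<^sup>2 * S) / K ^ 6 + M\<^sup>2 * S * A / K ^ 4"
  shows "M\<^sup>2 * S / (2 * K\<^sup>2) \<le> M\<^sup>2 / (pi * (K + 1)) + M / K"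
    "M\<^sup>2 / (pi * (K + 1)) - 11 * (M ^ 3 / K\<^sup>2) - 10 * (M / K) \<le>
      M\<^sup>2 * S / (2 * K\<^sup>2) - M\<^sup>2 * S / (2 * K ^ 4) - M ^ 4 * S\<^sup>2 / (4 * K ^ 6) - (4 * M * S * A + M * K\<^sup>2 * B)"
proof -
  have K0: "K > 0" and M0: "M > 0" using K M by auto
  have pi: "pi > 3" using pi_gt3 .
  have S0: "S \<ge> 0"
  proof -
    have "0 \<le> 2 * (K - 1) / pi" using K pi by simp
    then show ?thesis using S by linarith
  qed
  have SK: "S \<le> K"
  proof -
    have "2 * K / pi \<le> K" using K0 pi by (simp add: field_simps)
    then show ?thesis using S by linarith
  qed
  have t: "M / K \<le> 1" using M K0 by simp
  define u where "u = M / K"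
  have u: "0 < u" "u \<le> 1" using t M0 K0 by (auto simp: u_def)
  have M_u: "M = u * K" using K0 by (simp add: u_def)
  define w where "w = M ^ 3 / K\<^sup>2"
  have w: "w = u ^ 3 * K" using K0 by (simp add: w_def M_u field_simps power2_eq_square power3_eq_cube)
  have w0: "w \<ge> 0" using u K0 by (simp add: w)
  have up: "u ^ n \<le> u" if "n \<ge> 1" for n
    using u that power_decreasing[of 1 n u] by simp
  define i where "i = 1 / K"
  have i: "0 < i" "i \<le> 1" "i * K = 1" using K by (auto simp: i_def)
  define v where "v = M\<^sup>2 * S / K ^ 3"
  have v: "0 \<le> v" "v \<le> u\<^sup>2"
  proof -
    show "0 \<le> v" using S0 K0 by (simp add: v_def)
    have "M\<^sup>2 * S / K ^ 3 \<le> M\<^sup>2 * K / K ^ 3" using SK K0 by (intro divide_right_mono mult_left_mono) auto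
    also have "\<dots> = u\<^sup>2" using K0 by (simp add: u_def power_divide power2_eq_square power3_eq_cube)
    finally show "v \<le> u\<^sup>2" by (simp add: v_def)
  qed
  have A_eq: "A = i\<^sup>2 + v * i"
    using K0 by (simp add: A_def v_def i_def power_divide power2_eq_square eval_nat_numeral)
  have A0: "A \<ge> 0" unfolding A_eq using v i by simp
  have A_le: "A \<le> i\<^sup>2 + u\<^sup>2 * i" unfolding A_eq using v i by (intro add_left_mono mult_right_mono) auto
  have "M\<^sup>2 * S / (2 * K\<^sup>2) \<le> M\<^sup>2 * (2 * K / pi) / (2 * K\<^sup>2)"
    using S K0 by (intro divide_right_mono mult_left_mono) auto
  also have "\<dots> = M\<^sup>2 / (pi * (K + 1)) + M\<^sup>2 / (pi * K * (K + 1))"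
  proof -
    \<comment> \<open>K + 1 is the dimension d, which the main term has in its denominator.\<close>
    have "1 / K = 1 / (K + 1) + 1 / (K * (K + 1))" using K0 by (simp add: divide_simps)
    then have "M\<^sup>2 / pi * (1 / K) = M\<^sup>2 / pi * (1 / (K + 1) + 1 / (K * (K + 1)))" by simp
    then show ?thesis using K0 by (simp add: distrib_left power2_eq_square mult.assoc)
  qed
  also have "M\<^sup>2 / (pi * K * (K + 1)) \<le> M / K"
  proof -
    have "M * (M / (pi * (K + 1))) \<le> M * 1"
    proof (rule mult_left_mono)
      have "1 * (K + 1) \<le> pi * (K + 1)" using pi K0 by (intro mult_right_mono) auto
      moreover have "M \<le> 1 * (K + 1)" using M by simp
      ultimately have "M \<le> pi * (K + 1)" by (rule order_trans[rotated])
      then show "M / (pi * (K + 1)) \<le> 1" using pi K0 by (simp add: divide_le_eq)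
    qed (use M0 in auto)
    then have "M * (M / (pi * (K + 1))) / K \<le> M / K" using K0 by (intro divide_right_mono) auto
    then show ?thesis by (simp add: power2_eq_square mult.assoc mult.left_commute mult.commute)
  qed
  finally show "M\<^sup>2 * S / (2 * K\<^sup>2) \<le> M\<^sup>2 / (pi * (K + 1)) + M / K" by simp
  have main: "M\<^sup>2 / (pi * (K + 1)) - u \<le> M\<^sup>2 * S / (2 * K\<^sup>2)"
  proof -
    have "M\<^sup>2 / (pi * (K + 1)) - M\<^sup>2 / (pi * K\<^sup>2 * (K + 1)) = M\<^sup>2 * (2 * (K - 1) / pi) / (2 * K\<^sup>2)"
    proof -
      have "1 / (K + 1) - 1 / (K\<^sup>2 * (K + 1)) = (K - 1) / K\<^sup>2"
        using K0 by (simp add: divide_simps power2_eq_square) (simp add: algebra_simps)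
      then have "M\<^sup>2 / pi * (1 / (K + 1) - 1 / (K\<^sup>2 * (K + 1))) = M\<^sup>2 / pi * ((K - 1) / K\<^sup>2)" by simp
      moreover have "M\<^sup>2 * (2 * (K - 1) / pi) / (2 * K\<^sup>2) = M\<^sup>2 / pi * ((K - 1) / K\<^sup>2)"
        using K0 pi by (simp add: divide_simps)
      moreover have "M\<^sup>2 / pi * (1 / (K + 1) - 1 / (K\<^sup>2 * (K + 1))) = M\<^sup>2 / (pi * (K + 1)) - M\<^sup>2 / (pi * K\<^sup>2 * (K + 1))"
        by (simp add: right_diff_distrib mult.assoc)
      ultimately show ?thesis by simp
    qed
    also have "\<dots> \<le> M\<^sup>2 * S / (2 * K\<^sup>2)"
      using S K0 by (intro divide_right_mono mult_left_mono) auto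
    finally have 1: "M\<^sup>2 / (pi * (K + 1)) - M\<^sup>2 / (pi * K\<^sup>2 * (K + 1)) \<le> M\<^sup>2 * S / (2 * K\<^sup>2)" .
    have "M\<^sup>2 / (pi * K\<^sup>2 * (K + 1)) = u\<^sup>2 / (pi * (K + 1))"
      using K0 by (simp add: u_def power_divide)
    also have "\<dots> \<le> u\<^sup>2 / 1"
    proof (rule divide_left_mono)
      have "1 * 1 \<le> pi * (K + 1)" using pi K0 by (intro mult_mono) auto
      then show "1 \<le> pi * (K + 1)" by simp
    qed (use pi K0 in auto)
    also have "\<dots> \<le> u" using up[of 2] by simp
    finally show ?thesis using 1 by linarith
  qed
  have E1: "M\<^sup>2 * S / (2 * K ^ 4) \<le> u"
  proof -
    have "M\<^sup>2 * S / (2 * K ^ 4) = v * i / 2" using K0 by (simp add: v_def i_def eval_nat_numeral)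
    also have "\<dots> \<le> v" using mult_left_le[of i v] i v by auto
    finally show ?thesis using v up[of 2] by simp
  qed
  have E2: "M ^ 4 * S\<^sup>2 / (4 * K ^ 6) \<le> u"
  proof -
    have "M ^ 4 * S\<^sup>2 / (4 * K ^ 6) = v\<^sup>2 / 4" by (simp add: v_def power_divide power_mult_distrib power_mult[symmetric])
    also have "\<dots> \<le> (u\<^sup>2)\<^sup>2" using power_mono[OF v(2) v(1), of 2] zero_le_power2[of v] by linarith
    also have "\<dots> \<le> u" using up[of 4] by (simp add: power_mult[symmetric])
    finally show ?thesis .
  qed
  have E3: "4 * M * S * A \<le> 4 * u + 4 * w"
  proof -
    have "4 * M * S * A \<le> 4 * M * K * (i\<^sup>2 + u\<^sup>2 * i)"
      using SK S0 M0 A_le A0 K0 i by (intro mult_mono) auto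
    also have "\<dots> = 4 * (M * i) * (i * K) + 4 * M * u\<^sup>2 * (i * K)" by (simp add: algebra_simps power2_eq_square)
    also have "\<dots> = 4 * u + 4 * w" unfolding i(3) w by (simp add: M_u i_def K0 power2_eq_square power3_eq_cube) (use K0 in simp)
    finally show ?thesis .
  qed
  have KMA: "K * (M * A) \<le> u + w"
  proof -
    have "K * (M * A) \<le> K * (M * (i\<^sup>2 + u\<^sup>2 * i))" using A_le M0 K0 by (intro mult_left_mono) auto
    also have "\<dots> = u + w"
      using K0 by (simp add: w M_u i_def power2_eq_square power3_eq_cube field_simps)
    finally show ?thesis .
  qed
  have MA: "M * A \<le> u + w"
  proof -
    have "1 * (M * A) \<le> K * (M * A)" using K A0 M0 by (intro mult_right_mono) auto
    then show ?thesis using KMA by linarith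
  qed
  have E4: "M * K\<^sup>2 * B \<le> 3 * u + 7 * w"
  proof -
    have "M * K\<^sup>2 * B = 3 * (M * A) + 2 * (M * v * i) + v * (K * (M * A))"
      using K0 by (simp add: B_def v_def i_def field_simps power2_eq_square eval_nat_numeral)
    moreover have "2 * (M * v * i) \<le> 2 * w"
    proof -
      have "M * v * i = u * v" using K0 by (simp add: u_def i_def)
      also have "\<dots> \<le> u * u\<^sup>2" using v u by (intro mult_left_mono) auto
      also have "\<dots> = u ^ 3 * 1" by (simp add: power2_eq_square power3_eq_cube)
      also have "\<dots> \<le> w" unfolding w using K u by (intro mult_left_mono) auto
      finally show ?thesis by simp
    qed
    moreover have "v * (K * (M * A)) \<le> 2 * w"
    proof -
      have "v * (K * (M * A)) \<le> u\<^sup>2 * (u + w)" using v KMA M0 A0 K0 by (intro mult_mono) auto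
      also have "\<dots> = u ^ 3 * 1 + u\<^sup>2 * w" by (simp add: power2_eq_square power3_eq_cube algebra_simps)
      also have "\<dots> \<le> w + 1 * w"
        unfolding w using K u by (intro add_mono mult_left_mono mult_right_mono) (auto intro: power_le_one)
      finally show ?thesis by simp
    qed
    ultimately show ?thesis using MA by linarith
  qed
  \<comment> \<open>The errors in \<open>main\<close> and \<open>E1\<close> to \<open>E4\<close> add
    up to 1 + 1 + 1 + 4 + 3 = 10 times u and 4 + 7 = 11 times w.\<close>
  have "M\<^sup>2 / (pi * (K + 1)) - 11 * w - 10 * u \<le>
      M\<^sup>2 * S / (2 * K\<^sup>2) - M\<^sup>2 * S / (2 * K ^ 4) - M ^ 4 * S\<^sup>2 / (4 * K ^ 6) - (4 * M * S * A + M * K\<^sup>2 * B)"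
    using main E1 E2 E3 E4 by linarith
  then show "M\<^sup>2 / (pi * (K + 1)) - 11 * (M ^ 3 / K\<^sup>2) - 10 * (M / K) \<le>
      M\<^sup>2 * S / (2 * K\<^sup>2) - M\<^sup>2 * S / (2 * K ^ 4) - M ^ 4 * S\<^sup>2 / (4 * K ^ 6) - (4 * M * S * A + M * K\<^sup>2 * B)"
    by (simp add: w_def u_def)
qed

lemma facet_ratio_asymptotics:
  fixes k m :: nat
  assumes k: "k \<ge> 4" and m: "1 \<le> m" "m \<le> k"
  shows "ln (facet_ratio k m) \<le> (real m)\<^sup>2 / (pi * (real k + 1)) + real m / real k"
    "(real m)\<^sup>2 / (pi * (real k + 1)) - 11 * (real m ^ 3 / (real k)\<^sup>2) - 10 * (real m / real k) \<le> ln (facet_ratio k m)"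
proof -
  define e where "e = (real k ^ 2 - 2) / 2"
  define b where "b = wallis_integral (real k / 2 - 1)"
  define l where "l = real m / b"
  define S where "S = 1 / b\<^sup>2"
  have k2: "(real k)\<^sup>2 \<ge> 16" using k power_mono[of 4 "real k" 2] by simp
  have e: "e > 0" using k2 by (simp add: e_def)
  have c: "2 * e + 2 = (real k)\<^sup>2" by (simp add: e_def field_simps)
  have a: "real k / 2 - 1 > 0" using k by simp
  have b: "b > 0"
    using arc_one_pos[of "real k / 2 - 1"] a by (simp add: b_def arc_eq_integral wallis_integral_def)
  have l0: "l \<ge> 0" using b by (simp add: l_def)
  have l2: "l\<^sup>2 = (real m)\<^sup>2 * S" by (simp add: l_def S_def power_divide)
  have l4: "l ^ 4 = real m ^ 4 * S\<^sup>2" by (simp add: l_def S_def power_divide power_mult[symmetric])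
  have Sb: "2 * (real k - 1) / pi \<le> S" "S \<le> 2 * real k / pi"
  proof -
    have "pi / (2 * real k) \<le> b\<^sup>2" "b\<^sup>2 \<le> pi / (2 * (real k - 1))"
      unfolding b_def by (rule wallis_integral_sq_bounds; use k in simp)+
    then show "2 * (real k - 1) / pi \<le> S" "S \<le> 2 * real k / pi"
      using b k unfolding S_def by (simp_all add: field_simps)
  qed
  have K: "real k \<ge> 4" "1 \<le> real m" "real m \<le> real k" using k m by auto
  note N = numeric_bounds[OF K Sb]
  have P: "mgf e 0 > 0" by (rule mgf_0_pos[OF e])
  have R: "facet_ratio k m > 0" by (rule facet_ratio_pos) (use k in simp)
  note M = facet_ratio_mgf_bounds[OF k m(1), folded e_def b_def, folded l_def]
  have "facet_ratio k m \<le> exp (l\<^sup>2 / (2 * (real k)\<^sup>2))"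
  proof -
    have "mgf e l / mgf e 0 \<le> exp (l\<^sup>2 / (2 * (real k)\<^sup>2))"
      using mgf_upper[OF e l0] P unfolding c by (simp add: divide_le_eq mult.commute)
    then show ?thesis using M(1) by linarith
  qed
  then have "ln (facet_ratio k m) \<le> l\<^sup>2 / (2 * (real k)\<^sup>2)" using R by (metis exp_gt_zero ln_exp ln_le_cancel_iff)
  then show "ln (facet_ratio k m) \<le> (real m)\<^sup>2 / (pi * (real k + 1)) + real m / real k"
    using N(1) unfolding l2 by linarith
  \<comment> \<open>q is the exponent from \<open>mgf_lower\<close>, and r below is the loss from
    \<open>jensen_lower\<close>.\<close>
  define q where "q = l\<^sup>2 / (2 * (real k)\<^sup>2) - l\<^sup>2 / (2 * ((real k)\<^sup>2)\<^sup>2) - l ^ 4 / (4 * ((real k)\<^sup>2) ^ 3)"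
  define r where "r = 4 * real m * (1 / b)\<^sup>2 * moment2_bound e l + real m * (real k)\<^sup>2 * moment4_bound e l"
  have "exp (q - r) \<le> facet_ratio k m"
  proof -
    have "mgf e 0 * exp q \<le> mgf e l" using mgf_lower[OF e l0] unfolding c q_def .
    then have "exp q \<le> mgf e l / mgf e 0" using P by (simp add: le_divide_eq mult.commute)
    then have "exp q * exp (- r) \<le> mgf e l / mgf e 0 * exp (- r)" by (intro mult_right_mono) auto
    also have "\<dots> = mgf e l * exp (- r) / mgf e 0" by simp
    also have "\<dots> \<le> facet_ratio k m" using M(2) unfolding r_def .
    finally show ?thesis by (simp add: exp_add[symmetric])
  qed
  then have lo: "q - r \<le> ln (facet_ratio k m)" using R by (simp add: ln_ge_iff)
  have A: "moment2_bound e l = 1 / (real k)\<^sup>2 + (real m)\<^sup>2 * S / real k ^ 4"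
    unfolding moment2_bound_def[OF e l0] c l2 by (simp add: power_mult[symmetric])
  have B: "moment4_bound e l = 3 * moment2_bound e l / (real k)\<^sup>2 + 2 * ((real m)\<^sup>2 * S) / real k ^ 6 + (real m)\<^sup>2 * S * moment2_bound e l / real k ^ 4"
    unfolding moment4_bound_def[OF e l0] c l2 by (simp add: power_mult[symmetric])
  have Q: "q = (real m)\<^sup>2 * S / (2 * (real k)\<^sup>2) - (real m)\<^sup>2 * S / (2 * real k ^ 4) - real m ^ 4 * S\<^sup>2 / (4 * real k ^ 6)"
    unfolding q_def l2 l4 power_mult[symmetric] by simp
  have Rr: "r = 4 * real m * S * moment2_bound e l + real m * (real k)\<^sup>2 * moment4_bound e l"
    unfolding r_def S_def power_one_over ..
  have "(real m)\<^sup>2 / (pi * (real k + 1)) - 11 * (real m ^ 3 / (real k)\<^sup>2) - 10 * (real m / real k) \<le> q - r"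
    unfolding Q Rr B A by (rule N(2))
  from this lo show "(real m)\<^sup>2 / (pi * (real k + 1)) - 11 * (real m ^ 3 / (real k)\<^sup>2) - 10 * (real m / real k) \<le> ln (facet_ratio k m)"
    by (rule order_trans)
qed

subsection \<open>Faces of convex hulls of finite families\<close>

text \<open>The family y may repeat points. The coefficient of a point goes to one chosen index of
  it and the other indices get 0, which preserves signs.\<close>

lemma combination_over_image:
  fixes y :: "'i \<Rightarrow> 'a::real_vector"
  assumes "finite I"
  shows "\<exists>c. sum c I = sum u (y ` I) \<and> (\<Sum>i\<in>I. c i *\<^sub>R y i) = (\<Sum>v\<in>y ` I. u v *\<^sub>R v) \<and>
    (\<forall>i\<in>I. c i = 0 \<or> c i = u (y i))"
proof (intro exI conjI)
  define g where "g = inv_into I y"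
  define c where "c i = (if i \<in> g ` y ` I then u (y i) else 0)" for i
  have gI: "g ` y ` I \<subseteq> I" unfolding g_def by (auto intro: inv_into_into)
  have gi: "inj_on g (y ` I)" unfolding g_def by (auto intro: inj_on_inv_into)
  have yg: "y (g v) = v" if "v \<in> y ` I" for v unfolding g_def using that by (rule f_inv_into_f)
  have "sum c I = sum c (g ` y ` I)"
    by (rule sum.mono_neutral_right) (use assms gI in \<open>auto simp: c_def\<close>)
  also have "\<dots> = (\<Sum>v\<in>y ` I. c (g v))" by (simp add: sum.reindex[OF gi])
  also have "\<dots> = (\<Sum>v\<in>y ` I. u v)"
    by (rule sum.cong) (simp_all add: c_def yg)
  finally show "sum c I = sum u (y ` I)" .
  have "(\<Sum>i\<in>I. c i *\<^sub>R y i) = (\<Sum>i\<in>g ` y ` I. c i *\<^sub>R y i)"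
    by (rule sum.mono_neutral_right) (use assms gI in \<open>auto simp: c_def\<close>)
  also have "\<dots> = (\<Sum>v\<in>y ` I. c (g v) *\<^sub>R y (g v))" by (simp add: sum.reindex[OF gi])
  also have "\<dots> = (\<Sum>v\<in>y ` I. u v *\<^sub>R v)"
    by (rule sum.cong) (simp_all add: c_def yg)
  finally show "(\<Sum>i\<in>I. c i *\<^sub>R y i) = (\<Sum>v\<in>y ` I. u v *\<^sub>R v)" .
  show "\<forall>i\<in>I. c i = 0 \<or> c i = u (y i)" by (simp add: c_def)
qed

lemma combination_collapse:
  fixes y :: "'i \<Rightarrow> 'a::real_vector"
  assumes I: "finite I"
  shows "\<exists>u. sum u (y ` I) = sum c I \<and> (\<Sum>v\<in>y ` I. u v *\<^sub>R v) = (\<Sum>i\<in>I. c i *\<^sub>R y i) \<and>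
    ((\<forall>i\<in>I. 0 \<le> c i) \<longrightarrow> (\<forall>v\<in>y ` I. (0::real) \<le> u v))"
proof (intro exI conjI)
  let ?u = "\<lambda>v. sum c {i \<in> I. y i = v}"
  show "sum ?u (y ` I) = sum c I" by (rule sum.image_gen[OF I, symmetric])
  have "(\<Sum>v\<in>y ` I. ?u v *\<^sub>R v) = (\<Sum>v\<in>y ` I. \<Sum>i\<in>{i \<in> I. y i = v}. c i *\<^sub>R y i)"
    by (intro sum.cong refl) (simp add: scaleR_sum_left)
  also have "\<dots> = (\<Sum>i\<in>I. c i *\<^sub>R y i)" by (rule sum.image_gen[OF I, symmetric])
  finally show "(\<Sum>v\<in>y ` I. ?u v *\<^sub>R v) = (\<Sum>i\<in>I. c i *\<^sub>R y i)" .
  show "(\<forall>i\<in>I. 0 \<le> c i) \<longrightarrow> (\<forall>v\<in>y ` I. (0::real) \<le> ?u v)" by (auto intro!: sum_nonneg)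
qed

lemma affine_hull_finite_image:
  fixes y :: "'i \<Rightarrow> 'a::real_vector"
  assumes "finite I"
  shows "z \<in> affine hull (y ` I) \<longleftrightarrow> (\<exists>c. sum c I = 1 \<and> (\<Sum>i\<in>I. c i *\<^sub>R y i) = z)"
proof
  assume "z \<in> affine hull (y ` I)"
  then obtain u where "sum u (y ` I) = 1" "(\<Sum>v\<in>y ` I. u v *\<^sub>R v) = z"
    using assms by (auto simp: affine_hull_finite)
  with combination_over_image[OF assms, of u y] show "\<exists>c. sum c I = 1 \<and> (\<Sum>i\<in>I. c i *\<^sub>R y i) = z" by metis
next
  assume "\<exists>c. sum c I = 1 \<and> (\<Sum>i\<in>I. c i *\<^sub>R y i) = z"
  then obtain c where "sum c I = 1" "(\<Sum>i\<in>I. c i *\<^sub>R y i) = z" by blast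
  with combination_collapse[OF assms, of y c] show "z \<in> affine hull (y ` I)"
    using assms by (auto simp: affine_hull_finite)
qed

lemma convex_hull_finite_image:
  fixes y :: "'i \<Rightarrow> 'a::real_vector"
  assumes "finite I"
  shows "z \<in> convex hull (y ` I) \<longleftrightarrow> (\<exists>c. (\<forall>i\<in>I. 0 \<le> c i) \<and> sum c I = 1 \<and> (\<Sum>i\<in>I. c i *\<^sub>R y i) = z)"
proof
  assume "z \<in> convex hull (y ` I)"
  then obtain u where u: "\<forall>v\<in>y ` I. 0 \<le> u v" "sum u (y ` I) = 1" "(\<Sum>v\<in>y ` I. u v *\<^sub>R v) = z"
    using assms by (auto simp: convex_hull_finite)
  from combination_over_image[OF assms, of u y] obtain c where
    c: "sum c I = 1" "(\<Sum>i\<in>I. c i *\<^sub>R y i) = z" "\<forall>i\<in>I. c i = 0 \<or> c i = u (y i)"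
    unfolding u(2,3) by blast
  have "0 \<le> c i" if "i \<in> I" for i using c(3) u(1) that by (cases "c i = 0") auto
  with c(1,2) show "\<exists>c. (\<forall>i\<in>I. 0 \<le> c i) \<and> sum c I = 1 \<and> (\<Sum>i\<in>I. c i *\<^sub>R y i) = z" by blast
next
  assume "\<exists>c. (\<forall>i\<in>I. 0 \<le> c i) \<and> sum c I = 1 \<and> (\<Sum>i\<in>I. c i *\<^sub>R y i) = z"
  then obtain c where "\<forall>i\<in>I. 0 \<le> c i" "sum c I = 1" "(\<Sum>i\<in>I. c i *\<^sub>R y i) = z" by blast
  with combination_collapse[OF assms, of y c] obtain u where
    "sum u (y ` I) = 1" "(\<Sum>v\<in>y ` I. u v *\<^sub>R v) = z" "\<forall>v\<in>y ` I. 0 \<le> u v" by auto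
  then show "z \<in> convex hull (y ` I)"
    using assms by (auto simp: convex_hull_finite)
qed

text \<open>Stated for the family instead of its range, so that repeated points count as dependent
  and the coefficients are indexed by a fixed set, as measurability requires.\<close>

definition aff_indep :: "nat set \<Rightarrow> (nat \<Rightarrow> 'a::real_vector) \<Rightarrow> bool"
  where "aff_indep I y \<longleftrightarrow> (\<forall>c. sum c I = 0 \<and> (\<Sum>i\<in>I. c i *\<^sub>R y i) = 0 \<longrightarrow> (\<forall>i\<in>I. c i = (0::real)))"

lemma aff_indep_iff:
  assumes I: "finite I"
  shows "aff_indep I y \<longleftrightarrow> inj_on y I \<and> \<not> affine_dependent (y ` I)"
proof
  assume a: "aff_indep I y"
  have inj: "inj_on y I"
  proof (rule inj_onI, rule ccontr)
    fix i j assume ij: "i \<in> I" "j \<in> I" "y i = y j" "i \<noteq> j"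
    let ?c = "\<lambda>l. if l = i then 1 else if l = j then -1 else (0::real)"
    have 1: "(\<Sum>l\<in>I. ?c l) = (\<Sum>l\<in>{i, j}. ?c l)"
      by (rule sum.mono_neutral_right) (use I ij in auto)
    have 2: "(\<Sum>l\<in>I. ?c l *\<^sub>R y l) = (\<Sum>l\<in>{i, j}. ?c l *\<^sub>R y l)"
      by (rule sum.mono_neutral_right) (use I ij in auto)
    have "sum ?c I = 0" "(\<Sum>l\<in>I. ?c l *\<^sub>R y l) = 0" unfolding 1 2 using ij by auto
    with a ij(1) show False unfolding aff_indep_def by fastforce
  qed
  moreover have "\<not> affine_dependent (y ` I)"
  proof
    assume "affine_dependent (y ` I)"
    then obtain u where u: "sum u (y ` I) = 0" "(\<Sum>v\<in>y ` I. u v *\<^sub>R v) = 0" "\<exists>v\<in>y ` I. u v \<noteq> 0"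
      using I by (auto simp: affine_dependent_explicit_finite)
    have "sum (\<lambda>i. u (y i)) I = 0" "(\<Sum>i\<in>I. u (y i) *\<^sub>R y i) = 0"
      using u(1,2) by (simp_all add: sum.reindex[OF inj])
    then have "\<forall>i\<in>I. u (y i) = 0"
      using a[unfolded aff_indep_def, rule_format, of "\<lambda>i. u (y i)"] by blast
    with u(3) show False by auto
  qed
  ultimately show "inj_on y I \<and> \<not> affine_dependent (y ` I)" by blast
next
  assume r: "inj_on y I \<and> \<not> affine_dependent (y ` I)"
  show "aff_indep I y"
    unfolding aff_indep_def
  proof (intro allI impI ballI, rule ccontr)
    fix c i assume c: "sum c I = 0 \<and> (\<Sum>i\<in>I. c i *\<^sub>R y i) = 0" and i: "i \<in> I" "c i \<noteq> 0"
    let ?u = "\<lambda>v. c (inv_into I y v)"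
    have inj: "inj_on y I" using r by blast
    have "sum ?u (y ` I) = 0" "(\<Sum>v\<in>y ` I. ?u v *\<^sub>R v) = 0" "\<exists>v\<in>y ` I. ?u v \<noteq> 0"
      using c i by (auto simp: sum.reindex[OF inj] inv_into_f_f[OF inj] cong: sum.cong)
    then have "affine_dependent (y ` I)" using I by (auto simp: affine_dependent_explicit_finite)
    with r show False by blast
  qed
qed

text \<open>Translating each set by one of its points leaves linearly independent sets whose spans
  are parallel to the common hull and so coincide. It follows that the choice in
  \<open>affdim\<close> is well determined.\<close>

lemma card_eq_of_affine_hull_eq:
  fixes B C :: "'a::real_vector set"
  assumes B: "\<not> affine_dependent B" and C: "\<not> affine_dependent C" and h: "affine hull B = affine hull C"
  shows "card B = card C"
proof (cases "B = {}")
  case True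
  then show ?thesis using h by (metis affine_hull_empty affine_hull_eq_empty)
next
  case False
  then have "C \<noteq> {}" using h by (metis affine_hull_eq_empty)
  then obtain b c where b: "b \<in> B" and c: "c \<in> C" using False by blast
  define B' where "B' = (\<lambda>x. -b + x) ` (B - {b})"
  define C' where "C' = (\<lambda>x. -c + x) ` (C - {c})"
  have hB: "affine hull B = (\<lambda>x. b + x) ` span B'" and hC: "affine hull C = (\<lambda>x. c + x) ` span C'"
    unfolding B'_def C'_def by (rule affine_hull_span2[OF b], rule affine_hull_span2[OF c])
  have "affine_parallel (affine hull B) (span B')" "affine_parallel (affine hull C) (span C')"
    unfolding hB hC by (metis affine_parallel_commute affine_parallel_def)+
  then have span: "span B' = span C'"
    using affine_parallel_subspace[OF affine_affine_hull, of B] False h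
    by (metis affine_hull_eq_empty subspace_span)
  have "independent B'" "independent C'"
    unfolding B'_def C'_def using B C affine_dependent_iff_dependent2[OF b] affine_dependent_iff_dependent2[OF c] by auto
  from real_vector.bij_if_span_eq_span_bases[OF this span] obtain f where f: "bij_betw f B' C'" ..
  have i1: "bij_betw (\<lambda>x. -b + x) (B - {b}) B'" and i2: "bij_betw (\<lambda>x. -c + x) (C - {c}) C'"
    by (auto simp: B'_def C'_def bij_betw_def inj_on_def)
  have fin: "finite (B - {b}) = finite (C - {c})" and ce: "card (B - {b}) = card (C - {c})"
    using bij_betw_finite[OF f] bij_betw_finite[OF i1] bij_betw_finite[OF i2]
      bij_betw_same_card[OF f] bij_betw_same_card[OF i1] bij_betw_same_card[OF i2] by auto
  show ?thesis
  proof (cases "finite B")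
    case True
    then have "finite C" using fin by simp
    then show ?thesis using True ce b c by (metis card.remove)
  next
    case False
    then show ?thesis using fin by simp
  qed
qed

lemma affdim_eqI:
  assumes B: "\<not> affine_dependent B" and h: "affine hull B = affine hull V"
  shows "affdim V = int (card B) - 1"
  unfolding affdim_def
proof (rule some_equality)
  show "\<exists>C. affine hull C = affine hull V \<and> \<not> affine_dependent C \<and> int (card C) = int (card B) - 1 + 1"
    using assms by auto
next
  fix e assume "\<exists>C. affine hull C = affine hull V \<and> \<not> affine_dependent C \<and> int (card C) = e + 1"
  then obtain C where C: "affine hull C = affine hull V" "\<not> affine_dependent C" "int (card C) = e + 1" by blast
  then have "card B = card C" using B h by (intro card_eq_of_affine_hull_eq) auto
  then show "e = int (card B) - 1" using C by simp
qed

lemma affdim_cong: "affine hull V = affine hull W \<Longrightarrow> affdim V = affdim W"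
  by (simp add: affdim_def)

lemma affine_basis_of_image:
  fixes y :: "nat \<Rightarrow> 'a::real_vector"
  assumes J: "finite J"
  obtains I where "I \<subseteq> J" "aff_indep I y" "affine hull (y ` I) = affine hull (y ` J)"
    "affdim (y ` J) = int (card I) - 1"
proof -
  obtain B where B: "B \<subseteq> y ` J" "\<not> affine_dependent B" "affine hull (y ` J) = affine hull B"
    using affine_basis_exists by blast
  from subset_image_inj[of B y J] B(1) obtain I where I: "I \<subseteq> J" "inj_on y I" "B = y ` I" by blast
  have fI: "finite I" using I(1) J by (rule finite_subset)
  have "affdim (y ` J) = int (card B) - 1" by (rule affdim_eqI) (use B in auto)
  moreover have "card B = card I" unfolding I(3) by (rule card_image[OF I(2)])
  ultimately show ?thesis using that[of I] I B aff_indep_iff[OF fI, of y] by auto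
qed

text \<open>Reduces the dimension to finitely many statements about \<open>aff_indep\<close>, whose
  measurability is treated one by one.\<close>

lemma affdim_image_iff:
  fixes y :: "nat \<Rightarrow> 'a::real_vector"
  assumes J: "finite J"
  shows "affdim (y ` J) = int r - 1 \<longleftrightarrow>
    (\<exists>I. I \<subseteq> J \<and> card I = r \<and> aff_indep I y) \<and> (\<forall>I. I \<subseteq> J \<and> card I = Suc r \<longrightarrow> \<not> aff_indep I y)"
proof -
  obtain I0 where I0: "I0 \<subseteq> J" "aff_indep I0 y" "affdim (y ` J) = int (card I0) - 1"
    using affine_basis_of_image[OF J] by metis
  have le: "card I \<le> card I0" if I: "I \<subseteq> J" "aff_indep I y" for I
  proof -
    have fI: "finite I" using I(1) J by (rule finite_subset)
    have i: "inj_on y I" "\<not> affine_dependent (y ` I)" using aff_indep_iff[OF fI, of y] I(2) by auto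
    obtain T where T: "\<not> affine_dependent T" "y ` I \<subseteq> T" "T \<subseteq> y ` J" "affine hull T = affine hull (y ` J)"
      using extend_to_affine_basis[OF i(2), of "y ` J"] I(1) by (metis image_mono)
    have "affdim (y ` J) = int (card T) - 1" by (rule affdim_eqI[OF T(1,4)])
    then have "card T = card I0" using I0(3) by simp
    moreover have "card (y ` I) \<le> card T"
      using T(2,3) J by (intro card_mono) (auto intro: finite_subset)
    ultimately show ?thesis using card_image[OF i(1)] by simp
  qed
  have sub: "aff_indep I' y" if "I' \<subseteq> I" "aff_indep I y" "I \<subseteq> J" for I I'
    using that J aff_indep_iff[of I y] aff_indep_iff[of I' y]
    by (meson affine_dependent_subset finite_subset image_mono inj_on_subset)
  show ?thesis
  proof
    assume "affdim (y ` J) = int r - 1"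
    then have "card I0 = r" using I0(3) by simp
    then show "(\<exists>I. I \<subseteq> J \<and> card I = r \<and> aff_indep I y) \<and> (\<forall>I. I \<subseteq> J \<and> card I = Suc r \<longrightarrow> \<not> aff_indep I y)"
      using I0(1,2) le by (metis Suc_n_not_le_n)
  next
    assume R: "(\<exists>I. I \<subseteq> J \<and> card I = r \<and> aff_indep I y) \<and> (\<forall>I. I \<subseteq> J \<and> card I = Suc r \<longrightarrow> \<not> aff_indep I y)"
    then have "r \<le> card I0" using le by blast
    moreover have "\<not> Suc r \<le> card I0"
    proof
      assume "Suc r \<le> card I0"
      then obtain I' where "I' \<subseteq> I0" "card I' = Suc r" by (metis obtain_subset_with_card_n)
      then show False using R sub[of I' I0] I0 by blast
    qed
    ultimately show "affdim (y ` J) = int r - 1" using I0(3) by simp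
  qed
qed

text \<open>The combination lies in the open segment between s and the renormalised combination z of
  the other points, and a face contains the end points of such a segment. If u s = 1 or s = z there
  is no segment, but the combination is s itself.\<close>

lemma face_contains_summand:
  fixes S :: "'a::real_vector set"
  assumes F: "F face_of convex hull S" and S: "finite S" and u: "\<forall>v\<in>S. 0 \<le> u v" "sum u S = 1"
    and y: "(\<Sum>v\<in>S. u v *\<^sub>R v) \<in> F" and s: "s \<in> S" "u s > 0"
  shows "s \<in> F"
proof (cases "u s = 1")
  case True
  have "sum u (S - {s}) = 0" using u(2) s(1) S True by (simp add: sum_diff1)
  then have "\<forall>v\<in>S - {s}. u v = 0" using u(1) S by (subst (asm) sum_nonneg_eq_0_iff) auto
  then have "(\<Sum>v\<in>S. u v *\<^sub>R v) = (\<Sum>v\<in>{s}. u v *\<^sub>R v)"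
    using S s by (intro sum.mono_neutral_right) auto
  then show ?thesis using y True by simp
next
  case False
  have us: "sum u (S - {s}) = 1 - u s" using u(2) s(1) S by (simp add: sum_diff1)
  have "0 \<le> sum u (S - {s})" using u by (intro sum_nonneg) auto
  then have t: "1 - u s > 0" using us False by simp
  define z where "z = (\<Sum>v\<in>S - {s}. (u v / (1 - u s)) *\<^sub>R v)"
  have z: "z \<in> convex hull S"
    unfolding z_def
  proof (rule convex_sum)
    show "(\<Sum>v\<in>S - {s}. u v / (1 - u s)) = 1" using us t by (simp flip: sum_divide_distrib)
  qed (use S u t in \<open>auto intro: hull_inc\<close>)
  have eq: "(\<Sum>v\<in>S. u v *\<^sub>R v) = u s *\<^sub>R s + (1 - u s) *\<^sub>R z"
    using t by (subst sum.remove[OF S s(1)]) (simp add: z_def scaleR_sum_right)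
  show ?thesis
  proof (cases "s = z")
    case True
    then show ?thesis using y eq by (metis add.commute diff_add_cancel scaleR_left_distrib scaleR_one)
  next
    case False
    have "(\<Sum>v\<in>S. u v *\<^sub>R v) \<in> open_segment s z"
      unfolding eq in_segment using False t s(2) by (auto intro!: exI[of _ "1 - u s"])
    then show ?thesis using F y z s(1) unfolding face_of_def by (meson hull_inc)
  qed
qed

text \<open>For the second part let b be the barycentre of the points of S in F and z a common point
  of the two hulls. Prolonging the segment from z through b a little reaches a point b' still in F,
  so the face property puts z into F. Then all coefficients of z at points outside F would have to
  vanish.\<close>

lemma face_of_convex_hull_finite:
  fixes S :: "'a::real_vector set"
  assumes S: "finite S" and F: "F face_of convex hull S"
  shows "F = convex hull (S \<inter> F)" "affine hull (S \<inter> F) \<inter> convex hull (S - F) = {}"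
proof -
  have cF: "convex F" and sub: "F \<subseteq> convex hull S" using F by (auto simp: face_of_def)
  have supp: "u v = 0" if "\<forall>v\<in>S. 0 \<le> u v" "sum u S = 1" "(\<Sum>v\<in>S. u v *\<^sub>R v) \<in> F" "v \<in> S - F" for u :: "'a \<Rightarrow> real" and v
    using face_contains_summand[OF F S that(1-3), of v] that(1,4) by force
  show "F = convex hull (S \<inter> F)"
  proof
    show "convex hull (S \<inter> F) \<subseteq> F" using cF by (simp add: subset_hull)
    show "F \<subseteq> convex hull (S \<inter> F)"
    proof
      fix y assume y: "y \<in> F"
      then have "y \<in> convex hull S" using sub by blast
      then obtain u where u: "\<forall>v\<in>S. 0 \<le> u v" "sum u S = 1" "(\<Sum>v\<in>S. u v *\<^sub>R v) = y"
        using S by (auto simp: convex_hull_finite)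
      have z: "u v = 0" if "v \<in> S - F" for v using supp[OF u(1,2) _ that] u(3) y by simp
      have "sum u (S \<inter> F) = sum u S" by (rule sum.mono_neutral_left) (use S z in auto)
      moreover have "(\<Sum>v\<in>S \<inter> F. u v *\<^sub>R v) = (\<Sum>v\<in>S. u v *\<^sub>R v)"
        by (rule sum.mono_neutral_left) (use S z in auto)
      ultimately show "y \<in> convex hull (S \<inter> F)"
        using S u by (subst convex_hull_finite) (auto intro!: exI[of _ u])
    qed
  qed
  show "affine hull (S \<inter> F) \<inter> convex hull (S - F) = {}"
  proof (rule ccontr)
    let ?T = "S \<inter> F"
    have T: "finite ?T" using S by simp
    assume "affine hull ?T \<inter> convex hull (S - F) \<noteq> {}"
    then obtain z where za: "z \<in> affine hull ?T" and zc: "z \<in> convex hull (S - F)" by blast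
    have ne: "?T \<noteq> {}" using za by auto
    obtain c where c: "sum c ?T = 1" "(\<Sum>v\<in>?T. c v *\<^sub>R v) = z"
      using za T by (auto simp: affine_hull_finite)
    define N where "N = real (card ?T)"
    have N: "N > 0" using ne T by (simp add: N_def card_gt_0_iff)
    define b where "b = (\<Sum>v\<in>?T. (1 / N) *\<^sub>R v)"
    define C where "C = (\<Sum>v\<in>?T. \<bar>c v\<bar>) + 1"
    have C: "C > 0" unfolding C_def by (simp add: add_nonneg_pos sum_nonneg)
    have cC: "c v \<le> C" if "v \<in> ?T" for v
      using member_le_sum[OF that, of "\<lambda>v. \<bar>c v\<bar>"] T by (simp add: C_def)
    \<comment> \<open>Small enough to keep the coefficients (1 + e) / N - e c v of b' nonnegative: e
      C is 1 / N.\<close>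
    define e where "e = 1 / (N * C)"
    have e: "e > 0" using N C by (simp add: e_def)
    define b' where "b' = b + e *\<^sub>R (b - z)"
    have bF: "b \<in> F"
      unfolding b_def by (rule convex_sum[OF T cF]) (use N in \<open>auto simp: N_def\<close>)
    have b'_eq: "b' = (\<Sum>v\<in>?T. ((1 + e) / N - e * c v) *\<^sub>R v)"
    proof -
      have "(\<Sum>v\<in>?T. ((1 + e) / N - e * c v) *\<^sub>R v) = (1 + e) *\<^sub>R b - e *\<^sub>R z"
        unfolding b_def c(2)[symmetric] by (simp add: scaleR_diff_left sum_subtractf scaleR_sum_right)
      then show ?thesis by (simp add: b'_def algebra_simps)
    qed
    have b'F: "b' \<in> F"
      unfolding b'_eq
    proof (rule convex_sum[OF T cF])
      show "(\<Sum>v\<in>?T. (1 + e) / N - e * c v) = 1"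
        using c(1) N by (simp add: sum_subtractf flip: sum_distrib_left N_def)
      fix v assume v: "v \<in> ?T"
      have "e * c v \<le> e * C" using cC[OF v] e by (intro mult_left_mono) auto
      also have "\<dots> = 1 / N" using C by (simp add: e_def)
      also have "\<dots> \<le> (1 + e) / N" using e N by (intro divide_right_mono) auto
      finally show "0 \<le> (1 + e) / N - e * c v" by simp
      show "v \<in> F" using v by blast
    qed
    have "z \<in> F"
    proof (cases "z = b")
      case True
      then show ?thesis using bF by simp
    next
      case False
      have bz: "b' \<noteq> z"
      proof
        assume "b' = z"
        then have "(1 + e) *\<^sub>R (b - z) = 0" by (simp add: b'_def algebra_simps)
        then show False using e False by simp
      qed
      have "b = (1 - e / (1 + e)) *\<^sub>R b' + (e / (1 + e)) *\<^sub>R z"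
      proof -
        have 1: "1 - e / (1 + e) = 1 / (1 + e)" using e by (simp add: field_simps)
        have "(1 + e) *\<^sub>R b = b' + e *\<^sub>R z" by (simp add: b'_def algebra_simps)
        then have "(1 / (1 + e)) *\<^sub>R ((1 + e) *\<^sub>R b) = (1 / (1 + e)) *\<^sub>R (b' + e *\<^sub>R z)" by simp
        then show ?thesis unfolding 1 using e by (simp add: scaleR_add_right)
      qed
      then have "b \<in> open_segment b' z"
        unfolding in_segment using bz e by (auto intro!: exI[of _ "e / (1 + e)"])
      moreover have "z \<in> convex hull S" using zc hull_mono[of "S - F" S convex] by blast
      ultimately show ?thesis using F bF b'F sub unfolding face_of_def by blast
    qed
    from zc obtain u where u: "\<forall>v\<in>S - F. 0 \<le> u v" "sum u (S - F) = 1" "(\<Sum>v\<in>S - F. u v *\<^sub>R v) = z"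
      using S by (auto simp: convex_hull_finite)
    define u' where "u' v = (if v \<in> F then 0 else u v)" for v
    have 1: "sum u' S = sum u (S - F)"
      by (rule sum.mono_neutral_cong_right) (use S in \<open>auto simp: u'_def\<close>)
    have 2: "(\<Sum>v\<in>S. u' v *\<^sub>R v) = (\<Sum>v\<in>S - F. u v *\<^sub>R v)"
      by (rule sum.mono_neutral_cong_right) (use S in \<open>auto simp: u'_def\<close>)
    have "u v = 0" if "v \<in> S - F" for v
      using supp[of u' v] u 1 2 \<open>z \<in> F\<close> that by (auto simp: u'_def)
    then show False using u(2) by simp
  qed
qed

definition separated :: "nat set \<Rightarrow> nat set \<Rightarrow> (nat \<Rightarrow> 'a::real_vector) \<Rightarrow> bool"
  where "separated J K y \<longleftrightarrow> affine hull (y ` J) \<inter> convex hull (y ` K) = {}"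

text \<open>A face is recorded by the indices of all points in it and recovered as their hull;
  separation characterises the index sets that arise in this way. Degenerate and repeated points are
  covered, and the count becomes a finite sum of indicators.\<close>

lemma card_facets_eq:
  assumes N: "finite N"
  shows "card (facets d (convex hull (y ` N))) =
    card {J. J \<subseteq> N \<and> separated J (N - J) y \<and> affdim (y ` J) = int d - 1}"
proof -
  let ?S = "y ` N"
  let ?A = "{J. J \<subseteq> N \<and> separated J (N - J) y \<and> affdim (y ` J) = int d - 1}"
  have S: "finite ?S" using N by simp
  have disj: "y j \<notin> convex hull (y ` J)" if "J \<in> ?A" "j \<in> N - J" for J j
  proof
    assume "y j \<in> convex hull (y ` J)"
    then have "y j \<in> affine hull (y ` J)" using convex_hull_subset_affine_hull by blast
    moreover have "y j \<in> convex hull (y ` (N - J))" using that(2) by (auto intro: hull_inc)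
    ultimately show False using that(1) by (auto simp: separated_def)
  qed
  have recover: "J = {j \<in> N. y j \<in> convex hull (y ` J)}" if "J \<in> ?A" for J
    using disj[OF that] that by (auto intro: hull_inc)
  have "bij_betw (\<lambda>J. convex hull (y ` J)) ?A (facets d (convex hull ?S))"
    unfolding bij_betw_def
  proof
    show "inj_on (\<lambda>J. convex hull (y ` J)) ?A"
    proof (rule inj_onI)
      fix J K assume JK: "J \<in> ?A" "K \<in> ?A" and e: "convex hull (y ` J) = convex hull (y ` K)"
      have "J = {j \<in> N. y j \<in> convex hull (y ` J)}" by (rule recover[OF JK(1)])
      also have "\<dots> = {j \<in> N. y j \<in> convex hull (y ` K)}" using e by simp
      also have "\<dots> = K" by (rule recover[OF JK(2), symmetric])
      finally show "J = K" .
    qed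
    show "(\<lambda>J. convex hull (y ` J)) ` ?A = facets d (convex hull ?S)"
    proof (intro equalityI subsetI)
      fix F assume "F \<in> (\<lambda>J. convex hull (y ` J)) ` ?A"
      then obtain J where J: "J \<in> ?A" "F = convex hull (y ` J)" by blast
      have eq: "?S - y ` J = y ` (N - J)"
        using disj[OF J(1)] hull_inc[of _ "y ` J" convex] by force
      have "F face_of convex hull ?S"
        unfolding J(2) by (rule face_of_convex_hulls[OF S]) (use J(1) eq in \<open>auto simp: separated_def\<close>)
      moreover have "affdim F = int d - 1"
        using J affdim_cong[OF affine_hull_convex_hull, of "y ` J"] by simp
      ultimately show "F \<in> facets d (convex hull ?S)" by (simp add: facets_def)
    next
      fix F assume "F \<in> facets d (convex hull ?S)"
      then have F: "F face_of convex hull ?S" "affdim F = int d - 1" by (auto simp: facets_def)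
      define J where "J = {j \<in> N. y j \<in> F}"
      have e: "y ` J = ?S \<inter> F" "y ` (N - J) = ?S - F" by (auto simp: J_def)
      have FJ: "F = convex hull (y ` J)" unfolding e by (rule face_of_convex_hull_finite(1)[OF S F(1)])
      have "separated J (N - J) y"
        unfolding separated_def e by (rule face_of_convex_hull_finite(2)[OF S F(1)])
      moreover have "affdim (y ` J) = int d - 1"
        using F(2) affdim_cong[OF affine_hull_convex_hull, of "y ` J"] FJ by simp
      ultimately have "J \<in> ?A" by (auto simp: J_def)
      with FJ show "F \<in> (\<lambda>J. convex hull (y ` J)) ` ?A" by blast
    qed
  qed
  from bij_betw_same_card[OF this] show ?thesis by simp
qed

subsection \<open>Measurability of the number of facets\<close>

text \<open>
  The Bochner integral of a nonmeasurable function is \<open>0\<close>, so the number of facets has to be measurable also on the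
  null set of degenerate configurations. The coefficients witnessing degeneracy range over a countable union of compact
  boxes, along which closed sets project to closed sets.
\<close>

lemma closed_projection:
  fixes S :: "('a::topological_space \<times> 'b::topological_space) set"
  assumes S: "closed S" and C: "compact C"
  shows "closed {x. \<exists>c\<in>C. (x, c) \<in> S}"
proof -
  have "compact_space (top_of_set C)" using C by (simp add: compact_space_subtopology)
  from closed_map_fst[OF this, of "euclidean :: 'a topology"]
  have "closed_map (top_of_set (UNIV \<times> C)) euclidean (fst :: 'a \<times> 'b \<Rightarrow> 'a)"
    using prod_topology_subtopology_eu[of "UNIV :: 'a set" C] by simp
  moreover have "closedin (top_of_set (UNIV \<times> C)) ((UNIV \<times> C) \<inter> S)"
    using S by (rule closedin_closed_Int)
  ultimately have "closedin euclidean (fst ` ((UNIV \<times> C) \<inter> S))" unfolding closed_map_def by blast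
  moreover have "fst ` ((UNIV \<times> C) \<inter> S) = {x. \<exists>c\<in>C. (x, c) \<in> S}" by force
  ultimately show ?thesis by (simp only: closed_closedin)
qed

text \<open>Compact by Tychonoff's theorem, although all of \<open>nat\<close> indexes the
  coefficients.\<close>

definition coeff_box :: "real \<Rightarrow> (nat \<Rightarrow> real) set"
  where "coeff_box R = {c. \<forall>i. \<bar>c i\<bar> \<le> R}"

lemma compact_coeff_box: "compact (coeff_box R)"
proof -
  have "coeff_box R = PiE UNIV (\<lambda>_. {-R..R})" by (auto simp: coeff_box_def PiE_iff abs_le_iff minus_le_iff)
  moreover have "compactin (product_topology (\<lambda>_::nat. euclidean) UNIV) (PiE UNIV (\<lambda>_. {-R..R}))"
    by (subst compactin_PiE) simp
  ultimately show ?thesis by (simp add: euclidean_product_topology)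
qed

lemma sum_scaleR_fun_apply:
  "(\<Sum>i\<in>I. c i *\<^sub>R (y i :: nat \<Rightarrow> real)) = (\<lambda>p. \<Sum>i\<in>I. c i * y i p)"
proof (induction I rule: infinite_finite_induct)
  case (insert i I)
  then show ?case by (simp add: scaleR_fun_def fun_eq_iff)
qed (simp_all add: fun_eq_iff)

lemma continuous_on_coeff: "continuous_on S (\<lambda>z :: (nat \<Rightarrow> nat \<Rightarrow> real) \<times> (nat \<Rightarrow> real). snd z i)"
  by (rule continuous_on_compose2[OF continuous_on_product_coordinates[of i] continuous_on_snd[OF continuous_on_id]]) auto

lemma continuous_on_entry: "continuous_on S (\<lambda>z :: (nat \<Rightarrow> nat \<Rightarrow> real) \<times> (nat \<Rightarrow> real). fst z i p)"
proof -
  have "continuous_on S (\<lambda>z :: (nat \<Rightarrow> nat \<Rightarrow> real) \<times> (nat \<Rightarrow> real). fst z i)"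
    by (rule continuous_on_compose2[OF continuous_on_product_coordinates[of i] continuous_on_fst[OF continuous_on_id]]) auto
  then show ?thesis
    by (rule continuous_on_compose2[OF continuous_on_product_coordinates[of p]]) auto
qed

text \<open>J and K are disjoint, so one function c carries both families of coefficients. The
  affine ones are unbounded, hence the union over R.\<close>

lemma not_separated_iff:
  fixes y :: "nat \<Rightarrow> nat \<Rightarrow> real"
  assumes J: "finite J" and K: "finite K" and JK: "J \<inter> K = {}"
  shows "\<not> separated J K y \<longleftrightarrow> (\<exists>R::nat. \<exists>c\<in>coeff_box R. sum c J = 1 \<and> sum c K = 1 \<and> (\<forall>i\<in>K. 0 \<le> c i) \<and>
    (\<forall>p. (\<Sum>i\<in>J. c i * y i p) = (\<Sum>i\<in>K. c i * y i p)))"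
proof
  assume "\<not> separated J K y"
  then obtain z where "z \<in> affine hull (y ` J)" "z \<in> convex hull (y ` K)" by (auto simp: separated_def)
  then obtain a b where a: "sum a J = 1" "(\<Sum>i\<in>J. a i *\<^sub>R y i) = z"
    and b: "\<forall>i\<in>K. 0 \<le> b i" "sum b K = 1" "(\<Sum>i\<in>K. b i *\<^sub>R y i) = z"
    using affine_hull_finite_image[OF J, of z y] convex_hull_finite_image[OF K, of z y] by blast
  define c where "c i = (if i \<in> J then a i else if i \<in> K then b i else 0)" for i
  have cK: "c i = b i" if "i \<in> K" for i using that JK by (auto simp: c_def)
  have cJ: "c i = a i" if "i \<in> J" for i using that by (simp add: c_def)
  define R where "R = nat \<lceil>\<Sum>i\<in>J \<union> K. \<bar>c i\<bar>\<rceil>"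
  have "c \<in> coeff_box (real R)"
    unfolding coeff_box_def
  proof (intro CollectI allI)
    fix i
    have S: "(\<Sum>i\<in>J \<union> K. \<bar>c i\<bar>) \<le> real R" unfolding R_def by (rule real_nat_ceiling_ge)
    show "\<bar>c i\<bar> \<le> real R"
    proof (cases "i \<in> J \<union> K")
      case True
      from member_le_sum[OF this, of "\<lambda>i. \<bar>c i\<bar>"] J K S show ?thesis by simp
    next
      case False
      then show ?thesis by (simp add: c_def)
    qed
  qed
  moreover have "sum c J = 1" "sum c K = 1" "\<forall>i\<in>K. 0 \<le> c i"
    using a b cJ cK by (auto cong: sum.cong)
  moreover have "(\<Sum>i\<in>J. c i * y i p) = (\<Sum>i\<in>K. c i * y i p)" for p
  proof -
    have "(\<Sum>i\<in>J. c i * y i p) = z p" using a(2)[unfolded sum_scaleR_fun_apply] cJ by (auto cong: sum.cong)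
    moreover have "(\<Sum>i\<in>K. c i * y i p) = z p" using b(3)[unfolded sum_scaleR_fun_apply] cK by (auto cong: sum.cong)
    ultimately show ?thesis by simp
  qed
  ultimately show "\<exists>R::nat. \<exists>c\<in>coeff_box R. sum c J = 1 \<and> sum c K = 1 \<and> (\<forall>i\<in>K. 0 \<le> c i) \<and>
    (\<forall>p. (\<Sum>i\<in>J. c i * y i p) = (\<Sum>i\<in>K. c i * y i p))" by blast
next
  assume "\<exists>R::nat. \<exists>c\<in>coeff_box R. sum c J = 1 \<and> sum c K = 1 \<and> (\<forall>i\<in>K. 0 \<le> c i) \<and>
    (\<forall>p. (\<Sum>i\<in>J. c i * y i p) = (\<Sum>i\<in>K. c i * y i p))"
  then obtain c where c: "sum c J = 1" "sum c K = 1" "\<forall>i\<in>K. 0 \<le> c i"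
    "\<forall>p. (\<Sum>i\<in>J. c i * y i p) = (\<Sum>i\<in>K. c i * y i p)" by blast
  then have e: "(\<Sum>i\<in>J. c i *\<^sub>R y i) = (\<Sum>i\<in>K. c i *\<^sub>R y i)" unfolding sum_scaleR_fun_apply by simp
  have "(\<Sum>i\<in>J. c i *\<^sub>R y i) \<in> affine hull (y ` J)"
    unfolding affine_hull_finite_image[OF J] using c(1) by blast
  moreover have "(\<Sum>i\<in>J. c i *\<^sub>R y i) \<in> convex hull (y ` K)"
    unfolding convex_hull_finite_image[OF K] e using c(2,3) by blast
  ultimately show "\<not> separated J K y" by (auto simp: separated_def)
qed

lemma separated_borel:
  assumes J: "finite J" and K: "finite K" and JK: "J \<inter> K = {}"
  shows "{y :: nat \<Rightarrow> nat \<Rightarrow> real. separated J K y} \<in> sets borel"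
proof -
  define S where "S = {z :: (nat \<Rightarrow> nat \<Rightarrow> real) \<times> (nat \<Rightarrow> real). (\<Sum>i\<in>J. snd z i) = 1 \<and> (\<Sum>i\<in>K. snd z i) = 1 \<and> (\<forall>i. i \<in> K \<longrightarrow> 0 \<le> snd z i) \<and>
    (\<forall>p. (\<Sum>i\<in>J. snd z i * fst z i p) = (\<Sum>i\<in>K. snd z i * fst z i p))}"
  have "closed S"
    unfolding S_def
    by (intro closed_Collect_conj closed_Collect_all closed_Collect_imp closed_Collect_le closed_Collect_eq
        continuous_intros continuous_on_coeff continuous_on_entry) auto
  then have "closed {y. \<exists>c\<in>coeff_box (real R). (y, c) \<in> S}" for R :: nat
    by (rule closed_projection[OF _ compact_coeff_box])
  then have "(\<Union>R::nat. {y. \<exists>c\<in>coeff_box (real R). (y, c) \<in> S}) \<in> sets borel" by auto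
  then have "- (\<Union>R::nat. {y. \<exists>c\<in>coeff_box (real R). (y, c) \<in> S}) \<in> sets borel" by (rule borel_comp)
  also have "- (\<Union>R::nat. {y. \<exists>c\<in>coeff_box (real R). (y, c) \<in> S}) = {y. separated J K y}"
  proof -
    have "y \<in> (\<Union>R::nat. {y. \<exists>c\<in>coeff_box (real R). (y, c) \<in> S}) \<longleftrightarrow> \<not> separated J K y" for y
      unfolding not_separated_iff[OF assms] S_def by (simp add: Ball_def)
    then show ?thesis by blast
  qed
  finally show ?thesis .
qed

text \<open>Dividing by the sum of the absolute values makes nontriviality a closed condition and
  keeps all coefficients in a single box.\<close>

lemma not_aff_indep_iff:
  fixes y :: "nat \<Rightarrow> nat \<Rightarrow> real"
  assumes I: "finite I"
  shows "\<not> aff_indep I y \<longleftrightarrow> (\<exists>c\<in>coeff_box 1. (\<Sum>i\<in>I. \<bar>c i\<bar>) = 1 \<and> sum c I = 0 \<and> (\<forall>p. (\<Sum>i\<in>I. c i * y i p) = 0))"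
proof
  assume "\<not> aff_indep I y"
  then obtain c i where c: "sum c I = 0" "(\<Sum>i\<in>I. c i *\<^sub>R y i) = 0" and i: "i \<in> I" "c i \<noteq> 0"
    unfolding aff_indep_def by blast
  define s where "s = (\<Sum>i\<in>I. \<bar>c i\<bar>)"
  have "\<bar>c i\<bar> \<le> s" unfolding s_def using member_le_sum[OF i(1), of "\<lambda>i. \<bar>c i\<bar>"] I by simp
  then have s: "s > 0" using i(2) by simp
  define b where "b i = (if i \<in> I then c i / s else 0)" for i
  have bI: "b i = c i / s" if "i \<in> I" for i using that by (simp add: b_def)
  have 1: "(\<Sum>i\<in>I. \<bar>b i\<bar>) = 1" using s by (simp add: bI abs_divide flip: sum_divide_distrib s_def)
  have "\<bar>b i\<bar> \<le> 1" for i
  proof (cases "i \<in> I")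
    case True
    from member_le_sum[OF this, of "\<lambda>i. \<bar>b i\<bar>"] I 1 show ?thesis by simp
  qed (simp add: b_def)
  then have "b \<in> coeff_box 1" by (simp add: coeff_box_def)
  moreover have "sum b I = 0" using c(1) by (simp add: bI flip: sum_divide_distrib)
  moreover have "(\<Sum>i\<in>I. b i * y i p) = 0" for p
  proof -
    have "(\<Sum>i\<in>I. b i * y i p) = (\<Sum>i\<in>I. c i * y i p) / s" by (simp add: bI sum_divide_distrib)
    also have "(\<Sum>i\<in>I. c i * y i p) = 0" using c(2)[unfolded sum_scaleR_fun_apply] by (simp add: fun_eq_iff)
    finally show ?thesis by simp
  qed
  ultimately show "\<exists>c\<in>coeff_box 1. (\<Sum>i\<in>I. \<bar>c i\<bar>) = 1 \<and> sum c I = 0 \<and> (\<forall>p. (\<Sum>i\<in>I. c i * y i p) = 0)"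
    using 1 by blast
next
  assume "\<exists>c\<in>coeff_box 1. (\<Sum>i\<in>I. \<bar>c i\<bar>) = 1 \<and> sum c I = 0 \<and> (\<forall>p. (\<Sum>i\<in>I. c i * y i p) = 0)"
  then obtain c where c: "(\<Sum>i\<in>I. \<bar>c i\<bar>) = 1" "sum c I = 0" "\<forall>p. (\<Sum>i\<in>I. c i * y i p) = 0" by blast
  show "\<not> aff_indep I y"
  proof
    assume "aff_indep I y"
    moreover have "(\<Sum>i\<in>I. c i *\<^sub>R y i) = 0" unfolding sum_scaleR_fun_apply using c(3) by (simp add: fun_eq_iff)
    ultimately have "\<forall>i\<in>I. c i = 0" using c(2) by (auto simp: aff_indep_def)
    then show False using c(1) by simp
  qed
qed

lemma aff_indep_borel:
  assumes I: "finite I"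
  shows "{y :: nat \<Rightarrow> nat \<Rightarrow> real. aff_indep I y} \<in> sets borel"
proof -
  define S where "S = {z :: (nat \<Rightarrow> nat \<Rightarrow> real) \<times> (nat \<Rightarrow> real). (\<Sum>i\<in>I. \<bar>snd z i\<bar>) = 1 \<and> (\<Sum>i\<in>I. snd z i) = 0 \<and>
    (\<forall>p. (\<Sum>i\<in>I. snd z i * fst z i p) = 0)}"
  have "closed S"
    unfolding S_def
    by (intro closed_Collect_conj closed_Collect_all closed_Collect_eq
        continuous_intros continuous_on_coeff continuous_on_entry) 
  then have "closed {y. \<exists>c\<in>coeff_box 1. (y, c) \<in> S}"
    by (rule closed_projection[OF _ compact_coeff_box])
  then have "- {y. \<exists>c\<in>coeff_box 1. (y, c) \<in> S} \<in> sets borel" by (intro borel_comp borel_closed)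
  also have "- {y. \<exists>c\<in>coeff_box 1. (y, c) \<in> S} = {y. aff_indep I y}"
    using not_aff_indep_iff[OF assms] by (auto simp: S_def)
  finally show ?thesis .
qed

lemma affdim_borel:
  assumes J: "finite J"
  shows "{y :: nat \<Rightarrow> nat \<Rightarrow> real. affdim (y ` J) = int r - 1} \<in> sets borel"
proof -
  have fin: "finite {I. I \<subseteq> J \<and> card I = q}" for q using J by simp
  have m: "{y :: nat \<Rightarrow> nat \<Rightarrow> real. aff_indep I y} \<in> sets borel" if "I \<in> {I. I \<subseteq> J \<and> card I = q}" for I q
    using that J by (intro aff_indep_borel) (auto intro: finite_subset)
  have "(\<Union>I\<in>{I. I \<subseteq> J \<and> card I = q}. {y :: nat \<Rightarrow> nat \<Rightarrow> real. aff_indep I y}) \<in> sets borel" for q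
    by (rule sets.finite_UN[OF fin m])
  from sets.Diff[OF this[of r] this[of "Suc r"]]
  have "(\<Union>I\<in>{I. I \<subseteq> J \<and> card I = r}. {y :: nat \<Rightarrow> nat \<Rightarrow> real. aff_indep I y}) -
    (\<Union>I\<in>{I. I \<subseteq> J \<and> card I = Suc r}. {y. aff_indep I y}) \<in> sets borel" .
  also have "(\<Union>I\<in>{I. I \<subseteq> J \<and> card I = r}. {y :: nat \<Rightarrow> nat \<Rightarrow> real. aff_indep I y}) -
    (\<Union>I\<in>{I. I \<subseteq> J \<and> card I = Suc r}. {y. aff_indep I y}) = {y. affdim (y ` J) = int r - 1}"
    unfolding affdim_image_iff[OF J] by blast
  finally show ?thesis .
qed

lemma card_facets_measurable:
  "(\<lambda>y :: nat \<Rightarrow> nat \<Rightarrow> real. real (card (facets d (convex hull (y ` {..<n::nat}))))) \<in> borel_measurable borel"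
proof -
  let ?A = "\<lambda>J. {y :: nat \<Rightarrow> nat \<Rightarrow> real. separated J ({..<n} - J) y} \<inter> {y. affdim (y ` J) = int d - 1}"
  have eq: "real (card (facets d (convex hull (y ` {..<n})))) = (\<Sum>J\<in>Pow {..<n}. indicator (?A J) y)" for y :: "nat \<Rightarrow> nat \<Rightarrow> real"
  proof -
    have "(\<Sum>J\<in>Pow {..<n}. indicator (?A J) y) = (\<Sum>J\<in>Pow {..<n}. if y \<in> ?A J then 1 else 0 :: real)"
      by (intro sum.cong refl) (simp add: indicator_def)
    also have "\<dots> = real (card (Pow {..<n} \<inter> {J. y \<in> ?A J}))" by (subst sum.If_cases) auto
    also have "Pow {..<n} \<inter> {J. y \<in> ?A J} = {J. J \<subseteq> {..<n} \<and> separated J ({..<n} - J) y \<and> affdim (y ` J) = int d - 1}"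
      by auto
    finally show ?thesis by (simp add: card_facets_eq)
  qed
  have "?A J \<in> sets borel" if "J \<in> Pow {..<n}" for J
    using that by (intro sets.Int separated_borel affdim_borel) (auto intro: finite_subset)
  then show ?thesis unfolding eq by (intro borel_measurable_sum borel_measurable_indicator)
qed

subsection \<open>Facets in general position\<close>

lemma mdet_left_kernel:
  fixes c :: "nat \<Rightarrow> real"
  assumes D: "mdet d y \<noteq> 0" and c: "\<And>l. l < d \<Longrightarrow> (\<Sum>i<d. c i * y i l) = 0" and j: "j < d"
  shows "c j = 0"
proof -
  have "mdet d y * c j = (\<Sum>i<d. c i * (if i = j then mdet d y else 0))"
    using j by (simp add: if_distrib[of "\<lambda>x. _ * x"] cong: if_cong)
  also have "\<dots> = (\<Sum>i<d. c i * (\<Sum>k<d. y i k * madj d y k j))"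
    using j by (intro sum.cong refl) (simp add: madj_mult_right)
  also have "\<dots> = (\<Sum>k<d. (\<Sum>i<d. c i * y i k) * madj d y k j)"
    by (simp add: sum_distrib_left sum_distrib_right mult.assoc) (rule sum.swap)
  also have "\<dots> = 0" using c by simp
  finally show ?thesis using D by simp
qed

lemma aff_indep_mdet:
  fixes y :: "nat \<Rightarrow> nat \<Rightarrow> real"
  assumes D: "mdet d y \<noteq> 0"
  shows "aff_indep {..<d} y"
  unfolding aff_indep_def
proof (intro allI impI ballI)
  fix c j assume c: "sum c {..<d} = 0 \<and> (\<Sum>i<d. c i *\<^sub>R y i) = 0" and j: "j \<in> {..<d}"
  have "(\<Sum>i<d. c i * y i l) = 0" for l
    using c by (simp add: sum_scaleR_fun_apply fun_eq_iff)
  then show "c j = 0" using mdet_left_kernel[OF D] j by blast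
qed

lemma dotp_combination:
  fixes y :: "'i \<Rightarrow> nat \<Rightarrow> real"
  shows
  "dotp d v (\<Sum>i\<in>I. c i *\<^sub>R y i) = (\<Sum>i\<in>I. c i * dotp d v (y i))"
proof -
  have "dotp d v (\<Sum>i\<in>I. c i *\<^sub>R y i) = (\<Sum>l<d. \<Sum>i\<in>I. c i * (v l * y i l))"
    by (simp add: sum_scaleR_fun_apply dotp_def sum_distrib_left algebra_simps)
  also have "\<dots> = (\<Sum>i\<in>I. \<Sum>l<d. c i * (v l * y i l))" by (rule sum.swap)
  finally show ?thesis by (simp add: dotp_def sum_distrib_left)
qed

text \<open>The rows form a basis, and the adjugate gives the coefficients of q in it. As
  \<open>hvec\<close> takes the value 1 on every row, the sum of these coefficients is
  \<open>dotp d (hvec d y) q\<close>, which is 1 just on the hyperplane.\<close>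

lemma mem_affine_hull_rows:
  fixes y :: "nat \<Rightarrow> nat \<Rightarrow> real"
  assumes D: "mdet d y \<noteq> 0" and y: "\<And>i l. i < d \<Longrightarrow> d \<le> l \<Longrightarrow> y i l = 0" and q: "\<And>l. d \<le> l \<Longrightarrow> q l = 0"
  shows "q \<in> affine hull (y ` {..<d}) \<longleftrightarrow> above d y q = 0"
proof
  assume "q \<in> affine hull (y ` {..<d})"
  then obtain c where "sum c {..<d} = 1" "(\<Sum>i<d. c i *\<^sub>R y i) = q"
    unfolding affine_hull_finite_image[OF finite_lessThan] by blast
  then have "dotp d (hvec d y) q = 1"
    using dotp_combination[of d "hvec d y" c y "{..<d}"] by (simp add: dotp_hvec[OF D])
  then show "above d y q = 0" by (simp add: above_def)
next
  assume a: "above d y q = 0"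
  define c where "c i = (\<Sum>k<d. q k * madj d y k i) / mdet d y" for i
  have "(\<Sum>i<d. c i * y i l) = q l" for l
  proof (cases "l < d")
    case True
    have "(\<Sum>i<d. c i * y i l) = (\<Sum>i<d. \<Sum>k<d. q k * (madj d y k i * y i l)) / mdet d y"
      by (simp add: c_def sum_divide_distrib sum_distrib_left sum_distrib_right mult.assoc)
    also have "(\<Sum>i<d. \<Sum>k<d. q k * (madj d y k i * y i l)) = (\<Sum>k<d. \<Sum>i<d. q k * (madj d y k i * y i l))"
      by (rule sum.swap)
    also have "\<dots> = (\<Sum>k<d. q k * (if k = l then mdet d y else 0))"
      using True by (intro sum.cong refl) (simp add: madj_mult_left flip: sum_distrib_left)
    also have "\<dots> = q l * mdet d y"
      using True by (simp add: if_distrib[of "\<lambda>x. _ * x"] cong: if_cong)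
    finally show ?thesis using D by simp
  qed (use y q in simp)
  then have eq: "(\<Sum>i<d. c i *\<^sub>R y i) = q" by (simp add: sum_scaleR_fun_apply fun_eq_iff)
  have "sum c {..<d} = dotp d (hvec d y) (\<Sum>i<d. c i *\<^sub>R y i)"
    unfolding dotp_combination by (simp add: dotp_hvec[OF D])
  also have "\<dots> = 1" using a unfolding eq by (simp add: above_def)
  finally show "q \<in> affine hull (y ` {..<d})"
    unfolding affine_hull_finite_image[OF finite_lessThan] using eq by blast
qed

lemma above_combination:
  fixes y :: "'i \<Rightarrow> nat \<Rightarrow> real"
  assumes "sum c I = 1"
  shows "above d x (\<Sum>i\<in>I. c i *\<^sub>R y i) = (\<Sum>i\<in>I. c i * above d x (y i))"
  using assms by (simp add: above_def dotp_combination right_diff_distrib sum_subtractf)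

text \<open>Points on opposite sides are joined by a segment that crosses the hyperplane; if all
  points are strictly on one side, so is every convex combination of them.\<close>

lemma separated_iff_facet_set:
  fixes y :: "nat \<Rightarrow> nat \<Rightarrow> real"
  assumes D: "mdet d y \<noteq> 0" and dn: "d \<le> n"
    and y: "\<And>i l. i < n \<Longrightarrow> d \<le> l \<Longrightarrow> y i l = 0" and nz: "\<And>j. j \<in> {d..<n} \<Longrightarrow> above d y (y j) \<noteq> 0"
  shows "separated {..<d} {d..<n} y \<longleftrightarrow> y \<in> facet_set d n"
proof
  have hull: "q \<in> affine hull (y ` {..<d}) \<longleftrightarrow> above d y q = 0" if "\<And>l. d \<le> l \<Longrightarrow> q l = 0" for q
    using y dn that by (intro mem_affine_hull_rows[OF D]) auto
  {
    assume sep: "separated {..<d} {d..<n} y"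
    show "y \<in> facet_set d n"
    proof (rule ccontr)
      assume "y \<notin> facet_set d n"
      then obtain i j where ij: "i \<in> {d..<n}" "j \<in> {d..<n}" "\<not> above d y (y i) < 0" "\<not> above d y (y j) > 0"
        using D by (auto simp: facet_set_def)
      define a b where "a = above d y (y i)" and "b = above d y (y j)"
      have ab: "a > 0" "b < 0" using ij nz[of i] nz[of j] by (auto simp: a_def b_def)
      \<comment> \<open>The zero of (1 - t) a + t b, the value of \<open>above\<close> along the
        segment.\<close>
      define t where "t = a / (a - b)"
      have t: "0 \<le> t" "t \<le> 1" using ab by (auto simp: t_def field_simps)
      define q where "q = (1 - t) *\<^sub>R y i + t *\<^sub>R y j"
      have q0: "q l = 0" if "d \<le> l" for l using y that ij by (simp add: q_def scaleR_fun_def)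
      have "q \<in> convex hull (y ` {d..<n})"
        unfolding q_def by (rule convexD[OF convex_convex_hull]) (use ij t in \<open>auto intro: hull_inc\<close>)
      moreover have "above d y q = 0"
      proof -
        have "above d y q = (1 - t) * a + t * b"
          by (simp add: above_def q_def a_def b_def dotp_def scaleR_fun_def algebra_simps sum.distrib sum_subtractf sum_distrib_left)
        also have "\<dots> = 0" using ab by (simp add: t_def field_simps)
        finally show ?thesis .
      qed
      then have "q \<in> affine hull (y ` {..<d})" using hull[of q] q0 by blast
      ultimately show False using sep by (auto simp: separated_def)
    qed
  }
  {
    assume F: "y \<in> facet_set d n"
    show "separated {..<d} {d..<n} y"
    proof (rule ccontr)
      assume "\<not> separated {..<d} {d..<n} y"
      then obtain z where z: "z \<in> affine hull (y ` {..<d})" "z \<in> convex hull (y ` {d..<n})"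
        by (auto simp: separated_def)
      from z(2) obtain c where c: "\<forall>i\<in>{d..<n}. 0 \<le> c i" "sum c {d..<n} = 1" "(\<Sum>i\<in>{d..<n}. c i *\<^sub>R y i) = z"
        unfolding convex_hull_finite_image[OF finite_atLeastLessThan] by blast
      have "z l = 0" if "d \<le> l" for l
        using c(3) y that by (auto simp: sum_scaleR_fun_apply)
      then have "above d y z = 0" using z(1) hull by blast
      then have s: "(\<Sum>i\<in>{d..<n}. c i * above d y (y i)) = 0"
        using above_combination[OF c(2), of d y y] c(3) by simp
      have "\<forall>i\<in>{d..<n}. c i = 0"
      proof (cases "\<forall>j\<in>{d..<n}. above d y (y j) > 0")
        case True
        then have "0 \<le> c i * above d y (y i)" if "i \<in> {d..<n}" for i
          using c(1) that by (simp add: less_imp_le)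
        then have "\<forall>i\<in>{d..<n}. c i * above d y (y i) = 0"
          using s by (subst (asm) sum_nonneg_eq_0_iff) auto
        then show ?thesis using nz by auto
      next
        case False
        then have neg: "\<forall>j\<in>{d..<n}. above d y (y j) < 0" using F by (auto simp: facet_set_def)
        have s': "(\<Sum>i\<in>{d..<n}. c i * - above d y (y i)) = 0" using s by (simp add: sum_negf)
        have "0 \<le> c i * - above d y (y i)" if "i \<in> {d..<n}" for i
          by (rule mult_nonneg_nonneg) (use c(1) neg that in \<open>auto simp: less_imp_le\<close>)
        then have "\<forall>i\<in>{d..<n}. c i * - above d y (y i) = 0"
          using s' by (subst (asm) sum_nonneg_eq_0_iff) auto
        then show ?thesis using nz by auto
      qed
      then have "sum c {d..<n} = 0" by simp
      with c(2) show False by simp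
    qed
  }
qed

definition generic_config :: "nat \<Rightarrow> nat \<Rightarrow> (nat \<Rightarrow> nat \<Rightarrow> real) \<Rightarrow> bool"
  where "generic_config d n y \<longleftrightarrow> mdet d y \<noteq> 0 \<and> (\<forall>j\<in>{d..<n}. above d y (y j) \<noteq> 0)"

text \<open>The permutation \<open>p I\<close> moves I to the first d places, which brings every
  d-subset into the situation of \<open>facet_set\<close>.\<close>

lemma card_facets_generic:
  fixes x :: "nat \<Rightarrow> nat \<Rightarrow> real"
  assumes dn: "d \<le> n"
    and x: "\<And>i l. i < n \<Longrightarrow> d \<le> l \<Longrightarrow> x i l = 0"
    and p: "\<And>I. I \<subseteq> {..<n} \<Longrightarrow> card I = d \<Longrightarrow> p I permutes {..<n} \<and> p I ` {..<d} = I"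
    and g: "\<And>I. I \<subseteq> {..<n} \<Longrightarrow> card I = d \<Longrightarrow> generic_config d n (\<lambda>i. x (p I i))"
  shows "card (facets d (convex hull (x ` {..<n}))) =
    card {I. I \<subseteq> {..<n} \<and> card I = d \<and> (\<lambda>i. x (p I i)) \<in> facet_set d n}"
proof -
  have main: "x ` I = (\<lambda>i. x (p I i)) ` {..<d}" "x ` ({..<n} - I) = (\<lambda>i. x (p I i)) ` {d..<n}"
    "separated I ({..<n} - I) x \<longleftrightarrow> (\<lambda>i. x (p I i)) \<in> facet_set d n"
    "affdim (x ` I) = int d - 1"
    "\<And>j. j \<in> {..<n} - I \<Longrightarrow> x j \<notin> affine hull (x ` I)"
    if I: "I \<subseteq> {..<n}" "card I = d" for I
  proof -
    define y where "y i = x (p I i)" for i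
    have perm: "p I permutes {..<n}" and im: "p I ` {..<d} = I" using p[OF I] by auto
    have lt: "p I i < n" if "i < n" for i using permutes_in_image[OF perm, of i] that by simp
    have "p I ` {d..<n} = p I ` ({..<n} - {..<d})" by (rule arg_cong[of _ _ "image (p I)"]) auto
    also have "\<dots> = {..<n} - I"
      using permutes_image[OF perm] im permutes_inj_on[OF perm, of "{..<n}"] dn
      by (subst inj_on_image_set_diff[where C = "{..<n}"]) auto
    finally have im2: "p I ` {d..<n} = {..<n} - I" .
    show e1: "x ` I = (\<lambda>i. x (p I i)) ` {..<d}" by (subst im[symmetric]) (simp add: image_image)
    show e2: "x ` ({..<n} - I) = (\<lambda>i. x (p I i)) ` {d..<n}" by (subst im2[symmetric]) (simp add: image_image)
    have D: "mdet d y \<noteq> 0" and nz: "\<And>j. j \<in> {d..<n} \<Longrightarrow> above d y (y j) \<noteq> 0"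
      using g[OF I] by (auto simp: generic_config_def y_def[abs_def])
    have y0: "y i l = 0" if "i < n" "d \<le> l" for i l using x lt that by (simp add: y_def)
    have "separated I ({..<n} - I) x \<longleftrightarrow> separated {..<d} {d..<n} y"
      unfolding separated_def e1 e2 y_def ..
    also have "\<dots> \<longleftrightarrow> y \<in> facet_set d n" by (rule separated_iff_facet_set[OF D dn y0 nz])
    finally show "separated I ({..<n} - I) x \<longleftrightarrow> (\<lambda>i. x (p I i)) \<in> facet_set d n" unfolding y_def .
    have ind: "inj_on y {..<d}" "\<not> affine_dependent (y ` {..<d})"
      using aff_indep_mdet[OF D] aff_indep_iff[of "{..<d}" y] by auto
    have "affdim (y ` {..<d}) = int (card (y ` {..<d})) - 1" by (rule affdim_eqI[OF ind(2) refl])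
    then show "affdim (x ` I) = int d - 1" unfolding e1 using card_image[OF ind(1)] by (simp add: y_def)
    fix j assume "j \<in> {..<n} - I"
    then have "j \<in> p I ` {d..<n}" unfolding im2 .
    then obtain i where i: "i \<in> {d..<n}" "j = p I i" by blast
    have "y i \<notin> affine hull (y ` {..<d})"
      using nz[OF i(1)] i(1) y0 dn by (subst mem_affine_hull_rows[OF D]) auto
    then show "x j \<notin> affine hull (x ` I)" unfolding e1 i(2) y_def .
  qed
  have "{J. J \<subseteq> {..<n} \<and> separated J ({..<n} - J) x \<and> affdim (x ` J) = int d - 1} =
    {I. I \<subseteq> {..<n} \<and> card I = d \<and> (\<lambda>i. x (p I i)) \<in> facet_set d n}" (is "?L = ?R")
  proof (intro equalityI subsetI)
    fix J assume J: "J \<in> ?L"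
    then have fJ: "finite J" by (auto intro: finite_subset)
    \<comment> \<open>Excludes facets with more than d points: J contains an affine basis I of d
      points, and genericity keeps all other points off its hull.\<close>
    obtain I where I: "I \<subseteq> J" "affine hull (x ` I) = affine hull (x ` J)" "affdim (x ` J) = int (card I) - 1"
      using affine_basis_of_image[OF fJ, of x] by metis
    have I': "I \<subseteq> {..<n}" "card I = d" using I J by auto
    have "J \<subseteq> I"
    proof
      fix j assume j: "j \<in> J"
      then have "x j \<in> affine hull (x ` I)" unfolding I(2) by (auto intro: hull_inc)
      then show "j \<in> I" using main(5)[OF I', of j] j J by auto
    qed
    then have "J = I" using I by blast
    then show "J \<in> ?R" using main(3)[OF I'] I' J by auto
  next
    fix I assume "I \<in> ?R"
    then show "I \<in> ?L" using main(3,4)[of I] by auto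
  qed
  then show ?thesis by (simp add: card_facets_eq)
qed

subsection \<open>The expected number of facets\<close>

lemma law_permute:
  assumes \<mu>: "prob_space \<mu>" "sets \<mu> = sets borel" and p: "p permutes {..<n}"
  shows "distr (law n \<mu>) borel (\<lambda>x i. x (p i)) = law n \<mu>"
proof -
  let ?t = "\<lambda>x i. if i < n then x i else 0 :: nat \<Rightarrow> real"
  let ?P = "\<Pi>\<^sub>M i\<in>{..<n}. \<mu>"
  have lt: "p i < n \<longleftrightarrow> i < n" for i using permutes_in_image[OF p, of i] by simp
  have t: "?t \<in> ?P \<rightarrow>\<^sub>M borel" by (rule truncate_rows_measurable[OF \<mu>(2)])
  have pm: "(\<lambda>x i. x (p i)) \<in> borel \<rightarrow>\<^sub>M (borel :: (nat \<Rightarrow> nat \<Rightarrow> real) measure)"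
    by (rule fun2_measurableI) (rule entry_measurable)
  have r: "(\<lambda>x. \<lambda>i\<in>{..<n}. x (p i)) \<in> ?P \<rightarrow>\<^sub>M ?P"
    by (rule measurable_restrict) (use lt in \<open>auto intro: measurable_component_singleton\<close>)
  have re: "distr ?P ?P (\<lambda>x. \<lambda>i\<in>{..<n}. x (p i)) = ?P"
    using distr_PiM_reindex[of "{..<n}" "\<lambda>_. \<mu>" p "{..<n}"] \<mu>(1) permutes_inj_on[OF p] lt by (auto simp: comp_def)
  have "distr (law n \<mu>) borel (\<lambda>x i. x (p i)) = distr ?P borel (\<lambda>x i. ?t x (p i))"
    unfolding law_def by (subst distr_distr[OF pm t]) (simp add: comp_def)
  also have "\<dots> = distr ?P borel (\<lambda>x. ?t (\<lambda>i\<in>{..<n}. x (p i)))"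
    by (intro distr_cong refl ext) (simp add: lt)
  also have "\<dots> = distr (distr ?P ?P (\<lambda>x. \<lambda>i\<in>{..<n}. x (p i))) borel ?t"
    by (subst distr_distr[OF t r]) (simp add: comp_def)
  finally show ?thesis unfolding re law_def .
qed

lemma AE_law_row:
  assumes \<mu>: "prob_space \<mu>" "sets \<mu> = sets borel" and i: "i < n"
    and P: "AE y in \<mu>. P y" and m: "{y. P y} \<in> sets borel"
  shows "AE x in law n \<mu>. P (x i)"
proof -
  have t: "(\<lambda>x i. if i < n then x i else 0 :: nat \<Rightarrow> real) \<in> (\<Pi>\<^sub>M i\<in>{..<n}. \<mu>) \<rightarrow>\<^sub>M borel"
    by (rule truncate_rows_measurable[OF \<mu>(2)])
  have "{x :: nat \<Rightarrow> nat \<Rightarrow> real. P (x i)} \<in> sets borel"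
    using measurable_sets[OF coord2_measurable m, of i] by (simp add: vimage_def)
  then have "(AE x in law n \<mu>. P (x i)) \<longleftrightarrow> (AE x in (\<Pi>\<^sub>M i\<in>{..<n}. \<mu>). P (if i < n then x i else 0))"
    unfolding law_def by (subst AE_distr_iff[OF t]) auto
  also have "\<dots>" using AE_PiM_component[of "{..<n}" "\<lambda>_. \<mu>" i P] \<mu>(1) i P by simp
  finally show ?thesis .
qed

lemma expected_facets_law:
  assumes iid: "iid_uniform_sphere M n d X"
  shows "expected_facets M n d X =
    (\<integral>x. real (card (facets d (convex hull (x ` {..<n})))) \<partial>law n (uniform_sphere d))"
proof -
  let ?\<sigma> = "uniform_sphere d"
  interpret M: prob_space M using iid by (simp add: iid_uniform_sphere_def)
  have ind: "M.indep_vars (\<lambda>_. borel) X {..<n}" and dX: "\<And>i. i < n \<Longrightarrow> distr M borel (X i) = ?\<sigma>"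
    using iid by (auto simp: iid_uniform_sphere_def)
  have X: "X i \<in> M \<rightarrow>\<^sub>M borel" if "i < n" for i
    using ind that by (auto simp: M.indep_vars_def)
  show ?thesis
  \<comment> \<open>Independence is characterised by the product law for nonempty index sets; for n
    = 0 both sides are the same constant.\<close>
  proof (cases "n = 0")
    case True
    interpret L: prob_space "law n ?\<sigma>" by (rule prob_space_law[OF prob_space_uniform_sphere sets_uniform_sphere])
    show ?thesis unfolding expected_facets_def using True M.prob_space L.prob_space by simp
  next
    case False
    let ?t = "\<lambda>x i. if i < n then x i else 0 :: nat \<Rightarrow> real"
    let ?P = "\<Pi>\<^sub>M i\<in>{..<n}. ?\<sigma>"
    have "distr M (\<Pi>\<^sub>M i\<in>{..<n}. borel) (\<lambda>x. \<lambda>i\<in>{..<n}. X i x) = (\<Pi>\<^sub>M i\<in>{..<n}. distr M borel (X i))"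
      using M.indep_vars_iff_distr_eq_PiM'[of "{..<n}" X "\<lambda>_. borel"] ind X False by auto
    also have "\<dots> = ?P" by (rule PiM_cong) (use dX in auto)
    finally have P: "distr M (\<Pi>\<^sub>M i\<in>{..<n}. borel) (\<lambda>x. \<lambda>i\<in>{..<n}. X i x) = ?P" .
    have r: "(\<lambda>x. \<lambda>i\<in>{..<n}. X i x) \<in> M \<rightarrow>\<^sub>M (\<Pi>\<^sub>M i\<in>{..<n}. borel)"
      by (rule measurable_restrict) (use X in auto)
    have t: "?t \<in> (\<Pi>\<^sub>M i\<in>{..<n}. borel) \<rightarrow>\<^sub>M (borel :: (nat \<Rightarrow> nat \<Rightarrow> real) measure)"
      by (rule truncate_rows_measurable) simp
    have "law n ?\<sigma> = distr M borel (\<lambda>w. ?t (\<lambda>i\<in>{..<n}. X i w))"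
      unfolding law_def P[symmetric] by (subst distr_distr[OF t r]) (simp add: comp_def)
    then have "(\<integral>x. real (card (facets d (convex hull (x ` {..<n})))) \<partial>law n ?\<sigma>) =
      (\<integral>w. real (card (facets d (convex hull (?t (\<lambda>i\<in>{..<n}. X i w) ` {..<n})))) \<partial>M)"
      by (simp add: integral_distr[OF measurable_compose[OF r t] card_facets_measurable])
    also have "\<dots> = expected_facets M n d X"
      unfolding expected_facets_def by (intro Bochner_Integration.integral_cong refl arg_cong[of _ _ "\<lambda>A. real (card (facets d (convex hull A)))"]) auto
    finally show ?thesis ..
  qed
qed

lemma ex_permutes_initial:
  assumes "I \<subseteq> {..<n}" "card I = d"
  shows "\<exists>p. p permutes {..<n} \<and> p ` {..<d} = I"
proof -
  have fI: "finite I" using assms by (auto intro: finite_subset)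
  have d: "d \<le> n" using card_mono[OF _ assms(1)] assms(2) by simp
  obtain f where f: "bij_betw f {..<d} I"
    using finite_same_card_bij[of "{..<d}" I] fI assms(2) by auto
  have "card ({..<n} - {..<d}) = card ({..<n} - I)"
    using assms fI d by (simp add: card_Diff_subset)
  then obtain g where g: "bij_betw g ({..<n} - {..<d}) ({..<n} - I)"
    using finite_same_card_bij[of "{..<n} - {..<d}" "{..<n} - I"] by auto
  define p where "p i = (if i < d then f i else if i < n then g i else i)" for i
  have 1: "bij_betw p {..<d} I" using f by (rule bij_betw_cong[THEN iffD1, rotated]) (simp add: p_def)
  have 2: "bij_betw p ({..<n} - {..<d}) ({..<n} - I)"
    using g by (rule bij_betw_cong[THEN iffD1, rotated]) (auto simp: p_def)
  have "bij_betw p ({..<d} \<union> ({..<n} - {..<d})) (I \<union> ({..<n} - I))"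
    by (rule bij_betw_combine[OF 1 2]) auto
  moreover have "{..<d} \<union> ({..<n} - {..<d}) = {..<n}" "I \<union> ({..<n} - I) = {..<n}" using d assms(1) by auto
  ultimately have "bij_betw p {..<n} {..<n}" by simp
  then have "p permutes {..<n}" by (rule bij_imp_permutes) (use d in \<open>simp add: p_def\<close>)
  then show ?thesis using 1 by (auto simp: bij_betw_def)
qed

lemma expected_facets_eq:
  assumes d: "2 \<le> d" "d \<le> n" and iid: "iid_uniform_sphere M n d X"
  shows "expected_facets M n d X = real (n choose d) * measure (law n (uniform_sphere d)) (facet_set d n)"
proof -
  let ?\<sigma> = "uniform_sphere d"
  let ?L = "law n ?\<sigma>"
  have s: "prob_space ?\<sigma>" "sets ?\<sigma> = sets borel"
    by (rule prob_space_uniform_sphere, rule sets_uniform_sphere)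
  interpret L: prob_space ?L by (rule prob_space_law[OF s])
  have spL: "space ?L = UNIV" using sets_eq_imp_space_eq[OF sets_law[of n ?\<sigma>]] by simp
  define S where "S = {I. I \<subseteq> {..<n} \<and> card I = d}"
  have finS: "finite S" unfolding S_def by (rule finite_subset[of _ "Pow {..<n}"]) auto
  have cardS: "card S = n choose d" unfolding S_def using n_subsets[of "{..<n}" d] by simp
  have "\<forall>I\<in>S. \<exists>p. p permutes {..<n} \<and> p ` {..<d} = I"
    using ex_permutes_initial by (auto simp: S_def)
  from bchoice[OF this] obtain p where p0: "\<forall>I\<in>S. p I permutes {..<n} \<and> p I ` {..<d} = I" ..
  then have p: "p I permutes {..<n} \<and> p I ` {..<d} = I" if "I \<in> S" for I using that by (rule bspec)
  let ?q = "\<lambda>I x i. x (p I i) :: nat \<Rightarrow> real"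
  have qm: "?q I \<in> borel \<rightarrow>\<^sub>M borel" for I
    by (rule fun2_measurableI) (rule entry_measurable)
  then have qmL: "?q I \<in> ?L \<rightarrow>\<^sub>M borel" for I
    unfolding measurable_cong_sets[OF sets_law refl] .
  \<comment> \<open>Exchangeability, by which all d-subsets contribute the same probability.\<close>
  have dq: "distr ?L borel (?q I) = ?L" if "I \<in> S" for I
    using law_permute[OF s, of "p I" n] p[OF that] by blast
  have gen: "AE x in ?L. generic_config d n x"
    unfolding generic_config_def
  proof (rule AE_conjI[OF AE_law_sphere_mdet[OF d]], rule eventually_ball_finite, simp, rule ballI)
    fix j assume "j \<in> {d..<n}"
    then show "AE x in ?L. above d x (x j) \<noteq> 0"
      by (intro AE_law_above[OF s sphere_hyperplane_null[OF d(1)]]) auto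
  qed
  have "AE x in ?L. generic_config d n (?q I x)" if I: "I \<in> S" for I
  proof -
    have "AE x in distr ?L borel (?q I). generic_config d n x" unfolding dq[OF I] by (rule gen)
    then show ?thesis by (rule AE_distrD[OF qmL])
  qed
  then have genS: "AE x in ?L. \<forall>I\<in>S. generic_config d n (?q I x)"
    by (intro eventually_ball_finite finS) blast
  have supp: "AE x in ?L. \<forall>i\<in>{..<n}. x i \<in> unit_sphere d"
  proof (rule eventually_ball_finite, simp, rule ballI)
    fix i assume "i \<in> {..<n}"
    then show "AE x in ?L. x i \<in> unit_sphere d"
      using AE_uniform_sphere[of d] d unit_sphere_borel[of d] by (intro AE_law_row[OF s]) auto
  qed
  have ae: "AE x in ?L. real (card (facets d (convex hull (x ` {..<n})))) = (\<Sum>I\<in>S. indicator (facet_set d n) (?q I x))"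
    using genS supp
  proof eventually_elim
    case (elim x)
    have "card (facets d (convex hull (x ` {..<n}))) = card {I. I \<subseteq> {..<n} \<and> card I = d \<and> ?q I x \<in> facet_set d n}"
    proof (rule card_facets_generic[OF d(2)])
      fix i l assume "i < n" "d \<le> l"
      then show "x i l = 0" using elim(2) by (auto simp: unit_sphere_def topspace_Euclidean_space)
    qed (use p elim(1) in \<open>auto simp: S_def\<close>)
    also have "{I. I \<subseteq> {..<n} \<and> card I = d \<and> ?q I x \<in> facet_set d n} = S \<inter> {I. ?q I x \<in> facet_set d n}"
      by (auto simp: S_def)
    also have "real (card (S \<inter> {I. ?q I x \<in> facet_set d n})) = (\<Sum>I\<in>S. if ?q I x \<in> facet_set d n then 1 else 0)"
      by (subst sum.If_cases[OF finS]) simp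
    finally show ?case by (simp add: indicator_def of_bool_def)
  qed
  have im: "(\<lambda>x. indicator (facet_set d n) (?q I x) :: real) \<in> borel_measurable ?L" for I
    by (rule measurable_compose[OF qmL borel_measurable_indicator[OF facet_set_borel]])
  have ii: "integrable ?L (\<lambda>x. indicator (facet_set d n) (?q I x) :: real)" for I
    by (rule L.integrable_const_bound[where B = 1]) (use im in \<open>auto simp: indicator_def\<close>)
  have one: "(\<integral>x. indicator (facet_set d n) (?q I x) \<partial>?L) = measure ?L (facet_set d n)" if I: "I \<in> S" for I
  proof -
    have "(\<integral>x. indicator (facet_set d n) (?q I x) \<partial>?L) = (\<integral>x. indicator (facet_set d n) x \<partial>distr ?L borel (?q I) :: real)"
      by (rule integral_distr[OF qmL borel_measurable_indicator[OF facet_set_borel], symmetric])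
    also have "\<dots> = measure ?L (facet_set d n)" unfolding dq[OF I] using spL by simp
    finally show ?thesis .
  qed
  have "expected_facets M n d X = (\<integral>x. real (card (facets d (convex hull (x ` {..<n})))) \<partial>?L)"
    by (rule expected_facets_law[OF iid])
  also have "\<dots> = (\<integral>x. (\<Sum>I\<in>S. indicator (facet_set d n) (?q I x)) \<partial>?L)"
  proof (rule integral_cong_AE[OF _ _ ae])
    show "(\<lambda>x. real (card (facets d (convex hull (x ` {..<n}))))) \<in> borel_measurable ?L"
      using card_facets_measurable by (simp add: measurable_cong_sets[OF sets_law refl])
    show "(\<lambda>x. (\<Sum>I\<in>S. indicator (facet_set d n) (?q I x)) :: real) \<in> borel_measurable ?L"
      by (intro borel_measurable_sum im)
  qed
  also have "\<dots> = (\<Sum>I\<in>S. \<integral>x. indicator (facet_set d n) (?q I x) \<partial>?L)"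
    by (rule Bochner_Integration.integral_sum) (rule ii)
  also have "\<dots> = real (n choose d) * measure ?L (facet_set d n)" by (simp add: one cardS)
  finally show ?thesis .
qed

lemma expected_facets_rfac:
  assumes d: "2 \<le> d" "d \<le> n - 1" and iid: "iid_uniform_sphere M n d X"
  shows "expected_facets M n d X = real (n choose d) * (2 / 2 ^ (n - d)) * facet_ratio (d - 1) (n - d)"
proof -
  obtain k where k: "d = Suc k" "k \<ge> 1" using d by (cases d) auto
  define m where "m = n - d"
  have m: "m > 0" "n = Suc k + m" using d k by (auto simp: m_def)
  have "measure (law n (uniform_sphere d)) (facet_set d n) = 2 / 2 ^ m * facet_ratio k m"
    by (simp only: m(2) k(1) sphere_facet_measure[OF k(2) m(1)] facet_ratio_def) simp
  moreover have "d \<le> n" using d by simp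
  moreover have "n - Suc k = m" using m by simp
  ultimately show ?thesis using expected_facets_eq[OF d(1) _ iid] by (simp add: k(1))
qed

theorem theorem9:
  fixes d :: "nat \<Rightarrow> nat" and n0 :: nat
    and M :: "nat \<Rightarrow> 'a measure" and X :: "nat \<Rightarrow> nat \<Rightarrow> 'a \<Rightarrow> nat \<Rightarrow> real"
  assumes d_range: "\<And>n. n \<ge> n0 \<Longrightarrow> 2 \<le> d n \<and> d n \<le> n - 1"
    and d_cases: "(\<exists>c. \<forall>n\<ge>n0. d n = c) \<or> filterlim d at_top sequentially"
    and X_iid: "\<And>n. n \<ge> n0 \<Longrightarrow> iid_uniform_sphere (M n) n (d n) (X n)"
    and codim: "(\<lambda>n. real (n - d n) / real (d n)) \<longlonglongrightarrow> 0"
  shows "\<exists>g h :: nat \<Rightarrow> real.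
    g \<in> O(\<lambda>n. real (n - d n) ^ 3 / real (d n) ^ 2) \<and>
    h \<in> o(\<lambda>_. 1) \<and>
    (\<forall>n\<ge>n0. expected_facets (M n) n (d n) (X n) =
      real (n choose d n) * (2 / 2 ^ (n - d n)) *
      exp (real (n - d n) ^ 2 / (pi * real (d n)) + g n + h n))"
proof -
  define m where "m n = real (n - d n)" for n
  define \<delta> where "\<delta> n = ln (facet_ratio (d n - 1) (n - d n)) - (m n)\<^sup>2 / (pi * real (d n))" for n
  define w where "w n = m n ^ 3 / real (d n) ^ 2" for n
  \<comment> \<open>\<delta> is clipped to [-44 w, 0], so the bound for g holds for every n, and h
    takes the rest, including the n outside the asymptotic range. 44 is 11 times 4, where 4 bounds
    d^2 / (d - 1)^2.\<close>
  define g where "g n = max (- 44 * w n) (min (\<delta> n) 0)" for n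
  define h where "h n = \<delta> n - g n" for n
  have codim': "(\<lambda>n. m n / real (d n)) \<longlonglongrightarrow> 0" unfolding m_def by (rule codim)
  have ev1: "eventually (\<lambda>n. m n / real (d n) < 1 / 2) sequentially"
    by (rule order_tendstoD(2)[OF codim']) simp
  \<comment> \<open>Together with m < d / 2, n at least 10 gives d at least 7, so k = d - 1 is at
    least 4 and m at most k.\<close>
  have ev2: "eventually (\<lambda>n. n \<ge> n0 \<and> n \<ge> 10) sequentially"
    by (intro eventually_conj eventually_ge_at_top)
  \<comment> \<open>20 is 10 times 2, from the error 10 m / k and k >= d / 2. A positive \<delta> is
    at most m / k.\<close>
  have main: "eventually (\<lambda>n. \<bar>h n\<bar> \<le> 20 * (m n / real (d n))) sequentially"
    using ev1 ev2
  proof eventually_elim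
    case (elim n)
    have dn: "2 \<le> d n" "d n \<le> n - 1" using d_range elim(2) by auto
    have "m n < real (d n) / 2" using elim(1) dn by (simp add: field_simps)
    then have m2: "2 * (n - d n) < d n" by (simp add: m_def)
    define k where "k = d n - 1"
    have k: "d n = Suc k" using dn by (simp add: k_def)
    have k4: "k \<ge> 4" and mk: "1 \<le> n - d n" "n - d n \<le> k"
      using m2 elim(2) dn k by auto
    have K: "real (d n) = real k + 1" using k by simp
    have m0: "m n \<ge> 0" by (simp add: m_def)
    have r: "m n / real k \<le> 2 * (m n / real (d n))"
    proof -
      have "m n / real k \<le> m n / (real (d n) / 2)"
        using k4 m0 unfolding K by (intro divide_left_mono) auto
      then show ?thesis by (simp add: mult.commute)
    qed
    have r2: "m n ^ 3 / (real k)\<^sup>2 \<le> 4 * w n"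
    proof -
      have "(real (d n) / 2)\<^sup>2 \<le> (real k)\<^sup>2" using k4 unfolding K by (intro power_mono) auto
      then have "m n ^ 3 / (real k)\<^sup>2 \<le> m n ^ 3 / (real (d n) / 2)\<^sup>2"
        using k4 m0 unfolding K by (intro divide_left_mono mult_pos_pos) auto
      then show ?thesis by (simp add: w_def power_divide mult.commute)
    qed
    note A = facet_ratio_asymptotics[OF k4 mk, folded m_def]
    have de: "\<delta> n = ln (facet_ratio k (n - d n)) - (m n)\<^sup>2 / (pi * (real k + 1))"
      by (simp add: \<delta>_def k add.commute)
    have up: "\<delta> n \<le> m n / real k" using A(1) unfolding de by linarith
    have lo: "- 11 * (m n ^ 3 / (real k)\<^sup>2) - 10 * (m n / real k) \<le> \<delta> n"
      using A(2) unfolding de by linarith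
    have w0: "w n \<ge> 0" and q0: "0 \<le> m n / real k" using m0 by (simp_all add: w_def)
    show ?case
      unfolding h_def g_def using up lo r r2 w0 q0 by (simp add: max_def min_def abs_if)
  qed
  have "(\<lambda>n. 20 * (m n / real (d n))) \<longlonglongrightarrow> 0" using tendsto_mult_left[OF codim', of 20] by simp
  then have "h \<longlonglongrightarrow> 0" by (rule Lim_null_comparison[rotated]) (use main in simp)
  then have h: "h \<in> o(\<lambda>_. 1)" by (intro smalloI_tendsto) simp_all
  have g: "g \<in> O(\<lambda>n. real (n - d n) ^ 3 / real (d n) ^ 2)"
  proof (rule bigoI[of _ 44], intro always_eventually allI)
    fix n
    have "w n \<ge> 0" by (simp add: w_def m_def)
    then show "norm (g n) \<le> 44 * norm (real (n - d n) ^ 3 / real (d n) ^ 2)"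
      by (simp add: g_def flip: m_def w_def)
  qed
  have "expected_facets (M n) n (d n) (X n) = real (n choose d n) * (2 / 2 ^ (n - d n)) *
      exp (real (n - d n) ^ 2 / (pi * real (d n)) + g n + h n)" if n: "n \<ge> n0" for n
  proof -
    have dn: "2 \<le> d n" "d n \<le> n - 1" using d_range[OF n] by auto
    have "facet_ratio (d n - 1) (n - d n) > 0" by (rule facet_ratio_pos) (use dn in simp)
    then have "exp (real (n - d n) ^ 2 / (pi * real (d n)) + g n + h n) = facet_ratio (d n - 1) (n - d n)"
      by (simp add: h_def \<delta>_def m_def)
    then show ?thesis using expected_facets_rfac[OF dn X_iid[OF n]] by simp
  qed
  then show ?thesis using g h by blast
qed

end
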